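(* Let $Z$, $\Phi:Z\to\mathbf{CP}^3$, $B$ and $\Gamma_0$ be as described in the context, and let $L\subset Z$ be a real line, i.e. a smooth rational curve invariant under the real structure of $Z$ whose normal bundle in $Z$ is isomorphic to $O(1)^{\oplus2}$. Then $\Phi(L)$ is a line in $\mathbf{CP}^3$ if and only if $L\cap\Gamma_0\neq\emptyset$. Otherwise $\Phi(L)$ is a real touching conic of $B$.
   Context: Fix real numbers $a,b>0$ and a real quadratic form $Q(y_0,y_1)$; put $f(\lambda)=\lambda(\lambda+1)(a\lambda-b)$. Assume: there is $\lambda_0\in\mathbf R$ such that $Q(\lambda,1)^2-f(\lambda)\ge0$ for all $\lambda\in\mathbf R$ with equality iff $\lambda=\lambda_0$, and $\lambda_0$ is a root of multiplicity two; and $Q(\lambda,1)>\sqrt{f(\lambda)}$ whenever $\lambda\in\mathbf R$, $f(\lambda)\ge0$, $\lambda\ne\lambda_0$. $B\subset\mathbf{CP}^3$ is the quartic surface $(y_2y_3+Q(y_0,y_1))^2-y_0y_1(y_0+y_1)(ay_0-by_1)=0$. The real structure on $\mathbf{CP}^3$ is $\sigma(y_0:y_1:y_2:y_3)=(\overline y_0:\overline y_1:\overline y_3:\overline y_2)$. $B$ has exactly three singular points: $P_\infty=(0:0:0:1)$, $\overline P_\infty=(0:0:1:0)$ and the real ordinary double point $P_0=(\lambda_0:1:0:0)$. $\Phi_0:Z_0\to\mathbf{CP}^3$ is the double covering branched along $B$, i.e. $Z_0=\{z^2+(y_2y_3+Q(y_0,y_1))^2-y_0y_1(y_0+y_1)(ay_0-by_1)=0\}$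 in the total space of $O(2)$ ($z$ the fiber coordinate), with real structure $(y,z)\mapsto(\sigma(y),\overline z)$. $\mu:Z\to Z_0$ is a small resolution (with $Z$ smooth) of its three singular points to which the real structure lifts, $\Phi=\Phi_0\circ\mu$, and $\Gamma_0=\mu^{-1}(\Phi_0^{-1}(P_0))$, a real smooth rational curve. ($Z$ is not assumed to be a twistor space.) A real touching conic of $B$ is a $\sigma$-invariant irreducible conic $C\subset\mathbf{CP}^3$ such that either $C\subset B$ or the local intersection number of $C$ with $B$ is at least two at every intersection point. *)

theory Defs
  imports
    "HOL-Complex_Analysis.Complex_Analysis"
    "HOL-Computational_Algebra.Polynomial"
begin

section \<open>Complex manifolds\<close>

text \<open>Holomorphic functions of several variables: Frechet differentiable with complex linear
  derivative.\<close>

definition holomorphic_fn :: "(complex^'n) set \<Rightarrow> (complex^'n \<Rightarrow> complex) \<Rightarrow> bool" where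
  "holomorphic_fn S f \<longleftrightarrow>
     open S \<and> (\<forall>x\<in>S. \<exists>D. (f has_derivative D) (at x) \<and> (\<forall>c v. D (c *s v) = c * D v))"

text \<open>A chart is a pair of a domain and a coordinate map, which is relevant on that domain only.\<close>

type_synonym ('a, 'n) chart = "'a set \<times> ('a \<Rightarrow> complex^'n)"

record ('a, 'n::finite) complex_space =
  ctop :: "'a topology"
  charts :: "('a, 'n) chart set"

definition is_chart :: "'a topology \<Rightarrow> ('a, 'n::finite) chart \<Rightarrow> bool" where
  "is_chart X c \<longleftrightarrow> openin X (fst c) \<and> open (snd c ` fst c) \<and>
     homeomorphic_map (subtopology X (fst c)) (top_of_set (snd c ` fst c)) (snd c)"

text \<open>The expression of a map \<open>f\<close> in charts \<open>c\<close> of the source and \<open>d\<close> of the target,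
  and its domain.\<close>

definition local_rep ::
  "('a, 'n::finite) chart \<Rightarrow> ('b, 'm::finite) chart \<Rightarrow> ('a \<Rightarrow> 'b) \<Rightarrow> complex^'n \<Rightarrow> complex^'m" where
  "local_rep c d f = snd d \<circ> f \<circ> inv_into (fst c) (snd c)"

definition local_dom ::
  "('a, 'n::finite) chart \<Rightarrow> ('b, 'm::finite) chart \<Rightarrow> ('a \<Rightarrow> 'b) \<Rightarrow> (complex^'n) set" where
  "local_dom c d f = snd c ` {p \<in> fst c. f p \<in> fst d}"

definition compatible :: "('a, 'n::finite) chart \<Rightarrow> ('a, 'n) chart \<Rightarrow> bool" where
  "compatible c d \<longleftrightarrow>
     (\<forall>i. holomorphic_fn (local_dom c d id) (\<lambda>x. local_rep c d id x $ i)) \<and>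
     (\<forall>i. holomorphic_fn (local_dom d c id) (\<lambda>x. local_rep d c id x $ i))"

definition complex_manifold :: "('a, 'n::finite) complex_space \<Rightarrow> bool" where
  "complex_manifold M \<longleftrightarrow>
     Hausdorff_space (ctop M) \<and> second_countable (ctop M) \<and>
     (\<forall>c\<in>charts M. is_chart (ctop M) c) \<and>
     (\<Union>c\<in>charts M. fst c) = topspace (ctop M) \<and>
     (\<forall>c\<in>charts M. \<forall>d\<in>charts M. compatible c d)"

definition max_atlas :: "('a, 'n::finite) complex_space \<Rightarrow> ('a, 'n) chart set" where
  "max_atlas M = {c. is_chart (ctop M) c \<and> (\<forall>d\<in>charts M. compatible c d)}"

definition holomorphic_map ::
  "('a, 'n::finite) complex_space \<Rightarrow> ('b, 'm::finite) complex_space \<Rightarrow> ('a \<Rightarrow> 'b) \<Rightarrow> bool" where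
  "holomorphic_map M N f \<longleftrightarrow> continuous_map (ctop M) (ctop N) f \<and>
     (\<forall>c\<in>charts M. \<forall>d\<in>charts N. \<forall>i.
        holomorphic_fn (local_dom c d f) (\<lambda>x. local_rep c d f x $ i))"

definition antiholomorphic_map ::
  "('a, 'n::finite) complex_space \<Rightarrow> ('b, 'm::finite) complex_space \<Rightarrow> ('a \<Rightarrow> 'b) \<Rightarrow> bool" where
  "antiholomorphic_map M N f \<longleftrightarrow> continuous_map (ctop M) (ctop N) f \<and>
     (\<forall>c\<in>charts M. \<forall>d\<in>charts N. \<forall>i.
        holomorphic_fn (local_dom c d f) (\<lambda>x. cnj (local_rep c d f x $ i)))"

definition biholomorphic_map ::
  "('a, 'n::finite) complex_space \<Rightarrow> ('b, 'm::finite) complex_space \<Rightarrow> ('a \<Rightarrow> 'b) \<Rightarrow> bool" where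
  "biholomorphic_map M N f \<longleftrightarrow>
     bij_betw f (topspace (ctop M)) (topspace (ctop N)) \<and>
     holomorphic_map M N f \<and> holomorphic_map N M (inv_into (topspace (ctop M)) f)"

text \<open>A subset \<open>A\<close> is \<open>d\<close>-dimensional regular at \<open>p\<close> if near \<open>p\<close> it is a coordinate slice
  in which exactly the \<open>d\<close> coordinates with index in \<open>K\<close> are free.\<close>

definition regular_point ::
  "('a, 'n::finite) complex_space \<Rightarrow> 'a set \<Rightarrow> nat \<Rightarrow> 'a \<Rightarrow> bool" where
  "regular_point M A d p \<longleftrightarrow> p \<in> A \<and>
     (\<exists>c\<in>max_atlas M. p \<in> fst c \<and>
        (\<exists>K. card K = d \<and> (\<forall>q\<in>fst c. q \<in> A \<longleftrightarrow> (\<forall>j\<in>-K. snd c q $ j = 0))))"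

definition closed_submanifold :: "('a, 'n::finite) complex_space \<Rightarrow> nat \<Rightarrow> 'a set \<Rightarrow> bool" where
  "closed_submanifold M d A \<longleftrightarrow> closedin (ctop M) A \<and> (\<forall>p\<in>A. regular_point M A d p)"

text \<open>The complex structure induced on a locally closed submanifold \<open>A\<close> whose dimension is the
  cardinality of \<open>'d\<close>; in particular on an open subset, if \<open>'d\<close> and \<open>'n\<close> agree.\<close>

definition induced :: "('a, 'n::finite) complex_space \<Rightarrow> 'a set \<Rightarrow> ('a, 'd::finite) complex_space" where
  "induced M A = \<lparr>ctop = subtopology (ctop M) A,
     charts = {(fst c \<inter> A, \<lambda>p. \<chi> k. snd c p $ e k) | c e.
        c \<in> max_atlas M \<and> inj e \<and>
        (\<forall>q\<in>fst c. q \<in> A \<longleftrightarrow> (\<forall>j\<in>-range e. snd c q $ j = 0))}\<rparr>"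

text \<open>The dimension of an analytic subset is the supremum of the dimensions at its regular
  points. The definition is meaningful for analytic subsets only.\<close>

definition analytic_dim_le :: "('a, 'n::finite) complex_space \<Rightarrow> 'a set \<Rightarrow> nat \<Rightarrow> bool" where
  "analytic_dim_le M A d \<longleftrightarrow> (\<forall>e p. regular_point M A e p \<longrightarrow> e \<le> d)"


section \<open>Holomorphic vector bundles given by transition functions\<close>

text \<open>\<open>trans E i j p\<close> takes the fibre coordinates over \<open>patch E i\<close> to those over \<open>patch E j\<close>.\<close>

record ('i, 'a, 'r::finite) cocycle =
  indices :: "'i set"
  patch :: "'i \<Rightarrow> 'a set"
  trans :: "'i \<Rightarrow> 'i \<Rightarrow> 'a \<Rightarrow> complex^('r::finite)^'r"

definition holomorphic_on_patch ::
  "('a, 'n::finite) complex_space \<Rightarrow> 'a set \<Rightarrow> ('a \<Rightarrow> complex) \<Rightarrow> bool" where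
  "holomorphic_on_patch M W g \<longleftrightarrow>
     (\<forall>c\<in>charts M. holomorphic_fn (snd c ` (fst c \<inter> W)) (g \<circ> inv_into (fst c) (snd c)))"

definition bundle_isomorphic ::
  "('a, 'n::finite) complex_space \<Rightarrow> ('i, 'a, 'r::finite) cocycle \<Rightarrow> ('k, 'a, 'r) cocycle \<Rightarrow> bool" where
  "bundle_isomorphic M E F \<longleftrightarrow>
     (\<exists>h :: 'i \<Rightarrow> 'k \<Rightarrow> 'a \<Rightarrow> complex^'r^'r.
        (\<forall>i\<in>indices E. \<forall>k\<in>indices F.
           (\<forall>u v. holomorphic_on_patch M (patch E i \<inter> patch F k) (\<lambda>p. h i k p $ u $ v)) \<and>
           (\<forall>p\<in>patch E i \<inter> patch F k. invertible (h i k p))) \<and>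
        (\<forall>i\<in>indices E. \<forall>i'\<in>indices E. \<forall>k\<in>indices F. \<forall>k'\<in>indices F.
           \<forall>p\<in>patch E i \<inter> patch E i' \<inter> patch F k \<inter> patch F k'.
             h i' k' p ** trans E i i' p = trans F k k' p ** h i k p))"

definition pullback_bundle ::
  "('b, 'n::finite) complex_space \<Rightarrow> ('b \<Rightarrow> 'a) \<Rightarrow> ('i, 'a, 'r::finite) cocycle \<Rightarrow> ('i, 'b, 'r) cocycle" where
  "pullback_bundle M f E = \<lparr>indices = indices E,
     patch = (\<lambda>i. {p \<in> topspace (ctop M). f p \<in> patch E i}),
     trans = (\<lambda>i j p. trans E i j (f p))\<rparr>"

text \<open>The normal bundle of a submanifold \<open>A\<close>, of codimension the cardinality of \<open>'r\<close>. In a chart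
  in which \<open>A\<close> is cut out by the vanishing of the coordinates with index in the range of \<open>\<nu>\<close>,
  the quotient of the tangent bundle of the ambient manifold by that of \<open>A\<close> is framed by the
  corresponding coordinate vector fields; hence the transition functions are the normal blocks of
  the Jacobians of the coordinate changes.\<close>

definition normal_bundle ::
  "('a, 'n::finite) complex_space \<Rightarrow> 'a set \<Rightarrow> (('a, 'n) chart \<times> ('r \<Rightarrow> 'n), 'a, 'r::finite) cocycle" where
  "normal_bundle M A = \<lparr>
     indices = {(c, \<nu>). c \<in> max_atlas M \<and> inj \<nu> \<and>
                  (\<forall>q\<in>fst c. q \<in> A \<longleftrightarrow> (\<forall>l. snd c q $ \<nu> l = 0))},
     patch = (\<lambda>(c, \<nu>). fst c \<inter> A),
     trans = (\<lambda>(c, \<nu>) (d, \<nu>') p. \<chi> k l.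
        frechet_derivative (local_rep c d id) (at (snd c p)) (axis (\<nu> l) 1) $ \<nu>' k)\<rparr>"


section \<open>Projective spaces\<close>

text \<open>Homogeneous coordinates are indexed by \<open>0, 1, \<dots>\<close> in the numeral types \<open>2\<close> and \<open>4\<close>.
  Note that \<^const>\<open>vector\<close> would start with index \<open>1\<close> and place its last entry at index \<open>0\<close>.\<close>

definition vec4 :: "'a \<Rightarrow> 'a \<Rightarrow> 'a \<Rightarrow> 'a \<Rightarrow> 'a^4" where
  "vec4 u v w x = (\<chi> i. if i = 0 then u else if i = 1 then v else if i = 2 then w else x)"

definition pt :: "complex^'n \<Rightarrow> (complex^'n) set" where
  "pt y = {c *s y | c. c \<noteq> 0}"

definition proj_space :: "(complex^'n) set set" where
  "proj_space = pt ` (- {0})"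

definition quotient_topology :: "'a topology \<Rightarrow> ('a \<Rightarrow> 'b) \<Rightarrow> 'b topology" where
  "quotient_topology X q =
     topology (\<lambda>U. U \<subseteq> q ` topspace X \<and> openin X {x \<in> topspace X. q x \<in> U})"

lemma istopology_quotient:
  "istopology (\<lambda>U. U \<subseteq> q ` topspace X \<and> openin X {x \<in> topspace X. q x \<in> U})"
proof -
  have 1: "{x \<in> topspace X. q x \<in> S \<inter> T} =
      {x \<in> topspace X. q x \<in> S} \<inter> {x \<in> topspace X. q x \<in> T}" for S T
    by auto
  have 2: "{x \<in> topspace X. q x \<in> \<Union>\<K>} = (\<Union>K\<in>\<K>. {x \<in> topspace X. q x \<in> K})" for \<K>
    by auto
  show ?thesis
    unfolding istopology_def by (auto simp: 1 2 simp del: Int_iff Union_iff)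
qed

lemma quotient_map_quotient_topology: "quotient_map X (quotient_topology X q) q"
proof -
  have o: "openin (quotient_topology X q) U \<longleftrightarrow>
      U \<subseteq> q ` topspace X \<and> openin X {x \<in> topspace X. q x \<in> U}" for U
    unfolding quotient_topology_def by (simp add: topology_inverse' istopology_quotient)
  have "{x \<in> topspace X. q x \<in> q ` topspace X} = topspace X"
    by auto
  then have "openin (quotient_topology X q) (q ` topspace X)"
    by (simp add: o)
  then have "topspace (quotient_topology X q) = q ` topspace X"
    by (metis o openin_subset openin_topspace subset_antisym)
  then show ?thesis
    unfolding quotient_map_def by (auto simp: o)
qed

definition ratio :: "'n \<Rightarrow> 'n \<Rightarrow> (complex^'n) set \<Rightarrow> complex" where
  "ratio i j P = (let y = (SOME y. y \<in> P) in y $ i / y $ j)"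

lemma ratio_pt: "ratio i j (pt y) = y $ i / y $ j"
proof -
  have "y \<in> pt y"
    unfolding pt_def by (auto intro: exI[of _ 1])
  then have "(SOME x. x \<in> pt y) \<in> pt y"
    by (rule someI)
  then show ?thesis
    unfolding ratio_def pt_def by (auto simp: Let_def)
qed

definition affine_patch :: "'n \<Rightarrow> (complex^'n) set set" where
  "affine_patch i = pt ` {y. y $ i \<noteq> 0}"

text \<open>In the type \<open>2\<close>, \<open>1 - i\<close> is the index different from \<open>i\<close>.\<close>

definition proj_line :: "((complex^2) set, 1) complex_space" where
  "proj_line = \<lparr>ctop = quotient_topology (top_of_set (- {0})) pt,
     charts = {(affine_patch i, \<lambda>P. \<chi> _. ratio (1 - i) i P) | i. True}\<rparr>"

text \<open>The direct sum of copies of \<open>O(1)\<close> on the projective line, one for each element of \<open>'r\<close>: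
  a linear form \<open>s\<close>, as a section of \<open>O(1)\<close>, has the coordinate \<open>s / y\<^sub>i\<close> over the \<open>i\<close>-th
  affine patch.\<close>

definition O1_sum :: "(2, (complex^2) set, 'r::finite) cocycle" where
  "O1_sum = \<lparr>indices = UNIV, patch = affine_patch, trans = (\<lambda>i j P. mat (ratio i j P))\<rparr>"

definition smooth_rational_curve ::
  "('a, 'n::finite) complex_space \<Rightarrow> ((complex^2) set \<Rightarrow> 'a) \<Rightarrow> 'a set \<Rightarrow> bool" where
  "smooth_rational_curve M \<iota> L \<longleftrightarrow> closed_submanifold M 1 L \<and>
     biholomorphic_map proj_line (induced M L :: ('a, 1) complex_space) \<iota>"

definition real_line ::
  "('a, 3) complex_space \<Rightarrow> ('a \<Rightarrow> 'a) \<Rightarrow> 'a set \<Rightarrow> bool" where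
  "real_line Z s L \<longleftrightarrow> s ` L = L \<and>
     (\<exists>\<iota>. smooth_rational_curve Z \<iota> L \<and>
        bundle_isomorphic proj_line
          (pullback_bundle proj_line \<iota>
             (normal_bundle Z L :: (('a, 3) chart \<times> (2 \<Rightarrow> 3), 'a, 2) cocycle))
          O1_sum)"


section \<open>Lines, conics and local intersection numbers\<close>

definition linear_form :: "complex^'n::finite \<Rightarrow> complex^'n \<Rightarrow> complex" where
  "linear_form l y = (\<Sum>i\<in>UNIV. l $ i * y $ i)"

definition quadratic_form :: "complex^'n^'n::finite \<Rightarrow> complex^'n \<Rightarrow> complex" where
  "quadratic_form A y = (\<Sum>i\<in>UNIV. \<Sum>j\<in>UNIV. A $ i $ j * y $ i * y $ j)"

definition is_line :: "(complex^4) set set \<Rightarrow> bool" where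
  "is_line S \<longleftrightarrow> (\<exists>V. vec.subspace V \<and> vec.dim V = 2 \<and> S = pt ` (V - {0}))"

text \<open>The zero locus, in a plane, of an irreducible quadratic form on that plane. The zero form
  is the product of two zero linear forms.\<close>

definition irreducible_conic :: "(complex^4) set set \<Rightarrow> bool" where
  "irreducible_conic C \<longleftrightarrow> (\<exists>l A. l \<noteq> 0 \<and>
     (\<nexists>m n. \<forall>y. linear_form l y = 0 \<longrightarrow> quadratic_form A y = linear_form m y * linear_form n y) \<and>
     C = pt ` {y. y \<noteq> 0 \<and> linear_form l y = 0 \<and> quadratic_form A y = 0})"

text \<open>\<open>\<gamma>\<close> is a lift to \<open>\<complex>\<^sup>4 - {0}\<close> of a local parametrization at \<open>p\<close> of the smooth curve \<open>C\<close>;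
  the last condition says that the map to projective space is immersive at \<open>0\<close>.\<close>

definition local_parametrization ::
  "(complex^4) set set \<Rightarrow> (complex^4) set \<Rightarrow> (complex \<Rightarrow> complex^4) \<Rightarrow> bool" where
  "local_parametrization C p \<gamma> \<longleftrightarrow>
     (\<exists>r>0. (\<forall>i. (\<lambda>t. \<gamma> t $ i) holomorphic_on ball 0 r) \<and>
            (\<forall>t\<in>ball 0 r. \<gamma> t \<noteq> 0 \<and> pt (\<gamma> t) \<in> C)) \<and>
     pt (\<gamma> 0) = p \<and>
     (\<forall>c. (\<chi> i. deriv (\<lambda>t. \<gamma> t $ i) 0) \<noteq> c *s \<gamma> 0)"

text \<open>The local intersection number at \<open>p\<close> of the smooth curve \<open>C\<close> with the surface \<open>F = 0\<close>,
  \<open>F\<close> a homogeneous polynomial not vanishing identically on \<open>C\<close>: the vanishing order at \<open>p\<close> of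
  the restriction of \<open>F\<close> to \<open>C\<close>.\<close>

definition intersection_number ::
  "(complex^4 \<Rightarrow> complex) \<Rightarrow> (complex^4) set set \<Rightarrow> (complex^4) set \<Rightarrow> int" where
  "intersection_number F C p =
     (THE n. \<exists>\<gamma>. local_parametrization C p \<gamma> \<and> zorder (\<lambda>t. F (\<gamma> t)) 0 = n)"


section \<open>The quartic surface and the double solid\<close>

text \<open>\<open>Qf q0 q1 q2\<close> is the real quadratic form with these coefficients, evaluated at real or
  complex arguments.\<close>

definition Qf :: "real \<Rightarrow> real \<Rightarrow> real \<Rightarrow> 'a \<Rightarrow> 'a \<Rightarrow> 'a::{real_algebra_1, comm_ring_1}" where
  "Qf q0 q1 q2 u v = of_real q0 * u^2 + of_real q1 * u * v + of_real q2 * v^2"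

definition cubic :: "real \<Rightarrow> real \<Rightarrow> real \<Rightarrow> real" where
  "cubic a b t = t * (t + 1) * (a * t - b)"

definition discr_poly :: "real \<Rightarrow> real \<Rightarrow> real \<Rightarrow> real \<Rightarrow> real \<Rightarrow> real poly" where
  "discr_poly a b q0 q1 q2 = [:q2, q1, q0:]^2 - [:0, 1:] * [:1, 1:] * [:-b, a:]"

lemma poly_discr_poly: "poly (discr_poly a b q0 q1 q2) t = (Qf q0 q1 q2 t 1)^2 - cubic a b t"
  by (simp add: discr_poly_def Qf_def cubic_def algebra_simps power2_eq_square)

definition quartic :: "real \<Rightarrow> real \<Rightarrow> real \<Rightarrow> real \<Rightarrow> real \<Rightarrow> complex^4 \<Rightarrow> complex" where
  "quartic a b q0 q1 q2 y =
     (y $ 2 * y $ 3 + Qf q0 q1 q2 (y $ 0) (y $ 1))^2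
     - y $ 0 * y $ 1 * (y $ 0 + y $ 1) * (of_real a * y $ 0 - of_real b * y $ 1)"

definition surface_B :: "real \<Rightarrow> real \<Rightarrow> real \<Rightarrow> real \<Rightarrow> real \<Rightarrow> (complex^4) set set" where
  "surface_B a b q0 q1 q2 = pt ` {y. y \<noteq> 0 \<and> quartic a b q0 q1 q2 y = 0}"

definition conj4 :: "complex^4 \<Rightarrow> complex^4" where
  "conj4 y = vec4 (cnj (y $ 0)) (cnj (y $ 1)) (cnj (y $ 3)) (cnj (y $ 2))"

definition sigma :: "(complex^4) set \<Rightarrow> (complex^4) set" where
  "sigma P = conj4 ` P"

definition real_touching_conic ::
  "real \<Rightarrow> real \<Rightarrow> real \<Rightarrow> real \<Rightarrow> real \<Rightarrow> (complex^4) set set \<Rightarrow> bool" where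
  "real_touching_conic a b q0 q1 q2 C \<longleftrightarrow>
     irreducible_conic C \<and> sigma ` C = C \<and>
     (C \<subseteq> surface_B a b q0 q1 q2 \<or>
      (\<forall>p \<in> C \<inter> surface_B a b q0 q1 q2. intersection_number (quartic a b q0 q1 q2) C p \<ge> 2))"

text \<open>The total space of \<open>O(2)\<close> over projective 3-space, as the set of the classes of pairs
  \<open>(y, z)\<close>, \<open>y \<noteq> 0\<close>, under \<open>(y, z) \<sim> (c y, c\<^sup>2 z)\<close>. Over \<open>y\<^sub>i \<noteq> 0\<close> the \<open>i\<close>-th slot of the
  coordinate vector, free since \<open>y\<^sub>i / y\<^sub>i = 1\<close>, carries the fibre coordinate \<open>z / y\<^sub>i\<^sup>2\<close>.\<close>

definition pt_O2 :: "(complex^4) \<times> complex \<Rightarrow> ((complex^4) \<times> complex) set" where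
  "pt_O2 w = {(c *s fst w, c^2 * snd w) | c. c \<noteq> 0}"

definition tot_O2 :: "(((complex^4) \<times> complex) set, 4) complex_space" where
  "tot_O2 = \<lparr>ctop = quotient_topology (top_of_set {w. fst w \<noteq> 0}) pt_O2,
     charts = {(pt_O2 ` {w. fst w $ i \<noteq> 0},
        \<lambda>P. let w = (SOME w. w \<in> P) in
            \<chi> j. if j = i then snd w / (fst w $ i)^2 else fst w $ j / fst w $ i) | i. True}\<rparr>"

definition proj_O2 :: "((complex^4) \<times> complex) set \<Rightarrow> (complex^4) set" where
  "proj_O2 P = fst ` P"

definition conj_O2 :: "((complex^4) \<times> complex) set \<Rightarrow> ((complex^4) \<times> complex) set" where
  "conj_O2 P = (\<lambda>(y, z). (conj4 y, cnj z)) ` P"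

definition double_solid ::
  "real \<Rightarrow> real \<Rightarrow> real \<Rightarrow> real \<Rightarrow> real \<Rightarrow> ((complex^4) \<times> complex) set set" where
  "double_solid a b q0 q1 q2 =
     pt_O2 ` {(y, z). y \<noteq> 0 \<and> z^2 + quartic a b q0 q1 q2 y = 0}"

definition P0 :: "real \<Rightarrow> (complex^4) set" where
  "P0 l0 = pt (vec4 (of_real l0) 1 0 0)"

definition Pinf :: "(complex^4) set" where
  "Pinf = pt (vec4 0 0 0 1)"

definition Pinf' :: "(complex^4) set" where
  "Pinf' = pt (vec4 0 0 1 0)"

text \<open>A resolution of the points \<open>S\<close> of a 3-dimensional analytic subset \<open>X\<close> of the manifold \<open>N\<close>,
  smooth outside \<open>S\<close>: a proper holomorphic surjection from a complex manifold, biholomorphic over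
  the complement of \<open>S\<close>. It is small if its fibres over \<open>S\<close> have dimension at most one, i.e. if
  the exceptional set contains no surface.\<close>

definition small_resolution ::
  "('a, 3) complex_space \<Rightarrow> ('b, 'm::finite) complex_space \<Rightarrow> 'b set \<Rightarrow> 'b set \<Rightarrow> ('a \<Rightarrow> 'b) \<Rightarrow> bool" where
  "small_resolution Z N X S \<mu> \<longleftrightarrow>
     complex_manifold Z \<and> holomorphic_map Z N \<mu> \<and> \<mu> ` topspace (ctop Z) = X \<and>
     proper_map (ctop Z) (subtopology (ctop N) X) \<mu> \<and>
     biholomorphic_map
       (induced Z {p \<in> topspace (ctop Z). \<mu> p \<notin> S} :: ('a, 3) complex_space)
       (induced N (X - S) :: ('b, 3) complex_space) \<mu> \<and>
     (\<forall>s\<in>S. analytic_dim_le Z {p \<in> topspace (ctop Z). \<mu> p = s} 1)"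

definition real_structure_lift ::
  "('a, 3) complex_space \<Rightarrow> ('a \<Rightarrow> ((complex^4) \<times> complex) set) \<Rightarrow> ('a \<Rightarrow> 'a) \<Rightarrow> bool" where
  "real_structure_lift Z \<mu> s \<longleftrightarrow> antiholomorphic_map Z Z s \<and>
     (\<forall>p\<in>topspace (ctop Z). s (s p) = p \<and> \<mu> (s p) = conj_O2 (\<mu> p))"

end

theory Submission
  imports Defs
begin

text \<open>On a small resolution \<open>Z\<close>, the Poincare residue of the ambient volume form with values in
  \<open>O(2)\<close> extends without zeros over the exceptional curves by Hartogs' theorem, so the
  anticanonical bundle of \<open>Z\<close> is the pullback of \<open>O(2)\<close>. A line \<open>L\<close> with normal bundle
  \<open>O(1) \<oplus> O(1)\<close> has anticanonical degree \<open>4\<close>; hence the pullback of \<open>O(1)\<close> to \<open>L\<close> has degree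
  \<open>2\<close> and \<open>L\<close> maps to \<open>\<complex>P\<^sup>3\<close> by \<open>s\<^sup>2 \<alpha> + s t \<beta> + t\<^sup>2 \<gamma>\<close> for some
  vectors \<open>\<alpha>, \<beta>, \<gamma>\<close>.

  If these are dependent, then in suitable coordinates the map is \<open>(s, t) \<mapsto> s\<^sup>2 A + t\<^sup>2 C\<close>, onto a
  line. The fibre coordinate \<open>z\<close> of the double solid along \<open>L\<close> is then an odd function of \<open>t\<close>, as
  otherwise \<open>L\<close> would not be embedded, and a parity count of its zeros forces a singular point
  onto \<open>L\<close>; by reality it is the real one. If they are independent, the image is a smooth conic,
  which is touching because the quartic restricts to \<open>-z\<^sup>2\<close>. It avoids the real double point:
  a real conic through it would have a second real point, whose preimage on \<open>L\<close> is real, but all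
  real points of the double solid lie over the double point.\<close>

text \<open>The degree 4 is adjunction: along \<open>L\<close> the anticanonical bundle is the
  tangent bundle O(2) of \<open>L\<close> times the determinant O(2) of its normal bundle. Degrees
  of bundles are never formed. The inverse residue, paired with quadratic monomials, gives a
  symmetric matrix \<open>Q\<close> of functions on the two affine patches of the line, with
  transition factor -u^4 and with values proportional to y_r y_s. Its entries are polynomials of
  degree at most 4, and the square root of this rank-one matrix is the quadratic parametrization.
  The main obstacle is the extension over the exceptional curves. Smallness only bounds the
  dimension at regular points, whereas Hartogs' theorem needs codimension two. The gap is closed by
  contraposition: where circle means of a function fail to extend it, the exceptional set meets
  every nearby parallel line, and then it contains a piece of a smooth hypersurface, whose points
  are regular of dimension 2. Density and reciprocal are both extended, which excludes zeros. In the
  dependent case the ends s = 0 and t = 0 are the branch points of \<open>L\<close> over the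
  line.\<close>

no_notation fps_nth (infixl "$" 75) \<comment> \<open>otherwise every \<open>$\<close> is ambiguous with vector components\<close>

section \<open>Holomorphic functions of several variables\<close>

lemma holomorphic_fn_open: "holomorphic_fn S f \<Longrightarrow> open S"
  by (simp add: holomorphic_fn_def)

lemma holomorphic_fn_has_derivative:
  assumes "holomorphic_fn S f" "x \<in> S"
  shows "(f has_derivative frechet_derivative f (at x)) (at x)"
  using assms unfolding holomorphic_fn_def
  by (meson differentiable_def frechet_derivative_works)

lemma holomorphic_fn_derivative_linear:
  assumes "holomorphic_fn S f" "x \<in> S"
  shows "frechet_derivative f (at x) (c *s v) = c * frechet_derivative f (at x) v"
proof -
  obtain D where D: "(f has_derivative D) (at x)" "\<forall>c v. D (c *s v) = c * D v"
    using assms unfolding holomorphic_fn_def by blast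
  then show ?thesis
    by (metis frechet_derivative_at)
qed

lemma holomorphic_fn_continuous: "holomorphic_fn S f \<Longrightarrow> continuous_on S f"
  by (meson continuous_at_imp_continuous_on has_derivative_continuous holomorphic_fn_has_derivative)

lemma holomorphic_fn_subset: "holomorphic_fn S f \<Longrightarrow> open T \<Longrightarrow> T \<subseteq> S \<Longrightarrow> holomorphic_fn T f"
  unfolding holomorphic_fn_def by blast

text \<open>The representative \<open>g\<close> may vary with the point, so a function that comes
  from pointwise choices with \<open>SOME\<close> can be treated by any local formula for
  it.\<close>

lemma holomorphic_fn_local:
  assumes "\<And>x. x \<in> S \<Longrightarrow> \<exists>T g. x \<in> T \<and> T \<subseteq> S \<and> holomorphic_fn T g \<and> (\<forall>y\<in>T. f y = g y)"
  shows "holomorphic_fn S f"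
  unfolding holomorphic_fn_def
proof (intro conjI ballI)
  show "open S"
    using assms holomorphic_fn_open by (metis open_subopen)
next
  fix x assume "x \<in> S"
  then obtain T g where T: "x \<in> T" "holomorphic_fn T g" "\<forall>y\<in>T. f y = g y"
    using assms by meson
  then obtain D where "(g has_derivative D) (at x)" "\<forall>c v. D (c *s v) = c * D v"
    unfolding holomorphic_fn_def by blast
  moreover have "(f has_derivative D) (at x)"
    using T calculation(1) holomorphic_fn_open
    by (metis has_derivative_transform_within_open)
  ultimately show "\<exists>D. (f has_derivative D) (at x) \<and> (\<forall>c v. D (c *s v) = c * D v)"
    by blast
qed

lemma holomorphic_fn_cong:
  "holomorphic_fn S f \<Longrightarrow> (\<And>x. x \<in> S \<Longrightarrow> f x = g x) \<Longrightarrow> holomorphic_fn S g"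
  by (rule holomorphic_fn_local) (metis order_refl)

lemma holomorphic_fn_const: "open S \<Longrightarrow> holomorphic_fn S (\<lambda>x. c)"
  unfolding holomorphic_fn_def by (auto intro!: exI[of _ "\<lambda>x. 0"])

lemma holomorphic_fn_component: "open S \<Longrightarrow> holomorphic_fn S (\<lambda>x. x $ i)"
  unfolding holomorphic_fn_def
  by (auto intro!: exI[of _ "\<lambda>x. x $ i"] bounded_linear_imp_has_derivative bounded_linear_vec_nth)

lemma holomorphic_fn_add:
  assumes "holomorphic_fn S f" "holomorphic_fn S g"
  shows "holomorphic_fn S (\<lambda>x. f x + g x)"
  unfolding holomorphic_fn_def
proof (intro conjI ballI)
  fix x assume "x \<in> S"
  then obtain D E where "(f has_derivative D) (at x)" "\<forall>c v. D (c *s v) = c * D v"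
    "(g has_derivative E) (at x)" "\<forall>c v. E (c *s v) = c * E v"
    using assms unfolding holomorphic_fn_def by meson
  then show "\<exists>D. ((\<lambda>x. f x + g x) has_derivative D) (at x) \<and> (\<forall>c v. D (c *s v) = c * D v)"
    by (intro exI[of _ "\<lambda>x. D x + E x"]) (auto intro!: derivative_intros simp: algebra_simps)
qed (use assms holomorphic_fn_open in blast)

lemma holomorphic_fn_mult:
  assumes "holomorphic_fn S f" "holomorphic_fn S g"
  shows "holomorphic_fn S (\<lambda>x. f x * g x)"
  unfolding holomorphic_fn_def
proof (intro conjI ballI)
  fix x assume "x \<in> S"
  then obtain D E where "(f has_derivative D) (at x)" "\<forall>c v. D (c *s v) = c * D v"
    "(g has_derivative E) (at x)" "\<forall>c v. E (c *s v) = c * E v"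
    using assms unfolding holomorphic_fn_def by meson
  then show "\<exists>D. ((\<lambda>x. f x * g x) has_derivative D) (at x) \<and> (\<forall>c v. D (c *s v) = c * D v)"
    by (intro exI[of _ "\<lambda>h. f x * E h + D h * g x"] conjI has_derivative_mult)
      (auto simp: algebra_simps)
qed (use assms holomorphic_fn_open in blast)

lemma holomorphic_fn_minus:
  "holomorphic_fn S f \<Longrightarrow> holomorphic_fn S (\<lambda>x. - f x)"
  using holomorphic_fn_mult[OF holomorphic_fn_const[of S "-1"]] holomorphic_fn_open[of S f] by fastforce

lemma holomorphic_fn_diff:
  "holomorphic_fn S f \<Longrightarrow> holomorphic_fn S g \<Longrightarrow> holomorphic_fn S (\<lambda>x. f x - g x)"
  using holomorphic_fn_add[of S f "\<lambda>x. - g x"] holomorphic_fn_minus[of S g] by simp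

lemma holomorphic_fn_power:
  assumes "holomorphic_fn S f" shows "holomorphic_fn S (\<lambda>x. f x ^ n)"
  by (induction n)
    (use assms holomorphic_fn_const[OF holomorphic_fn_open[OF assms]] holomorphic_fn_mult in auto)

lemma holomorphic_fn_inverse:
  assumes "holomorphic_fn S f" "\<And>x. x \<in> S \<Longrightarrow> f x \<noteq> 0"
  shows "holomorphic_fn S (\<lambda>x. inverse (f x))"
  unfolding holomorphic_fn_def
proof (intro conjI ballI)
  fix x assume x: "x \<in> S"
  then obtain D where "(f has_derivative D) (at x)" "\<forall>c v. D (c *s v) = c * D v"
    using assms unfolding holomorphic_fn_def by meson
  then show "\<exists>D. ((\<lambda>x. inverse (f x)) has_derivative D) (at x) \<and> (\<forall>c v. D (c *s v) = c * D v)"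
    using assms(2)[OF x]
    by (intro exI[of _ "\<lambda>h. - (inverse (f x) * D h * inverse (f x))"] conjI Deriv.has_derivative_inverse)
      (auto simp: algebra_simps)
qed (use assms holomorphic_fn_open in blast)

lemma holomorphic_fn_divide:
  assumes "holomorphic_fn S f" "holomorphic_fn S g" "\<And>x. x \<in> S \<Longrightarrow> g x \<noteq> 0"
  shows "holomorphic_fn S (\<lambda>x. f x / g x)"
  using holomorphic_fn_mult[OF assms(1) holomorphic_fn_inverse[OF assms(2,3)]]
  by (simp add: divide_inverse)

definition holo_map :: "(complex^'n) set \<Rightarrow> (complex^'n \<Rightarrow> complex^'m) \<Rightarrow> bool" where
  "holo_map S f \<longleftrightarrow> (\<forall>i. holomorphic_fn S (\<lambda>x. f x $ i))"

lemma has_derivative_vec: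
  fixes f :: "'a::real_normed_vector \<Rightarrow> 'b::real_normed_vector ^ 'n::finite"
  assumes "\<And>i. ((\<lambda>x. f x $ i) has_derivative (\<lambda>h. D h $ i)) (at x within S)"
  shows "(f has_derivative D) (at x within S)"
proof -
  have b: "bounded_linear D"
  proof -
    interpret l: bounded_linear "\<lambda>h. D h $ i" for i
      using assms has_derivative_bounded_linear by blast
    show ?thesis
    proof (rule bounded_linear_intro[where K = "\<Sum>i\<in>UNIV. onorm (\<lambda>h. D h $ i)"])
      show "norm (D x) \<le> norm x * (\<Sum>i\<in>UNIV. onorm (\<lambda>h. D h $ i))" for x
      proof -
        have "norm (D x) \<le> (\<Sum>i\<in>UNIV. norm (D x $ i))"
          unfolding norm_vec_def by (simp add: L2_set_le_sum)
        also have "\<dots> \<le> (\<Sum>i\<in>UNIV. onorm (\<lambda>h. D h $ i) * norm x)"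
          by (intro sum_mono onorm l.bounded_linear_axioms)
        finally show ?thesis
          by (simp add: sum_distrib_right [symmetric] mult.commute[of "norm x"])
      qed
    qed (simp_all add: vec_eq_iff l.add l.scaleR)
  qed
  have "((\<lambda>y. inverse (norm (y - x)) *\<^sub>R (f y - (f x + D (y - x)))) \<longlongrightarrow> 0) (at x within S)"
  proof (rule vec_tendstoI)
    fix i
    show "((\<lambda>y. (inverse (norm (y - x)) *\<^sub>R (f y - (f x + D (y - x)))) $ i) \<longlongrightarrow> 0 $ i) (at x within S)"
      using assms[of i] by (simp add: has_derivative_within inverse_eq_divide)
  qed
  with b show ?thesis
    by (simp add: has_derivative_within inverse_eq_divide)
qed

lemma holo_map_open: "holo_map S f \<Longrightarrow> open S"
  unfolding holo_map_def using holomorphic_fn_open by blast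

lemma holo_map_has_derivative:
  assumes "holo_map S f" "x \<in> S"
  shows "(f has_derivative frechet_derivative f (at x)) (at x)"
proof -
  have "(f has_derivative (\<lambda>h. \<chi> i. frechet_derivative (\<lambda>x. f x $ i) (at x) h)) (at x)"
    by (rule has_derivative_vec)
      (use assms holomorphic_fn_has_derivative in \<open>force simp: holo_map_def\<close>)
  then show ?thesis
    by (metis frechet_derivative_at)
qed

lemma frechet_derivative_component:
  assumes "f differentiable (at x)"
  shows "frechet_derivative (\<lambda>x. f x $ i) (at x) = (\<lambda>h. frechet_derivative f (at x) h $ i)"
proof -
  have "((\<lambda>x. f x $ i) has_derivative (\<lambda>h. frechet_derivative f (at x) h $ i)) (at x)"
    using assms frechet_derivative_works
    by (intro bounded_linear.has_derivative[OF bounded_linear_vec_nth]) blast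
  then show ?thesis
    by (metis frechet_derivative_at)
qed

lemma holo_map_derivative_linear:
  assumes "holo_map S f" "x \<in> S"
  shows "frechet_derivative f (at x) (c *s v) = c *s frechet_derivative f (at x) v"
proof -
  have "f differentiable (at x)"
    using holo_map_has_derivative[OF assms] by (rule differentiableI)
  moreover have "frechet_derivative (\<lambda>x. f x $ i) (at x) (c *s v) = c * frechet_derivative (\<lambda>x. f x $ i) (at x) v" for i
    using assms by (intro holomorphic_fn_derivative_linear) (auto simp: holo_map_def)
  ultimately show ?thesis
    by (simp add: vec_eq_iff frechet_derivative_component)
qed

lemma holo_map_continuous: "holo_map S f \<Longrightarrow> continuous_on S f"
  by (meson continuous_at_imp_continuous_on has_derivative_continuous holo_map_has_derivative)

lemma holomorphic_fn_compose:
  assumes "holomorphic_fn T g" "holo_map S f" "f ` S \<subseteq> T"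
  shows "holomorphic_fn S (\<lambda>x. g (f x))"
  unfolding holomorphic_fn_def
proof (intro conjI ballI)
  show "open S" using assms holo_map_open by blast
  fix x assume x: "x \<in> S"
  with assms have fx: "f x \<in> T" by auto
  show "\<exists>D. ((\<lambda>x. g (f x)) has_derivative D) (at x) \<and> (\<forall>c v. D (c *s v) = c * D v)"
    using has_derivative_compose[OF holo_map_has_derivative[OF assms(2) x] holomorphic_fn_has_derivative[OF assms(1) fx]]
      holo_map_derivative_linear[OF assms(2) x] holomorphic_fn_derivative_linear[OF assms(1) fx]
    by auto
qed

lemma holo_map_compose:
  assumes "holo_map T g" "holo_map S f" "f ` S \<subseteq> T"
  shows "holo_map S (\<lambda>x. g (f x))"
  using assms holomorphic_fn_compose[OF _ assms(2,3)] unfolding holo_map_def by blast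

lemma holo_map_subset: "holo_map S f \<Longrightarrow> open T \<Longrightarrow> T \<subseteq> S \<Longrightarrow> holo_map T f"
  unfolding holo_map_def by (meson holomorphic_fn_subset)

lemma holo_map_cong:
  "holo_map S f \<Longrightarrow> (\<And>x. x \<in> S \<Longrightarrow> f x = g x) \<Longrightarrow> holo_map S g"
  unfolding holo_map_def using holomorphic_fn_cong by fastforce

lemma holo_map_local:
  assumes "\<And>x. x \<in> S \<Longrightarrow> \<exists>T g. x \<in> T \<and> T \<subseteq> S \<and> holo_map T g \<and> (\<forall>y\<in>T. f y = g y)"
  shows "holo_map S f"
  unfolding holo_map_def
proof (intro allI holomorphic_fn_local)
  fix i x assume "x \<in> S"
  then obtain T g where "x \<in> T" "T \<subseteq> S" "holo_map T g" "\<forall>y\<in>T. f y = g y"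
    using assms by blast
  then show "\<exists>T g. x \<in> T \<and> T \<subseteq> S \<and> holomorphic_fn T g \<and> (\<forall>y\<in>T. f y $ i = g y)"
    by (intro exI[of _ T] exI[of _ "\<lambda>y. g y $ i"]) (auto simp: holo_map_def)
qed

lemma holo_map_id: "open S \<Longrightarrow> holo_map S (\<lambda>x. x)"
  by (simp add: holo_map_def holomorphic_fn_component)

text \<open>The bridge to one variable: complex linearity of the derivative turns the real chain
  rule into a complex derivative, so Cauchy's formula and the identity theorem become available on
  every holomorphic curve.\<close>

lemma holomorphic_fn_along_curve:
  fixes \<gamma> :: "complex \<Rightarrow> complex^'n::finite"
  assumes f: "holomorphic_fn S f" and "\<gamma> t \<in> S"
    and \<gamma>: "\<And>i. ((\<lambda>t. \<gamma> t $ i) has_field_derivative v $ i) (at t)"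
  shows "((\<lambda>t. f (\<gamma> t)) has_field_derivative frechet_derivative f (at (\<gamma> t)) v) (at t)"
proof -
  have "(\<gamma> has_derivative (\<lambda>h. h *s v)) (at t)"
    by (rule has_derivative_vec) (use \<gamma> in \<open>simp add: has_field_derivative_def mult.commute[of _ "v $ _"]\<close>)
  from has_derivative_compose[OF this holomorphic_fn_has_derivative[OF f assms(2)]]
  show ?thesis
    by (simp add: has_field_derivative_def holomorphic_fn_derivative_linear[OF f assms(2)] mult.commute[of _ "frechet_derivative _ _ _"])
qed

lemma holomorphic_on_along_curve:
  fixes \<gamma> :: "complex \<Rightarrow> complex^'n::finite"
  assumes f: "holomorphic_fn S f" and "\<gamma> ` T \<subseteq> S" "open T"
    and \<gamma>: "\<And>i. (\<lambda>t. \<gamma> t $ i) holomorphic_on T"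
  shows "(\<lambda>t. f (\<gamma> t)) holomorphic_on T"
proof (rule holomorphic_onI)
  fix t assume t: "t \<in> T"
  have "((\<lambda>t. f (\<gamma> t)) has_field_derivative frechet_derivative f (at (\<gamma> t)) (\<chi> i. deriv (\<lambda>t. \<gamma> t $ i) t)) (at t)"
    by (rule holomorphic_fn_along_curve[OF f])
      (use assms t in \<open>auto intro!: holomorphic_derivI\<close>)
  then show "(\<lambda>t. f (\<gamma> t)) field_differentiable at t within T"
    using field_differentiable_at_within field_differentiable_def by blast
qed

section \<open>Cauchy integrals over circles, Osgood's lemma, integrals with parameters\<close>

lemma norm_axis_one [simp]: "norm (axis k (1::complex)) = 1"
  by (simp add: axis_def norm_vec_def L2_set_def if_distrib[of norm] if_distrib[of "\<lambda>x. x^2"] cong: if_cong)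

lemma norm_vector_smult: "norm (c *s (v::complex^'n)) = norm c * norm v"
  unfolding norm_vec_def by (simp add: norm_mult L2_set_right_distrib)

lemma continuous_on_vector_smult [continuous_intros]:
  fixes g :: "'a::topological_space \<Rightarrow> complex^'n"
  assumes "continuous_on S f" "continuous_on S g"
  shows "continuous_on S (\<lambda>x. f x *s g x)"
  unfolding vector_scalar_mult_def
  by (intro continuous_on_vec_lambda continuous_intros assms)

text \<open>Cauchy's formula with the circle written out as an integral over [0,1]; in this form the
  centre \<open>z\<close> is an ordinary parameter of the integrand.\<close>

lemma mean_value_holomorphic:
  assumes "g holomorphic_on ball z R" "0 < r" "r < R"
  shows "integral {0..1} (\<lambda>s. g (z + of_real r * exp (2 * of_real pi * \<i> * of_real s))) = g z"
proof -
  have vd: "vector_derivative (circlepath z r) (at s) = 2 * of_real pi * \<i> * (of_real r * exp (2 * of_real pi * \<i> * of_real s))" for s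
    by (simp add: vector_derivative_circlepath mult_ac)
  have circlepath': "circlepath z r s = z + of_real r * exp (2 * of_real pi * \<i> * of_real s)" for s
    by (simp add: circlepath)
  have c: "continuous_on (cball z r) g"
    by (rule holomorphic_on_imp_continuous_on[OF holomorphic_on_subset[OF assms(1)]]) (use assms in auto)
  have h: "g holomorphic_on ball z r"
    by (rule holomorphic_on_subset[OF assms(1)]) (use assms in auto)
  have "((\<lambda>u. g u / (u - z)) has_contour_integral 2 * of_real pi * \<i> * g z) (circlepath z r)"
    by (rule Cauchy_integral_circlepath[OF c h]) (use assms in auto)
  then have "((\<lambda>s. g (circlepath z r s) / (circlepath z r s - z) * vector_derivative (circlepath z r) (at s))
      has_integral 2 * of_real pi * \<i> * g z) {0..1}"
    by (simp add: has_contour_integral)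
  then have "((\<lambda>s. 2 * of_real pi * \<i> * g (z + of_real r * exp (2 * of_real pi * \<i> * of_real s)))
      has_integral 2 * of_real pi * \<i> * g z) {0..1}"
    using assms by (simp add: vd circlepath' field_simps)
  from has_integral_mult_right[OF this, of "1 / (2 * of_real pi * \<i>)"]
  have "((\<lambda>s. g (z + of_real r * exp (2 * of_real pi * \<i> * of_real s))) has_integral g z) {0..1}"
    by simp
  then show ?thesis by (rule integral_unique)
qed

text \<open>Cauchy's formula for the first derivative in the same form. It expresses derivatives
  through values, so continuity and holomorphy pass from a function to its derivatives.\<close>

lemma deriv_as_mean:
  assumes "g holomorphic_on ball z R" "0 < r" "r < R"
  shows "integral {0..1} (\<lambda>s. g (z + of_real r * exp (2 * of_real pi * \<i> * of_real s)) /
      (of_real r * exp (2 * of_real pi * \<i> * of_real s))) = deriv g z"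
proof -
  have vd: "vector_derivative (circlepath z r) (at s) = 2 * of_real pi * \<i> * (of_real r * exp (2 * of_real pi * \<i> * of_real s))" for s
    by (simp add: vector_derivative_circlepath mult_ac)
  have circlepath': "circlepath z r s = z + of_real r * exp (2 * of_real pi * \<i> * of_real s)" for s
    by (simp add: circlepath)
  have c: "continuous_on (cball z r) g"
    by (rule holomorphic_on_imp_continuous_on[OF holomorphic_on_subset[OF assms(1)]]) (use assms in auto)
  have h: "g holomorphic_on ball z r"
    by (rule holomorphic_on_subset[OF assms(1)]) (use assms in auto)
  have "((\<lambda>u. g u / (u - z) ^ Suc 1) has_contour_integral (2 * pi * \<i>) / fact 1 * (deriv ^^ 1) g z) (circlepath z r)"
    by (rule Cauchy_has_contour_integral_higher_derivative_circlepath[OF c h]) (use assms in auto)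
  then have "((\<lambda>s. g (circlepath z r s) / (circlepath z r s - z)^2 * vector_derivative (circlepath z r) (at s))
      has_integral 2 * of_real pi * \<i> * deriv g z) {0..1}"
    by (simp add: has_contour_integral numeral_2_eq_2)
  then have "((\<lambda>s. 2 * of_real pi * \<i> * (g (z + of_real r * exp (2 * of_real pi * \<i> * of_real s)) /
      (of_real r * exp (2 * of_real pi * \<i> * of_real s))))
      has_integral 2 * of_real pi * \<i> * deriv g z) {0..1}"
    using assms by (simp add: vd circlepath' field_simps power2_eq_square)
  from has_integral_mult_right[OF this, of "1 / (2 * of_real pi * \<i>)"]
  have "((\<lambda>s. g (z + of_real r * exp (2 * of_real pi * \<i> * of_real s)) /
      (of_real r * exp (2 * of_real pi * \<i> * of_real s))) has_integral deriv g z) {0..1}"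
    by simp
  then show ?thesis by (rule integral_unique)
qed

lemma holomorphic_on_line:
  assumes f: "holomorphic_fn S f" and "\<And>t. t \<in> T \<Longrightarrow> x + t *s d \<in> S" "open T"
  shows "(\<lambda>t. f (x + t *s d)) holomorphic_on T"
  by (rule holomorphic_on_along_curve[OF f _ assms(3)]) (use assms in \<open>auto intro!: holomorphic_intros\<close>)

lemma deriv_on_line:
  assumes f: "holomorphic_fn S f" and "x \<in> S"
  shows "deriv (\<lambda>t. f (x + t *s d)) 0 = frechet_derivative f (at x) d"
proof (rule DERIV_imp_deriv)
  have "((\<lambda>t. f (x + t *s d)) has_field_derivative frechet_derivative f (at (x + 0 *s d)) d) (at 0)"
    by (rule holomorphic_fn_along_curve[OF f]) (use assms in \<open>auto intro!: derivative_eq_intros\<close>)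
  then show "((\<lambda>t. f (x + t *s d)) has_field_derivative frechet_derivative f (at x) d) (at 0)"
    by simp
qed

text \<open>Morera's theorem: Fubini exchanges the integral around a triangle with the integral over
  \<open>s\<close>, and for fixed \<open>s\<close> the former vanishes by Cauchy's theorem.\<close>

lemma holomorphic_integral_parameter_complex:
  fixes G :: "complex \<Rightarrow> real \<Rightarrow> complex"
  assumes "open T" and c: "continuous_on (T \<times> {0..1}) (\<lambda>(w, s). G w s)"
    and h: "\<And>s. s \<in> {0..1} \<Longrightarrow> (\<lambda>w. G w s) holomorphic_on T"
  shows "(\<lambda>w. integral {0..1} (G w)) holomorphic_on T"
proof -
  have "(\<lambda>w. integral {0..1} (G w)) analytic_on T"
  proof (rule Morera_triangle)
    show "continuous_on T (\<lambda>w. integral {0..1} (G w))"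
      using integral_continuous_on_param[of T 0 1 G] c by simp
    show "open T" by fact
    fix a b c' :: complex
    show "convex hull {a, b, c'} \<subseteq> T \<longrightarrow>
      contour_integral (linepath a b) (\<lambda>w. integral {0..1} (G w)) +
      contour_integral (linepath b c') (\<lambda>w. integral {0..1} (G w)) +
      contour_integral (linepath c' a) (\<lambda>w. integral {0..1} (G w)) = 0"
    proof
      assume hull: "convex hull {a, b, c'} \<subseteq> T"
      \<comment> \<open>Fubini on one side of the triangle. Continuity in \<open>s\<close> is
        recorded because the three sides are later added under the integral sign.\<close>
      have seg: "contour_integral (linepath p q) (\<lambda>w. integral {0..1} (G w)) =
          integral {0..1} (\<lambda>s. contour_integral (linepath p q) (\<lambda>w. G w s))
        \<and> continuous_on {0..1} (\<lambda>s. contour_integral (linepath p q) (\<lambda>w. G w s))"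
        if "closed_segment p q \<subseteq> T" for p q
      proof -
        have im: "linepath p q t \<in> T" if "t \<in> {0..1}" for t
          using that \<open>closed_segment p q \<subseteq> T\<close> linepath_in_path by fastforce
        have cc: "continuous_on (cbox (0,0) (1,1)) (\<lambda>(t, s). G (linepath p q t) s * (q - p))"
        proof -
          have "continuous_on (cbox (0,0) (1,1)) (\<lambda>z. (\<lambda>(w, s). G w s) (linepath p q (fst z), snd z))"
            by (rule continuous_on_compose2[OF c])
              (auto intro!: continuous_intros simp: im linepath_def[abs_def] cbox_Pair_eq, metis im atLeastAtMost_iff linepath_def)
          then have "continuous_on (cbox (0,0) (1,1)) (\<lambda>z. G (linepath p q (fst z)) (snd z) * (q - p))"
            by (auto intro!: continuous_intros)
          then show ?thesis by (simp add: case_prod_unfold)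
        qed
        have ci: "contour_integral (linepath p q) f = integral {0..1} (\<lambda>t. f (linepath p q t) * (q - p))" for f
          by (simp add: contour_integral_integral)
        have "contour_integral (linepath p q) (\<lambda>w. integral {0..1} (G w)) =
            integral (cbox 0 1) (\<lambda>t. integral (cbox 0 1) (\<lambda>s. G (linepath p q t) s * (q - p)))"
          by (simp add: ci)
        also have "\<dots> = integral (cbox 0 1) (\<lambda>s. integral (cbox 0 1) (\<lambda>t. G (linepath p q t) s * (q - p)))"
          by (rule integral_swap_continuous[OF cc])
        also have "\<dots> = integral {0..1} (\<lambda>s. contour_integral (linepath p q) (\<lambda>w. G w s))"
          by (simp add: ci)
        finally have 1: "contour_integral (linepath p q) (\<lambda>w. integral {0..1} (G w)) =
          integral {0..1} (\<lambda>s. contour_integral (linepath p q) (\<lambda>w. G w s))" .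
        have "continuous_on ({0..1} \<times> cbox 0 1) (\<lambda>(s, t). G (linepath p q t) s * (q - p))"
        proof -
          have "continuous_on ({0..1} \<times> cbox 0 1) (\<lambda>z. (\<lambda>(t, s). G (linepath p q t) s * (q - p)) (snd z, fst z))"
            by (rule continuous_on_compose2[OF cc]) (auto intro!: continuous_intros simp: cbox_Pair_eq)
          then show ?thesis by (simp add: case_prod_unfold)
        qed
        then have "continuous_on {0..1} (\<lambda>s. integral (cbox 0 1) (\<lambda>t. G (linepath p q t) s * (q - p)))"
          by (rule integral_continuous_on_param)
        then show ?thesis using 1 by (simp add: ci)
      qed
      have sub: "closed_segment a b \<subseteq> T" "closed_segment b c' \<subseteq> T" "closed_segment c' a \<subseteq> T"
        using hull by (meson dual_order.trans segments_subset_convex_hull)+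
      have zero: "contour_integral (linepath a b) (\<lambda>w. G w s) + contour_integral (linepath b c') (\<lambda>w. G w s) +
          contour_integral (linepath c' a) (\<lambda>w. G w s) = 0" if "s \<in> {0..1}" for s
      proof -
        have "((\<lambda>w. G w s) has_contour_integral 0) (linepath a b +++ linepath b c' +++ linepath c' a)"
          by (rule Cauchy_theorem_triangle) (rule holomorphic_on_subset[OF h[OF that] hull])
        then show ?thesis
          using has_chain_integral_chain_integral3 by blast
      qed
      have "integral {0..1} (\<lambda>s. contour_integral (linepath a b) (\<lambda>w. G w s) + contour_integral (linepath b c') (\<lambda>w. G w s) +
          contour_integral (linepath c' a) (\<lambda>w. G w s)) = 0"
        by (rule trans[OF Henstock_Kurzweil_Integration.integral_cong[where g = "\<lambda>_. 0"]]) (use zero in auto)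
      then show "contour_integral (linepath a b) (\<lambda>w. integral {0..1} (G w)) +
        contour_integral (linepath b c') (\<lambda>w. integral {0..1} (G w)) +
        contour_integral (linepath c' a) (\<lambda>w. integral {0..1} (G w)) = 0"
        using seg[OF sub(1)] seg[OF sub(2)] seg[OF sub(3)]
        by (simp add: Henstock_Kurzweil_Integration.integral_add integrable_continuous_real continuous_on_add)
    qed
  qed
  then show ?thesis by (rule analytic_imp_holomorphic)
qed

lemma dist_self_add: "dist x (x + w) = norm (w::'a::real_normed_vector)"
  by (simp add: dist_norm)

text \<open>Telescoping over the coordinates: each step changes one coordinate and is estimated by
  the mean value inequality, using that \<open>D k\<close> is close to its value at
  \<open>x\<close>.\<close>

lemma has_derivative_continuous_partials:
  fixes f :: "complex^'n \<Rightarrow> complex"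
  assumes "open S" "x \<in> S"
    and d: "\<And>y k. y \<in> S \<Longrightarrow> ((\<lambda>t. f (y + t *s axis k 1)) has_field_derivative D k y) (at 0)"
    and c: "\<And>k. continuous_on S (D k)"
  shows "(f has_derivative (\<lambda>v. \<Sum>k\<in>UNIV. v $ k * D k x)) (at x)"
proof -
  obtain R where R: "R > 0" "ball x R \<subseteq> S"
    using assms openE by blast
  \<comment> \<open>Induction over the set \<open>A\<close> of coordinates in which the increment
    \<open>v\<close> may be nonzero; \<open>A = UNIV\<close> is the case wanted.\<close>
  have main: "\<exists>\<delta>>0. \<forall>v. norm v < \<delta> \<and> (\<forall>k\<in>-A. v $ k = 0) \<longrightarrow>
      norm (f (x + v) - f x - (\<Sum>k\<in>A. v $ k * D k x)) \<le> \<epsilon> * (\<Sum>k\<in>A. norm (v $ k))"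
    if "\<epsilon> > 0" for A :: "'n set" and \<epsilon>
  proof (use finite[of A] in \<open>induction A rule: finite_induct\<close>)
    case empty
    have "v = 0" if "\<forall>k. v $ k = 0" for v :: "complex^'n"
      using that by (simp add: vec_eq_iff)
    then show ?case by (intro exI[of _ 1]) fastforce
  next
    case (insert k A)
    then obtain \<delta> where \<delta>: "\<delta> > 0" "\<And>v. norm v < \<delta> \<Longrightarrow> (\<forall>k\<in>-A. v $ k = 0) \<Longrightarrow>
      norm (f (x + v) - f x - (\<Sum>k\<in>A. v $ k * D k x)) \<le> \<epsilon> * (\<Sum>k\<in>A. norm (v $ k))"
      by blast
    have "isCont (D k) x"
      using assms continuous_on_eq_continuous_at by blast
    then obtain \<eta> where \<eta>: "\<eta> > 0" "\<And>y. norm (y - x) < \<eta> \<Longrightarrow> norm (D k y - D k x) < \<epsilon>"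
      unfolding continuous_at_eps_delta dist_norm using \<open>\<epsilon> > 0\<close> by metis
    \<comment> \<open>The vector \<open>v'\<close> below has norm less than twice \<delta>', and
      moving along the k-th axis adds less than \<delta>'; the quarter keeps every point used within
      all three radii.\<close>
    define \<delta>' where "\<delta>' = min (min \<delta> \<eta>) R / 4"
    have \<delta>': "\<delta>' > 0" using \<delta>(1) \<eta>(1) R(1) by (simp add: \<delta>'_def)
    show ?case
    proof (intro exI[of _ \<delta>'] conjI \<delta>' allI impI)
      fix v :: "complex^'n" assume v: "norm v < \<delta>' \<and> (\<forall>j\<in>- insert k A. v $ j = 0)"
      define v' where "v' = v - (v $ k) *s axis k 1"
      have vk: "norm (v $ k) < \<delta>'" using v Finite_Cartesian_Product.norm_nth_le[of v k] by linarith
      have nv': "norm v' < 2 * \<delta>'"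
        using norm_triangle_ineq4[of v "(v $ k) *s axis k 1"] v vk by (simp add: v'_def norm_vector_smult)
      have v'0: "\<forall>j\<in>-A. v' $ j = 0"
        using v by (auto simp: v'_def axis_def)
      have v'A: "v' $ j = v $ j" if "j \<in> A" for j
        using that insert by (auto simp: v'_def axis_def)
      have small: "norm (v' + t *s axis k 1) < 4 * \<delta>'" if "norm t < \<delta>'" for t
        using norm_triangle_ineq[of v' "t *s axis k 1"] nv' that \<delta>'
        unfolding norm_vector_smult norm_axis_one mult_1_right by linarith
      have inS: "x + (v' + t *s axis k 1) \<in> S" if "norm t < \<delta>'" for t
      proof -
        have "4 * \<delta>' \<le> R" by (simp add: \<delta>'_def)
        then show ?thesis using small[OF that] R by (intro subsetD[OF R(2)]) (simp add: dist_self_add)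
      qed
      \<comment> \<open>With the linear term subtracted, the derivative is a difference of two
        values of \<open>D k\<close> and so at most \<epsilon> in norm.\<close>
      define g where "g t = f (x + (v' + t *s axis k 1)) - t * D k x" for t
      have dg: "(g has_field_derivative D k (x + (v' + t *s axis k 1)) - D k x) (at t)" if "norm t < \<delta>'" for t
      proof -
        have "((\<lambda>u. f ((x + (v' + t *s axis k 1)) + u *s axis k 1)) has_field_derivative D k (x + (v' + t *s axis k 1))) (at (t - t))"
          using d[OF inS[OF that]] by simp
        then have "((\<lambda>u. f ((x + (v' + t *s axis k 1)) + (u - t) *s axis k 1)) has_field_derivative D k (x + (v' + t *s axis k 1))) (at t)"
          by (rule DERIV_cong[OF DERIV_chain2[where g = "\<lambda>u. u - t"]]) (auto intro!: derivative_eq_intros)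
        moreover have "(x + (v' + t *s axis k 1)) + (u - t) *s axis k 1 = x + (v' + u *s axis k 1)" for u
          by (simp add: vec_eq_iff algebra_simps)
        ultimately have "((\<lambda>u. f (x + (v' + u *s axis k 1))) has_field_derivative D k (x + (v' + t *s axis k 1))) (at t)"
          by simp
        then show ?thesis unfolding g_def
          by (auto intro!: derivative_eq_intros)
      qed
      have "norm (g (v $ k) - g 0) \<le> \<epsilon> * norm (v $ k - 0)"
      proof (rule field_differentiable_bound[of "ball 0 \<delta>'"])
        show "(g has_field_derivative D k (x + (v' + t *s axis k 1)) - D k x) (at t within ball 0 \<delta>')"
          if "t \<in> ball 0 \<delta>'" for t
          using dg that by (simp add: has_field_derivative_at_within)
        show "norm (D k (x + (v' + t *s axis k 1)) - D k x) \<le> \<epsilon>" if "t \<in> ball 0 \<delta>'" for t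
        proof -
          have "4 * \<delta>' \<le> \<eta>" by (simp add: \<delta>'_def)
          then show ?thesis using \<eta>(2)[of "x + (v' + t *s axis k 1)"] small[of t] that by simp
        qed
      qed (use vk \<delta>' in auto)
      moreover have "v' + (v $ k) *s axis k 1 = v" by (simp add: v'_def)
      ultimately have 1: "norm (f (x + v) - v $ k * D k x - f (x + v')) \<le> \<epsilon> * norm (v $ k)"
        by (simp add: g_def)
      have "4 * \<delta>' \<le> \<delta>" by (simp add: \<delta>'_def)
      then have 2: "norm (f (x + v') - f x - (\<Sum>k\<in>A. v $ k * D k x)) \<le> \<epsilon> * (\<Sum>k\<in>A. norm (v $ k))"
        using \<delta>(2)[of v'] nv' v'0 v'A \<delta>' by simp
      have "norm (f (x + v) - f x - (\<Sum>k\<in>insert k A. v $ k * D k x)) =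
          norm ((f (x + v) - v $ k * D k x - f (x + v')) + (f (x + v') - f x - (\<Sum>k\<in>A. v $ k * D k x)))"
        using insert by (simp add: algebra_simps)
      also have "\<dots> \<le> \<epsilon> * norm (v $ k) + \<epsilon> * (\<Sum>k\<in>A. norm (v $ k))"
        using norm_triangle_ineq 1 2 by (meson add_mono order_trans)
      finally show "norm (f (x + v) - f x - (\<Sum>k\<in>insert k A. v $ k * D k x)) \<le> \<epsilon> * (\<Sum>k\<in>insert k A. norm (v $ k))"
        using insert by (simp add: algebra_simps)
    qed
  qed
  show ?thesis
    unfolding has_derivative_at_alt
  proof (intro conjI allI impI)
    show "bounded_linear (\<lambda>v. \<Sum>k\<in>UNIV. v $ k * D k x)"
      by (intro bounded_linear_sum bounded_linear_mult_const bounded_linear_vec_nth)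
    fix e :: real assume "e > 0"
    define \<epsilon> where "\<epsilon> = e / CARD('n)"
    have \<epsilon>: "\<epsilon> > 0" using \<open>e > 0\<close> by (simp add: \<epsilon>_def)
    from main[OF this, of UNIV] obtain \<delta> where \<delta>: "\<delta> > 0" "\<And>v. norm v < \<delta> \<Longrightarrow>
      norm (f (x + v) - f x - (\<Sum>k\<in>UNIV. v $ k * D k x)) \<le> \<epsilon> * (\<Sum>k\<in>UNIV. norm (v $ k))"
      by auto
    show "\<exists>d>0. \<forall>y. norm (y - x) < d \<longrightarrow> norm (f y - f x - (\<Sum>k\<in>UNIV. (y - x) $ k * D k x)) \<le> e * norm (y - x)"
    proof (intro exI[of _ \<delta>] conjI \<delta>(1) allI impI)
      fix y assume "norm (y - x) < \<delta>"
      from \<delta>(2)[OF this]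
      have "norm (f y - f x - (\<Sum>k\<in>UNIV. (y - x) $ k * D k x)) \<le> \<epsilon> * (\<Sum>k\<in>UNIV. norm ((y - x) $ k))"
        by simp
      also have "\<dots> \<le> \<epsilon> * (\<Sum>k\<in>(UNIV::'n set). norm (y - x))"
        using \<epsilon> by (intro mult_left_mono sum_mono Finite_Cartesian_Product.norm_nth_le) auto
      also have "\<dots> = e * norm (y - x)" by (simp add: \<epsilon>_def)
      finally show "norm (f y - f x - (\<Sum>k\<in>UNIV. (y - x) $ k * D k x)) \<le> e * norm (y - x)" .
    qed
  qed
qed

lemma mean_circle_continuous:
  assumes "continuous_on S f" and "\<And>x s. x \<in> T \<Longrightarrow> x + (of_real r * exp (2 * of_real pi * \<i> * of_real s)) *s d \<in> S"
  shows "continuous_on (T \<times> {0..1::real}) (\<lambda>(x, s). f (x + (of_real r * exp (2 * of_real pi * \<i> * of_real s)) *s d))"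
  unfolding case_prod_unfold
  by (rule continuous_on_compose2[OF assms(1)]) (use assms(2) in \<open>auto intro!: continuous_intros\<close>)

text \<open>Cauchy's formula identifies the partial derivatives with circle means of the continuous
  function \<open>f\<close>. So they are continuous, and continuous partial derivatives give total
  differentiability.\<close>

theorem osgood:
  fixes f :: "complex^'n \<Rightarrow> complex"
  assumes S: "open S" and c: "continuous_on S f"
    and h: "\<And>x k. x \<in> S \<Longrightarrow> \<exists>e>0. (\<lambda>t. f (x + t *s axis k 1)) holomorphic_on ball 0 e"
  shows "holomorphic_fn S f"
proof -
  define D where "D k x = deriv (\<lambda>t. f (x + t *s axis k 1)) 0" for k x
  have hol: "(\<lambda>t. f (x + t *s axis k 1)) holomorphic_on T"
    if T: "open T" and TS: "\<And>t. t \<in> T \<Longrightarrow> x + t *s axis k 1 \<in> S" for T x k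
    unfolding holomorphic_on_open[OF T]
  proof
    fix t assume t: "t \<in> T"
    obtain e where e: "e > 0" "(\<lambda>u. f ((x + t *s axis k 1) + u *s axis k 1)) holomorphic_on ball 0 e"
      using h[OF TS[OF t]] by blast
    have "(\<lambda>u. f ((x + t *s axis k 1) + (u - t) *s axis k 1)) holomorphic_on ball t e"
      by (rule holomorphic_on_compose_gen[OF _ e(2), unfolded o_def])
        (auto intro!: holomorphic_intros simp: dist_norm norm_minus_commute)
    moreover have "(x + t *s axis k 1) + (u - t) *s axis k 1 = x + u *s axis k 1" for u
      by (simp add: vec_eq_iff algebra_simps)
    ultimately have "(\<lambda>u. f (x + u *s axis k 1)) holomorphic_on ball t e" by simp
    then show "\<exists>f'. ((\<lambda>u. f (x + u *s axis k 1)) has_field_derivative f') (at t)"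
      using e(1) by (meson centre_in_ball holomorphic_derivI open_ball)
  qed
  have d: "((\<lambda>t. f (y + t *s axis k 1)) has_field_derivative D k y) (at 0)" if "y \<in> S" for y k
    using h[OF that, of k] unfolding D_def by (meson centre_in_ball holomorphic_derivI open_ball)
  have cD: "continuous_on S (D k)" for k
  proof (subst continuous_on_eq_continuous_at[OF S], intro ballI)
    fix x assume "x \<in> S"
    then obtain R where R: "R > 0" "ball x R \<subseteq> S" using S openE by blast
    define r where "r = R / 4"
    have r: "r > 0" using R by (simp add: r_def)
    have inS: "y + t *s axis k 1 \<in> S" if "y \<in> ball x r" "norm t < 2 * r" for y t
    proof -
      have "norm (y - x + t *s axis k 1) < R"
        using norm_triangle_ineq[of "y - x" "t *s axis k 1"] that r unfolding r_def
        by (auto simp: norm_vector_smult dist_norm norm_minus_commute)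
      moreover have "y + t *s axis k 1 - x = y - x + t *s axis k 1" by (simp add: vec_eq_iff)
      ultimately have "dist x (y + t *s axis k 1) < R"
        by (metis dist_commute dist_norm)
      then show ?thesis using R by auto
    qed
    have eq: "integral {0..1} (\<lambda>s. f (y + (of_real r * exp (2 * of_real pi * \<i> * of_real s)) *s axis k 1) /
        (of_real r * exp (2 * of_real pi * \<i> * of_real s))) = D k y" if "y \<in> ball x r" for y
      using deriv_as_mean[OF hol[of "ball 0 (2 * r)" y k] r] inS[OF that] r by (simp add: D_def)
    have "continuous_on (ball x r \<times> {0..1}) (\<lambda>(y, s). f (y + (of_real r * exp (2 * of_real pi * \<i> * of_real s)) *s axis k 1) /
        (of_real r * exp (2 * of_real pi * \<i> * of_real s)))"
      unfolding case_prod_unfold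
      by (intro continuous_intros mean_circle_continuous[OF c, of "ball x r", unfolded case_prod_unfold])
        (use r inS in \<open>auto simp: norm_mult\<close>)
    then have "continuous_on (ball x r) (\<lambda>y. integral {0..1} (\<lambda>s. f (y + (of_real r * exp (2 * of_real pi * \<i> * of_real s)) *s axis k 1) /
        (of_real r * exp (2 * of_real pi * \<i> * of_real s))))"
      unfolding cbox_interval[symmetric] by (rule integral_continuous_on_param)
    then have "continuous_on (ball x r) (D k)"
      by (rule continuous_on_eq) (use eq in auto)
    then show "isCont (D k) x"
      using r continuous_on_eq_continuous_at by (metis centre_in_ball open_ball)
  qed
  show ?thesis
    unfolding holomorphic_fn_def
  proof (intro conjI S ballI)
    fix x assume "x \<in> S"
    from has_derivative_continuous_partials[OF S this d cD]
    show "\<exists>D. (f has_derivative D) (at x) \<and> (\<forall>c v. D (c *s v) = c * D v)"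
      by (intro exI[of _ "\<lambda>v. \<Sum>k\<in>UNIV. v $ k * D k x"]) (simp add: sum_distrib_left mult.assoc)
  qed
qed

text \<open>Osgood's lemma reduces the claim to one coordinate at a time, where the one-variable
  version applies.\<close>

lemma holomorphic_fn_integral_parameter:
  fixes F :: "complex^'n \<Rightarrow> real \<Rightarrow> complex"
  assumes U: "open U" and c: "continuous_on (U \<times> {0..1}) (\<lambda>(x, s). F x s)"
    and h: "\<And>s. s \<in> {0..1} \<Longrightarrow> holomorphic_fn U (\<lambda>x. F x s)"
  shows "holomorphic_fn U (\<lambda>x. integral {0..1} (F x))"
proof (rule osgood[OF U])
  show "continuous_on U (\<lambda>x. integral {0..1} (F x))"
    using integral_continuous_on_param[of U 0 1 F] c by simp
  fix x :: "complex^'n" and k assume "x \<in> U"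
  then obtain e where e: "e > 0" "ball x e \<subseteq> U" using U openE by blast
  have inU: "x + t *s axis k 1 \<in> U" if "t \<in> ball 0 e" for t
    using that by (intro subsetD[OF e(2)]) (simp add: dist_norm norm_vector_smult)
  have "(\<lambda>t. integral {0..1} (F (x + t *s axis k 1))) holomorphic_on ball 0 e"
  proof (rule holomorphic_integral_parameter_complex)
    have "continuous_on (ball 0 e \<times> {0..1}) (\<lambda>z. (\<lambda>(x, s). F x s) (x + fst z *s axis k 1, snd z))"
      by (rule continuous_on_compose2[OF c]) (use inU in \<open>auto intro!: continuous_intros\<close>)
    then show "continuous_on (ball 0 e \<times> {0..1}) (\<lambda>(w, s). F (x + w *s axis k 1) s)"
      by (simp add: case_prod_unfold)
    show "(\<lambda>w. F (x + w *s axis k 1) s) holomorphic_on ball 0 e" if "s \<in> {0..1}" for s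
      by (rule holomorphic_on_line[OF h[OF that]]) (use inU in auto)
  qed simp
  then show "\<exists>e>0. (\<lambda>t. integral {0..1} (F (x + t *s axis k 1))) holomorphic_on ball 0 e"
    using e(1) by blast
qed

lemma holo_map_translate:
  assumes "open S" "\<And>x. x \<in> S \<Longrightarrow> x + c \<in> T"
  shows "holo_map S (\<lambda>x. x + c)"
  unfolding holo_map_def
  using assms holomorphic_fn_add[OF holomorphic_fn_component[OF assms(1)] holomorphic_fn_const[OF assms(1)]] by simp

lemma holomorphic_fn_translate:
  assumes "holomorphic_fn T f" "open S" "\<And>x. x \<in> S \<Longrightarrow> x + c \<in> T"
  shows "holomorphic_fn S (\<lambda>x. f (x + c))"
  by (rule holomorphic_fn_compose[OF assms(1) holo_map_translate[OF assms(2,3)]]) (use assms in auto)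

lemma holomorphic_fn_circle_mean:
  assumes f: "holomorphic_fn S f" and T: "open T"
    and inS: "\<And>x s. x \<in> T \<Longrightarrow> x + (of_real r * exp (2 * of_real pi * \<i> * of_real s)) *s d \<in> S"
    and g: "continuous_on UNIV g"
  shows "holomorphic_fn T (\<lambda>x. integral {0..1} (\<lambda>s.
    f (x + (of_real r * exp (2 * of_real pi * \<i> * of_real s)) *s d) * g s))"
proof (rule holomorphic_fn_integral_parameter[OF T])
  show "continuous_on (T \<times> {0..1}) (\<lambda>(x, s). f (x + (of_real r * exp (2 * of_real pi * \<i> * of_real s)) *s d) * g s)"
    unfolding case_prod_unfold
    by (intro continuous_intros mean_circle_continuous[OF holomorphic_fn_continuous[OF f], of T, unfolded case_prod_unfold]
        continuous_on_compose2[OF g]) (use inS in auto)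
  show "holomorphic_fn T (\<lambda>x. f (x + (of_real r * exp (2 * of_real pi * \<i> * of_real s)) *s d) * g s)" for s
    by (intro holomorphic_fn_mult holomorphic_fn_const[OF T] holomorphic_fn_translate[OF f T] inS)
qed

text \<open>Near each point the derivative in direction \<open>d\<close> is a circle mean of
  \<open>f\<close>, and circle means depend holomorphically on the centre.\<close>

lemma holomorphic_fn_directional:
  assumes f: "holomorphic_fn S f"
  shows "holomorphic_fn S (\<lambda>x. frechet_derivative f (at x) d)"
proof (rule holomorphic_fn_local)
  fix x assume "x \<in> S"
  then obtain R where R: "R > 0" "ball x R \<subseteq> S"
    using holomorphic_fn_open[OF f] openE by blast
  \<comment> \<open>The summand 1 covers \<open>d = 0\<close>. With this radius all circles in
    direction \<open>d\<close> with centre in \<open>ball x (R/2)\<close> stay in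
    \<open>ball x R\<close>, even at twice the radius.\<close>
  define r where "r = R / (4 * (1 + norm d))"
  have nd: "1 + norm d > 0" by (simp add: add_pos_nonneg)
  have r: "r > 0" "r * norm d < R / 4"
    using R nd by (auto simp: r_def field_simps)
  have inS: "y + t *s d \<in> S" if "y \<in> ball x (R/2)" "norm t < 2 * r" for y t
  proof -
    have "norm (t *s d) \<le> 2 * r * norm d"
      using that by (simp add: norm_vector_smult mult_right_mono)
    then have "norm (t *s d) < R / 2" using r by linarith
    then have "norm (y - x + t *s d) < R"
      using norm_triangle_ineq[of "y - x" "t *s d"] that(1) by (simp add: dist_norm norm_minus_commute)
    moreover have "y + t *s d - x = y - x + t *s d" by (simp add: vec_eq_iff)
    ultimately have "dist x (y + t *s d) < R"
      by (metis dist_commute dist_norm)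
    then show ?thesis using R by auto
  qed
  define g where "g y = integral {0..1} (\<lambda>s. f (y + (of_real r * exp (2 * of_real pi * \<i> * of_real s)) *s d) *
    inverse (of_real r * exp (2 * of_real pi * \<i> * of_real s)))" for y
  have "holomorphic_fn (ball x (R/2)) g"
    unfolding g_def by (rule holomorphic_fn_circle_mean[OF f])
      (use r inS in \<open>auto intro!: continuous_intros simp: norm_mult\<close>)
  moreover have "frechet_derivative f (at y) d = g y" if y: "y \<in> ball x (R/2)" for y
  proof -
    have "(\<lambda>t. f (y + t *s d)) holomorphic_on ball 0 (2 * r)"
      by (rule holomorphic_on_line[OF f]) (use inS[OF y] in auto)
    from deriv_as_mean[OF this r(1)] r(1)
    have "g y = deriv (\<lambda>t. f (y + t *s d)) 0"
      by (simp add: g_def divide_inverse)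
    also have "\<dots> = frechet_derivative f (at y) d"
      by (rule deriv_on_line[OF f]) (use inS[OF y, of 0] r in simp)
    finally show ?thesis ..
  qed
  moreover have "ball x (R/2) \<subseteq> S" using inS[of _ 0] r by auto
  ultimately show "\<exists>T g. x \<in> T \<and> T \<subseteq> S \<and> holomorphic_fn T g \<and> (\<forall>y\<in>T. frechet_derivative f (at y) d = g y)"
    using R by (intro exI[of _ "ball x (R/2)"] exI[of _ g]) auto
qed

section \<open>Removable singularities along thin sets\<close>

lemma holo_map_derivative_continuous:
  assumes f: "holo_map S f"
  shows "continuous_on S (\<lambda>x. frechet_derivative f (at x) d)"
proof (subst continuous_on_eq_continuous_at[OF holo_map_open[OF f]], intro ballI)
  fix x assume x: "x \<in> S"
  have "continuous_on S (\<lambda>x. \<chi> i. frechet_derivative (\<lambda>x. f x $ i) (at x) d)"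
    by (intro continuous_on_vec_lambda holomorphic_fn_continuous[OF holomorphic_fn_directional])
      (use f in \<open>auto simp: holo_map_def\<close>)
  then have "continuous_on S (\<lambda>x. frechet_derivative f (at x) d)"
  proof (rule continuous_on_eq)
    fix x assume "x \<in> S"
    then have "f differentiable (at x)"
      using holo_map_has_derivative[OF f] differentiableI by blast
    then show "(\<chi> i. frechet_derivative (\<lambda>x. f x $ i) (at x) d) = frechet_derivative f (at x) d"
      by (simp add: frechet_derivative_component vec_eq_iff)
  qed
  then show "isCont (\<lambda>x. frechet_derivative f (at x) d) x"
    using x continuous_on_eq_continuous_at holo_map_open[OF f] by blast
qed

text \<open>The real inverse function theorem supplies \<open>g\<close>; its derivative is the
  inverse of a complex linear bijection and therefore complex linear.\<close>

theorem holo_map_inverse_function: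
  fixes f :: "complex^'n \<Rightarrow> complex^'n"
  assumes f: "holo_map S f" and x0: "x0 \<in> S"
    and inj: "\<And>v. frechet_derivative f (at x0) v = 0 \<Longrightarrow> v = 0"
  obtains U V g where "open U" "x0 \<in> U" "U \<subseteq> S" "open V" "homeomorphism U V f g" "holo_map V g"
proof -
  define f' where "f' x = Blinfun (frechet_derivative f (at x))" for x
  have bl: "bounded_linear (frechet_derivative f (at x))" if "x \<in> S" for x
    using holo_map_has_derivative[OF f that] has_derivative_bounded_linear by blast
  have app: "blinfun_apply (f' x) = frechet_derivative f (at x)" if "x \<in> S" for x
    unfolding f'_def using bounded_linear_Blinfun_apply[OF bl[OF that]] .
  have der: "(f has_derivative blinfun_apply (f' x)) (at x)" if "x \<in> S" for x
    using holo_map_has_derivative[OF f that] app[OF that] by simp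
  have cont: "continuous_on S f'"
  proof (rule continuous_on_blinfun_componentwise)
    fix i
    show "continuous_on S (\<lambda>x. blinfun_apply (f' x) i)"
      by (rule continuous_on_eq[OF holo_map_derivative_continuous[OF f, of i]]) (simp add: app)
  qed
  have lin: "linear (frechet_derivative f (at x0))"
    using bl[OF x0] bounded_linear.linear by blast
  obtain h where h: "linear h" "h \<circ> frechet_derivative f (at x0) = id"
    using linear_injective_left_inverse[OF lin] linear_injective_0[OF lin] inj by blast
  have "Blinfun h o\<^sub>L f' x0 = id_blinfun"
  proof (rule blinfun_eqI)
    fix i
    have "bounded_linear h" using h(1) linear_conv_bounded_linear by blast
    then show "blinfun_apply (Blinfun h o\<^sub>L f' x0) i = blinfun_apply id_blinfun i"
      using h(2) by (simp add: app[OF x0] bounded_linear_Blinfun_apply fun_eq_iff)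
  qed
  from inverse_function_theorem[OF holo_map_open[OF f] der cont x0 this]
  obtain U V g g' where U: "open U" "U \<subseteq> S" "x0 \<in> U" "open V" "homeomorphism U V f g"
    and g': "\<And>y. y \<in> V \<Longrightarrow> (g has_derivative (g' y)) (at y)"
      "\<And>y. y \<in> V \<Longrightarrow> g' y = inv (blinfun_apply (f'(g y)))"
      "\<And>y. y \<in> V \<Longrightarrow> bij (blinfun_apply (f'(g y)))"
    by metis
  have "holo_map V g"
    unfolding holo_map_def holomorphic_fn_def
  proof (intro allI conjI U(4) ballI)
    fix i y assume y: "y \<in> V"
    then have gy: "g y \<in> S" using U homeomorphism_image2 by blast
    have lin: "g' y (c *s v) = c *s g' y v" for c v
    proof -
      let ?A = "frechet_derivative f (at (g y))"
      have b: "bij ?A" and g'e: "g' y = inv ?A" using g'(2,3)[OF y] app[OF gy] by auto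
      have "?A (c *s inv ?A v) = c *s v"
        using b holo_map_derivative_linear[OF f gy] by (simp add: bij_is_surj surj_f_inv_f)
      then show ?thesis using b g'e by (metis bij_inv_eq_iff)
    qed
    have "((\<lambda>x. g x $ i) has_derivative (\<lambda>v. g' y v $ i)) (at y)"
      by (rule bounded_linear.has_derivative[OF bounded_linear_vec_nth g'(1)[OF y]])
    then show "\<exists>D. ((\<lambda>x. g x $ i) has_derivative D) (at y) \<and> (\<forall>c v. D (c *s v) = c * D v)"
      using lin by (intro exI[of _ "\<lambda>v. g' y v $ i"]) simp
  qed
  with U that show ?thesis by blast
qed

text \<open>Some partial derivative of \<beta> is nonzero. Putting \<beta> in place of that
  coordinate gives local coordinates in which the zero set of \<beta> is a slice.\<close>

lemma submersion_chart:
  fixes \<beta> :: "complex^'n \<Rightarrow> complex"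
  assumes \<beta>: "holomorphic_fn S \<beta>" and x0: "x0 \<in> S" and w: "frechet_derivative \<beta> (at x0) w \<noteq> 0"
  obtains k U V and \<phi> g :: "complex^'n \<Rightarrow> complex^'n"
  where "open U" "x0 \<in> U" "U \<subseteq> S" "open V" "homeomorphism U V \<phi> g"
    "holo_map U \<phi>" "holo_map V g" "\<And>x. \<phi> x $ k = \<beta> x"
proof -
  define D where "D = frechet_derivative \<beta> (at x0)"
  have D: "(\<beta> has_derivative D) (at x0)" "\<And>c v. D (c *s v) = c * D v"
    unfolding D_def using holomorphic_fn_has_derivative[OF \<beta> x0] holomorphic_fn_derivative_linear[OF \<beta> x0] by auto
  have lin: "linear D" using D(1) has_derivative_linear by blast
  obtain k where k: "D (axis k 1) \<noteq> 0"
  proof (rule ccontr)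
    assume "\<not> thesis"
    with that have z: "D (axis k 1) = 0" for k by blast
    have "D w = D (\<Sum>k\<in>UNIV. w $ k *s axis k 1)" by (simp add: basis_expansion)
    also have "\<dots> = 0" by (simp add: linear_sum[OF lin] D(2) z)
    finally show False using w by (simp add: D_def)
  qed
  define \<phi> where "\<phi> x = (\<chi> j. if j = k then \<beta> x else x $ j)" for x
  have \<phi>: "holo_map S \<phi>"
    unfolding holo_map_def
  proof
    fix i show "holomorphic_fn S (\<lambda>x. \<phi> x $ i)"
      using \<beta> holomorphic_fn_component[OF holomorphic_fn_open[OF \<beta>]] by (cases "i = k") (simp_all add: \<phi>_def)
  qed
  have d\<phi>: "frechet_derivative \<phi> (at x0) = (\<lambda>v. \<chi> j. if j = k then D v else v $ j)"
  proof -
    have "(\<phi> has_derivative (\<lambda>v. \<chi> j. if j = k then D v else v $ j)) (at x0)"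
    proof (rule has_derivative_vec)
      fix i show "((\<lambda>x. \<phi> x $ i) has_derivative (\<lambda>h. (\<chi> j. if j = k then D h else h $ j) $ i)) (at x0)"
        using D(1) by (cases "i = k")
          (simp_all add: \<phi>_def bounded_linear_imp_has_derivative bounded_linear_vec_nth)
    qed
    then show ?thesis by (rule frechet_derivative_at[symmetric])
  qed
  have inj: "v = 0" if "frechet_derivative \<phi> (at x0) v = 0" for v
  proof -
    have 1: "(if j = k then D v else v $ j) = 0" for j
      using that by (simp add: d\<phi> vec_eq_iff)
    have "v = (v $ k) *s axis k 1"
      unfolding vec_eq_iff
    proof
      fix i show "v $ i = ((v $ k) *s axis k 1) $ i" using 1[of i] by (cases "i = k") (simp_all add: axis_def)
    qed
    moreover have "v $ k = 0"
      using 1[of k] k D(2)[of "v $ k" "axis k 1"] calculation by auto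
    ultimately show ?thesis by (metis vector_smult_lzero)
  qed
  from holo_map_inverse_function[OF \<phi> x0 inj]
  obtain U V g where U: "open U" "x0 \<in> U" "U \<subseteq> S" "open V" "homeomorphism U V \<phi> g" "holo_map V g"
    by blast
  show ?thesis
    by (rule that[OF U(1-5) _ U(6), of k]) (use U holo_map_subset[OF \<phi>] in \<open>auto simp: \<phi>_def\<close>)
qed

text \<open>The argument principle with a weight: \<open>u = 1\<close> counts zeros with
  multiplicity, and the identity as \<open>u\<close> sums their positions, which locates a single
  zero of unknown multiplicity.\<close>

lemma count_zeros_integral:
  fixes h :: "complex \<Rightarrow> complex"
  assumes h: "h holomorphic_on ball z R" and r: "0 < r" "r < R"
    and nz: "\<And>w. w \<in> sphere z r \<Longrightarrow> h w \<noteq> 0" and u: "u holomorphic_on ball z R"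
  shows "finite {w \<in> ball z r. h w = 0}"
    and "integral {0..1} (\<lambda>s. deriv h (z + of_real r * exp (2 * of_real pi * \<i> * of_real s)) *
        u (z + of_real r * exp (2 * of_real pi * \<i> * of_real s)) /
        h (z + of_real r * exp (2 * of_real pi * \<i> * of_real s)) * (of_real r * exp (2 * of_real pi * \<i> * of_real s)))
      = (\<Sum>p | p \<in> ball z r \<and> h p = 0. u p * of_int (zorder h p))"
proof -
  have nz0: "h (z + of_real r) \<noteq> 0" using nz r by (simp add: dist_norm)
  have in0: "z + of_real r \<in> ball z R" using r by (simp add: dist_norm)
  have fin: "finite {w \<in> cball z r. h w = 0}"
  proof (rule ccontr)
    assume inf: "infinite {w \<in> cball z r. h w = 0}"
    have "compact (cball z r)" by simp
    then obtain l where l: "l \<in> cball z r" "l islimpt {w \<in> cball z r. h w = 0}"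
      using inf by (metis (no_types, lifting) Heine_Borel_imp_Bolzano_Weierstrass mem_Collect_eq subsetI)
    have "h (z + of_real r) = 0"
      by (rule analytic_continuation[OF h _ _ _ _ l(2) _ in0]) (use r l in auto)
    with nz0 show False by simp
  qed
  then show "finite {w \<in> ball z r. h w = 0}"
    by (rule finite_subset[rotated]) auto
  define P where "P = {w \<in> ball z r. h w = 0}"
  \<comment> \<open>The argument principle needs an open set around the closed disc; this slightly
    larger disc contains no further zeros.\<close>
  obtain R' where R': "r < R'" "R' < R" "\<And>w. w \<in> ball z R' \<Longrightarrow> h w = 0 \<Longrightarrow> w \<in> ball z r"
  proof -
    define R1 where "R1 = (r + R) / 2"
    have R1: "r < R1" "R1 < R" using r by (auto simp: R1_def)
    have fin1: "finite {w \<in> cball z R1. h w = 0}"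
    proof (rule ccontr)
      assume inf: "infinite {w \<in> cball z R1. h w = 0}"
      have "compact (cball z R1)" by simp
      then obtain l where l: "l \<in> cball z R1" "l islimpt {w \<in> cball z R1. h w = 0}"
        using inf by (metis (no_types, lifting) Heine_Borel_imp_Bolzano_Weierstrass mem_Collect_eq subsetI)
      have "h (z + of_real r) = 0"
        by (rule analytic_continuation[OF h _ _ _ _ l(2) _ in0]) (use R1 l in auto)
      with nz0 show False by simp
    qed
    define Q where "Q = {w \<in> cball z R1. h w = 0} - ball z r"
    define m where "m = Min (insert R1 (dist z ` Q))"
    have finQ: "finite (insert R1 (dist z ` Q))" using fin1 by (simp add: Q_def)
    have "r < x" if "x \<in> insert R1 (dist z ` Q)" for x
      using that R1 nz by (force simp: Q_def)
    then have "r < m" using finQ by (simp add: m_def)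
    moreover have "m \<le> R1" using finQ by (simp add: m_def)
    moreover have "w \<in> ball z r" if "w \<in> ball z m" "h w = 0" for w
    proof (rule ccontr)
      assume "w \<notin> ball z r"
      then have "w \<in> Q" using that \<open>m \<le> R1\<close> by (auto simp: Q_def)
      then have "m \<le> dist z w" using finQ by (simp add: m_def)
      then show False using that by simp
    qed
    ultimately show ?thesis using R1 that[of m] by auto
  qed
  have pz: "{w \<in> ball z R'. h w = 0 \<or> w \<in> {}} = P"
    using R' r by (auto simp: P_def)
  have "contour_integral (circlepath z r) (\<lambda>x. deriv h x * u x / h x) = 2 * pi * \<i> *
          (\<Sum>p\<in>P. winding_number (circlepath z r) p * u p * zorder h p)"
    unfolding pz[symmetric]
  proof (rule argument_principle)
    show "h holomorphic_on ball z R' - {}" "u holomorphic_on ball z R'"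
      using h u R' by (auto intro: holomorphic_on_subset)
    show "path_image (circlepath z r) \<subseteq> ball z R' - {w \<in> ball z R'. h w = 0 \<or> w \<in> {}}"
      using nz r R' by auto
    show "\<forall>w. w \<notin> ball z R' \<longrightarrow> winding_number (circlepath z r) w = 0"
    proof (intro allI impI)
      fix w assume "w \<notin> ball z R'"
      then show "winding_number (circlepath z r) w = 0"
        using R' r by (intro winding_number_zero_outside[of _ "cball z r"]) auto
    qed
    show "finite {w \<in> ball z R'. h w = 0 \<or> w \<in> {}}"
      unfolding pz P_def using fin by (rule finite_subset[rotated]) auto
  qed auto
  also have "(\<Sum>p\<in>P. winding_number (circlepath z r) p * u p * zorder h p) = (\<Sum>p\<in>P. u p * zorder h p)"
    by (rule sum.cong) (auto simp: P_def winding_number_circlepath dist_norm norm_minus_commute)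
  finally have 1: "contour_integral (circlepath z r) (\<lambda>x. deriv h x * u x / h x) = 2 * pi * \<i> * (\<Sum>p\<in>P. u p * zorder h p)" .
  have vd: "vector_derivative (circlepath z r) (at s) = 2 * of_real pi * \<i> * (of_real r * exp (2 * of_real pi * \<i> * of_real s))" for s
    by (simp add: vector_derivative_circlepath mult_ac)
  have circlepath': "circlepath z r s = z + of_real r * exp (2 * of_real pi * \<i> * of_real s)" for s
    by (simp add: circlepath)
  let ?I = "\<lambda>s. deriv h (z + of_real r * exp (2 * of_real pi * \<i> * of_real s)) *
        u (z + of_real r * exp (2 * of_real pi * \<i> * of_real s)) /
        h (z + of_real r * exp (2 * of_real pi * \<i> * of_real s)) * (of_real r * exp (2 * of_real pi * \<i> * of_real s))"
  have "contour_integral (circlepath z r) (\<lambda>x. deriv h x * u x / h x) = integral {0..1} (\<lambda>s. (2 * pi * \<i>) * ?I s)"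
    unfolding contour_integral_integral vd circlepath' by (simp add: mult_ac)
  also have "\<dots> = 2 * pi * \<i> * integral {0..1} ?I" by (rule integral_mult_right)
  finally have "2 * pi * \<i> * integral {0..1} ?I = 2 * pi * \<i> * (\<Sum>p\<in>P. u p * zorder h p)"
    using 1 by simp
  then show "integral {0..1} ?I = (\<Sum>p | p \<in> ball z r \<and> h p = 0. u p * of_int (zorder h p))"
    by (simp add: P_def)
qed

section \<open>Zeros along parallel complex lines\<close>

lemma tube_line:
  fixes G :: "(complex^'n) set"
  assumes "open G" "compact K" "\<And>\<zeta>. \<zeta> \<in> K \<Longrightarrow> y + \<zeta> *s d \<in> G"
  obtains \<rho> where "\<rho> > 0" "\<And>y' \<zeta>. y' \<in> ball y \<rho> \<Longrightarrow> \<zeta> \<in> K \<Longrightarrow> y' + \<zeta> *s d \<in> G"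
proof -
  have "compact ((\<lambda>\<zeta>. y + \<zeta> *s d) ` K)"
    by (intro compact_continuous_image assms continuous_intros)
  moreover have "(\<lambda>\<zeta>. y + \<zeta> *s d) ` K \<subseteq> G" using assms by auto
  ultimately obtain \<rho> where \<rho>: "\<rho> > 0" "(\<Union>x\<in>(\<lambda>\<zeta>. y + \<zeta> *s d) ` K. ball x \<rho>) \<subseteq> G"
    using compact_subset_open_imp_ball_epsilon_subset assms(1) by metis
  show ?thesis
  proof (rule that[OF \<rho>(1)])
    fix y' \<zeta> assume "y' \<in> ball y \<rho>" "\<zeta> \<in> K"
    then have "y' + \<zeta> *s d \<in> ball (y + \<zeta> *s d) \<rho>" by simp
    then show "y' + \<zeta> *s d \<in> G" using \<rho>(2) \<open>\<zeta> \<in> K\<close> by blast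
  qed
qed

lemma cball_subset_open_larger_ball:
  fixes z :: complex
  assumes "open W" "cball z r \<subseteq> W" "0 < r"
  obtains R where "R > r" "ball z R \<subseteq> W"
proof -
  obtain e where e: "e > 0" "(\<Union>x\<in>cball z r. ball x e) \<subseteq> W"
    using compact_subset_open_imp_ball_epsilon_subset[OF compact_cball assms(1,2)] by metis
  show ?thesis
  proof (rule that[of "r + e"])
    show "ball z (r + e) \<subseteq> W"
    proof
      fix w assume w: "w \<in> ball z (r + e)"
      show "w \<in> W"
      proof (cases "w \<in> cball z r")
        case True with assms show ?thesis by auto
      next
        case False
        then have n: "norm (w - z) > r" by (simp add: dist_norm norm_minus_commute)
        then have n0: "norm (w - z) > 0" using assms by linarith
        \<comment> \<open>The radial projection of \<open>w\<close> to the circle, i.e. the nearest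
          point of the closed disc.\<close>
        define p where "p = z + of_real (r / norm (w - z)) * (w - z)"
        have "norm (p - z) = r" using assms n0 by (simp add: p_def norm_mult norm_divide)
        then have "p \<in> cball z r" by (simp add: dist_norm norm_minus_commute)
        moreover have "w - p = of_real (1 - r / norm (w - z)) * (w - z)"
          by (simp add: p_def algebra_simps)
        then have "norm (w - p) = (1 - r / norm (w - z)) * norm (w - z)"
          using n n0 by (simp only: norm_mult norm_of_real) simp
        then have "norm (w - p) = norm (w - z) - r"
          using n0 by (simp add: left_diff_distrib)
        then have "norm (w - p) < e" using w by (simp add: dist_norm norm_minus_commute)
        then have "w \<in> ball p e" by (simp add: dist_norm norm_minus_commute)
        ultimately show ?thesis using e by blast
      qed
    qed
  qed (use e in simp)
qed

text \<open>A finite Baire argument: either \<open>F p\<close> contains \<open>W\<close>, or the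
  rest \<open>W - F p\<close> is open, nonempty and covered by the remaining sets.\<close>

lemma open_covered_by_finite_closed:
  assumes "finite P" "open W" "W \<noteq> {}" "W \<subseteq> (\<Union>p\<in>P. F p)" "\<And>p. p \<in> P \<Longrightarrow> open (W - F p)"
  shows "\<exists>p\<in>P. \<exists>W'. open W' \<and> W' \<noteq> {} \<and> W' \<subseteq> W \<and> W' \<subseteq> F p"
  using assms
proof (induction P arbitrary: W rule: finite_induct)
  case (insert p P)
  show ?case
  proof (cases "W \<subseteq> F p")
    case False
    have "\<exists>q\<in>P. \<exists>W'. open W' \<and> W' \<noteq> {} \<and> W' \<subseteq> W - F p \<and> W' \<subseteq> F q"
    proof (rule insert.IH)
      show "open (W - F p - F q)" if "q \<in> P" for q
      proof -
        have "W - F p - F q = (W - F p) \<inter> (W - F q)" by auto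
        then show ?thesis using insert.prems(4) that by (simp add: open_Int)
      qed
    qed (use insert.prems False in auto)
    then show ?thesis by blast
  qed (use insert.prems in blast)
qed simp

text \<open>The set \<open>E\<close>, relatively closed in \<open>U\<close> and contained in the
  zero set of \<open>h\<close>, is studied on the complex lines of direction \<open>d\<close>. The
  goal is to see what it means for \<open>E\<close> to meet all lines near a given one.\<close>

locale slices =
  fixes U E :: "(complex^'n) set" and h :: "complex^'n \<Rightarrow> complex" and d :: "complex^'n"
  assumes h: "holomorphic_fn U h" and EU: "E \<subseteq> U" and UE: "open (U - E)"
    and hE: "\<And>x. x \<in> E \<Longrightarrow> h x = 0"
begin

lemma open_nonzero: "open {x \<in> U. h x \<noteq> 0}"
proof -
  have "{x \<in> U. h x \<noteq> 0} = U \<inter> h -` (- {0})" by auto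
  then show ?thesis
    using continuous_open_preimage[OF holomorphic_fn_continuous[OF h] holomorphic_fn_open[OF h], of "-{0}"]
    by (simp add: open_Compl)
qed

text \<open>No zero lies on the bounding circle, so zeros neither enter nor leave the disc when
  \<open>y\<close> moves a little.\<close>

definition good :: "complex^'n \<Rightarrow> complex \<Rightarrow> real \<Rightarrow> bool" where
  "good y z r \<longleftrightarrow> 0 < r \<and> (\<forall>w\<in>cball z r. y + w *s d \<in> U) \<and> (\<forall>w\<in>sphere z r. h (y + w *s d) \<noteq> 0)"

definition zeros :: "complex^'n \<Rightarrow> complex \<Rightarrow> real \<Rightarrow> complex set" where
  "zeros y z r = {w \<in> ball z r. h (y + w *s d) = 0}"

definition count :: "complex^'n \<Rightarrow> complex \<Rightarrow> real \<Rightarrow> int" where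
  "count y z r = (\<Sum>p\<in>zeros y z r. zorder (\<lambda>w. h (y + w *s d)) p)"

text \<open>The integral of u h'/h over the circle divided by 2 pi i, where h' is the derivative
  along \<open>d\<close>. The centre appears separately as \<open>y + z *s d\<close>, so that this
  is a circle mean in direction \<open>d\<close>.\<close>

definition log_integral :: "(complex \<Rightarrow> complex) \<Rightarrow> complex \<Rightarrow> real \<Rightarrow> complex^'n \<Rightarrow> complex" where
  "log_integral u z r y = integral {0..1} (\<lambda>s. (\<lambda>x. frechet_derivative h (at x) d / h x)
     (y + z *s d + (of_real r * exp (2 * of_real pi * \<i> * of_real s)) *s d) *
     (u (z + of_real r * exp (2 * of_real pi * \<i> * of_real s)) * (of_real r * exp (2 * of_real pi * \<i> * of_real s))))"

lemma good_ball:
  assumes "good y z r"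
  obtains R where "R > r" "(\<lambda>w. h (y + w *s d)) holomorphic_on ball z R"
    "\<And>w. w \<in> ball z R \<Longrightarrow> y + w *s d \<in> U"
proof -
  have "open ((\<lambda>w. y + w *s d) -` U)"
    using holomorphic_fn_open[OF h] by (intro open_vimage continuous_intros)
  then obtain R where R: "R > r" "ball z R \<subseteq> (\<lambda>w. y + w *s d) -` U"
    using assms cball_subset_open_larger_ball[of _ z r] unfolding good_def by blast
  then show ?thesis
    by (intro that[OF R(1)] holomorphic_on_line[OF h]) auto
qed

lemma good_nearby:
  assumes "good y z r"
  obtains \<rho> where "\<rho> > 0" "\<And>y'. y' \<in> ball y \<rho> \<Longrightarrow> good y' z r"
proof -
  obtain \<rho>1 where \<rho>1: "\<rho>1 > 0" "\<And>y' w. y' \<in> ball y \<rho>1 \<Longrightarrow> w \<in> cball z r \<Longrightarrow> y' + w *s d \<in> U"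
    by (rule tube_line[OF holomorphic_fn_open[OF h] compact_cball[of z r], of y d])
      (use assms in \<open>auto simp: good_def\<close>)
  from open_nonzero
 obtain \<rho>2 where \<rho>2: "\<rho>2 > 0" "\<And>y' w. y' \<in> ball y \<rho>2 \<Longrightarrow> w \<in> sphere z r \<Longrightarrow> y' + w *s d \<in> {x \<in> U. h x \<noteq> 0}"
    by (rule tube_line[OF _ compact_sphere[of z r], of _ y d])
      (use assms in \<open>auto simp: good_def\<close>)
  show ?thesis
    by (rule that[of "min \<rho>1 \<rho>2"]) (use \<rho>1 \<rho>2 assms in \<open>auto simp: good_def\<close>)
qed

lemma log_integral_eq:
  assumes "good y z r" "u holomorphic_on UNIV"
  shows "finite (zeros y z r)"
    and "log_integral u z r y = (\<Sum>p\<in>zeros y z r. u p * of_int (zorder (\<lambda>w. h (y + w *s d)) p))"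
proof -
  obtain R where R: "R > r" "(\<lambda>w. h (y + w *s d)) holomorphic_on ball z R"
    "\<And>w. w \<in> ball z R \<Longrightarrow> y + w *s d \<in> U"
    using good_ball[OF assms(1)] by blast
  have r: "0 < r" "\<And>w. w \<in> sphere z r \<Longrightarrow> h (y + w *s d) \<noteq> 0"
    using assms by (auto simp: good_def)
  have u: "u holomorphic_on ball z R" using assms(2) holomorphic_on_subset by blast
  show "finite (zeros y z r)"
    using count_zeros_integral(1)[OF R(2) r(1) R(1) r(2) u] by (simp add: zeros_def)
  have der: "deriv (\<lambda>w. h (y + w *s d)) v = frechet_derivative h (at (y + v *s d)) d" if "v \<in> ball z R" for v
  proof (rule DERIV_imp_deriv)
    show "((\<lambda>w. h (y + w *s d)) has_field_derivative frechet_derivative h (at (y + v *s d)) d) (at v)"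
      by (rule holomorphic_fn_along_curve[OF h]) (use R(3)[OF that] in \<open>auto intro!: derivative_eq_intros\<close>)
  qed
  have "log_integral u z r y = integral {0..1} (\<lambda>s. deriv (\<lambda>w. h (y + w *s d)) (z + of_real r * exp (2 * of_real pi * \<i> * of_real s)) *
        u (z + of_real r * exp (2 * of_real pi * \<i> * of_real s)) /
        h (y + (z + of_real r * exp (2 * of_real pi * \<i> * of_real s)) *s d) * (of_real r * exp (2 * of_real pi * \<i> * of_real s)))"
    unfolding log_integral_def
  proof (rule Henstock_Kurzweil_Integration.integral_cong)
    fix s :: real
    have i: "z + of_real r * exp (2 * of_real pi * \<i> * of_real s) \<in> ball z R"
      using r R(1) by (simp add: dist_self_add norm_mult)
    have e: "y + z *s d + (of_real r * exp (2 * of_real pi * \<i> * of_real s)) *s d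
      = y + (z + of_real r * exp (2 * of_real pi * \<i> * of_real s)) *s d"
      by (simp add: vec_eq_iff algebra_simps)
    show "(\<lambda>x. frechet_derivative h (at x) d / h x)
     (y + z *s d + (of_real r * exp (2 * of_real pi * \<i> * of_real s)) *s d) *
     (u (z + of_real r * exp (2 * of_real pi * \<i> * of_real s)) * (of_real r * exp (2 * of_real pi * \<i> * of_real s)))
     = deriv (\<lambda>w. h (y + w *s d)) (z + of_real r * exp (2 * of_real pi * \<i> * of_real s)) *
        u (z + of_real r * exp (2 * of_real pi * \<i> * of_real s)) /
        h (y + (z + of_real r * exp (2 * of_real pi * \<i> * of_real s)) *s d) * (of_real r * exp (2 * of_real pi * \<i> * of_real s))"
      unfolding e der[OF i] by simp
  qed
  also have "\<dots> = (\<Sum>p\<in>zeros y z r. u p * of_int (zorder (\<lambda>w. h (y + w *s d)) p))"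
    unfolding zeros_def using count_zeros_integral(2)[OF R(2) r(1) R(1) r(2) u] by simp
  finally show "log_integral u z r y = (\<Sum>p\<in>zeros y z r. u p * of_int (zorder (\<lambda>w. h (y + w *s d)) p))" .
qed

lemma log_integral_one: "good y z r \<Longrightarrow> log_integral (\<lambda>_. 1) z r y = of_int (count y z r)"
  by (simp add: log_integral_eq count_def)

lemma zorder_zero_pos:
  assumes "good y z r" "p \<in> zeros y z r"
  shows "zorder (\<lambda>w. h (y + w *s d)) p > 0"
proof -
  obtain R where R: "R > r" "(\<lambda>w. h (y + w *s d)) holomorphic_on ball z R"
    using good_ball[OF assms(1)] by blast
  have r: "0 < r" using assms(1) by (simp add: good_def)
  have "z + of_real r \<in> sphere z r" using r by (simp add: dist_self_add)
  then have nz: "h (y + (z + of_real r) *s d) \<noteq> 0" using assms(1) unfolding good_def by blast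
  have p: "p \<in> ball z R" "h (y + p *s d) = 0" using assms(2) R(1) by (auto simp: zeros_def)
  have "z + of_real r \<in> ball z R" using r R(1) by (simp add: dist_self_add)
  then have "\<exists>w\<in>ball z R. h (y + w *s d) \<noteq> 0" using nz by blast
  then show ?thesis
    using zorder_exist_zero[OF R(2) open_ball _ p(1)] p(2) by simp
qed

lemma log_integral_holomorphic:
  assumes "\<And>y. y \<in> ball y1 \<rho> \<Longrightarrow> good y z r" "continuous_on UNIV u"
  shows "holomorphic_fn (ball y1 \<rho>) (log_integral u z r)"
proof -
  from open_nonzero
 have q: "holomorphic_fn {x \<in> U. h x \<noteq> 0} (\<lambda>x. frechet_derivative h (at x) d / h x)"
    by (intro holomorphic_fn_divide holomorphic_fn_subset[OF holomorphic_fn_directional[OF h]] holomorphic_fn_subset[OF h]) auto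
  have m: "holomorphic_fn (ball (y1 + z *s d) \<rho>) (\<lambda>x. integral {0..1} (\<lambda>s. (\<lambda>x. frechet_derivative h (at x) d / h x)
     (x + (of_real r * exp (2 * of_real pi * \<i> * of_real s)) *s d) *
     (u (z + of_real r * exp (2 * of_real pi * \<i> * of_real s)) * (of_real r * exp (2 * of_real pi * \<i> * of_real s)))))"
  proof (rule holomorphic_fn_circle_mean[OF q])
    fix x :: "complex^'n" and s :: real
    assume "x \<in> ball (y1 + z *s d) \<rho>"
    then have "x - z *s d \<in> ball y1 \<rho>" by (simp add: dist_norm algebra_simps)
    then have g: "good (x - z *s d) z r" by (rule assms(1))
    have e: "x - z *s d + (z + of_real r * exp (2 * of_real pi * \<i> * of_real s)) *s d =
      x + (of_real r * exp (2 * of_real pi * \<i> * of_real s)) *s d"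
      by (simp add: vec_eq_iff algebra_simps)
    have "z + of_real r * exp (2 * of_real pi * \<i> * of_real s) \<in> sphere z r"
      using g by (simp add: dist_self_add norm_mult good_def)
    then show "x + (of_real r * exp (2 * of_real pi * \<i> * of_real s)) *s d \<in> {x \<in> U. h x \<noteq> 0}"
      using g sphere_cball[of z r] unfolding good_def e[symmetric] by blast
  qed (auto intro!: continuous_intros continuous_on_compose2[OF assms(2)])
  show ?thesis
    unfolding log_integral_def
    by (rule holomorphic_fn_translate[OF m]) (simp_all add: dist_norm)
qed

text \<open>An integer that is given by an integral depending continuously on
  \<open>y\<close>.\<close>

lemma count_locally_constant:
  assumes "good y z r"
  obtains \<rho> where "\<rho> > 0" "\<And>y'. y' \<in> ball y \<rho> \<Longrightarrow> good y' z r \<and> count y' z r = count y z r"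
proof -
  obtain \<rho>1 where \<rho>1: "\<rho>1 > 0" "\<And>y'. y' \<in> ball y \<rho>1 \<Longrightarrow> good y' z r"
    using good_nearby[OF assms] by blast
  have "continuous_on (ball y \<rho>1) (log_integral (\<lambda>_. 1) z r)"
    by (intro holomorphic_fn_continuous log_integral_holomorphic \<rho>1 continuous_intros)
  then have "isCont (log_integral (\<lambda>_. 1) z r) y"
    using \<rho>1(1) continuous_on_eq_continuous_at by (metis centre_in_ball open_ball)
  then obtain \<rho>2 where \<rho>2: "\<rho>2 > 0" "\<And>y'. dist y' y < \<rho>2 \<Longrightarrow> dist (log_integral (\<lambda>_. 1) z r y') (log_integral (\<lambda>_. 1) z r y) < 1"
    unfolding continuous_at_eps_delta by (metis zero_less_one)
  show ?thesis
  proof (rule that[of "min \<rho>1 \<rho>2"])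
    fix y' assume y': "y' \<in> ball y (min \<rho>1 \<rho>2)"
    then have g: "good y' z r" using \<rho>1 by simp
    have "dist (of_int (count y' z r) :: complex) (of_int (count y z r)) < 1"
      using \<rho>2(2)[of y'] y' by (simp add: log_integral_one[OF g] log_integral_one[OF assms] dist_commute)
    then have "norm (of_int (count y' z r - count y z r) :: complex) < 1"
      by (simp add: dist_norm)
    then have "\<bar>count y' z r - count y z r\<bar> < 1"
      by (simp only: norm_of_int)
    then show "good y' z r \<and> count y' z r = count y z r" using g by simp
  qed (use \<rho>1 \<rho>2 in simp)
qed

text \<open>Seen along \<open>d\<close>, the set \<open>E\<close> has no gap over the ball, as would
  be the case for a hypersurface transversal to \<open>d\<close>.\<close>

definition admissible :: "complex^'n \<Rightarrow> real \<Rightarrow> complex \<Rightarrow> real \<Rightarrow> bool" where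
  "admissible y \<rho> z r \<longleftrightarrow> 0 < \<rho> \<and> (\<forall>y'\<in>ball y \<rho>. good y' z r \<and> (\<exists>w\<in>ball z r. y' + w *s d \<in> E))"

text \<open>Each zero on the slice through \<open>y\<close> gets a small disc containing no other
  zero of that slice. The base points whose slices meet \<open>E\<close> in a given disc form
  finitely many relatively closed sets covering a ball, so one of these sets has interior points;
  its disc has lost the other zeros.\<close>

lemma split_zeros:
  assumes adm: "admissible y \<rho> z r" and pq: "p \<in> zeros y z r" "q \<in> zeros y z r" "p \<noteq> q"
  shows "\<exists>y' \<rho>' z' r'. admissible y' \<rho>' z' r' \<and> count y' z' r' < count y z r"
proof -
  have g: "good y z r" using adm by (simp add: admissible_def)
  have fin: "finite (zeros y z r)" using log_integral_eq(1)[OF g, of "\<lambda>_. 1"] by simp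
  let ?P = "zeros y z r"
  obtain \<delta> where \<delta>: "\<delta> > 0" "\<And>p. p \<in> ?P \<Longrightarrow> cball p \<delta> \<subseteq> ball z r"
    "\<And>p w. p \<in> ?P \<Longrightarrow> w \<in> cball p \<delta> \<Longrightarrow> h (y + w *s d) = 0 \<Longrightarrow> w = p"
  proof -
    have "\<exists>e>0. cball p e \<subseteq> ball z r - (?P - {p})" if "p \<in> ?P" for p
    proof -
      have "open (ball z r - (?P - {p}))" using fin by (intro open_Diff finite_imp_closed) auto
      moreover have "p \<in> ball z r - (?P - {p})" using that by (auto simp: zeros_def)
      ultimately show ?thesis using open_contains_cball by blast
    qed
    then obtain e where e: "\<And>p. p \<in> ?P \<Longrightarrow> e p > 0 \<and> cball p (e p) \<subseteq> ball z r - (?P - {p})"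
      by metis
    define \<delta> where "\<delta> = Min (e ` ?P)"
    have le: "\<delta> \<le> e p" if "p \<in> ?P" for p using that fin by (simp add: \<delta>_def)
    have "\<delta> \<in> e ` ?P" unfolding \<delta>_def using fin pq(1) by (intro Min_in) auto
    then have "\<delta> > 0" using e by auto
    moreover have sub: "cball p \<delta> \<subseteq> ball z r - (?P - {p})" if "p \<in> ?P" for p
      using e[OF that] le[OF that] by (meson subset_cball subset_trans)
    moreover have "w = p" if "p \<in> ?P" "w \<in> cball p \<delta>" "h (y + w *s d) = 0" for p w
    proof -
      have "w \<in> ball z r" using sub[OF that(1)] that(2) by blast
      then have "w \<in> ?P" using that(3) by (simp add: zeros_def)
      then show ?thesis using sub[OF that(1)] that(2) by blast
    qed
    ultimately show ?thesis by (intro that[of \<delta>]) auto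
  qed
  have gp: "good y p \<delta>" if "p \<in> ?P" for p
    unfolding good_def
  proof (intro conjI \<delta>(1) ballI)
    fix w assume "w \<in> cball p \<delta>"
    then have "w \<in> cball z r" using \<delta>(2)[OF that] by auto
    then show "y + w *s d \<in> U" using g by (simp add: good_def)
  next
    fix w assume w: "w \<in> sphere p \<delta>"
    then show "h (y + w *s d) \<noteq> 0" using \<delta>(3)[OF that, of w] \<delta>(1) by auto
  qed
  have "\<exists>\<rho>>0. \<forall>y'\<in>ball y \<rho>. good y' p \<delta> \<and> count y' p \<delta> = count y p \<delta>" if "p \<in> ?P" for p
    using count_locally_constant[OF gp[OF that]] by metis
  then obtain e where e: "\<And>p. p \<in> ?P \<Longrightarrow> e p > 0 \<and> (\<forall>y'\<in>ball y (e p). good y' p \<delta> \<and> count y' p \<delta> = count y p \<delta>)"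
    by metis
  define K where "K = cball z r - (\<Union>p\<in>?P. ball p \<delta>)"
  have cK: "compact K" unfolding K_def by (intro compact_diff) auto
  have KU: "y + w *s d \<in> {x \<in> U. h x \<noteq> 0}" if "w \<in> K" for w
  proof -
    have "w \<in> cball z r" and n: "\<forall>p\<in>?P. w \<notin> ball p \<delta>" using that by (auto simp: K_def)
    moreover have "h (y + w *s d) \<noteq> 0"
    proof
      assume "h (y + w *s d) = 0"
      moreover then have "w \<notin> sphere z r" using g by (auto simp: good_def)
      ultimately have "w \<in> ?P" using \<open>w \<in> cball z r\<close> by (simp add: zeros_def)
      then show False using n \<delta>(1) by force
    qed
    ultimately show ?thesis using g by (simp add: good_def)
  qed
  obtain \<rho>1 where \<rho>1: "\<rho>1 > 0" "\<And>y' w. y' \<in> ball y \<rho>1 \<Longrightarrow> w \<in> K \<Longrightarrow> y' + w *s d \<in> {x \<in> U. h x \<noteq> 0}"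
    by (rule tube_line[OF open_nonzero cK, of y d, OF KU]) blast+
  define \<rho>2 where "\<rho>2 = Min (insert \<rho> (insert \<rho>1 (e ` ?P)))"
  have \<rho>: "\<rho> > 0" using adm by (simp add: admissible_def)
  have \<rho>2: "\<rho>2 > 0" "\<rho>2 \<le> \<rho>" "\<rho>2 \<le> \<rho>1" "\<And>p. p \<in> ?P \<Longrightarrow> \<rho>2 \<le> e p"
  proof -
    have fin': "finite (insert \<rho> (insert \<rho>1 (e ` ?P)))" using fin by simp
    have "\<rho>2 \<in> insert \<rho> (insert \<rho>1 (e ` ?P))" unfolding \<rho>2_def using fin' by (intro Min_in) auto
    then show "\<rho>2 > 0" using e \<rho>1(1) \<rho> by auto
    show "\<rho>2 \<le> \<rho>" "\<rho>2 \<le> \<rho>1" "\<And>p. p \<in> ?P \<Longrightarrow> \<rho>2 \<le> e p"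
      unfolding \<rho>2_def using fin' by (blast intro: Min_le)+
  qed
  \<comment> \<open>Closed discs make \<open>F p\<close> relatively closed. Points of
    \<open>E\<close> on the boundary circle are excluded afterwards, because \<open>h\<close> has no
    zeros there.\<close>
  define F where "F p = {y'. \<exists>w\<in>cball p \<delta>. y' + w *s d \<in> E}" for p
  have cov: "ball y \<rho>2 \<subseteq> (\<Union>p\<in>?P. F p)"
  proof
    fix y' assume y': "y' \<in> ball y \<rho>2"
    then obtain w where w: "w \<in> ball z r" "y' + w *s d \<in> E"
      using adm \<rho>2(2) unfolding admissible_def by (meson subset_ball subsetD)
    have "w \<notin> K" using \<rho>1(2)[of y' w] y' \<rho>2(3) hE[OF w(2)] by auto
    then obtain p where "p \<in> ?P" "w \<in> ball p \<delta>" using w(1) by (auto simp: K_def)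
    then show "y' \<in> (\<Union>p\<in>?P. F p)" using w(2) by (force simp: F_def)
  qed
  have op: "open (ball y \<rho>2 - F p)" if p: "p \<in> ?P" for p
  proof (rule openI)
    fix y' assume y': "y' \<in> ball y \<rho>2 - F p"
    have gy': "good y' p \<delta>" using y' e[OF p] \<rho>2(4)[OF p] by auto
    have "y' + w *s d \<in> U - E" if "w \<in> cball p \<delta>" for w
      using gy' that y' by (auto simp: good_def F_def)
    then obtain \<sigma> where \<sigma>: "\<sigma> > 0" "\<And>y'' w. y'' \<in> ball y' \<sigma> \<Longrightarrow> w \<in> cball p \<delta> \<Longrightarrow> y'' + w *s d \<in> U - E"
      using tube_line[OF UE compact_cball[of p \<delta>], of y' d] by metis
    obtain \<tau> where \<tau>: "\<tau> > 0" "ball y' \<tau> \<subseteq> ball y \<rho>2" using y' by (meson Diff_iff open_ball openE)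
    have "ball y' (min \<sigma> \<tau>) \<subseteq> ball y \<rho>2 - F p"
      using \<sigma>(2) \<tau>(2) by (auto simp: F_def)
    then show "\<exists>e>0. ball y' e \<subseteq> ball y \<rho>2 - F p" using \<sigma>(1) \<tau>(1) by (metis min_less_iff_conj)
  qed
  obtain p0 W where p0: "p0 \<in> ?P" and W: "open W" "W \<noteq> {}" "W \<subseteq> ball y \<rho>2" "W \<subseteq> F p0"
    using open_covered_by_finite_closed[OF fin open_ball _ cov op] \<rho>2(1) by (metis ball_eq_empty not_less)
  obtain y3 \<rho>3 where y3: "\<rho>3 > 0" "ball y3 \<rho>3 \<subseteq> W" "y3 \<in> W"
    using W(1,2) by (meson equals0I openE)
  have inb: "y' \<in> ball y (e p0)" if "y' \<in> ball y3 \<rho>3" for y'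
    using that y3(2) W(3) \<rho>2(4)[OF p0] by (meson subsetD subset_ball)
  have "admissible y3 \<rho>3 p0 \<delta>"
    unfolding admissible_def
  proof (intro conjI y3(1) ballI)
    fix y' assume y': "y' \<in> ball y3 \<rho>3"
    show g': "good y' p0 \<delta>" using e[OF p0] inb[OF y'] by blast
    obtain w where w: "w \<in> cball p0 \<delta>" "y' + w *s d \<in> E"
      using y' y3(2) W(4) unfolding F_def by blast
    have "w \<notin> sphere p0 \<delta>" using g' hE[OF w(2)] by (auto simp: good_def)
    then show "\<exists>w\<in>ball p0 \<delta>. y' + w *s d \<in> E" using w by (intro bexI[of _ w]) auto
  qed
  \<comment> \<open>By local constancy the left side is the multiplicity of \<open>p0\<close> alone,
    while every other zero adds a positive amount to the right side.\<close>
  moreover have "count y3 p0 \<delta> < count y z r"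
  proof -
    have "zeros y p0 \<delta> = {p0}"
      using \<delta>(1,3) p0 by (auto simp: zeros_def)
    then have "count y3 p0 \<delta> = zorder (\<lambda>w. h (y + w *s d)) p0"
      using e[OF p0] inb[of y3] y3(1) by (simp add: count_def)
    moreover obtain q0 where q0: "q0 \<in> ?P" "q0 \<noteq> p0" using pq by metis
    have "count y z r = zorder (\<lambda>w. h (y + w *s d)) p0 + (\<Sum>p\<in>?P - {p0}. zorder (\<lambda>w. h (y + w *s d)) p)"
      unfolding count_def by (rule sum.remove[OF fin p0])
    moreover have "(\<Sum>p\<in>?P - {p0}. zorder (\<lambda>w. h (y + w *s d)) p) > 0"
      by (rule sum_pos) (use fin q0 zorder_zero_pos[OF g] in auto)
    ultimately show ?thesis by simp
  qed
  ultimately show ?thesis by blast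
qed

text \<open>For an admissible disc with the least count each slice has a single zero, possibly of
  high multiplicity, and this zero is the point of \<open>E\<close>. Its position depends
  holomorphically on the slice, so \<open>E\<close> is locally a hypersurface transversal to
  \<open>d\<close>.\<close>

lemma surface_in_slices:
  assumes "admissible y0 \<rho>0 z0 r0"
  shows "\<exists>x V \<beta>. x \<in> E \<and> x \<in> V \<and> V \<subseteq> U \<and> holomorphic_fn V \<beta> \<and> frechet_derivative \<beta> (at x) d \<noteq> 0 \<and>
    (\<forall>y\<in>V. y \<in> E \<longleftrightarrow> \<beta> y = 0)"
proof -
  have cn: "count y z r \<ge> 0" if "good y z r" for y z r
    unfolding count_def by (rule sum_nonneg) (use zorder_zero_pos[OF that] in force)
  define m where "m = (\<lambda>(y, \<rho>::real, z, r). nat (count y z r))"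
  define A where "A = (\<lambda>(y, \<rho>, z, r). admissible y \<rho> z r)"
  have "A (y0, \<rho>0, z0, r0)" using assms by (simp add: A_def)
  then obtain t where t: "A t" "\<And>t'. A t' \<Longrightarrow> m t \<le> m t'"
    using ex_has_least_nat[of A _ m] by blast
  obtain y1 \<rho>1 z r where t_eq: "t = (y1, \<rho>1, z, r)" by (metis prod_cases4)
  have adm: "admissible y1 \<rho>1 z r" using t(1) by (simp add: A_def t_eq)
  have min: "count y1 z r \<le> count y' z' r'" if "admissible y' \<rho>' z' r'" for y' \<rho>' z' r'
  proof -
    have "good y' z' r'" "good y1 z r" using that adm by (auto simp: admissible_def)
    then show ?thesis using t(2)[of "(y', \<rho>', z', r')"] that cn by (simp add: A_def m_def t_eq nat_le_eq_zle)
  qed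
  have g1: "good y1 z r" using adm by (simp add: admissible_def)
  obtain \<rho>2 where \<rho>2: "\<rho>2 > 0" "\<And>y'. y' \<in> ball y1 \<rho>2 \<Longrightarrow> good y' z r \<and> count y' z r = count y1 z r"
    using count_locally_constant[OF g1] by blast
  define \<rho> where "\<rho> = min \<rho>1 \<rho>2"
  have \<rho>: "\<rho> > 0" using \<rho>2 adm by (simp add: \<rho>_def admissible_def)
  have gy: "good y z r" if "y \<in> ball y1 \<rho>" for y using \<rho>2(2) that by (simp add: \<rho>_def)
  have uniq: "p = q" if y: "y \<in> ball y1 \<rho>" and "p \<in> zeros y z r" "q \<in> zeros y z r" for y p q
  proof (rule ccontr)
    assume "p \<noteq> q"
    obtain \<tau> where \<tau>: "\<tau> > 0" "ball y \<tau> \<subseteq> ball y1 \<rho>" using y by (meson open_ball openE)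
    have "admissible y \<tau> z r"
      using \<tau> adm unfolding admissible_def \<rho>_def by (auto simp: subset_iff)
    from split_zeros[OF this that(2,3) \<open>p \<noteq> q\<close>] min \<rho>2(2)[of y] y
    show False by (fastforce simp: \<rho>_def)
  qed
  \<comment> \<open>For a single zero p of multiplicity k this is (k p) / k, whatever k is.\<close>
  define \<alpha> where "\<alpha> y = log_integral (\<lambda>w. w) z r y / log_integral (\<lambda>_. 1) z r y" for y
  have \<alpha>: "\<alpha> y = p \<and> log_integral (\<lambda>_. 1) z r y \<noteq> 0" if y: "y \<in> ball y1 \<rho>" and p: "p \<in> zeros y z r" for y p
  proof -
    have "zeros y z r = {p}" using uniq[OF y] p by blast
    moreover have "zorder (\<lambda>w. h (y + w *s d)) p > 0" by (rule zorder_zero_pos[OF gy[OF y] p])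
    ultimately show ?thesis by (simp add: \<alpha>_def log_integral_eq[OF gy[OF y]])
  qed
  have ex: "\<exists>p. p \<in> zeros y z r \<and> y + p *s d \<in> E" if y: "y \<in> ball y1 \<rho>" for y
  proof -
    obtain w where "w \<in> ball z r" "y + w *s d \<in> E"
      using adm y unfolding admissible_def \<rho>_def by (meson min.cobounded1 subset_ball subsetD)
    then show ?thesis using hE by (auto simp: zeros_def)
  qed
  have \<alpha>hol: "holomorphic_fn (ball y1 \<rho>) \<alpha>"
    unfolding \<alpha>_def
    by (intro holomorphic_fn_divide log_integral_holomorphic gy continuous_intros) (use \<alpha> ex in blast)+
  obtain a where a: "a \<in> zeros y1 z r" "y1 + a *s d \<in> E" using ex[of y1] \<rho> by auto
  have \<alpha>1: "\<alpha> y1 = a" using \<alpha>[of y1 a] a \<rho> by simp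
  define x1 where "x1 = y1 + a *s d"
  define V where "V = ball x1 \<rho>"
  \<comment> \<open>After the shift the point \<open>x\<close> has parameter \<open>a\<close> on its
    slice; hence it lies in \<open>E\<close> exactly when the zero of this slice sits at
    \<open>a\<close>.\<close>
  define \<beta> where "\<beta> x = \<alpha> (x + - (a *s d)) - a" for x
  have Vb: "x + - (a *s d) \<in> ball y1 \<rho>" if "x \<in> V" for x
    using that by (simp add: V_def x1_def dist_norm algebra_simps)
  have VU: "V \<subseteq> U"
  proof
    fix x assume "x \<in> V"
    then have "good (x + - (a *s d)) z r" using gy[OF Vb] by blast
    moreover have "a \<in> cball z r" using a(1) by (simp add: zeros_def)
    ultimately have "(x + - (a *s d)) + a *s d \<in> U" unfolding good_def by blast
    then show "x \<in> U" by simp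
  qed
  have \<beta>hol: "holomorphic_fn V \<beta>"
    unfolding \<beta>_def
    by (intro holomorphic_fn_diff holomorphic_fn_const holomorphic_fn_translate[OF \<alpha>hol] Vb) (simp_all add: V_def)
  have iff: "x \<in> E \<longleftrightarrow> \<beta> x = 0" if x: "x \<in> V" for x
  proof
    assume "x \<in> E"
    then have "a \<in> zeros (x + - (a *s d)) z r" using hE[of x] a(1) by (simp add: zeros_def)
    then show "\<beta> x = 0" using \<alpha>[OF Vb[OF x]] by (simp add: \<beta>_def)
  next
    assume "\<beta> x = 0"
    then have "\<alpha> (x + - (a *s d)) = a" by (simp add: \<beta>_def)
    moreover obtain p where "p \<in> zeros (x + - (a *s d)) z r" "(x + - (a *s d)) + p *s d \<in> E"
      using ex[OF Vb[OF x]] by blast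
    ultimately have "(x + - (a *s d)) + a *s d \<in> E" using \<alpha>[OF Vb[OF x]] by metis
    then show "x \<in> E" by simp
  qed
  \<comment> \<open>Moving the base point by \<open>t *s d\<close> along its own line lowers the
    parameter of the zero by \<open>t\<close>.\<close>
  have "frechet_derivative \<beta> (at x1) d = -1"
  proof -
    have o1: "open ((\<lambda>t. y1 + t *s d) -` ball y1 \<rho> \<inter> (\<lambda>t. a - t) -` ball z r)"
      by (intro open_Int open_vimage continuous_intros) auto
    have z1: "0 \<in> (\<lambda>t. y1 + t *s d) -` ball y1 \<rho> \<inter> (\<lambda>t. a - t) -` ball z r"
      using \<rho> a(1) by (auto simp: zeros_def)
    have eq1: "- t = \<beta> (x1 + t *s d)" if t: "t \<in> (\<lambda>t. y1 + t *s d) -` ball y1 \<rho> \<inter> (\<lambda>t. a - t) -` ball z r" for t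
    proof -
      have "(y1 + t *s d) + (a - t) *s d = x1" by (simp add: x1_def vec_eq_iff algebra_simps)
      then have "a - t \<in> zeros (y1 + t *s d) z r"
        using t hE[of x1] a(2) by (simp add: zeros_def x1_def)
      then have "\<alpha> (y1 + t *s d) = a - t" using \<alpha>[of "y1 + t *s d"] t by blast
      moreover have "x1 + t *s d + - (a *s d) = y1 + t *s d" by (simp add: x1_def)
      ultimately have "\<beta> (x1 + t *s d) = (a - t) - a" by (simp only: \<beta>_def)
      then show ?thesis by simp
    qed
    have "((\<lambda>t::complex. - t) has_field_derivative -1) (at 0)" by (auto intro!: derivative_eq_intros)
    then have "((\<lambda>t. \<beta> (x1 + t *s d)) has_field_derivative -1) (at 0)"
      by (rule has_field_derivative_transform_within_open[OF _ o1 z1 eq1])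
    moreover have "deriv (\<lambda>t. \<beta> (x1 + t *s d)) 0 = frechet_derivative \<beta> (at x1) d"
      by (rule deriv_on_line[OF \<beta>hol]) (use \<rho> in \<open>simp add: V_def\<close>)
    ultimately show ?thesis using DERIV_imp_deriv by metis
  qed
  then have "frechet_derivative \<beta> (at x1) d \<noteq> 0" by simp
  moreover have "x1 \<in> E" "x1 \<in> V" using a(2) \<rho> by (simp_all add: x1_def V_def)
  ultimately show ?thesis using VU \<beta>hol iff by blast
qed

end

section \<open>Thin sets and Hartogs extension\<close>

text \<open>The last clause says that \<open>E\<close> contains no piece of a smooth hypersurface, i.e. that the
  codimension is at least two.\<close>

definition thin_subset :: "(complex^'n) set \<Rightarrow> (complex^'n) set \<Rightarrow> bool" where
  "thin_subset D E \<longleftrightarrow> E \<subseteq> D \<and>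
     (\<forall>x\<in>E. \<exists>W h. open W \<and> x \<in> W \<and> W \<subseteq> D \<and> holomorphic_fn W h \<and> (\<forall>y\<in>E \<inter> W. h y = 0) \<and>
        (\<forall>\<epsilon>>0. \<exists>y\<in>ball x \<epsilon> \<inter> W. h y \<noteq> 0)) \<and>
     (\<forall>x V \<beta> d. x \<in> E \<longrightarrow> x \<in> V \<longrightarrow> V \<subseteq> D \<longrightarrow> holomorphic_fn V \<beta> \<longrightarrow>
        frechet_derivative \<beta> (at x) d \<noteq> 0 \<longrightarrow> \<not> (\<forall>y\<in>V. y \<in> E \<longleftrightarrow> \<beta> y = 0))"

lemma thin_subsetE:
  assumes "thin_subset D E" "x \<in> E"
  obtains W h where "open W" "x \<in> W" "W \<subseteq> D" "holomorphic_fn W h" "\<And>y. y \<in> E \<Longrightarrow> y \<in> W \<Longrightarrow> h y = 0"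
    "\<And>\<epsilon>. \<epsilon> > 0 \<Longrightarrow> \<exists>y\<in>ball x \<epsilon> \<inter> W. h y \<noteq> 0"
proof -
  have "\<forall>x\<in>E. \<exists>W h. open W \<and> x \<in> W \<and> W \<subseteq> D \<and> holomorphic_fn W h \<and> (\<forall>y\<in>E \<inter> W. h y = 0) \<and>
        (\<forall>\<epsilon>>0. \<exists>y\<in>ball x \<epsilon> \<inter> W. h y \<noteq> 0)"
    using assms(1) unfolding thin_subset_def by (elim conjE) assumption
  from bspec[OF this assms(2)] show ?thesis
    by (elim exE conjE) (rule that, assumption+, simp_all)
qed

lemma thin_subset_dense:
  assumes "thin_subset D E" "open T" "y \<in> T" "y \<in> D"
  obtains z where "z \<in> T" "z \<in> D - E"
proof (cases "y \<in> E")
  case True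
  obtain W h where W: "open W" "y \<in> W" "W \<subseteq> D" "holomorphic_fn W h" "\<And>z. z \<in> E \<Longrightarrow> z \<in> W \<Longrightarrow> h z = 0"
    "\<And>\<epsilon>. \<epsilon> > 0 \<Longrightarrow> \<exists>z\<in>ball y \<epsilon> \<inter> W. h z \<noteq> 0"
    by (fact thin_subsetE[OF assms(1) True])
  obtain \<epsilon> where \<epsilon>: "\<epsilon> > 0" "ball y \<epsilon> \<subseteq> T" using assms openE by blast
  obtain z where "z \<in> ball y \<epsilon>" "z \<in> W" "h z \<noteq> 0" using W(6)[OF \<epsilon>(1)] by blast
  then show ?thesis using that[of z] W(3,5) \<epsilon>(2) by blast
qed (use that assms in blast)

text \<open>Circle means of \<open>J\<close>, in a direction along which the local equation
  \<open>h\<close> of \<open>E\<close> has an isolated zero, give a holomorphic candidate across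
  \<open>E\<close>. Where the candidate differs from \<open>J\<close>, every nearby slice must meet
  \<open>E\<close>, since otherwise the mean value property holds; then \<open>E\<close> contains a
  piece of a smooth hypersurface, against \<open>thin\<close>.\<close>

theorem hartogs_extension:
  fixes J :: "complex^'n \<Rightarrow> complex"
  assumes J: "holomorphic_fn (D - E) J" and D: "open D"
    and thin: "thin_subset D E"
  obtains J' where "holomorphic_fn D J'" "\<And>x. x \<in> D - E \<Longrightarrow> J' x = J x"
proof -
  have oDE: "open (D - E)" using J holomorphic_fn_open by blast
  have local: "\<exists>T g. x0 \<in> T \<and> open T \<and> T \<subseteq> D \<and> holomorphic_fn T g \<and> (\<forall>y\<in>T - E. g y = J y)" if x0: "x0 \<in> E" for x0
  proof -
    obtain W h where W: "open W" "x0 \<in> W" "W \<subseteq> D" and h: "holomorphic_fn W h"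
      and hE: "\<And>y. y \<in> E \<inter> W \<Longrightarrow> h y = 0" and nz: "\<And>\<epsilon>. \<epsilon> > 0 \<Longrightarrow> \<exists>y\<in>ball x0 \<epsilon> \<inter> W. h y \<noteq> 0"
      by (rule thin_subsetE[OF thin x0]) blast
    obtain \<epsilon> where \<epsilon>: "\<epsilon> > 0" "ball x0 \<epsilon> \<subseteq> W" using W openE by blast
    obtain y where y: "y \<in> ball x0 \<epsilon>" "h y \<noteq> 0" using nz[OF \<epsilon>(1)] by blast
    \<comment> \<open>On the line through \<open>x0\<close> and a nearby point with \<open>h\<close>
      nonzero, the zero of \<open>h\<close> at \<open>x0\<close> is isolated, so a small circle
      around it avoids \<open>E\<close>.\<close>
    define d where "d = y - x0"
    define T where "T = (\<lambda>t. x0 + t *s d) -` ball x0 \<epsilon>"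
    have oT: "open T" unfolding T_def by (intro open_vimage continuous_intros) auto
    have T_eq: "T = {t. norm t * norm d < \<epsilon>}" by (auto simp: T_def dist_self_add norm_vector_smult)
    have cT: "connected T"
    proof (intro convex_connected convexI)
      fix a b :: complex and u v :: real assume a: "a \<in> T" "b \<in> T" "0 \<le> u" "0 \<le> v" "u + v = 1"
      have "norm (u *\<^sub>R a + v *\<^sub>R b) * norm d \<le> (u * norm a + v * norm b) * norm d"
        using a by (intro mult_right_mono order.trans[OF norm_triangle_ineq]) auto
      also have "\<dots> = u * (norm a * norm d) + v * (norm b * norm d)" by (simp add: algebra_simps)
      also have "\<dots> < \<epsilon>" using a by (intro convex_bound_lt) (auto simp: T_eq)
      finally show "u *\<^sub>R a + v *\<^sub>R b \<in> T" by (simp add: T_eq)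
    qed
    have hT: "(\<lambda>t. h (x0 + t *s d)) holomorphic_on T"
      by (rule holomorphic_on_line[OF h _ oT]) (use \<epsilon> in \<open>auto simp: T_def\<close>)
    have "0 \<in> T" "1 \<in> T" using \<epsilon>(1) y by (auto simp: T_def d_def)
    moreover have "h (x0 + 0 *s d) = 0" "h (x0 + 1 *s d) \<noteq> 0" using hE[of x0] x0 W y by (auto simp: d_def)
    ultimately obtain R where R: "R > 0" "ball 0 R \<subseteq> T" "\<And>t. t \<in> ball 0 R - {0} \<Longrightarrow> h (x0 + t *s d) \<noteq> 0"
      using isolated_zeros[OF hT oT cT, of 0 1] by metis
    define r where "r = R / 2"
    have r: "0 < r" "r < R" using R by (auto simp: r_def)
    interpret slices W "E \<inter> W" h d
    proof
      have "W - E \<inter> W = W \<inter> (D - E)" using W by auto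
      then show "open (W - E \<inter> W)" using W oDE by auto
    qed (use h hE in auto)
    have "good x0 0 r"
      unfolding good_def
    proof (intro conjI ballI r(1))
      fix w :: complex assume "w \<in> cball 0 r"
      then have "w \<in> ball 0 R" using r by auto
      then show "x0 + w *s d \<in> W" using R(2) \<epsilon>(2) by (auto simp: T_def)
    next
      fix w :: complex assume "w \<in> sphere 0 r"
      then have "w \<in> ball 0 R - {0}" using r by auto
      then show "h (x0 + w *s d) \<noteq> 0" by (rule R(3))
    qed
    then obtain \<rho> where \<rho>: "\<rho> > 0" "\<And>y. y \<in> ball x0 \<rho> \<Longrightarrow> good y 0 r"
      using good_nearby by blast
    define g where "g x = integral {0..1} (\<lambda>s. J (x + (of_real r * exp (2 * of_real pi * \<i> * of_real s)) *s d) * 1)" for x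
    have g: "holomorphic_fn (ball x0 \<rho>) g"
      unfolding g_def
    proof (rule holomorphic_fn_circle_mean[OF J])
      fix x and s :: real assume "x \<in> ball x0 \<rho>"
      then have gx: "good x 0 r" by (rule \<rho>(2))
      have "of_real r * exp (2 * of_real pi * \<i> * of_real s) \<in> sphere 0 r"
        using r by (simp add: norm_mult)
      then have "x + (of_real r * exp (2 * of_real pi * \<i> * of_real s)) *s d \<in> W"
        "h (x + (of_real r * exp (2 * of_real pi * \<i> * of_real s)) *s d) \<noteq> 0"
        using gx sphere_cball[of 0 r] unfolding good_def by blast+
      then show "x + (of_real r * exp (2 * of_real pi * \<i> * of_real s)) *s d \<in> D - E"
        using W hE by blast
    qed auto
    have bW: "ball x0 \<rho> \<subseteq> W"
    proof
      fix x assume "x \<in> ball x0 \<rho>"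
      then have "x + 0 *s d \<in> W" using \<rho>(2) r unfolding good_def by (metis centre_in_cball less_imp_le)
      then show "x \<in> W" by simp
    qed
    \<comment> \<open>If \<open>E\<close> does not meet the disc, then \<open>J\<close> is
      holomorphic on it and the mean over the circle is the value at the centre.\<close>
    have eq: "g x = J x" if x: "x \<in> ball x0 \<rho>" and free: "\<And>w. w \<in> ball 0 r \<Longrightarrow> x + w *s d \<notin> E" for x
    proof -
      have gx: "good x 0 r" using \<rho>(2) x .
      have "open ((\<lambda>w. x + w *s d) -` (D - E))" by (intro open_vimage oDE continuous_intros)
      moreover have "cball 0 r \<subseteq> (\<lambda>w. x + w *s d) -` (D - E)"
      proof
        fix w :: complex assume w: "w \<in> cball 0 r"
        have "x + w *s d \<in> W" using gx w by (auto simp: good_def)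
        moreover have "x + w *s d \<notin> E"
        proof (cases "w \<in> sphere 0 r")
          case True
          then show ?thesis using gx hE \<open>x + w *s d \<in> W\<close> unfolding good_def by blast
        next
          case False
          then show ?thesis using w by (intro free) auto
        qed
        ultimately show "w \<in> (\<lambda>w. x + w *s d) -` (D - E)" using W by auto
      qed
      ultimately obtain R' where R': "R' > r" "ball 0 R' \<subseteq> (\<lambda>w. x + w *s d) -` (D - E)"
        using cball_subset_open_larger_ball r(1) by blast
      have "(\<lambda>w. J (x + w *s d)) holomorphic_on ball 0 R'"
        by (rule holomorphic_on_line[OF J]) (use R' in auto)
      from mean_value_holomorphic[OF this r(1) R'(1)] show ?thesis by (simp add: g_def)
    qed
    have "g x = J x" if x: "x \<in> ball x0 \<rho> - E" for x
    proof (rule ccontr)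
      assume ne: "g x \<noteq> J x"
      have sub: "ball x0 \<rho> - E = ball x0 \<rho> \<inter> (D - E)" using bW W by auto
      have ob: "open (ball x0 \<rho> - E)" unfolding sub using oDE by auto
      have "holomorphic_fn (ball x0 \<rho> - E) (\<lambda>x. g x - J x)"
        by (intro holomorphic_fn_diff holomorphic_fn_subset[OF g ob] holomorphic_fn_subset[OF J ob]) (use sub in auto)
      then have "open ((ball x0 \<rho> - E) \<inter> (\<lambda>x. g x - J x) -` (- {0}))"
        by (intro continuous_open_preimage[OF holomorphic_fn_continuous ob]) auto
      moreover have "x \<in> (ball x0 \<rho> - E) \<inter> (\<lambda>x. g x - J x) -` (- {0})" using x ne by simp
      ultimately obtain \<tau> where \<tau>: "\<tau> > 0" "ball x \<tau> \<subseteq> (ball x0 \<rho> - E) \<inter> (\<lambda>x. g x - J x) -` (- {0})"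
        using openE by blast
      \<comment> \<open>The mean differs from \<open>J\<close> on a whole neighbourhood of
        \<open>x\<close>, so each slice there meets \<open>E\<close> inside the disc.\<close>
      have "admissible x \<tau> 0 r"
        unfolding admissible_def
      proof (intro conjI \<tau>(1) ballI)
        fix y assume "y \<in> ball x \<tau>"
        then have y: "y \<in> ball x0 \<rho>" "g y \<noteq> J y" using \<tau>(2) by auto
        show gy: "good y 0 r" using \<rho>(2) y by blast
        obtain w where w: "w \<in> ball 0 r" "y + w *s d \<in> E" using eq[OF y(1)] y(2) by blast
        moreover have "y + w *s d \<in> W" using gy w(1) unfolding good_def by (meson ball_subset_cball subsetD)
        ultimately show "\<exists>w\<in>ball 0 r. y + w *s d \<in> E \<inter> W" by blast
      qed
      from surface_in_slices[OF this] obtain x1 V \<beta> where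
        "x1 \<in> E \<inter> W" "x1 \<in> V" "V \<subseteq> W" "holomorphic_fn V \<beta>" "frechet_derivative \<beta> (at x1) d \<noteq> 0"
        "\<forall>y\<in>V. y \<in> E \<inter> W \<longleftrightarrow> \<beta> y = 0" by blast
      moreover from this W(3) have "\<forall>y\<in>V. y \<in> E \<longleftrightarrow> \<beta> y = 0" "x1 \<in> E" "V \<subseteq> D" by blast+
      ultimately show False using thin unfolding thin_subset_def by metis
    qed
    then show ?thesis using \<rho>(1) g bW W(3) by (intro exI[of _ "ball x0 \<rho>"] exI[of _ g]) auto
  qed
  obtain T G where TG: "\<And>x. x \<in> E \<Longrightarrow> x \<in> T x \<and> open (T x) \<and> T x \<subseteq> D \<and> holomorphic_fn (T x) (G x) \<and> (\<forall>y\<in>T x - E. G x y = J y)"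
    using local by metis
  define J' where "J' x = (if x \<in> E then G x x else J x)" for x
  \<comment> \<open>Two local extensions agree off \<open>E\<close>, hence also on \<open>E\<close>,
    because the complement of a thin set is dense.\<close>
  have agree: "G x y = J' y" if x: "x \<in> E" and y: "y \<in> T x" for x y
  proof (cases "y \<in> E")
    case False
    then show ?thesis using TG[OF x] y by (simp add: J'_def)
  next
    case True
    have hd: "holomorphic_fn (T x \<inter> T y) (\<lambda>z. G x z - G y z)"
      using TG[OF x] TG[OF True] by (intro holomorphic_fn_diff) (auto intro: holomorphic_fn_subset)
    have yD: "y \<in> D" using TG[OF x] y by blast
    have "G x y - G y y = 0"
    proof (rule ccontr)
      assume ne: "G x y - G y y \<noteq> 0"
      have "open ((T x \<inter> T y) \<inter> (\<lambda>z. G x z - G y z) -` (- {0}))"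
        by (intro continuous_open_preimage holomorphic_fn_continuous[OF hd] holomorphic_fn_open[OF hd]) auto
      moreover have "y \<in> (T x \<inter> T y) \<inter> (\<lambda>z. G x z - G y z) -` (- {0})" using ne y TG[OF True] by simp
      ultimately obtain z where z: "z \<in> (T x \<inter> T y) \<inter> (\<lambda>z. G x z - G y z) -` (- {0})" "z \<in> D - E"
        by (rule thin_subset_dense[OF thin _ _ yD])
      then have "G x z = J z" "G y z = J z" using TG[OF x] TG[OF True] by auto
      then show False using z by simp
    qed
    then show ?thesis using True by (simp add: J'_def)
  qed
  have "holomorphic_fn D J'"
  proof (rule holomorphic_fn_local)
    fix x assume xD: "x \<in> D"
    show "\<exists>T g. x \<in> T \<and> T \<subseteq> D \<and> holomorphic_fn T g \<and> (\<forall>y\<in>T. J' y = g y)"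
    proof (cases "x \<in> E")
      case True
      then show ?thesis using TG[OF True] agree[OF True] by (intro exI[of _ "T x"] exI[of _ "G x"]) auto
    next
      case False
      then show ?thesis using xD J by (intro exI[of _ "D - E"] exI[of _ J]) (auto simp: J'_def)
    qed
  qed
  then show ?thesis by (rule that) (simp add: J'_def)
qed

text \<open>The reciprocal of \<open>J\<close> extends too, and the product of the two extensions is
  1 on a dense set.\<close>

theorem hartogs_extension_nonvanishing:
  fixes J :: "complex^'n \<Rightarrow> complex"
  assumes J: "holomorphic_fn (D - E) J" and D: "open D"
    and nz: "\<And>x. x \<in> D - E \<Longrightarrow> J x \<noteq> 0"
    and thin: "thin_subset D E"
  obtains J' where "holomorphic_fn D J'" "\<And>x. x \<in> D - E \<Longrightarrow> J' x = J x" "\<And>x. x \<in> D \<Longrightarrow> J' x \<noteq> 0"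
proof -
  obtain J1 where J1: "holomorphic_fn D J1" "\<And>x. x \<in> D - E \<Longrightarrow> J1 x = J x"
    using hartogs_extension[OF J D thin] by metis
  obtain J2 where J2: "holomorphic_fn D J2" "\<And>x. x \<in> D - E \<Longrightarrow> J2 x = inverse (J x)"
    using hartogs_extension[OF holomorphic_fn_inverse[OF J nz] D thin] by metis
  have hp: "holomorphic_fn D (\<lambda>x. J1 x * J2 x - 1)"
    by (intro holomorphic_fn_diff holomorphic_fn_mult holomorphic_fn_const J1 J2 D)
  have "J1 x * J2 x - 1 = 0" if x: "x \<in> D" for x
  proof (rule ccontr)
    assume ne: "J1 x * J2 x - 1 \<noteq> 0"
    have "open (D \<inter> (\<lambda>x. J1 x * J2 x - 1) -` (- {0}))"
      by (intro continuous_open_preimage holomorphic_fn_continuous[OF hp] D) auto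
    moreover have "x \<in> D \<inter> (\<lambda>x. J1 x * J2 x - 1) -` (- {0})" using x ne by simp
    ultimately obtain y where "y \<in> D \<inter> (\<lambda>x. J1 x * J2 x - 1) -` (- {0})" "y \<in> D - E"
      by (rule thin_subset_dense[OF thin _ _ x])
    then have "y \<in> D - E" "J1 y * J2 y - 1 \<noteq> 0" by auto
    then show False using J1(2)[of y] J2(2)[of y] nz[of y] by simp
  qed
  then have "J1 x \<noteq> 0" if "x \<in> D" for x using that by force
  then show ?thesis using that[OF J1] by blast
qed

section \<open>Atlases and the total space of O(2)\<close>

lemma is_chart_open_domain: "is_chart X c \<Longrightarrow> openin X (fst c)"
  by (simp add: is_chart_def)

lemma is_chart_domain_subset: "is_chart X c \<Longrightarrow> fst c \<subseteq> topspace X"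
  by (simp add: is_chart_def openin_subset)

lemma is_chart_inj: "is_chart X c \<Longrightarrow> inj_on (snd c) (fst c)"
  using homeomorphic_imp_injective_map is_chart_domain_subset
  by (metis inf.absorb_iff2 is_chart_def topspace_subtopology)

lemma is_chart_open_image:
  assumes "is_chart X c" "openin X V" "V \<subseteq> fst c"
  shows "open (snd c ` V)"
proof -
  have "openin (subtopology X (fst c)) V"
    using assms openin_open_subtopology[OF is_chart_open_domain[OF assms(1)]] by blast
  then have "openin (top_of_set (snd c ` fst c)) (snd c ` V)"
    using assms(1) homeomorphic_imp_open_map unfolding is_chart_def open_map_def by blast
  then show ?thesis
    using assms(1) by (meson is_chart_def openin_open_trans)
qed

lemma is_chart_open_preimage:
  assumes "is_chart X c" "open W"
  shows "openin X {p \<in> fst c. snd c p \<in> W}"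
proof -
  have "continuous_map (subtopology X (fst c)) (top_of_set (snd c ` fst c)) (snd c)"
    using assms(1) homeomorphic_imp_continuous_map unfolding is_chart_def by blast
  then have "continuous_map (subtopology X (fst c)) euclidean (snd c)"
    by (simp add: continuous_map_in_subtopology)
  then have "openin (subtopology X (fst c)) {p \<in> topspace (subtopology X (fst c)). snd c p \<in> W}"
    using assms(2) openin_continuous_map_preimage open_openin by blast
  moreover have "topspace (subtopology X (fst c)) = fst c"
    using is_chart_domain_subset[OF assms(1)] by auto
  ultimately show ?thesis
    using is_chart_open_domain[OF assms(1)] openin_trans_full by fastforce
qed

lemma is_chartI:
  assumes "openin X (fst c)" "inj_on (snd c) (fst c)"
    and o: "\<And>V. openin X V \<Longrightarrow> V \<subseteq> fst c \<Longrightarrow> open (snd c ` V)"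
    and p: "\<And>W. open W \<Longrightarrow> openin X {p \<in> fst c. snd c p \<in> W}"
  shows "is_chart X c"
  unfolding is_chart_def
proof (intro conjI assms(1) o[OF assms(1)] subset_refl)
  have t: "topspace (subtopology X (fst c)) = fst c"
    using openin_subset[OF assms(1)] by auto
  show "homeomorphic_map (subtopology X (fst c)) (top_of_set (snd c ` fst c)) (snd c)"
  proof (rule bijective_open_imp_homeomorphic_map)
    show "continuous_map (subtopology X (fst c)) (top_of_set (snd c ` fst c)) (snd c)"
      unfolding continuous_map_in_subtopology
    proof (intro conjI)
      show "continuous_map (subtopology X (fst c)) euclidean (snd c)"
        unfolding continuous_map_def t
        using p openin_open_subtopology[OF assms(1)] by (auto simp: open_openin[symmetric])
    qed (use t in auto)
    show "open_map (subtopology X (fst c)) (top_of_set (snd c ` fst c)) (snd c)"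
      unfolding open_map_def
    proof (intro allI impI)
      fix V assume "openin (subtopology X (fst c)) V"
      then have "openin X V" "V \<subseteq> fst c" using openin_open_subtopology[OF assms(1)] by auto
      then show "openin (top_of_set (snd c ` fst c)) (snd c ` V)"
        using o by (metis image_mono openin_open_eq o[OF assms(1)] subset_refl)
    qed
  qed (use t assms(2) in auto)
qed

lemma local_rep_chart:
  "inj_on (snd c) (fst c) \<Longrightarrow> p \<in> fst c \<Longrightarrow> local_rep c d f (snd c p) = snd d (f p)"
  by (simp add: local_rep_def)

lemma compatible_iff:
  "compatible c d \<longleftrightarrow> holo_map (local_dom c d id) (local_rep c d id) \<and> holo_map (local_dom d c id) (local_rep d c id)"
  by (simp add: compatible_def holo_map_def)

text \<open>The chart axioms alone, so that the lemmas on charts apply to \<open>tot_O2\<close> as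
  well as to \<open>Z\<close>.\<close>

definition atlas :: "('a, 'n::finite) complex_space \<Rightarrow> bool" where
  "atlas M \<longleftrightarrow> (\<forall>c\<in>charts M. is_chart (ctop M) c) \<and> (\<Union>c\<in>charts M. fst c) = topspace (ctop M) \<and>
     (\<forall>c\<in>charts M. \<forall>d\<in>charts M. compatible c d)"

lemma complex_manifold_atlas: "complex_manifold M \<Longrightarrow> atlas M"
  by (simp add: complex_manifold_def atlas_def)

lemma charts_max_atlas: "atlas M \<Longrightarrow> c \<in> charts M \<Longrightarrow> c \<in> max_atlas M"
  by (simp add: atlas_def max_atlas_def)

lemma max_atlas_is_chart: "c \<in> max_atlas M \<Longrightarrow> is_chart (ctop M) c"
  by (simp add: max_atlas_def)

lemma max_atlas_inj: "c \<in> max_atlas M \<Longrightarrow> inj_on (snd c) (fst c)"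
  using is_chart_inj max_atlas_is_chart by blast

lemma atlas_chart_at:
  assumes "atlas M" "p \<in> topspace (ctop M)"
  obtains c where "c \<in> charts M" "p \<in> fst c"
  using assms unfolding atlas_def by blast

text \<open>Near each point \<open>c\<close> is compared with a chart \<open>c0\<close> of the
  atlas, and compatibility reduces the claim to \<open>c0\<close>.\<close>

lemma holo_map_local_rep_max_atlas:
  assumes M: "atlas M" and c: "c \<in> max_atlas M"
    and o: "openin (ctop M) {p \<in> topspace (ctop M). f p \<in> fst d}"
    and h: "\<And>c0. c0 \<in> charts M \<Longrightarrow> holo_map (local_dom c0 d f) (local_rep c0 d f)"
  shows "holo_map (local_dom c d f) (local_rep c d f)"
proof (rule holo_map_local)
  fix x assume "x \<in> local_dom c d f"
  then obtain p where p: "x = snd c p" "p \<in> fst c" "f p \<in> fst d" by (auto simp: local_dom_def)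
  have cc: "is_chart (ctop M) c" using c max_atlas_is_chart by blast
  have pt: "p \<in> topspace (ctop M)" using p is_chart_domain_subset[OF cc] by blast
  obtain c0 where c0: "c0 \<in> charts M" "p \<in> fst c0" using atlas_chart_at[OF M pt] by blast
  have cc0: "is_chart (ctop M) c0" using M c0 by (simp add: atlas_def)
  define V where "V = fst c \<inter> fst c0 \<inter> {p \<in> topspace (ctop M). f p \<in> fst d}"
  have oV: "openin (ctop M) V"
    unfolding V_def using cc cc0 o by (intro openin_Int) (auto simp: is_chart_def)
  define T where "T = snd c ` V"
  have oT: "open T" unfolding T_def by (rule is_chart_open_image[OF cc oV]) (auto simp: V_def)
  have injc: "inj_on (snd c) (fst c)" and injc0: "inj_on (snd c0) (fst c0)"
    by (rule is_chart_inj[OF cc], rule is_chart_inj[OF cc0])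
  have 1: "holo_map T (local_rep c c0 id)"
  proof (rule holo_map_subset[OF _ oT])
    show "holo_map (local_dom c c0 id) (local_rep c c0 id)"
      using c c0 by (simp add: max_atlas_def compatible_iff)
  qed (auto simp: T_def V_def local_dom_def)
  have 2: "local_rep c c0 id ` T \<subseteq> local_dom c0 d f"
    using injc by (auto simp: T_def V_def local_rep_chart local_dom_def)
  have "holo_map T (\<lambda>y. local_rep c0 d f (local_rep c c0 id y))"
    by (rule holo_map_compose[OF h[OF c0(1)] 1 2])
  moreover have "local_rep c d f y = local_rep c0 d f (local_rep c c0 id y)" if y: "y \<in> T" for y
    using y injc injc0 by (auto simp: T_def V_def local_rep_chart)
  moreover have "x \<in> T" "T \<subseteq> local_dom c d f"
    using p c0 pt by (auto simp: T_def V_def local_dom_def)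
  ultimately show "\<exists>T g. x \<in> T \<and> T \<subseteq> local_dom c d f \<and> holo_map T g \<and> (\<forall>y\<in>T. local_rep c d f y = g y)"
    by (intro exI[of _ T] exI[of _ "\<lambda>y. local_rep c0 d f (local_rep c c0 id y)"]) auto
qed

lemma max_atlas_compatible:
  assumes M: "atlas M" and c: "c \<in> max_atlas M" and d: "d \<in> max_atlas M"
  shows "holo_map (local_dom c d id) (local_rep c d id)"
proof (rule holo_map_local_rep_max_atlas[OF M c])
  have "{p \<in> topspace (ctop M). id p \<in> fst d} = fst d"
    using is_chart_domain_subset[OF max_atlas_is_chart[OF d]] by auto
  then show "openin (ctop M) {p \<in> topspace (ctop M). id p \<in> fst d}"
    using is_chart_open_domain[OF max_atlas_is_chart[OF d]] by simp
  show "holo_map (local_dom c0 d id) (local_rep c0 d id)" if "c0 \<in> charts M" for c0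
    using d that by (simp add: max_atlas_def compatible_iff)
qed

lemma max_atlas_compose:
  assumes c: "c \<in> max_atlas M" and U: "open U" "U \<subseteq> snd c ` fst c" and V: "open V"
    and hom: "homeomorphism U V \<phi> g" and \<phi>: "holo_map U \<phi>" and g: "holo_map V g"
    and M: "atlas M"
  shows "({p \<in> fst c. snd c p \<in> U}, \<phi> \<circ> snd c) \<in> max_atlas M"
proof -
  let ?c = "({p \<in> fst c. snd c p \<in> U}, \<phi> \<circ> snd c)"
  have cc: "is_chart (ctop M) c" using c max_atlas_is_chart by blast
  have inj: "inj_on (snd c) (fst c)" by (rule is_chart_inj[OF cc])
  have gphi: "g (\<phi> x) = x" "\<phi> x \<in> V" if "x \<in> U" for x
    using hom that by (auto simp: homeomorphism_def)
  have phig: "\<phi> (g y) = y" "g y \<in> U" if "y \<in> V" for y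
    using hom that by (auto simp: homeomorphism_def)
  have od: "openin (ctop M) {p \<in> fst c. snd c p \<in> U}" by (rule is_chart_open_preimage[OF cc U(1)])
  have inj': "inj_on (snd ?c) (fst ?c)"
    using inj gphi by (auto simp: inj_on_def) (metis gphi(1))
  have chart: "is_chart (ctop M) ?c"
  proof (rule is_chartI)
    show "openin (ctop M) (fst ?c)" using od by simp
    show "inj_on (snd ?c) (fst ?c)" by (rule inj')
    fix W assume W: "openin (ctop M) W" "W \<subseteq> fst ?c"
    have "snd ?c ` W = V \<inter> g -` (snd c ` W)"
    proof
      show "snd ?c ` W \<subseteq> V \<inter> g -` (snd c ` W)" using W gphi by auto
      show "V \<inter> g -` (snd c ` W) \<subseteq> snd ?c ` W"
      proof
        fix y assume "y \<in> V \<inter> g -` (snd c ` W)"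
        then obtain p where "p \<in> W" "g y = snd c p" "y \<in> V" by auto
        then have "y = snd ?c p" using phig by (metis comp_apply snd_conv)
        then show "y \<in> snd ?c ` W" using \<open>p \<in> W\<close> by blast
      qed
    qed
    moreover have "open (V \<inter> g -` (snd c ` W))"
      by (intro continuous_open_preimage holo_map_continuous[OF g] V is_chart_open_image[OF cc W(1)]) (use W in auto)
    ultimately show "open (snd ?c ` W)" by simp
  next
    fix W :: "(complex^'b) set" assume W: "open W"
    have "open (U \<inter> \<phi> -` W)" by (intro continuous_open_preimage holo_map_continuous[OF \<phi>] U W)
    from is_chart_open_preimage[OF cc this]
    show "openin (ctop M) {p \<in> fst ?c. snd ?c p \<in> W}" by (simp add: conj_ac)
  qed
  have comp: "compatible ?c d" if d: "d \<in> charts M" for d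
    unfolding compatible_iff
  proof
    have cd: "holo_map (local_dom c d id) (local_rep c d id)" "holo_map (local_dom d c id) (local_rep d c id)"
      using c d by (auto simp: max_atlas_def compatible_iff)
    have dc: "is_chart (ctop M) d" using M d by (simp add: atlas_def)
    have injd: "inj_on (snd d) (fst d)" by (rule is_chart_inj[OF dc])
    have oi: "openin (ctop M) (fst ?c \<inter> fst d)"
      using openin_Int[OF od is_chart_open_domain[OF dc]] by simp
    have "local_dom ?c d id = snd ?c ` (fst ?c \<inter> fst d)" by (auto simp: local_dom_def)
    then have o1: "open (local_dom ?c d id)"
      using is_chart_open_image[OF chart oi] by simp
    have "holo_map (local_dom ?c d id) (\<lambda>y. local_rep c d id (g y))"
    proof (rule holo_map_compose[OF cd(1) holo_map_subset[OF g o1]])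
      show "local_dom ?c d id \<subseteq> V" using gphi by (auto simp: local_dom_def)
      show "g ` local_dom ?c d id \<subseteq> local_dom c d id" using gphi by (auto simp: local_dom_def)
    qed
    then show "holo_map (local_dom ?c d id) (local_rep ?c d id)"
    proof (rule holo_map_cong)
      fix y assume "y \<in> local_dom ?c d id"
      then obtain p where p: "p \<in> fst ?c" "y = snd ?c p" "p \<in> fst d" by (auto simp: local_dom_def)
      then show "local_rep c d id (g y) = local_rep ?c d id y"
        unfolding p(2) local_rep_chart[OF inj' p(1)]
        using gphi(1)[of "snd c p"] local_rep_chart[OF inj, of p d id] by simp
    qed
    have "local_dom d ?c id = snd d ` (fst ?c \<inter> fst d)" by (auto simp: local_dom_def)
    then have o2: "open (local_dom d ?c id)"
      using is_chart_open_image[OF dc oi] by simp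
    have h2: "holo_map (local_dom d ?c id) (local_rep d c id)"
      by (rule holo_map_subset[OF cd(2) o2]) (auto simp: local_dom_def)
    have "holo_map (local_dom d ?c id) (\<lambda>y. \<phi> (local_rep d c id y))"
      by (rule holo_map_compose[OF \<phi> h2]) (use injd in \<open>auto simp: local_dom_def local_rep_chart\<close>)
    then show "holo_map (local_dom d ?c id) (local_rep d ?c id)"
      by (rule holo_map_cong) (simp add: local_rep_def)
  qed
  show ?thesis using chart comp by (simp add: max_atlas_def)
qed

lemma max_atlas_restrict:
  assumes c: "c \<in> max_atlas M" and W: "openin (ctop M) W" and M: "atlas M"
  shows "(fst c \<inter> W, snd c) \<in> max_atlas M"
proof -
  have cc: "is_chart (ctop M) c" using c max_atlas_is_chart by blast
  define U where "U = snd c ` (fst c \<inter> W)"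
  have U: "open U"
    unfolding U_def using W is_chart_open_domain[OF cc] by (intro is_chart_open_image[OF cc]) auto
  have "({p \<in> fst c. snd c p \<in> U}, (\<lambda>x. x) \<circ> snd c) \<in> max_atlas M"
    by (rule max_atlas_compose[OF c U _ U _ holo_map_id[OF U] holo_map_id[OF U] M])
      (auto simp: U_def homeomorphism_def continuous_on_id)
  moreover have "{p \<in> fst c. snd c p \<in> U} = fst c \<inter> W"
    using is_chart_inj[OF cc] by (auto simp: U_def inj_on_def)
  ultimately show ?thesis by (simp add: comp_def)
qed

section \<open>Standard charts of the total space of O(2)\<close>

definition tcoord :: "4 \<Rightarrow> (complex^4) \<times> complex \<Rightarrow> complex^4" where
  "tcoord i w = (\<chi> j. if j = i then snd w / (fst w $ i)^2 else fst w $ j / fst w $ i)"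

text \<open>The representative whose i-th homogeneous coordinate is 1. The i-th slot of
  \<open>X\<close> holds the fibre coordinate and is therefore overwritten.\<close>

definition tlift :: "4 \<Rightarrow> complex^4 \<Rightarrow> complex^4" where
  "tlift i X = (\<chi> j. if j = i then 1 else X $ j)"

definition tchart :: "4 \<Rightarrow> (((complex^4) \<times> complex) set, 4) chart" where
  "tchart i = (pt_O2 ` {w. fst w $ i \<noteq> 0},
        \<lambda>P. let w = (SOME w. w \<in> P) in
            \<chi> j. if j = i then snd w / (fst w $ i)^2 else fst w $ j / fst w $ i)"

lemma charts_tot_O2: "charts tot_O2 = range tchart"
  by (auto simp: tot_O2_def tchart_def)

lemma pt_O2_self: "w \<in> pt_O2 w"
  unfolding pt_O2_def by (auto intro!: exI[of _ 1])

lemma pt_O2_scale: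
  assumes "c \<noteq> 0" shows "pt_O2 (c *s y, c^2 * z) = pt_O2 (y, z)"
  unfolding pt_O2_def
proof (intro set_eqI iffI)
  fix v assume "v \<in> {(k *s fst (c *s y, c^2 * z), k^2 * snd (c *s y, c^2 * z)) |k. k \<noteq> 0}"
  then obtain k where "k \<noteq> 0" "v = (k *s (c *s y), k^2 * (c^2 * z))" by auto
  then show "v \<in> {(k *s fst (y, z), k^2 * snd (y, z)) |k. k \<noteq> 0}"
    using assms by (intro CollectI exI[of _ "k * c"]) (simp add: power_mult_distrib)
next
  fix v assume "v \<in> {(k *s fst (y, z), k^2 * snd (y, z)) |k. k \<noteq> 0}"
  then obtain k where "k \<noteq> 0" "v = (k *s y, k^2 * z)" by auto
  then show "v \<in> {(k *s fst (c *s y, c^2 * z), k^2 * snd (c *s y, c^2 * z)) |k. k \<noteq> 0}"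
    using assms by (intro CollectI exI[of _ "k / c"]) (simp add: power_divide)
qed

lemma pt_O2_eq_iff: "pt_O2 w = pt_O2 w' \<longleftrightarrow> (\<exists>c. c \<noteq> 0 \<and> fst w' = c *s fst w \<and> snd w' = c^2 * snd w)"
proof
  assume "pt_O2 w = pt_O2 w'"
  then have "w' \<in> pt_O2 w" using pt_O2_self by blast
  then show "\<exists>c. c \<noteq> 0 \<and> fst w' = c *s fst w \<and> snd w' = c^2 * snd w" by (auto simp: pt_O2_def)
next
  assume "\<exists>c. c \<noteq> 0 \<and> fst w' = c *s fst w \<and> snd w' = c^2 * snd w"
  then show "pt_O2 w = pt_O2 w'" using pt_O2_scale by (metis prod.collapse)
qed

lemma pt_O2_mem_tchart: "pt_O2 w \<in> fst (tchart i) \<longleftrightarrow> fst w $ i \<noteq> 0"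
proof
  assume "pt_O2 w \<in> fst (tchart i)"
  then obtain w' where "fst w' $ i \<noteq> 0" "pt_O2 w' = pt_O2 w" by (auto simp: tchart_def)
  then show "fst w $ i \<noteq> 0" by (auto simp: pt_O2_eq_iff)
qed (auto simp: tchart_def)

lemma tcoord_scale: "c \<noteq> 0 \<Longrightarrow> tcoord i (c *s y, c^2 * z) = tcoord i (y, z)"
  by (auto simp: tcoord_def vec_eq_iff power_mult_distrib)

lemma tchart_coord: "snd (tchart i) (pt_O2 w) = tcoord i w"
proof -
  define w' where "w' = (SOME v. v \<in> pt_O2 w)"
  have "w' \<in> pt_O2 w" unfolding w'_def by (rule someI[of "\<lambda>v. v \<in> pt_O2 w", OF pt_O2_self])
  then obtain c where "c \<noteq> 0" "w' = (c *s fst w, c^2 * snd w)" by (auto simp: pt_O2_def)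
  then have "tcoord i w' = tcoord i w" using tcoord_scale by (metis prod.collapse)
  then show ?thesis by (simp add: tchart_def tcoord_def w'_def Let_def)
qed

lemma tcoord_tlift: "tcoord i (tlift i X, X $ i) = X"
  by (auto simp: tcoord_def tlift_def vec_eq_iff)

lemma tlift_tcoord:
  fixes w :: "(complex^4) \<times> complex"
  assumes "fst w $ i \<noteq> 0"
  shows "pt_O2 (tlift i (tcoord i w), tcoord i w $ i) = pt_O2 w"
  unfolding pt_O2_eq_iff
  by (rule exI[of _ "fst w $ i"]) (use assms in \<open>auto simp: tlift_def tcoord_def vec_eq_iff\<close>)

lemma topspace_tot_O2: "topspace (ctop tot_O2) = pt_O2 ` {w. fst w \<noteq> 0}"
  using quotient_map_quotient_topology[of "top_of_set {w::(complex^4) \<times> complex. fst w \<noteq> 0}" pt_O2]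
  by (simp add: quotient_map_def tot_O2_def)

lemma openin_tot_O2:
  "openin (ctop tot_O2) S \<longleftrightarrow> S \<subseteq> pt_O2 ` {w. fst w \<noteq> 0} \<and> open {w. fst w \<noteq> 0 \<and> pt_O2 w \<in> S}"
proof -
  let ?A = "{w::(complex^4) \<times> complex. fst w \<noteq> 0}"
  have "open (fst -` (-{0::complex^4}) :: ((complex^4) \<times> complex) set)"
    by (intro open_vimage_fst) auto
  then have oA: "open ?A" by (simp add: vimage_def Compl_eq)
  have q: "quotient_map (top_of_set ?A) (ctop tot_O2) pt_O2"
    using quotient_map_quotient_topology[of "top_of_set ?A" pt_O2] by (simp add: tot_O2_def)
  show ?thesis
  proof
    assume o: "openin (ctop tot_O2) S"
    then have s: "S \<subseteq> pt_O2 ` ?A" using openin_subset topspace_tot_O2 by blast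
    then have "openin (top_of_set ?A) {w \<in> topspace (top_of_set ?A). pt_O2 w \<in> S}"
      using q o topspace_tot_O2 unfolding quotient_map_def by blast
    then show "S \<subseteq> pt_O2 ` ?A \<and> open {w. fst w \<noteq> 0 \<and> pt_O2 w \<in> S}"
      using s oA openin_open_trans by fastforce
  next
    assume a: "S \<subseteq> pt_O2 ` ?A \<and> open {w. fst w \<noteq> 0 \<and> pt_O2 w \<in> S}"
    then have "openin (top_of_set ?A) {w \<in> topspace (top_of_set ?A). pt_O2 w \<in> S}"
      by (subst openin_open_eq[OF oA]) auto
    then show "openin (ctop tot_O2) S"
      using q a unfolding quotient_map_def topspace_tot_O2 by (metis (no_types, lifting))
  qed
qed

lemma continuous_on_tlift: "continuous_on UNIV (\<lambda>X. (tlift i X, X $ i))"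
proof -
  have "continuous_on UNIV (tlift i)"
    unfolding tlift_def[abs_def]
  proof (rule continuous_on_vec_lambda)
    fix j show "continuous_on UNIV (\<lambda>X. if j = i then 1 else X $ j)"
      by (cases "j = i") (simp_all add: continuous_on_component)
  qed
  then show ?thesis by (intro continuous_intros)
qed

lemma tchart_image: "P \<in> fst (tchart i) \<Longrightarrow> P = pt_O2 (tlift i (snd (tchart i) P), snd (tchart i) P $ i)"
proof -
  assume "P \<in> fst (tchart i)"
  then obtain w where "P = pt_O2 w" "fst w $ i \<noteq> 0" by (auto simp: tchart_def)
  then show ?thesis using tlift_tcoord[of w i] by (simp add: tchart_coord)
qed

lemma tlift_mem: "pt_O2 (tlift i X, z) \<in> fst (tchart i)"
  by (simp add: pt_O2_mem_tchart tlift_def)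

lemma tchart_tlift: "snd (tchart i) (pt_O2 (tlift i X, X $ i)) = X"
  by (simp add: tchart_coord tcoord_tlift)

lemma continuous_on_tcoord:
  fixes S :: "((complex^4) \<times> complex) set"
  assumes "\<And>w. w \<in> S \<Longrightarrow> fst w $ i \<noteq> 0"
  shows "continuous_on S (tcoord i)"
  unfolding tcoord_def[abs_def]
proof (rule continuous_on_vec_lambda)
  fix j
  have 1: "continuous_on S (\<lambda>w. snd w / (fst w $ i)^2)" "continuous_on S (\<lambda>w. fst w $ j / fst w $ i)"
    using assms by (auto intro!: continuous_intros)
  show "continuous_on S (\<lambda>w. if j = i then snd w / (fst w $ i)^2 else fst w $ j / fst w $ i)"
    using 1 by (cases "j = i") simp_all
qed

lemma open_nonzero_component: "open {w::(complex^4) \<times> complex. fst w $ i \<noteq> 0}"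
proof -
  have "open ((\<lambda>w::(complex^4) \<times> complex. fst w $ i) -` (- {0}))"
    by (intro open_vimage continuous_intros) (simp add: open_Compl)?
  then show ?thesis by (simp add: vimage_def Compl_eq)
qed

lemma is_chart_tchart: "is_chart (ctop tot_O2) (tchart i)"
proof (rule is_chartI)
  have nz: "fst w \<noteq> 0" if "fst w $ i \<noteq> 0" for w :: "(complex^4) \<times> complex"
    using that by auto
  have o: "openin (ctop tot_O2) {P \<in> fst (tchart i). snd (tchart i) P \<in> W}" if "open W" for W
    unfolding openin_tot_O2
  proof
    show "{P \<in> fst (tchart i). snd (tchart i) P \<in> W} \<subseteq> pt_O2 ` {w. fst w \<noteq> 0}"
      using nz by (auto simp: tchart_def)
    have "open ({w. fst w $ i \<noteq> 0} \<inter> tcoord i -` W)"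
      by (intro continuous_open_preimage continuous_on_tcoord open_nonzero_component that) simp
    moreover have "{w. fst w \<noteq> 0 \<and> pt_O2 w \<in> {P \<in> fst (tchart i). snd (tchart i) P \<in> W}} = {w. fst w $ i \<noteq> 0} \<inter> tcoord i -` W"
      using nz by (auto simp: pt_O2_mem_tchart tchart_coord)
    ultimately show "open {w. fst w \<noteq> 0 \<and> pt_O2 w \<in> {P \<in> fst (tchart i). snd (tchart i) P \<in> W}}" by simp
  qed
  then show "openin (ctop tot_O2) {P \<in> fst (tchart i). snd (tchart i) P \<in> W}" if "open W" for W using that .
  from o[of UNIV] show "openin (ctop tot_O2) (fst (tchart i))" by simp
  show "inj_on (snd (tchart i)) (fst (tchart i))"
    by (rule inj_onI) (metis tchart_image)
  fix V assume V: "openin (ctop tot_O2) V" "V \<subseteq> fst (tchart i)"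
  have "snd (tchart i) ` V = (\<lambda>X. (tlift i X, X $ i)) -` {w. fst w \<noteq> 0 \<and> pt_O2 w \<in> V}"
  proof
    show "snd (tchart i) ` V \<subseteq> (\<lambda>X. (tlift i X, X $ i)) -` {w. fst w \<noteq> 0 \<and> pt_O2 w \<in> V}"
    proof
      fix X assume "X \<in> snd (tchart i) ` V"
      then obtain P where P: "P \<in> V" "X = snd (tchart i) P" by auto
      then have "pt_O2 (tlift i X, X $ i) = P" using V tchart_image by blast
      moreover have "tlift i X $ i \<noteq> 0" by (simp add: tlift_def)
      then have "tlift i X \<noteq> 0" by auto
      ultimately show "X \<in> (\<lambda>X. (tlift i X, X $ i)) -` {w. fst w \<noteq> 0 \<and> pt_O2 w \<in> V}"
        using P by simp
    qed
    show "(\<lambda>X. (tlift i X, X $ i)) -` {w. fst w \<noteq> 0 \<and> pt_O2 w \<in> V} \<subseteq> snd (tchart i) ` V"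
      by (auto intro!: rev_image_eqI simp: tchart_tlift)
  qed
  moreover have "open ((\<lambda>X. (tlift i X, X $ i)) -` {w. fst w \<noteq> 0 \<and> pt_O2 w \<in> V})"
    using V(1) continuous_on_tlift by (intro open_vimage) (auto simp: openin_tot_O2)
  ultimately show "open (snd (tchart i) ` V)" by simp
qed

lemma holo_map_tlift_coord: "holo_map {X. tlift i X $ j \<noteq> 0} (\<lambda>X. tcoord j (tlift i X, X $ i))"
proof -
  have "open ((\<lambda>X. tlift i X $ j) -` (- {0}))"
    unfolding tlift_def by (intro open_vimage) (cases "j = i"; auto intro!: continuous_intros)+
  then have o: "open {X. tlift i X $ j \<noteq> 0}" by (simp add: vimage_def Compl_eq)
  have l: "holomorphic_fn {X. tlift i X $ j \<noteq> 0} (\<lambda>X. tlift i X $ k)" for k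
    by (cases "k = i") (simp_all add: tlift_def holomorphic_fn_const[OF o[unfolded tlift_def, simplified]]
      holomorphic_fn_component[OF o[unfolded tlift_def, simplified]])
  show ?thesis
    unfolding holo_map_def
  proof
    fix k
    show "holomorphic_fn {X. tlift i X $ j \<noteq> 0} (\<lambda>X. tcoord j (tlift i X, X $ i) $ k)"
      by (cases "k = j")
        (auto simp: tcoord_def intro!: holomorphic_fn_divide holomorphic_fn_power l holomorphic_fn_component o)
  qed
qed

lemma local_dom_tchart: "local_dom (tchart i) (tchart j) id = {X. tlift i X $ j \<noteq> 0}"
proof
  show "local_dom (tchart i) (tchart j) id \<subseteq> {X. tlift i X $ j \<noteq> 0}"
  proof
    fix X assume "X \<in> local_dom (tchart i) (tchart j) id"
    then obtain P where "P \<in> fst (tchart i)" "P \<in> fst (tchart j)" "X = snd (tchart i) P"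
      by (auto simp: local_dom_def)
    then show "X \<in> {X. tlift i X $ j \<noteq> 0}"
      using tchart_image[of P i] pt_O2_mem_tchart by (metis fst_conv mem_Collect_eq)
  qed
  show "{X. tlift i X $ j \<noteq> 0} \<subseteq> local_dom (tchart i) (tchart j) id"
  proof
    fix X assume "X \<in> {X. tlift i X $ j \<noteq> 0}"
    then have "pt_O2 (tlift i X, X $ i) \<in> {p \<in> fst (tchart i). id p \<in> fst (tchart j)}"
      by (simp add: tlift_mem) (simp add: pt_O2_mem_tchart)
    then have "snd (tchart i) (pt_O2 (tlift i X, X $ i)) \<in> local_dom (tchart i) (tchart j) id"
      unfolding local_dom_def by blast
    then show "X \<in> local_dom (tchart i) (tchart j) id" unfolding tchart_tlift .
  qed
qed

lemma local_rep_tchart: "local_rep (tchart i) (tchart j) id X = tcoord j (tlift i X, X $ i)"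
proof -
  have "local_rep (tchart i) (tchart j) id (snd (tchart i) (pt_O2 (tlift i X, X $ i))) =
      snd (tchart j) (id (pt_O2 (tlift i X, X $ i)))"
    by (rule local_rep_chart[OF is_chart_inj[OF is_chart_tchart] tlift_mem])
  then show ?thesis by (simp only: tchart_tlift id_apply) (simp only: tchart_coord)
qed

lemma atlas_tot_O2: "atlas tot_O2"
  unfolding atlas_def charts_tot_O2
proof (intro conjI ballI)
  show "is_chart (ctop tot_O2) c" if "c \<in> range tchart" for c
    using that is_chart_tchart by blast
  have "\<exists>i. fst w $ i \<noteq> 0" if "fst w \<noteq> 0" for w :: "(complex^4) \<times> complex"
    using that by (simp add: vec_eq_iff)
  then show "(\<Union>c\<in>range tchart. fst c) = topspace (ctop tot_O2)"
    unfolding topspace_tot_O2 tchart_def by fastforce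
  have "holo_map (local_dom (tchart i) (tchart j) id) (local_rep (tchart i) (tchart j) id)" for i j
    unfolding local_dom_tchart local_rep_tchart[abs_def] by (rule holo_map_tlift_coord)
  then show "compatible c d" if "c \<in> range tchart" "d \<in> range tchart" for c d
    using that by (auto simp: compatible_iff)
qed

section \<open>The quartic and the double solid\<close>

lemma four_eq_zero: "(4::4) = 0" by simp

lemma three_eq_zero: "(3::3) = 0" by simp

lemma UNIV_4_from_0: "(UNIV :: 4 set) = {0, 1, 2, 3}"
  unfolding UNIV_4 four_eq_zero by blast

lemma forall_4_from_0: "(\<forall>i::4. P i) \<longleftrightarrow> P 0 \<and> P 1 \<and> P 2 \<and> P 3"
  using forall_4[of P] unfolding four_eq_zero by blast

lemma forall_3_from_0: "(\<forall>i::3. P i) \<longleftrightarrow> P 0 \<and> P 1 \<and> P 2"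
  using forall_3[of P] unfolding three_eq_zero by blast

lemma sum_4_from_0: "sum f (UNIV :: 4 set) = f 0 + f 1 + f 2 + f 3"
  unfolding sum_4 four_eq_zero by (simp only: add_ac)

lemma sum_3_from_0: "sum f (UNIV :: 3 set) = f 0 + f 1 + f 2"
  unfolding sum_3 three_eq_zero by (simp only: add_ac)

lemma vec4_nth [simp]: "vec4 u v w x $ 0 = u" "vec4 u v w x $ 1 = v" "vec4 u v w x $ 2 = w" "vec4 u v w x $ 3 = x"
  by (simp_all add: vec4_def)

section \<open>Determinants and the ambient volume form\<close>

lemma det_4_from_0:
  fixes A :: "complex^4^4"
  shows "det A =
    A$0$0 * (A$1$1 * (A$2$2 * A$3$3 - A$2$3 * A$3$2) - A$1$2 * (A$2$1 * A$3$3 - A$2$3 * A$3$1) + A$1$3 * (A$2$1 * A$3$2 - A$2$2 * A$3$1))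
  - A$0$1 * (A$1$0 * (A$2$2 * A$3$3 - A$2$3 * A$3$2) - A$1$2 * (A$2$0 * A$3$3 - A$2$3 * A$3$0) + A$1$3 * (A$2$0 * A$3$2 - A$2$2 * A$3$0))
  + A$0$2 * (A$1$0 * (A$2$1 * A$3$3 - A$2$3 * A$3$1) - A$1$1 * (A$2$0 * A$3$3 - A$2$3 * A$3$0) + A$1$3 * (A$2$0 * A$3$1 - A$2$1 * A$3$0))
  - A$0$3 * (A$1$0 * (A$2$1 * A$3$2 - A$2$2 * A$3$1) - A$1$1 * (A$2$0 * A$3$2 - A$2$2 * A$3$0) + A$1$2 * (A$2$0 * A$3$1 - A$2$1 * A$3$0))"
proof -
  have f123: "finite {1::4, 2, 3}" "0 \<notin> {1::4, 2, 3}" by simp_all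
  have f23: "finite {2::4, 3}" "1 \<notin> {2::4, 3}" by simp_all
  have f3: "finite {3::4}" "2 \<notin> {3::4}" by simp_all
  show ?thesis
    unfolding det_def UNIV_4_from_0
    unfolding sum_over_permutations_insert[OF f123]
    unfolding sum_over_permutations_insert[OF f23]
    unfolding sum_over_permutations_insert[OF f3]
    unfolding permutes_sing
    by (simp add: sign_swap_id sign_compose permutation_swap_id permutation_compose sign_id swap_id_eq)
      ((simp only: right_diff_distrib distrib_left), (simp only: diff_conv_add_uminus minus_add_distrib minus_minus add_ac))
qed

lemma det_3_from_0:
  fixes A :: "complex^3^3"
  shows "det A = A$0$0 * (A$1$1 * A$2$2 - A$1$2 * A$2$1) - A$0$1 * (A$1$0 * A$2$2 - A$1$2 * A$2$0)
    + A$0$2 * (A$1$0 * A$2$1 - A$1$1 * A$2$0)"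
proof -
  show ?thesis unfolding det_3 three_eq_zero by (simp add: algebra_simps)
qed

text \<open>The ambient volume form contracted with \<open>v\<close> and pulled back along
  \<open>D\<close>. Divided by the differential of a hypersurface equation at \<open>v\<close>, it
  is the density of the Poincare residue.\<close>

definition vol4 :: "complex^4 \<Rightarrow> (complex^3 \<Rightarrow> complex^4) \<Rightarrow> complex" where
  "vol4 v D = det (vec4 v (D (axis 0 1)) (D (axis 1 1)) (D (axis 2 1)))"

lemma invertible_kernel:
  fixes A :: "complex^'n^'n"
  assumes "det A \<noteq> 0" "A *v x = 0" shows "x = 0"
proof -
  obtain B where "B ** A = mat 1" using assms(1) invertible_det_nz[of A] by (auto simp: invertible_def)
  then show ?thesis using assms(2)
    by (metis matrix_vector_mul_assoc matrix_vector_mul_lid matrix_vector_mult_0_right)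
qed

lemma det_zero_kernel:
  fixes A :: "complex^'n^'n"
  assumes "det A = 0" obtains x where "x \<noteq> 0" "A *v x = 0"
proof -
  have "\<not> invertible A" using assms invertible_det_nz by blast
  then have "\<not> inj ((*v) A)"
    using matrix_left_invertible_injective invertible_left_inverse by blast
  then obtain u v where "A *v u = A *v v" "u \<noteq> v" by (auto simp: inj_def)
  then show ?thesis using that[of "u - v"] by (simp add: matrix_vector_mult_diff_distrib)
qed

text \<open>Two linear forms in \<open>v\<close> with the same kernel, the hyperplane spanned by the
  range of \<open>D\<close>, are proportional.\<close>

lemma volume_proportional:
  fixes ll :: "complex^4 \<Rightarrow> complex" and D :: "complex^3 \<Rightarrow> complex^4"
  assumes lin: "linear ll" "\<And>c v. ll (c *s v) = c * ll v" and w: "ll w \<noteq> 0"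
    and linD: "linear D" "\<And>c v. D (c *s v) = c *s D v"
    and inj: "\<And>v. D v = 0 \<Longrightarrow> v = 0" and ker: "\<And>v. ll (D v) = 0"
  obtains J where "J \<noteq> 0" "\<And>v. vol4 v D = J * ll v"
proof -
  define l where "l = (\<chi> k. ll (axis k 1))"
  have ll: "ll v = (\<Sum>k\<in>UNIV. v $ k * l $ k)" for v
  proof -
    have "ll v = ll (\<Sum>k\<in>UNIV. v $ k *s axis k 1)" by (simp add: basis_expansion)
    also have "\<dots> = (\<Sum>k\<in>UNIV. v $ k * l $ k)"
      by (simp add: linear_sum[OF lin(1)] lin(2) l_def)
    finally show ?thesis .
  qed
  let ?A = "\<lambda>v. vec4 v (D (axis 0 1)) (D (axis 1 1)) (D (axis 2 1)) :: complex^4^4"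
  have zero: "vol4 v D = 0" if "ll v = 0" for v
  proof (rule ccontr)
    assume "vol4 v D \<noteq> 0"
    \<comment> \<open>The coefficient vector \<open>l\<close> of \<open>ll\<close> annihilates all
      four rows, so a nonzero determinant would force \<open>l = 0\<close>.\<close>
    moreover have "?A v *v l = 0"
      using ll[of v] that ker ll[of "D _"]
      by (simp add: vec_eq_iff matrix_vector_mult_def forall_4_from_0)
    ultimately have "l = 0" using invertible_kernel unfolding vol4_def by blast
    then show False using w ll[of w] by simp
  qed
  have "vol4 w D \<noteq> 0"
  proof
    assume "vol4 w D = 0"
    then have "det (transpose (?A w)) = 0" by (simp add: vol4_def det_transpose)
    then obtain x where x: "x \<noteq> 0" "transpose (?A w) *v x = 0" by (rule det_zero_kernel)
    define y :: "complex^3" where "y = (\<chi> k. if k = 0 then x $ 1 else if k = 1 then x $ 2 else x $ 3)"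
    have Dy: "D y = x $ 1 *s D (axis 0 1) + x $ 2 *s D (axis 1 1) + x $ 3 *s D (axis 2 1)"
    proof -
      have "y = x $ 1 *s axis 0 1 + x $ 2 *s axis 1 1 + x $ 3 *s axis 2 1"
        by (simp add: y_def vec_eq_iff forall_3_from_0 axis_def)
      then show ?thesis by (simp only: linear_add[OF linD(1)] linD(2))
    qed
    have e: "x $ 0 *s w + D y = 0"
      using x(2) unfolding Dy
      by (simp add: vec_eq_iff matrix_vector_mult_def transpose_def sum_4_from_0 mult_ac add_ac)
    have "ll (x $ 0 *s w + D y) = x $ 0 * ll w"
      by (simp add: linear_add[OF lin(1)] lin(2) ker)
    then have x0: "x $ 0 = 0" using w e linear_0[OF lin(1)] by simp
    then have "y = 0" using e inj by simp
    then have "x = 0" using x0 by (simp add: y_def vec_eq_iff forall_4_from_0 forall_3_from_0)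
    then show False using x(1) by simp
  qed
  have lin4: "vol4 (u + c *s v) D = vol4 u D + c * vol4 v D" for u v c
  proof -
    have h: "(u0 + c * v0) * x0 - (u1 + c * v1) * x1 + (u2 + c * v2) * x2 - (u3 + c * v3) * x3
      = (u0 * x0 - u1 * x1 + u2 * x2 - u3 * x3) + c * (v0 * x0 - v1 * x1 + v2 * x2 - v3 * x3)"
      for u0 u1 u2 u3 v0 v1 v2 v3 x0 x1 x2 x3 :: complex
      by (simp add: algebra_simps)
    show ?thesis
      unfolding vol4_def det_4_from_0 vec4_nth vector_add_component vector_smult_component by (rule h)
  qed
  have "vol4 v D = vol4 w D / ll w * ll v" for v
  proof -
    have "ll (v + (- (ll v / ll w)) *s w) = 0"
      unfolding linear_add[OF lin(1)] lin(2) using w by simp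
    from zero[OF this] have "vol4 v D + (- (ll v / ll w)) * vol4 w D = 0" unfolding lin4 .
    then have "vol4 v D = - ((- (ll v / ll w)) * vol4 w D)" by (rule eq_neg_iff_add_eq_0[THEN iffD2])
    then show ?thesis by simp
  qed
  moreover have "vol4 w D / ll w \<noteq> 0" using \<open>vol4 w D \<noteq> 0\<close> w by simp
  ultimately show ?thesis using that by blast
qed

lemma vol4_compose_right:
  fixes D :: "complex^3 \<Rightarrow> complex^4" and T :: "complex^3 \<Rightarrow> complex^3"
  assumes linD: "linear D" "\<And>c v. D (c *s v) = c *s D v"
  shows "vol4 v (\<lambda>u. D (T u)) = det (\<chi> k l. T (axis l 1) $ k) * vol4 v D"
proof -
  \<comment> \<open>The block matrix with blocks 1 and the transposed matrix of \<open>T\<close>;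
    multiplication from the left acts on the rows.\<close>
  define K :: "complex^4^4" where "K = vec4 (vec4 1 0 0 0)
    (vec4 0 (T (axis 0 1) $ 0) (T (axis 0 1) $ 1) (T (axis 0 1) $ 2))
    (vec4 0 (T (axis 1 1) $ 0) (T (axis 1 1) $ 1) (T (axis 1 1) $ 2))
    (vec4 0 (T (axis 2 1) $ 0) (T (axis 2 1) $ 1) (T (axis 2 1) $ 2))"
  have D: "D u = u $ 0 *s D (axis 0 1) + u $ 1 *s D (axis 1 1) + u $ 2 *s D (axis 2 1)" for u
  proof -
    have "u = u $ 0 *s axis 0 1 + u $ 1 *s axis 1 1 + u $ 2 *s axis 2 1"
      by (simp add: vec_eq_iff forall_3_from_0 axis_def)
    then have "D u = D (u $ 0 *s axis 0 1 + u $ 1 *s axis 1 1 + u $ 2 *s axis 2 1)" by simp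
    then show ?thesis by (simp only: linear_add[OF linD(1)] linD(2))
  qed
  have "vec4 v (D (T (axis 0 1))) (D (T (axis 1 1))) (D (T (axis 2 1)))
      = K ** vec4 v (D (axis 0 1)) (D (axis 1 1)) (D (axis 2 1))"
    unfolding D[of "T _"]
    by (simp add: vec_eq_iff matrix_matrix_mult_def sum_4_from_0 forall_4_from_0 K_def)
  moreover have "det K = det (\<chi> k l. T (axis l 1) $ k)"
    unfolding det_4_from_0 det_3_from_0 K_def by (simp add: algebra_simps)
  ultimately show ?thesis unfolding vol4_def by (simp add: det_mul)
qed

lemma vol4_compose_left:
  fixes D :: "complex^3 \<Rightarrow> complex^4" and M :: "complex^4^4"
  shows "vol4 (M *v v) (\<lambda>u. M *v D u) = det M * vol4 v D"
proof -
  have "vec4 (M *v v) (M *v D (axis 0 1)) (M *v D (axis 1 1)) (M *v D (axis 2 1))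
      = vec4 v (D (axis 0 1)) (D (axis 1 1)) (D (axis 2 1)) ** transpose M"
    by (simp add: vec_eq_iff matrix_matrix_mult_def matrix_vector_mult_def transpose_def forall_4_from_0 mult.commute)
  then show ?thesis unfolding vol4_def by (simp add: det_mul det_transpose mult.commute)
qed

section \<open>Derivatives of the quartic and of the chart equations\<close>

definition quartic_grad :: "real \<Rightarrow> real \<Rightarrow> real \<Rightarrow> real \<Rightarrow> real \<Rightarrow> complex^4 \<Rightarrow> complex^4 \<Rightarrow> complex" where
  "quartic_grad a b q0 q1 q2 y v =
     2 * (y $ 2 * y $ 3 + Qf q0 q1 q2 (y $ 0) (y $ 1)) *
       (v $ 2 * y $ 3 + y $ 2 * v $ 3 + (2 * of_real q0 * y $ 0 + of_real q1 * y $ 1) * v $ 0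
        + (of_real q1 * y $ 0 + 2 * of_real q2 * y $ 1) * v $ 1)
     - ((y $ 1 * (y $ 0 + y $ 1) * (of_real a * y $ 0 - of_real b * y $ 1)
         + y $ 0 * y $ 1 * (of_real a * y $ 0 - of_real b * y $ 1)
         + of_real a * (y $ 0 * y $ 1 * (y $ 0 + y $ 1))) * v $ 0
      + (y $ 0 * (y $ 0 + y $ 1) * (of_real a * y $ 0 - of_real b * y $ 1)
         + y $ 0 * y $ 1 * (of_real a * y $ 0 - of_real b * y $ 1)
         - of_real b * (y $ 0 * y $ 1 * (y $ 0 + y $ 1))) * v $ 1)"

lemma quartic_has_derivative:
  "(quartic a b q0 q1 q2 has_derivative quartic_grad a b q0 q1 q2 y) (at y)"
proof -
  have c: "((\<lambda>y::complex^4. y $ i) has_derivative (\<lambda>v. v $ i)) (at y)" for i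
    by (intro bounded_linear_imp_has_derivative bounded_linear_vec_nth)
  show ?thesis
    unfolding quartic_def[abs_def] Qf_def
    by (rule has_derivative_eq_rhs) (rule derivative_intros c | (simp add: quartic_grad_def Qf_def fun_eq_iff power2_eq_square algebra_simps; fail))+
qed

lemma quartic_euler: "quartic_grad a b q0 q1 q2 y y = 4 * quartic a b q0 q1 q2 y"
  unfolding quartic_grad_def quartic_def Qf_def by (simp add: algebra_simps power2_eq_square)

lemma quartic_scale: "quartic a b q0 q1 q2 (c *s y) = c^4 * quartic a b q0 q1 q2 y"
  unfolding quartic_def Qf_def by (simp add: algebra_simps power2_eq_square power4_eq_xxxx)

lemma quartic_grad_linear:
  "linear (quartic_grad a b q0 q1 q2 y)" "quartic_grad a b q0 q1 q2 y (c *s v) = c * quartic_grad a b q0 q1 q2 y v"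
  using has_derivative_linear[OF quartic_has_derivative] by (auto simp: quartic_grad_def algebra_simps)

definition chart_eq :: "real \<Rightarrow> real \<Rightarrow> real \<Rightarrow> real \<Rightarrow> real \<Rightarrow> 4 \<Rightarrow> complex^4 \<Rightarrow> complex" where
  "chart_eq a b q0 q1 q2 i X = (X $ i)^2 + quartic a b q0 q1 q2 (tlift i X)"

definition chart_grad :: "real \<Rightarrow> real \<Rightarrow> real \<Rightarrow> real \<Rightarrow> real \<Rightarrow> 4 \<Rightarrow> complex^4 \<Rightarrow> complex^4 \<Rightarrow> complex" where
  "chart_grad a b q0 q1 q2 i X v =
    2 * X $ i * v $ i + quartic_grad a b q0 q1 q2 (tlift i X) (\<chi> j. if j = i then 0 else v $ j)"

lemma tlift_has_derivative: "(tlift i has_derivative (\<lambda>v. \<chi> j. if j = i then 0 else v $ j)) (at X)"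
proof (rule has_derivative_vec)
  fix j show "((\<lambda>X. tlift i X $ j) has_derivative (\<lambda>h. (\<chi> j. if j = i then 0 else h $ j) $ j)) (at X)"
    by (cases "j = i") (simp_all add: tlift_def bounded_linear_imp_has_derivative bounded_linear_vec_nth)
qed

lemma chart_eq_has_derivative:
  "(chart_eq a b q0 q1 q2 i has_derivative chart_grad a b q0 q1 q2 i X) (at X)"
proof -
  have c: "((\<lambda>X::complex^4. X $ i) has_derivative (\<lambda>v. v $ i)) (at X)"
    by (intro bounded_linear_imp_has_derivative bounded_linear_vec_nth)
  have p: "((\<lambda>X::complex^4. (X $ i)^2) has_derivative (\<lambda>v. 2 * X $ i * v $ i)) (at X)"
    unfolding power2_eq_square by (rule has_derivative_eq_rhs[OF has_derivative_mult[OF c c]]) auto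
  show ?thesis
    unfolding chart_eq_def[abs_def] chart_grad_def[abs_def]
    by (intro has_derivative_add p has_derivative_compose[OF tlift_has_derivative quartic_has_derivative])
qed

lemma chart_grad_linear:
  "linear (chart_grad a b q0 q1 q2 i X)" "chart_grad a b q0 q1 q2 i X (c *s v) = c * chart_grad a b q0 q1 q2 i X v"
proof -
  show "linear (chart_grad a b q0 q1 q2 i X)"
    using has_derivative_linear[OF chart_eq_has_derivative] .
  have "(\<chi> j. if j = i then 0 else (c *s v) $ j) = c *s (\<chi> j. if j = i then 0 else v $ j)"
    by (simp add: vec_eq_iff)
  then show "chart_grad a b q0 q1 q2 i X (c *s v) = c * chart_grad a b q0 q1 q2 i X v"
    unfolding chart_grad_def by (simp add: quartic_grad_linear algebra_simps)
qed

lemma holomorphic_chart_eq: "open S \<Longrightarrow> holomorphic_fn S (chart_eq a b q0 q1 q2 i)"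
  unfolding holomorphic_fn_def using chart_eq_has_derivative chart_grad_linear by metis

text \<open>The Jacobian of the change from chart \<open>i\<close> to chart \<open>j\<close>: the
  new slot \<open>i\<close> holds 1 / X_j, the new slot \<open>j\<close> holds the fibre coordinate
  X_i / X_j^2, and any other slot k holds X_k / X_j.\<close>

definition chart_change :: "4 \<Rightarrow> 4 \<Rightarrow> complex^4 \<Rightarrow> complex^4^4" where
  "chart_change i j X = (\<chi> k l. if k = i then (if l = j then - 1 / (X $ j)^2 else 0)
     else if k = j then (if l = i then 1 / (X $ j)^2 else if l = j then - 2 * X $ i / (X $ j)^3 else 0)
     else (if l = k then 1 / X $ j else if l = j then - X $ k / (X $ j)^2 else 0))"

lemma forall_4_cases: "(i::4) = 0 \<or> i = 1 \<or> i = 2 \<or> i = 3"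
  using UNIV_4_from_0 by blast

text \<open>The exponent 6 says that the canonical bundle of the total space of O(2) is the pullback
  of O(-6). The equation of degree 4 accounts for 4 of it, and the remaining 2 is the O(2) of the
  anticanonical bundle of \<open>Z\<close>.\<close>

lemma det_chart_change:
  assumes "i \<noteq> j" "X $ j \<noteq> 0"
  shows "det (chart_change i j X) = 1 / (X $ j)^6"
  using forall_4_cases[of i] forall_4_cases[of j] assms
  by (elim disjE) (simp_all add: det_4_from_0 chart_change_def field_simps power2_eq_square eval_nat_numeral)

lemma chart_change_has_derivative:
  assumes "i \<noteq> j" "X $ j \<noteq> 0"
  shows "((\<lambda>X. tcoord j (tlift i X, X $ i)) has_derivative (\<lambda>v. chart_change i j X *v v)) (at X)"
proof (rule has_derivative_vec)
  fix k
  have c: "((\<lambda>y::complex^4. y $ l) has_derivative (\<lambda>v. v $ l)) (at X)" for l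
    by (intro bounded_linear_imp_has_derivative bounded_linear_vec_nth)
  have r1: "(chart_change i j X *v v) $ k = - v $ j / (X $ j)^2" if "k = i" for v
    using that by (simp add: matrix_vector_mult_def chart_change_def if_distrib[of "\<lambda>x. x * _"] cong: if_cong)
  have r2: "(chart_change i j X *v v) $ k = v $ i / (X $ j)^2 - 2 * X $ i * v $ j / (X $ j)^3" if "k = j" for v
  proof -
    have "(chart_change i j X *v v) $ k = (\<Sum>l\<in>UNIV. (if l = i then v $ i / (X $ j)^2 else 0) + (if l = j then - 2 * X $ i * v $ j / (X $ j)^3 else 0))"
      unfolding matrix_vector_mult_def using that assms by (auto simp: chart_change_def intro!: sum.cong)
    then show ?thesis by (simp add: sum.distrib)
  qed
  have r3: "(chart_change i j X *v v) $ k = v $ k / X $ j - X $ k * v $ j / (X $ j)^2" if "k \<noteq> i" "k \<noteq> j" for v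
  proof -
    have "(chart_change i j X *v v) $ k = (\<Sum>l\<in>UNIV. (if l = k then v $ k / X $ j else 0) + (if l = j then - X $ k * v $ j / (X $ j)^2 else 0))"
      unfolding matrix_vector_mult_def using that assms by (auto simp: chart_change_def intro!: sum.cong)
    then show ?thesis by (simp add: sum.distrib)
  qed
  consider "k = i" | "k = j" "k \<noteq> i" | "k \<noteq> i" "k \<noteq> j" by blast
  then show "((\<lambda>X. tcoord j (tlift i X, X $ i) $ k) has_derivative (\<lambda>v. (chart_change i j X *v v) $ k)) (at X)"
  proof cases
    case 1
    have "((\<lambda>X::complex^4. 1 / X $ j) has_derivative (\<lambda>v. - v $ j / (X $ j)^2)) (at X)"
      by (rule has_derivative_eq_rhs, rule has_derivative_divide[OF has_derivative_const c])
        (use assms in \<open>auto simp: field_simps power2_eq_square\<close>)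
    then show ?thesis unfolding r1[OF 1] using 1 assms by (simp add: tcoord_def tlift_def)
  next
    case 2
    have c2: "((\<lambda>X::complex^4. (X $ j)^2) has_derivative (\<lambda>v. 2 * X $ j * v $ j)) (at X)"
      unfolding power2_eq_square by (rule has_derivative_eq_rhs[OF has_derivative_mult[OF c c]]) auto
    have "((\<lambda>X::complex^4. X $ i / (X $ j)^2) has_derivative (\<lambda>v. v $ i / (X $ j)^2 - 2 * X $ i * v $ j / (X $ j)^3)) (at X)"
      by (rule has_derivative_eq_rhs, rule has_derivative_divide[OF c c2])
        (use assms in \<open>auto simp: field_simps power2_eq_square eval_nat_numeral\<close>)
    then show ?thesis unfolding r2[OF 2(1)] using 2 assms by (simp add: tcoord_def tlift_def)
  next
    case 3
    have "((\<lambda>X::complex^4. X $ k / X $ j) has_derivative (\<lambda>v. v $ k / X $ j - X $ k * v $ j / (X $ j)^2)) (at X)"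
      by (rule has_derivative_eq_rhs, rule has_derivative_divide[OF c c])
        (use assms in \<open>auto simp: field_simps power2_eq_square\<close>)
    then show ?thesis unfolding r3[OF 3] using 3 assms by (simp add: tcoord_def tlift_def)
  qed
qed

lemma chart_eq_change:
  assumes "i \<noteq> j" "X $ j \<noteq> 0"
  shows "chart_eq a b q0 q1 q2 j (tcoord j (tlift i X, X $ i)) = chart_eq a b q0 q1 q2 i X / (X $ j)^4"
proof -
  have "tlift j (tcoord j (tlift i X, X $ i)) = (1 / X $ j) *s tlift i X"
    using assms by (auto simp: tlift_def tcoord_def vec_eq_iff)
  then show ?thesis
    using assms by (simp add: chart_eq_def quartic_scale tcoord_def) (simp add: tlift_def field_simps power2_eq_square power4_eq_xxxx)
qed

text \<open>On the zero locus the product rule leaves no term from differentiating the factor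
  (X_j)^-4.\<close>

lemma chart_grad_change:
  assumes "i \<noteq> j" "X $ j \<noteq> 0" "chart_eq a b q0 q1 q2 i X = 0"
  shows "chart_grad a b q0 q1 q2 j (tcoord j (tlift i X, X $ i)) (chart_change i j X *v v)
    = chart_grad a b q0 q1 q2 i X v / (X $ j)^4"
proof -
  let ?G = "chart_eq a b q0 q1 q2"
  have 1: "((\<lambda>X. ?G j (tcoord j (tlift i X, X $ i))) has_derivative
    (\<lambda>v. chart_grad a b q0 q1 q2 j (tcoord j (tlift i X, X $ i)) (chart_change i j X *v v))) (at X)"
    by (rule has_derivative_compose[OF chart_change_has_derivative[OF assms(1,2)] chart_eq_has_derivative])
  have c: "((\<lambda>y::complex^4. y $ j) has_derivative (\<lambda>v. v $ j)) (at X)"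
    by (intro bounded_linear_imp_has_derivative bounded_linear_vec_nth)
  have 2: "((\<lambda>X. ?G i X / (X $ j)^4) has_derivative (\<lambda>v. chart_grad a b q0 q1 q2 i X v / (X $ j)^4)) (at X)"
    by (rule has_derivative_eq_rhs, rule has_derivative_divide[OF chart_eq_has_derivative has_derivative_power[OF c]])
      (use assms in \<open>auto simp: fun_eq_iff field_simps\<close>)
  have o: "open {X::complex^4. X $ j \<noteq> 0}"
  proof -
    have "open ((\<lambda>w::complex^4. w $ j) -` (- {0}))"
      by (intro open_vimage continuous_intros) (simp add: open_Compl)?
    then show ?thesis by (simp add: vimage_def Compl_eq)
  qed
  have "((\<lambda>X. ?G j (tcoord j (tlift i X, X $ i))) has_derivative (\<lambda>v. chart_grad a b q0 q1 q2 i X v / (X $ j)^4)) (at X)"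
    by (rule has_derivative_transform_within_open[OF 2 o]) (use assms chart_eq_change in auto)
  from has_derivative_unique[OF 1 this] show ?thesis by (rule fun_cong)
qed

section \<open>Singular points of the quartic and real points of the double solid\<close>

locale pencil =
  fixes a b q0 q1 q2 l0 :: real
  assumes a: "a > 0" and b: "b > 0"
    and nonneg: "\<And>t::real. (Qf q0 q1 q2 t 1)^2 - cubic a b t \<ge> 0"
    and zero: "\<And>t::real. (Qf q0 q1 q2 t 1)^2 - cubic a b t = 0 \<longleftrightarrow> t = l0"
    and double: "order l0 (discr_poly a b q0 q1 q2) = 2"
    and above: "\<And>t::real. cubic a b t \<ge> 0 \<Longrightarrow> t \<noteq> l0 \<Longrightarrow> Qf q0 q1 q2 t 1 > sqrt (cubic a b t)"
begin

text \<open>For \<open>q0 = 0\<close> the square of a linear polynomial falls below the cubic far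
  out. For \<open>q0 < 0\<close> the form Q is at most 0 far out, where the cubic is nonnegative and
  Q should exceed its root.\<close>

lemma leading_coeff_pos: "q0 > 0"
proof (rule ccontr)
  assume "\<not> q0 > 0"
  then consider "q0 = 0" | "q0 < 0" by linarith
  then show False
  proof cases
    case 1
    define k where "k = \<bar>q1\<bar> + \<bar>q2\<bar>"
    \<comment> \<open>Chosen so that a t - b = a + k^2; then the cubic exceeds (k t)^2, which bounds
      (q1 t + q2)^2.\<close>
    define t where "t = 1 + b / a + k^2 / a"
    have t: "t \<ge> 1" using a b by (simp add: t_def)
    have at: "a * t - b = a + k^2" using a by (simp add: t_def field_simps)
    have "\<bar>q1 * t + q2\<bar> \<le> \<bar>q1\<bar> * t + \<bar>q2\<bar> * 1"
      using t by (intro order.trans[OF abs_triangle_ineq]) (simp add: abs_mult)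
    also have "\<dots> \<le> k * t" using t mult_left_mono[of 1 t "\<bar>q2\<bar>"] by (simp add: k_def algebra_simps)
    finally have "(q1 * t + q2)^2 \<le> (k * t)^2"
      by (metis abs_ge_zero power2_abs power_mono)
    moreover have "cubic a b t = t^2 * (a + k^2) + t * (a + k^2)"
      by (simp add: cubic_def at algebra_simps power2_eq_square)
    moreover have "t^2 * (a + k^2) + t * (a + k^2) > (k * t)^2"
      using t a by (simp add: algebra_simps power_mult_distrib add_pos_nonneg)
    ultimately show False using nonneg[of t] 1 by (simp add: Qf_def)
  next
    case 2
    \<comment> \<open>Beyond b / a the cubic is nonnegative, the quotient by -q0 makes q0 t + q1 at
      most -|q2|, and the last summand keeps \<open>t\<close> away from \<open>l0\<close>.\<close>
    define t where "t = 1 + b / a + (\<bar>q1\<bar> + \<bar>q2\<bar>) / (- q0) + \<bar>l0\<bar>"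
    have ba: "b / a > 0" using a b by simp
    have dd: "(\<bar>q1\<bar> + \<bar>q2\<bar>) / (- q0) \<ge> 0" using 2 by (intro divide_nonneg_nonneg) auto
    have t: "t \<ge> 1" "t \<noteq> l0" "t \<ge> b / a" using ba dd unfolding t_def by linarith+
    have "q0 * t \<le> q0 * ((\<bar>q1\<bar> + \<bar>q2\<bar>) / (- q0))"
      using 2 ba unfolding t_def by (intro mult_left_mono_neg) linarith+
    also have "\<dots> = - (\<bar>q1\<bar> + \<bar>q2\<bar>)" using 2 by simp
    finally have "q0 * t + q1 \<le> - \<bar>q2\<bar>" by linarith
    then have "(q0 * t + q1) * t \<le> (- \<bar>q2\<bar>) * t" using t by (intro mult_right_mono) auto
    also have "\<dots> \<le> (- \<bar>q2\<bar>) * 1" using t by (intro mult_left_mono_neg) auto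
    finally have "Qf q0 q1 q2 t 1 \<le> 0" by (simp add: Qf_def algebra_simps power2_eq_square)
    moreover have f: "cubic a b t \<ge> 0"
    proof -
      have "a * t - b \<ge> 0" using t a by (simp add: field_simps)
      then show ?thesis using t unfolding cubic_def by (intro mult_nonneg_nonneg) auto
    qed
    moreover have "sqrt (cubic a b t) \<ge> 0" using f by simp
    ultimately show False using above[of t] t by linarith
  qed
qed

text \<open>The hypothesis \<open>above\<close> excludes \<open>l0\<close> itself. If Q were
  negative there, the cubic, which equals its square, would be positive nearby while Q is still
  negative.\<close>

lemma Q_l0_nonneg: "Qf q0 q1 q2 l0 1 \<ge> 0"
proof (rule ccontr)
  assume neg: "\<not> Qf q0 q1 q2 l0 1 \<ge> 0"
  have "(Qf q0 q1 q2 l0 1)^2 = cubic a b l0" using zero[of l0] by simp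
  then have pos: "cubic a b l0 > 0" using neg by (metis less_irrefl not_le zero_less_power2)
  have cf: "isCont (cubic a b) l0" unfolding cubic_def[abs_def] by (intro continuous_intros)
  have cQ: "isCont (\<lambda>t::real. Qf q0 q1 q2 t 1) l0" unfolding Qf_def by (intro continuous_intros)
  have 1: "eventually (\<lambda>t. cubic a b t > 0) (at l0)"
    using order_tendstoD(1)[OF cf[unfolded isCont_def] pos] .
  have 2: "eventually (\<lambda>t. Qf q0 q1 q2 t 1 < (0::real)) (at l0)"
    using order_tendstoD(2)[OF cQ[unfolded isCont_def], of 0] neg by simp
  have 3: "eventually (\<lambda>t. t \<noteq> l0) (at l0)" by (simp add: eventually_at_filter)
  have "eventually (\<lambda>t. False) (at l0)"
    using 1 2 3
  proof eventually_elim
    case (elim t)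
    then have "sqrt (cubic a b t) \<ge> 0" by simp
    then show ?case using above[of t] elim by linarith
  qed
  then show False by (simp add: eventually_False)
qed

text \<open>The factorization is needed at complex arguments, since a singular point of the quartic
  is not real a priori. The exact order 2 keeps the cofactor from vanishing at \<open>l0\<close>,
  and \<open>zero\<close> excludes every other real root.\<close>

lemma double_root_factor:
  obtains r0 r1 where
    "\<And>x::complex. (Qf q0 q1 q2 x 1)^2 - x * (x + 1) * (of_real a * x - of_real b)
      = (x - of_real l0)^2 * (of_real r0 + of_real r1 * x + of_real (q0^2) * x^2)"
    "r0 + r1 * l0 + q0^2 * l0^2 \<noteq> 0"
    "\<And>x::real. r0 + r1 * x + q0^2 * x^2 = 0 \<Longrightarrow> x = l0"
proof -
  define p where "p = discr_poly a b q0 q1 q2"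
  have pp: "poly p t = (q0 * t^2 + q1 * t + q2)^2 - t * (t + 1) * (a * t - b)" for t
    by (simp add: p_def poly_discr_poly Qf_def cubic_def)
  have p0: "p \<noteq> 0" using zero[of "l0 + 1"] poly_discr_poly[of a b q0 q1 q2 "l0 + 1"] by (auto simp: p_def)
  obtain k where k: "p = [:- l0, 1:]^2 * k" using order_1[of l0 p] double by (auto simp: p_def dvd_def)
  have A: "poly p l0 = 0" by (simp add: k)
  have B: "poly (pderiv p) l0 = 0"
  proof -
    have "p = [:- l0, 1:] * ([:- l0, 1:] * k)" by (simp only: k power2_eq_square mult.assoc)
    then show ?thesis by (simp only: pderiv_mult poly_add poly_mult) simp
  qed
  have "p = [:q2^2, 2*q1*q2 + b, q1^2 + 2*q0*q2 - a + b, 2*q0*q1 - a, q0^2:]"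
    by (rule poly_eq_poly_eq_iff[THEN iffD1], rule ext) (simp add: pp algebra_simps power2_eq_square)
  then have B': "2*q1*q2 + b + 2 * (q1^2 + 2*q0*q2 - a + b) * l0 + 3 * (2*q0*q1 - a) * l0^2 + 4 * q0^2 * l0^3 = 0"
    using B by (simp add: pderiv_pCons algebra_simps power2_eq_square power3_eq_cube)
  have A': "q2^2 + (2*q1*q2 + b) * l0 + (q1^2 + 2*q0*q2 - a + b) * l0^2 + (2*q0*q1 - a) * l0^3 + q0^2 * l0^4 = 0"
    using A unfolding pp by (simp add: algebra_simps eval_nat_numeral)
  \<comment> \<open>The coefficients of the quotient by (x - l0)^2, read off from the top; the two
    lowest coefficients of the product are then right by \<open>A'\<close> and
    \<open>B'\<close>.\<close>
  define r1 where "r1 = 2*q0*q1 - a + 2 * l0 * q0^2"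
  define r0 where "r0 = q1^2 + 2*q0*q2 - a + b + 2 * l0 * r1 - l0^2 * q0^2"
  have c1: "l0^2 * r1 - 2 * l0 * r0 = 2*q1*q2 + b"
    using B' unfolding r0_def r1_def by (simp add: algebra_simps power2_eq_square power3_eq_cube)
  have c0: "l0^2 * r0 = q2^2"
  proof -
    have "q2^2 = - ((2*q1*q2 + b) * l0 + (q1^2 + 2*q0*q2 - a + b) * l0^2 + (2*q0*q1 - a) * l0^3 + q0^2 * l0^4)"
      using A' by linarith
    then show ?thesis
      unfolding c1[symmetric] unfolding r0_def r1_def by (simp add: algebra_simps power2_eq_square eval_nat_numeral)
  qed
  have id: "(Qf q0 q1 q2 x 1)^2 - x * (x + 1) * (of_real a * x - of_real b)
      = (x - of_real l0)^2 * (of_real r0 + of_real r1 * x + of_real (q0^2) * x^2)" for x :: "'x::{real_algebra_1, comm_ring_1}"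
  proof -
    have "(x - of_real l0)^2 * (of_real r0 + of_real r1 * x + of_real (q0^2) * x^2) =
      of_real (l0^2 * r0) + of_real (l0^2 * r1 - 2 * l0 * r0) * x + of_real (r0 - 2 * l0 * r1 + l0^2 * q0^2) * x^2
      + of_real (r1 - 2 * l0 * q0^2) * x^3 + of_real (q0^2) * x^4"
      by (simp add: algebra_simps eval_nat_numeral)
    also have "\<dots> = of_real (q2^2) + of_real (2*q1*q2 + b) * x + of_real (q1^2 + 2*q0*q2 - a + b) * x^2
      + of_real (2*q0*q1 - a) * x^3 + of_real (q0^2) * x^4"
      unfolding c0 c1 by (simp add: r0_def r1_def algebra_simps)
    also have "\<dots> = (Qf q0 q1 q2 x 1)^2 - x * (x + 1) * (of_real a * x - of_real b)"
      by (simp add: Qf_def algebra_simps eval_nat_numeral)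
    finally show ?thesis ..
  qed
  have r: "r0 + r1 * l0 + q0^2 * l0^2 \<noteq> 0"
  proof
    assume z: "r0 + r1 * l0 + q0^2 * l0^2 = 0"
    have "p = [:- l0, 1:]^3 * [:r1 + l0 * q0^2, q0^2:]"
    proof (rule poly_eq_poly_eq_iff[THEN iffD1], rule ext)
      fix x
      have "poly p x = (x - l0)^2 * (r0 + r1 * x + q0^2 * x^2)"
        using id[of x] by (simp add: pp Qf_def)
      also have "r0 + r1 * x + q0^2 * x^2 = (r0 + r1 * x + q0^2 * x^2) - (r0 + r1 * l0 + q0^2 * l0^2)" using z by simp
      also have "\<dots> = (x - l0) * (r1 + l0 * q0^2 + q0^2 * x)" by (simp add: algebra_simps power2_eq_square)
      finally show "poly p x = poly ([:- l0, 1:]^3 * [:r1 + l0 * q0^2, q0^2:]) x"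
        by (simp add: algebra_simps eval_nat_numeral)
    qed
    then have "[:- l0, 1:]^3 dvd p" by (metis dvd_triv_left)
    moreover have "Suc (order l0 p) = 3" using double by (simp add: p_def)
    ultimately show False using order_2[OF p0, of l0] by metis
  qed
  have "x = l0" if "r0 + r1 * x + q0^2 * x^2 = 0" for x
  proof -
    have "(Qf q0 q1 q2 x 1)^2 - cubic a b x = 0" using id[of x] that by (simp add: cubic_def)
    then show ?thesis using zero by blast
  qed
  then show ?thesis using that[of r0 r1] id r by blast
qed

lemma grad_axis:
  assumes "\<And>v. quartic_grad a b q0 q1 q2 y v = 0"
  defines "W \<equiv> y $ 2 * y $ 3 + Qf q0 q1 q2 (y $ 0) (y $ 1)"
  shows "W * y $ 3 = 0" "W * y $ 2 = 0"
    "2 * W * (2 * of_real q0 * y $ 0 + of_real q1 * y $ 1) = y $ 1 * (y $ 0 + y $ 1) * (of_real a * y $ 0 - of_real b * y $ 1)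
         + y $ 0 * y $ 1 * (of_real a * y $ 0 - of_real b * y $ 1) + of_real a * (y $ 0 * y $ 1 * (y $ 0 + y $ 1))"
    "2 * W * (of_real q1 * y $ 0 + 2 * of_real q2 * y $ 1) = y $ 0 * (y $ 0 + y $ 1) * (of_real a * y $ 0 - of_real b * y $ 1)
         + y $ 0 * y $ 1 * (of_real a * y $ 0 - of_real b * y $ 1) - of_real b * (y $ 0 * y $ 1 * (y $ 0 + y $ 1))"
  using assms(1)[of "axis 2 1"] assms(1)[of "axis 3 1"] assms(1)[of "axis 0 1"] assms(1)[of "axis 1 1"]
  unfolding quartic_grad_def W_def[symmetric] by (simp_all add: axis_def)

lemma pt_eqI: "k \<noteq> 0 \<Longrightarrow> y = k *s x \<Longrightarrow> pt y = pt x"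
proof -
  assume k: "k \<noteq> 0" "y = k *s x"
  show ?thesis
    unfolding pt_def
  proof (intro set_eqI iffI)
    fix v assume "v \<in> {c *s y |c. c \<noteq> 0}"
    then obtain c where "c \<noteq> 0" "v = c *s y" by auto
    then show "v \<in> {c *s x |c. c \<noteq> 0}" using k by (intro CollectI exI[of _ "c * k"]) auto
  next
    fix v assume "v \<in> {c *s x |c. c \<noteq> 0}"
    then obtain c where "c \<noteq> 0" "v = c *s x" by auto
    then show "v \<in> {c *s y |c. c \<noteq> 0}" using k by (intro CollectI exI[of _ "c / k"]) auto
  qed
qed

text \<open>The derivatives in y_2 and y_3 give W y_3 = W y_2 = 0. If W = 0, the product of four
  distinct linear forms is singular at (y_0, y_1), which forces y_0 = y_1 = 0. Otherwise y_2 = y_3 =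
  0 and y_0 / y_1 is a multiple root of the discriminant.\<close>

theorem singular_points:
  assumes y: "y \<noteq> 0" "quartic a b q0 q1 q2 y = 0" and g: "\<And>v. quartic_grad a b q0 q1 q2 y v = 0"
  shows "pt y \<in> {Pinf, Pinf', P0 l0}"
proof -
  define W where "W = y $ 2 * y $ 3 + Qf q0 q1 q2 (y $ 0) (y $ 1)"
  define A where "A = complex_of_real a"
  define B where "B = complex_of_real b"
  note ga = grad_axis[OF g, folded W_def A_def B_def]
  have AB: "A \<noteq> 0" "B \<noteq> 0" "A + B \<noteq> 0"
  proof -
    have "complex_of_real (a + b) \<noteq> 0" using a b by (simp only: of_real_eq_0_iff)
    then show "A + B \<noteq> 0" by (simp add: A_def B_def)
  qed (use a b in \<open>simp_all add: A_def B_def\<close>)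
  have q: "W^2 - y $ 0 * y $ 1 * (y $ 0 + y $ 1) * (A * y $ 0 - B * y $ 1) = 0"
    using y(2) by (simp add: quartic_def W_def A_def B_def)
  show ?thesis
  proof (cases "W = 0")
    case True
    have f0: "y $ 1 * (y $ 0 + y $ 1) * (A * y $ 0 - B * y $ 1)
         + y $ 0 * y $ 1 * (A * y $ 0 - B * y $ 1) + A * (y $ 0 * y $ 1 * (y $ 0 + y $ 1)) = 0"
      using ga(3) True by simp
    have f1: "y $ 0 * (y $ 0 + y $ 1) * (A * y $ 0 - B * y $ 1)
         + y $ 0 * y $ 1 * (A * y $ 0 - B * y $ 1) - B * (y $ 0 * y $ 1 * (y $ 0 + y $ 1)) = 0"
      using ga(4) True by simp
    have "y $ 0 = 0 \<or> y $ 1 = 0 \<or> y $ 0 + y $ 1 = 0 \<or> A * y $ 0 - B * y $ 1 = 0"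
      using q True by auto
    then have y01: "y $ 0 = 0 \<and> y $ 1 = 0"
    proof (elim disjE)
      assume z: "y $ 0 = 0" then show ?thesis using f0 AB by simp
    next
      assume z: "y $ 1 = 0" then show ?thesis using f1 AB by simp
    next
      assume "y $ 0 + y $ 1 = 0"
      then have e: "y $ 0 = - y $ 1" by (simp add: eq_neg_iff_add_eq_0)
      have "(A + B) * (y $ 1 * y $ 1 * y $ 1) = 0" using f0 unfolding e by (simp add: algebra_simps)
      then show ?thesis using AB e by simp
    next
      assume z: "A * y $ 0 - B * y $ 1 = 0"
      then have "y $ 0 * y $ 1 * (y $ 0 + y $ 1) = 0" using f0 AB by simp
      then consider "y $ 0 = 0" | "y $ 1 = 0" | "y $ 0 = - y $ 1"
        by (auto simp: eq_neg_iff_add_eq_0)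
      then show ?thesis
      proof cases
        case 3
        have "A * (- y $ 1) - B * y $ 1 = 0" using z unfolding 3 .
        moreover have "(A + B) * y $ 1 = - (A * (- y $ 1) - B * y $ 1)" by (simp add: algebra_simps)
        ultimately have "(A + B) * y $ 1 = 0" by simp
        then show ?thesis using AB 3 by simp
      qed (use z AB in auto)
    qed
    then have "y $ 2 * y $ 3 = 0" using True by (simp add: W_def Qf_def)
    then consider "y $ 2 = 0" | "y $ 3 = 0" by auto
    then show ?thesis
    proof cases
      case 1
      have e: "y = y $ 3 *s vec4 0 0 0 1" using y01 1 by (simp add: vec_eq_iff forall_4_from_0)
      moreover have "y $ 3 \<noteq> 0" using y(1) e by (metis vector_smult_lzero)
      ultimately show ?thesis using pt_eqI unfolding Pinf_def by blast
    next
      case 2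
      have e: "y = y $ 2 *s vec4 0 0 1 0" using y01 2 by (simp add: vec_eq_iff forall_4_from_0)
      moreover have "y $ 2 \<noteq> 0" using y(1) e by (metis vector_smult_lzero)
      ultimately show ?thesis using pt_eqI unfolding Pinf'_def by blast
    qed
  next
    case False
    then have y23: "y $ 2 = 0" "y $ 3 = 0" using ga(1,2) by auto
    have W: "W = Qf q0 q1 q2 (y $ 0) (y $ 1)" using y23 by (simp add: W_def)
    have y1: "y $ 1 \<noteq> 0"
    proof
      assume "y $ 1 = 0"
      then show False using q False by simp
    qed
    define x where "x = y $ 0 / y $ 1"
    have y0: "y $ 0 = x * y $ 1" using y1 by (simp add: x_def)
    obtain r0 r1 where r: "\<And>x::complex. (Qf q0 q1 q2 x 1)^2 - x * (x + 1) * (of_real a * x - of_real b)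
      = (x - of_real l0)^2 * (of_real r0 + of_real r1 * x + of_real (q0^2) * x^2)"
      "r0 + r1 * l0 + q0^2 * l0^2 \<noteq> 0" "\<And>x::real. r0 + r1 * x + q0^2 * x^2 = 0 \<Longrightarrow> x = l0"
      by (fact double_root_factor)
    define R where "R x = complex_of_real r0 + of_real r1 * x + of_real (q0^2) * x^2" for x
    have WQ: "W = Qf q0 q1 q2 x 1 * (y $ 1)^2" unfolding W y0 Qf_def by (simp add: algebra_simps power2_eq_square)
    have "(y $ 1)^4 * ((Qf q0 q1 q2 x 1)^2 - x * (x + 1) * (A * x - B)) = 0"
      using q unfolding WQ unfolding y0 by (simp add: algebra_simps eval_nat_numeral)
    then have p: "(x - of_real l0)^2 * R x = 0"
      using y1 r(1)[of x] by (simp add: A_def B_def R_def)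
    have "(y $ 1)^3 * (2 * Qf q0 q1 q2 x 1 * (2 * of_real q0 * x + of_real q1) -
        ((x + 1) * (A * x - B) + x * (A * x - B) + A * (x * (x + 1)))) = 0"
      using ga(3) unfolding WQ unfolding y0 by (simp add: algebra_simps eval_nat_numeral)
    then have p': "2 * Qf q0 q1 q2 x 1 * (2 * of_real q0 * x + of_real q1) -
        ((x + 1) * (A * x - B) + x * (A * x - B) + A * (x * (x + 1))) = 0" using y1 by simp
    \<comment> \<open>The same polynomial in expanded and in factored form, so the two derivatives
      coincide.\<close>
    have D1: "((\<lambda>x::complex. (Qf q0 q1 q2 x 1)^2 - x * (x + 1) * (of_real a * x - of_real b)) has_field_derivative
       2 * Qf q0 q1 q2 x 1 * (2 * of_real q0 * x + of_real q1) -
        ((x + 1) * (A * x - B) + x * (A * x - B) + A * (x * (x + 1)))) (at x)"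
      unfolding Qf_def A_def B_def by (auto intro!: derivative_eq_intros simp: algebra_simps)
    have D2: "((\<lambda>x::complex. (x - of_real l0)^2 * (of_real r0 + of_real r1 * x + of_real (q0^2) * x^2)) has_field_derivative
       2 * (x - of_real l0) * R x + (x - of_real l0)^2 * (of_real r1 + 2 * of_real (q0^2) * x)) (at x)"
      unfolding R_def by (auto intro!: derivative_eq_intros simp: algebra_simps)
    have p2: "2 * (x - of_real l0) * R x + (x - of_real l0)^2 * (of_real r1 + 2 * of_real (q0^2) * x) = 0"
      using DERIV_unique[OF D1[unfolded r(1)] D2] p' by simp
    have "x = of_real l0"
    proof (rule ccontr)
      assume ne: "x \<noteq> of_real l0"
      then have R0: "R x = 0" using p by simp
      \<comment> \<open>Off \<open>l0\<close> the point is a common zero of \<open>R\<close> and its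
        derivative. The derivative is linear with real coefficients, so the zero is real, and
        \<open>R\<close> has no real zero other than \<open>l0\<close>.\<close>
      then have R1: "of_real r1 + 2 * of_real (q0^2) * x = 0" using p2 ne by simp
      have "q0^2 * Im x = 0" using arg_cong[OF R1, of Im] by simp
      then have "Im x = 0" using leading_coeff_pos by simp
      then have xr: "x = of_real (Re x)" by (simp add: complex_eq_iff)
      have "of_real (r0 + r1 * Re x + q0^2 * (Re x)^2) = (0::complex)"
        using R0 unfolding R_def by (subst (asm) (1 2) xr) simp
      then have "r0 + r1 * Re x + q0^2 * (Re x)^2 = 0" by (simp only: of_real_eq_0_iff)
      then show False using r(3) xr ne by metis
    qed
    then have "y = y $ 1 *s vec4 (of_real l0) 1 0 0"
      using y0 y23 by (simp add: vec_eq_iff forall_4_from_0)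
    then show ?thesis using pt_eqI[OF y1] unfolding P0_def by blast
  qed
qed

text \<open>For a representative fixed by \<open>conj4\<close>, y_2 y_3 is the nonnegative number w
  = |y_3|^2, and the equation t^2 + (w + Q)^2 = f has real terms. Since Q exceeds the root of f away
  from \<open>l0\<close>, only \<open>l0\<close> remains, and there w = 0.\<close>

theorem real_point:
  assumes y: "y \<noteq> 0" and eq: "z^2 + quartic a b q0 q1 q2 y = 0"
    and c: "conj4 y = c *s y" "cnj z = c^2 * z"
  shows "pt y = P0 l0"
proof -
  have inv: "conj4 (conj4 y) = y" by (simp add: conj4_def vec_eq_iff forall_4_from_0)
  have "conj4 (c *s y) = cnj c *s conj4 y" by (simp add: conj4_def vec_eq_iff forall_4_from_0)
  then have cc: "(cnj c * c) *s y = y" using inv c(1) by simp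
  obtain k where "y $ k \<noteq> 0" using y by (auto simp: vec_eq_iff)
  then have "cnj c * c = 1" using cc by (metis mult_cancel_right1 vector_smult_component)
  then have n: "norm c = 1" by (metis complex_norm_square mult.commute norm_ge_zero of_real_1 of_real_eq_iff power2_eq_1_iff of_real_power abs_of_nonneg real_sqrt_abs real_sqrt_one)
  \<comment> \<open>As \<open>c\<close> has modulus 1, multiplying the representative by a square
    root of it makes it fixed by \<open>conj4\<close>; the fibre coordinate becomes real at the same
    time.\<close>
  define d where "d = csqrt c"
  have dd: "d^2 = c" by (simp add: d_def)
  have nd: "norm d = 1" using n by (simp add: d_def norm_csqrt)
  then have cd: "cnj d * d = 1" by (metis complex_norm_square mult.commute of_real_1 one_power2 of_real_power)
  have d0: "d \<noteq> 0" using nd by auto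
  define Y where "Y = d *s y"
  define x where "x = d^2 * z"
  have YY: "conj4 Y = Y"
  proof -
    have "conj4 Y = cnj d *s conj4 y" by (simp add: Y_def conj4_def vec_eq_iff forall_4_from_0)
    also have "\<dots> = (cnj d * d * d) *s y" using c(1) dd by (simp add: power2_eq_square)
    finally show ?thesis by (simp add: cd Y_def)
  qed
  have xx: "cnj x = x"
  proof -
    have "cnj x = (cnj d)^2 * (d^2)^2 * z" using c(2) unfolding x_def dd[symmetric] by (simp add: mult.assoc)
    also have "\<dots> = (cnj d * d)^2 * d^2 * z" by (simp add: power2_eq_square)
    finally show ?thesis by (simp add: cd x_def)
  qed
  have eqY: "x^2 + quartic a b q0 q1 q2 Y = 0"
  proof -
    have "x^2 + quartic a b q0 q1 q2 Y = d^4 * (z^2 + quartic a b q0 q1 q2 y)"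
      by (simp add: x_def Y_def quartic_scale algebra_simps eval_nat_numeral)
    then show ?thesis using eq by simp
  qed
  have comp: "cnj (Y $ 0) = Y $ 0" "cnj (Y $ 1) = Y $ 1" "cnj (Y $ 3) = Y $ 2"
    using arg_cong[OF YY, of "\<lambda>v. v $ 0"] arg_cong[OF YY, of "\<lambda>v. v $ 1"] arg_cong[OF YY, of "\<lambda>v. v $ 2"]
    by (simp_all add: conj4_def)
  define u where "u = Re (Y $ 0)"
  define v where "v = Re (Y $ 1)"
  define w where "w = (norm (Y $ 3))^2"
  define t where "t = Re x"
  have Yu: "Y $ 0 = of_real u" "Y $ 1 = of_real v" "x = of_real t"
    using comp(1,2) xx by (simp_all add: u_def v_def t_def complex_eq_iff)
  have Y23: "Y $ 2 * Y $ 3 = of_real w"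
    using comp(3) by (metis w_def complex_norm_square mult.commute of_real_power)
  have "complex_of_real (t^2 + (w + Qf q0 q1 q2 u v)^2 - u * v * (u + v) * (a * u - b * v)) = 0"
    using eqY by (simp add: quartic_def Y23 Yu Qf_def add_diff_eq)
  then have main: "t^2 + (w + Qf q0 q1 q2 u v)^2 - u * v * (u + v) * (a * u - b * v) = 0"
    by (simp only: of_real_eq_0_iff)
  have w0: "w \<ge> 0" by (simp add: w_def)
  have Y0: "Y \<noteq> 0" using y d0 by (simp add: Y_def)
  have v0: "v \<noteq> 0"
  proof
    assume v: "v = 0"
    then have "t^2 + (w + q0 * u^2)^2 = 0" using main by (simp add: Qf_def)
    then have "w + q0 * u^2 = 0" by (simp add: sum_power2_eq_zero_iff)
    moreover have "q0 * u^2 \<ge> 0" using leading_coeff_pos by simp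
    ultimately have "w = 0" "q0 * u^2 = 0" using w0 by linarith+
    then have "u = 0" "Y $ 3 = 0" using leading_coeff_pos by (auto simp: w_def)
    then show False using Y0 v Yu comp(3) by (simp add: vec_eq_iff forall_4_from_0)
  qed
  define l where "l = u / v"
  have u: "u = l * v" using v0 by (simp add: l_def)
  have Ql: "Qf q0 q1 q2 u v = Qf q0 q1 q2 l 1 * v^2" unfolding u Qf_def by (simp add: algebra_simps power2_eq_square)
  have "v^4 * ((w / v^2 + Qf q0 q1 q2 l 1)^2 - cubic a b l) = - (t^2)"
  proof -
    have "(w + Qf q0 q1 q2 u v)^2 = v^4 * (w / v^2 + Qf q0 q1 q2 l 1)^2"
      unfolding Ql using v0 by (simp add: field_simps power2_eq_square eval_nat_numeral)
    moreover have "u * v * (u + v) * (a * u - b * v) = v^4 * cubic a b l"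
      unfolding u cubic_def by (simp add: algebra_simps eval_nat_numeral)
    ultimately show ?thesis using main by (simp add: right_diff_distrib)
  qed
  then have "v^4 * ((w / v^2 + Qf q0 q1 q2 l 1)^2 - cubic a b l) \<le> 0" by simp
  moreover have "v^4 > 0" using v0 by simp
  ultimately have le: "(w / v^2 + Qf q0 q1 q2 l 1)^2 \<le> cubic a b l"
    by (simp add: mult_le_0_iff)
  have wv: "w / v^2 \<ge> 0" using w0 by simp
  have ll: "l = l0"
  proof (rule ccontr)
    assume ne: "l \<noteq> l0"
    have f: "cubic a b l \<ge> 0" using le zero_le_power2 order.trans by blast
    have s: "Qf q0 q1 q2 l 1 > sqrt (cubic a b l)" by (rule above[OF f ne])
    have "sqrt (cubic a b l) \<ge> 0" using f by simp
    then have "(w / v^2 + Qf q0 q1 q2 l 1)^2 > (sqrt (cubic a b l))^2"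
      using s wv by (intro power_strict_mono) auto
    then show False using le f by simp
  qed
  have "(w / v^2 + Qf q0 q1 q2 l0 1)^2 \<le> (Qf q0 q1 q2 l0 1)^2"
    using le zero[of l0] unfolding ll by simp
  then have "w / (v^2) + Qf q0 q1 q2 l0 1 \<le> Qf q0 q1 q2 l0 1"
    using Q_l0_nonneg by (rule power2_le_imp_le)
  then have "w = 0" using wv v0 by (simp add: divide_le_0_iff) (use w0 in linarith)
  then have "Y $ 3 = 0" "Y $ 2 = 0" using comp(3) by (auto simp: w_def)
  then have "Y = of_real v *s vec4 (of_real l0) 1 0 0"
    using Yu u ll by (simp add: vec_eq_iff forall_4_from_0)
  then have "pt Y = P0 l0" unfolding P0_def by (rule pt_eqI[of "of_real v", rotated]) (use v0 in simp)
  moreover have "pt Y = pt y" by (rule pt_eqI[OF d0]) (simp add: Y_def)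
  ultimately show ?thesis by simp
qed

end

section \<open>The volume form of a small resolution\<close>

lemma proj_O2_pt: "proj_O2 (pt_O2 (y, z)) = pt y"
  unfolding proj_O2_def pt_O2_def pt_def by force

lemma double_solid_iff:
  "pt_O2 (y, z) \<in> double_solid a b q0 q1 q2 \<longleftrightarrow> y \<noteq> 0 \<and> z^2 + quartic a b q0 q1 q2 y = 0"
proof
  assume "pt_O2 (y, z) \<in> double_solid a b q0 q1 q2"
  then obtain y' z' where w: "y' \<noteq> 0" "z'^2 + quartic a b q0 q1 q2 y' = 0" "pt_O2 (y', z') = pt_O2 (y, z)"
    by (auto simp: double_solid_def)
  then obtain c where c: "c \<noteq> 0" "y = c *s y'" "z = c^2 * z'" by (auto simp: pt_O2_eq_iff)
  have "z^2 + quartic a b q0 q1 q2 y = c^4 * (z'^2 + quartic a b q0 q1 q2 y')"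
    unfolding c quartic_scale by (simp add: algebra_simps eval_nat_numeral)
  then show "y \<noteq> 0 \<and> z^2 + quartic a b q0 q1 q2 y = 0" using w c by simp
qed (auto simp: double_solid_def)

lemma tlift_nonzero: "tlift i X \<noteq> 0"
proof
  assume "tlift i X = 0"
  then have "tlift i X $ i = 0" by simp
  then show False by (simp add: tlift_def)
qed

lemma double_solid_chart:
  assumes "P \<in> fst (tchart i)"
  shows "P \<in> double_solid a b q0 q1 q2 \<longleftrightarrow> chart_eq a b q0 q1 q2 i (snd (tchart i) P) = 0"
  by (subst tchart_image[OF assms]) (simp add: double_solid_iff chart_eq_def tlift_nonzero)

lemma tchart_cover:
  assumes "P \<in> topspace (ctop tot_O2)" obtains i where "P \<in> fst (tchart i)"
  using atlas_tot_O2 assms unfolding atlas_def charts_tot_O2 by blast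

lemma tchart_surj: "snd (tchart i) ` fst (tchart i) = UNIV"
proof -
  have "X \<in> snd (tchart i) ` fst (tchart i)" for X
    using tchart_tlift[of i X] tlift_mem[of i X "X $ i"] by (metis imageI)
  then show ?thesis by blast
qed

lemma tchart_inj: "inj_on (snd (tchart i)) (fst (tchart i))"
  by (rule is_chart_inj[OF is_chart_tchart])

lemma openin_tot_O2_cofinite:
  assumes "finite F"
  shows "openin (ctop tot_O2) (topspace (ctop tot_O2) - F)"
proof -
  define G where "G i = snd (tchart i) ` (F \<inter> fst (tchart i))" for i
  have "openin (ctop tot_O2) {P \<in> fst (tchart i). snd (tchart i) P \<in> - G i}" for i
    by (rule is_chart_open_preimage[OF is_chart_tchart])
      (simp add: G_def assms finite_imp_closed open_Compl)
  then have "openin (ctop tot_O2) (\<Union>i. {P \<in> fst (tchart i). snd (tchart i) P \<in> - G i})"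
    by (intro openin_Union) auto
  moreover have "{P \<in> fst (tchart i). snd (tchart i) P \<in> - G i} = fst (tchart i) - F" for i
    using tchart_inj[of i] by (auto simp: G_def inj_on_def)
  moreover have "(\<Union>i. fst (tchart i) - F) = topspace (ctop tot_O2) - F"
  proof
    show "(\<Union>i. fst (tchart i) - F) \<subseteq> topspace (ctop tot_O2) - F"
      using is_chart_domain_subset[OF is_chart_tchart] by blast
    show "topspace (ctop tot_O2) - F \<subseteq> (\<Union>i. fst (tchart i) - F)"
    proof
      fix P assume P: "P \<in> topspace (ctop tot_O2) - F"
      then obtain i where "P \<in> fst (tchart i)" by (meson DiffD1 tchart_cover)
      then show "P \<in> (\<Union>i. fst (tchart i) - F)" using P by blast
    qed
  qed
  ultimately show ?thesis by simp
qed

section \<open>The resolution in charts, its exceptional set and the density\<close>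

locale resolution = pencil +
  fixes Z :: "('a, 3) complex_space" and \<mu> :: "'a \<Rightarrow> ((complex^4) \<times> complex) set"
  assumes res: "small_resolution Z tot_O2 (double_solid a b q0 q1 q2)
           {P \<in> double_solid a b q0 q1 q2. proj_O2 P \<in> {Pinf, Pinf', P0 l0}} \<mu>"
begin

definition XX :: "((complex^4) \<times> complex) set set" where "XX = double_solid a b q0 q1 q2"
definition SS :: "((complex^4) \<times> complex) set set" where "SS = {P \<in> XX. proj_O2 P \<in> {Pinf, Pinf', P0 l0}}"
definition EE :: "'a set" where "EE = {p \<in> topspace (ctop Z). \<mu> p \<in> SS}"
definition m :: "('a, 3) chart \<Rightarrow> 4 \<Rightarrow> complex^3 \<Rightarrow> complex^4" where "m c i = local_rep c (tchart i) \<mu>"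
definition dom :: "('a, 3) chart \<Rightarrow> 4 \<Rightarrow> (complex^3) set" where "dom c i = local_dom c (tchart i) \<mu>"
definition Edom :: "('a, 3) chart \<Rightarrow> 4 \<Rightarrow> (complex^3) set" where
  "Edom c i = snd c ` {p \<in> fst c. \<mu> p \<in> fst (tchart i) \<and> p \<in> EE}"

lemma res': "small_resolution Z tot_O2 XX SS \<mu>"
  using res by (simp add: XX_def SS_def)

lemma Z_atlas: "atlas Z"
  using res' by (simp add: small_resolution_def complex_manifold_atlas)

lemma mu_cont: "continuous_map (ctop Z) (ctop tot_O2) \<mu>"
  using res' by (simp add: small_resolution_def holomorphic_map_def)

lemma mu_in: "p \<in> topspace (ctop Z) \<Longrightarrow> \<mu> p \<in> XX"
  using res' by (auto simp: small_resolution_def)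

lemma mu_top: "p \<in> topspace (ctop Z) \<Longrightarrow> \<mu> p \<in> topspace (ctop tot_O2)"
  using mu_cont by (auto simp: continuous_map_def)

lemma chart_top: "c \<in> max_atlas Z \<Longrightarrow> p \<in> fst c \<Longrightarrow> p \<in> topspace (ctop Z)"
  using is_chart_domain_subset[OF max_atlas_is_chart] by blast

lemma openin_mu: "openin (ctop tot_O2) W \<Longrightarrow> openin (ctop Z) {p \<in> topspace (ctop Z). \<mu> p \<in> W}"
  using mu_cont openin_continuous_map_preimage by blast

text \<open>Each of the three points has only z = 0 above it, since the quartic vanishes
  there.\<close>

lemma finite_SS: "finite SS"
proof -
  have "SS \<subseteq> {pt_O2 (vec4 0 0 0 1, 0), pt_O2 (vec4 0 0 1 0, 0), pt_O2 (vec4 (of_real l0) 1 0 0, 0)}"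
  proof
    fix P assume P: "P \<in> SS"
    then obtain y z where yz: "y \<noteq> 0" "z^2 + quartic a b q0 q1 q2 y = 0" "P = pt_O2 (y, z)"
      by (auto simp: SS_def XX_def double_solid_def)
    have "pt y \<in> {Pinf, Pinf', P0 l0}" using P yz by (auto simp: SS_def proj_O2_pt)
    then obtain s where s: "s \<in> {vec4 0 0 0 1, vec4 0 0 1 0, vec4 (of_real l0) 1 0 0}" "pt y = pt s"
      by (auto simp: Pinf_def Pinf'_def P0_def)
    have "y \<in> pt y" unfolding pt_def by (auto intro!: exI[of _ 1])
    then obtain k where k: "k \<noteq> 0" "y = k *s s" using s(2) by (auto simp: pt_def)
    have "quartic a b q0 q1 q2 (vec4 (of_real l0) 1 0 0) = of_real ((Qf q0 q1 q2 l0 1)^2 - cubic a b l0)"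
      by (simp add: quartic_def Qf_def cubic_def)
    also have "\<dots> = 0" using zero[of l0] by simp
    finally have "quartic a b q0 q1 q2 s = 0" using s(1) by (auto simp: quartic_def Qf_def)
    then have "z = 0" using yz(2) k by (simp add: quartic_scale)
    then have "P = pt_O2 (s, 0)" using pt_O2_scale[OF k(1), of s 0] k yz(3) by simp
    then show "P \<in> {pt_O2 (vec4 0 0 0 1, 0), pt_O2 (vec4 0 0 1 0, 0), pt_O2 (vec4 (of_real l0) 1 0 0, 0)}"
      using s(1) by auto
  qed
  then show ?thesis by (rule finite_subset) simp
qed

lemma open_complement_EE: "openin (ctop Z) (topspace (ctop Z) - EE)"
proof -
  have "{p \<in> topspace (ctop Z). \<mu> p \<in> topspace (ctop tot_O2) - SS} = topspace (ctop Z) - EE"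
    using mu_top by (auto simp: EE_def)
  then show ?thesis using openin_mu[OF openin_tot_O2_cofinite[OF finite_SS]] by simp
qed

lemma m_at: "c \<in> max_atlas Z \<Longrightarrow> p \<in> fst c \<Longrightarrow> m c i (snd c p) = snd (tchart i) (\<mu> p)"
  unfolding m_def by (rule local_rep_chart[OF max_atlas_inj])

lemma dom_mem: "c \<in> max_atlas Z \<Longrightarrow> p \<in> fst c \<Longrightarrow> snd c p \<in> dom c i \<longleftrightarrow> \<mu> p \<in> fst (tchart i)"
  using max_atlas_inj[of c Z] by (auto simp: dom_def local_dom_def inj_on_def)

lemma dom_cases: "x \<in> dom c i \<Longrightarrow> (\<And>p. p \<in> fst c \<Longrightarrow> \<mu> p \<in> fst (tchart i) \<Longrightarrow> x = snd c p \<Longrightarrow> thesis) \<Longrightarrow> thesis"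
  by (auto simp: dom_def local_dom_def)

lemma Edom_mem: "c \<in> max_atlas Z \<Longrightarrow> p \<in> fst c \<Longrightarrow> \<mu> p \<in> fst (tchart i) \<Longrightarrow> snd c p \<in> Edom c i \<longleftrightarrow> p \<in> EE"
  using max_atlas_inj[of c Z] by (auto simp: Edom_def inj_on_def)

lemma Edom_subset: "Edom c i \<subseteq> dom c i"
  by (auto simp: Edom_def dom_def local_dom_def)

lemma m_holo:
  assumes c: "c \<in> max_atlas Z" shows "holo_map (dom c i) (m c i)"
  unfolding dom_def m_def
proof (rule holo_map_local_rep_max_atlas[OF Z_atlas c])
  show "openin (ctop Z) {p \<in> topspace (ctop Z). \<mu> p \<in> fst (tchart i)}"
    by (rule openin_mu[OF is_chart_open_domain[OF is_chart_tchart]])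
  show "holo_map (local_dom c0 (tchart i) \<mu>) (local_rep c0 (tchart i) \<mu>)" if "c0 \<in> charts Z" for c0
    using res' that by (auto simp: small_resolution_def holomorphic_map_def holo_map_def charts_tot_O2)
qed

lemma open_dom: "c \<in> max_atlas Z \<Longrightarrow> open (dom c i)"
  using m_holo holo_map_open by blast

lemma chart_eq_m:
  assumes "c \<in> max_atlas Z" "x \<in> dom c i" shows "chart_eq a b q0 q1 q2 i (m c i x) = 0"
  using assms(2)
proof (rule dom_cases)
  fix p assume p: "p \<in> fst c" "\<mu> p \<in> fst (tchart i)" "x = snd c p"
  have "\<mu> p \<in> double_solid a b q0 q1 q2" using mu_in[OF chart_top[OF assms(1) p(1)]] by (simp add: XX_def)
  then show ?thesis using double_solid_chart[OF p(2)] by (simp add: p(3) m_at[OF assms(1) p(1)])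
qed

text \<open>At a critical point the derivative in the fibre direction gives z = 0. The gradient of
  the quartic then vanishes in the chart directions, and Euler's identity supplies the remaining
  direction \<open>y\<close>, so \<open>singular_points\<close> applies.\<close>

lemma chart_grad_nonzero:
  assumes P: "P \<in> XX - SS" "P \<in> fst (tchart i)"
  obtains w where "chart_grad a b q0 q1 q2 i (snd (tchart i) P) w \<noteq> 0"
proof (rule ccontr)
  assume "\<not> thesis"
  with that have z: "chart_grad a b q0 q1 q2 i (snd (tchart i) P) v = 0" for v by blast
  define X where "X = snd (tchart i) P"
  define y where "y = tlift i X"
  have y: "y \<noteq> 0" by (simp add: y_def tlift_nonzero)
  have yi: "y $ i = 1" by (simp add: y_def tlift_def)
  have "(\<chi> j. if j = i then 0 else axis i (1::complex) $ j) = 0" by (simp add: vec_eq_iff axis_def)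
  then have "chart_grad a b q0 q1 q2 i X (axis i 1) = 2 * X $ i"
    unfolding chart_grad_def by (simp add: linear_0[OF quartic_grad_linear(1)])
  then have Xi: "X $ i = 0" using z by (simp add: X_def)
  have Pe: "P = pt_O2 (y, 0)" using tchart_image[OF P(2)] Xi by (simp add: X_def y_def)
  have q: "quartic a b q0 q1 q2 y = 0"
    using P(1) Pe by (simp add: XX_def double_solid_iff)
  have g: "quartic_grad a b q0 q1 q2 y v = 0" for v
  proof -
    define u where "u = v + (- (v $ i)) *s y"
    have "u $ i = 0" using yi by (simp add: u_def)
    then have "(\<chi> j. if j = i then 0 else u $ j) = u" by (simp add: vec_eq_iff)
    then have "quartic_grad a b q0 q1 q2 y u = 0"
      using z[of u] Xi unfolding chart_grad_def X_def[symmetric] y_def[symmetric] by simp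
    moreover have "quartic_grad a b q0 q1 q2 y u = quartic_grad a b q0 q1 q2 y v + (- (v $ i)) * quartic_grad a b q0 q1 q2 y y"
      unfolding u_def linear_add[OF quartic_grad_linear(1)] quartic_grad_linear(2) ..
    ultimately show ?thesis by (simp add: quartic_euler q)
  qed
  have "pt y \<in> {Pinf, Pinf', P0 l0}" by (rule singular_points[OF y q g])
  then have "P \<in> SS" using P(1) Pe by (simp add: SS_def proj_O2_pt)
  then show False using P(1) by simp
qed

text \<open>The chart equation becomes a coordinate and the singular points are removed from the
  domain. The result is a slice chart of the kind from which \<open>induced\<close> builds the
  charts of the smooth locus.\<close>

lemma regular_chart:
  assumes P: "P \<in> XX - SS" "P \<in> fst (tchart i)"
  obtains c k \<phi> where "c \<in> max_atlas tot_O2" "P \<in> fst c" "fst c \<subseteq> fst (tchart i)"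
    "\<And>q. q \<in> fst c \<Longrightarrow> q \<in> XX - SS \<longleftrightarrow> snd c q $ k = 0"
    "\<And>q. q \<in> fst c \<Longrightarrow> snd c q = \<phi> (snd (tchart i) q)" "holo_map (snd (tchart i) ` fst c) \<phi>"
proof -
  let ?X = "snd (tchart i) P"
  obtain w where w: "chart_grad a b q0 q1 q2 i ?X w \<noteq> 0" by (rule chart_grad_nonzero[OF P])
  have fd: "frechet_derivative (chart_eq a b q0 q1 q2 i) (at X) = chart_grad a b q0 q1 q2 i X" for X
    by (rule frechet_derivative_at[OF chart_eq_has_derivative, symmetric])
  have w': "frechet_derivative (chart_eq a b q0 q1 q2 i) (at ?X) w \<noteq> 0" using w fd by simp
  obtain k U V and \<phi> g :: "complex^4 \<Rightarrow> complex^4" where U: "open U" "?X \<in> U" "U \<subseteq> UNIV" "open V"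
    "homeomorphism U V \<phi> g" "holo_map U \<phi>" "holo_map V g" "\<And>x. \<phi> x $ k = chart_eq a b q0 q1 q2 i x"
    using submersion_chart[OF holomorphic_chart_eq[OF open_UNIV] UNIV_I w'] by metis
  define c1 where "c1 = ({p \<in> fst (tchart i). snd (tchart i) p \<in> U}, \<phi> \<circ> snd (tchart i))"
  have c1: "c1 \<in> max_atlas tot_O2"
    unfolding c1_def
    by (rule max_atlas_compose[OF charts_max_atlas[OF atlas_tot_O2] U(1) _ U(4-7) atlas_tot_O2])
      (simp_all add: charts_tot_O2 tchart_surj)
  define c where "c = (fst c1 \<inter> (topspace (ctop tot_O2) - SS), snd c1)"
  have c: "c \<in> max_atlas tot_O2"
    unfolding c_def by (rule max_atlas_restrict[OF c1 openin_tot_O2_cofinite[OF finite_SS] atlas_tot_O2])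
  show ?thesis
  proof (rule that[OF c, of k \<phi>])
    show "P \<in> fst c" using P U(2) is_chart_domain_subset[OF is_chart_tchart, of i] by (auto simp: c_def c1_def)
    show "fst c \<subseteq> fst (tchart i)" by (auto simp: c_def c1_def)
    show "q \<in> XX - SS \<longleftrightarrow> snd c q $ k = 0" if "q \<in> fst c" for q
    proof -
      have q: "q \<in> fst (tchart i)" "q \<notin> SS" using that by (auto simp: c_def c1_def)
      then show ?thesis using double_solid_chart[OF q(1)] by (simp add: c_def c1_def U(8) XX_def)
    qed
    show "snd c q = \<phi> (snd (tchart i) q)" if "q \<in> fst c" for q by (simp add: c_def c1_def)
    have "openin (ctop tot_O2) (fst c)" by (rule is_chart_open_domain[OF max_atlas_is_chart[OF c]])
    then have "open (snd (tchart i) ` fst c)"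
      by (rule is_chart_open_image[OF is_chart_tchart]) (auto simp: c_def c1_def)
    then show "holo_map (snd (tchart i) ` fst c) \<phi>"
      by (rule holo_map_subset[OF U(6)]) (auto simp: c_def c1_def)
  qed
qed

text \<open>Biholomorphy is known only in charts of the induced structures. There the inverse of
  \<mu> composed with the slice coordinates \<open>h\<close> of \<mu> is the identity, and the chain
  rule leaves no kernel.\<close>

theorem m_immersion:
  assumes c: "c \<in> max_atlas Z" and p: "p \<in> fst c" "p \<notin> EE" "\<mu> p \<in> fst (tchart i)"
    and v: "frechet_derivative (m c i) (at (snd c p)) v = 0"
  shows "v = 0"
proof -
  define Ec where "Ec = {p \<in> topspace (ctop Z). \<mu> p \<notin> SS}"
  have Ec: "Ec = topspace (ctop Z) - EE" by (auto simp: Ec_def EE_def)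
  have ptop: "p \<in> topspace (ctop Z)" by (rule chart_top[OF c p(1)])
  have P: "\<mu> p \<in> XX - SS" using p(2) ptop mu_in by (auto simp: EE_def)
  obtain cN k \<phi> where cN: "cN \<in> max_atlas tot_O2" "\<mu> p \<in> fst cN" "fst cN \<subseteq> fst (tchart i)"
    "\<And>q. q \<in> fst cN \<Longrightarrow> q \<in> XX - SS \<longleftrightarrow> snd cN q $ k = 0"
    "\<And>q. q \<in> fst cN \<Longrightarrow> snd cN q = \<phi> (snd (tchart i) q)" "holo_map (snd (tchart i) ` fst cN) \<phi>"
    using regular_chart[OF P p(3)] by metis
  \<comment> \<open>The numbering \<open>e\<close> of the three coordinates other than the equation
    \<open>k\<close> yields the chart \<open>d\<close> of the smooth locus.\<close>
  obtain e :: "3 \<Rightarrow> 4" where e: "bij_betw e UNIV (- {k})"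
  proof -
    have "card (UNIV :: 3 set) = card (- {k})" by (simp add: Compl_eq_Diff_UNIV card_Diff_singleton)
    then show ?thesis using that finite_same_card_bij[of "UNIV :: 3 set" "- {k}"] by auto
  qed
  then have e': "inj e" "range e = - {k}" by (auto simp: bij_betw_def)
  define d where "d = (fst cN \<inter> (XX - SS), \<lambda>p. \<chi> r. snd cN p $ e r)"
  have d: "d \<in> charts (induced tot_O2 (XX - SS) :: (_, 3) complex_space)"
  proof -
    have "\<forall>q\<in>fst cN. q \<in> XX - SS \<longleftrightarrow> (\<forall>j\<in>- range e. snd cN q $ j = 0)"
      unfolding e'(2) using cN(4) by simp
    then have "\<exists>c e'. d = (fst c \<inter> (XX - SS), \<lambda>p. \<chi> k. snd c p $ e' k) \<and> c \<in> max_atlas tot_O2 \<and> inj e' \<and>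
        (\<forall>q\<in>fst c. q \<in> XX - SS \<longleftrightarrow> (\<forall>j\<in>- range e'. snd c q $ j = 0))"
      using cN(1) e'(1) by (intro exI[of _ cN] exI[of _ e]) (simp add: d_def)
    then show ?thesis unfolding induced_def by simp
  qed
  define c' where "c' = (fst c \<inter> Ec, snd c)"
  have c': "c' \<in> max_atlas Z"
    unfolding c'_def Ec by (rule max_atlas_restrict[OF c open_complement_EE Z_atlas])
  \<comment> \<open>An open subset is a slice without equations, hence \<open>id\<close> as the
    numbering of the free coordinates.\<close>
  define dZ :: "('a, 3) chart" where "dZ = (fst c' \<inter> Ec, \<lambda>p. \<chi> r. snd c' p $ id r)"
  have dZ: "dZ \<in> charts (induced Z Ec :: ('a, 3) complex_space)"
  proof -
    have "\<forall>q\<in>fst c'. q \<in> Ec \<longleftrightarrow> (\<forall>j\<in>- range (id :: 3 \<Rightarrow> 3). snd c' q $ j = 0)"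
      by (auto simp: c'_def)
    then have "\<exists>c e'. dZ = (fst c \<inter> Ec, \<lambda>p. \<chi> k. snd c p $ e' k) \<and> c \<in> max_atlas Z \<and> inj e' \<and>
        (\<forall>q\<in>fst c. q \<in> Ec \<longleftrightarrow> (\<forall>j\<in>- range (e' :: 3 \<Rightarrow> 3). snd c q $ j = 0))"
      using c' inj_on_id by (intro exI[of _ c'] exI[of _ id]) (simp add: dZ_def)
    then show ?thesis unfolding induced_def by simp
  qed
  have bih: "biholomorphic_map (induced Z Ec :: ('a, 3) complex_space) (induced tot_O2 (XX - SS) :: (_, 3) complex_space) \<mu>"
    using res' by (simp add: small_resolution_def Ec_def)
  have topE: "topspace (ctop (induced Z Ec :: ('a, 3) complex_space)) = Ec"
    by (auto simp: induced_def Ec_def)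
  define inv\<mu> where "inv\<mu> = inv_into Ec \<mu>"
  have injE: "inj_on \<mu> Ec" using bih by (simp add: biholomorphic_map_def bij_betw_def topE)
  have R: "holo_map (local_dom d dZ inv\<mu>) (local_rep d dZ inv\<mu>)"
    using bih d dZ unfolding biholomorphic_map_def holomorphic_map_def holo_map_def topE inv\<mu>_def by blast
  have injd: "inj_on (snd d) (fst d)"
  proof (rule inj_onI)
    fix P Q assume PQ: "P \<in> fst d" "Q \<in> fst d" "snd d P = snd d Q"
    have "snd cN P $ j = snd cN Q $ j" for j
    proof (cases "j = k")
      case True
      have "snd cN P $ k = 0" "snd cN Q $ k = 0" using PQ(1,2) cN(4)[of P] cN(4)[of Q] by (auto simp: d_def)
      then show ?thesis using True by simp
    next
      case False
      then obtain r where "j = e r" using e'(2) by blast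
      moreover have "snd cN P $ e r = snd cN Q $ e r" using arg_cong[OF PQ(3), of "\<lambda>v. v $ r"] unfolding d_def by simp
      ultimately show ?thesis by simp
    qed
    then have "snd cN P = snd cN Q" by (simp add: vec_eq_iff)
    then show "P = Q" using max_atlas_inj[OF cN(1)] PQ by (auto simp: d_def inj_on_def)
  qed
  define V where "V = fst c' \<inter> {q \<in> topspace (ctop Z). \<mu> q \<in> fst cN}"
  have oV: "openin (ctop Z) V"
    unfolding V_def
    by (intro openin_Int is_chart_open_domain[OF max_atlas_is_chart[OF c']] openin_mu is_chart_open_domain[OF max_atlas_is_chart[OF cN(1)]])
  define T where "T = snd c ` V"
  have oT: "open T"
    unfolding T_def by (rule is_chart_open_image[OF max_atlas_is_chart[OF c] oV]) (auto simp: V_def c'_def)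
  have pV: "p \<in> V" using p ptop cN(2) by (auto simp: V_def c'_def Ec)
  have Vd: "\<mu> q \<in> fst d" "q \<in> fst c" "q \<in> Ec" if "q \<in> V" for q
    using that mu_in by (auto simp: V_def c'_def d_def Ec_def)
  define h where "h x = (\<chi> r. \<phi> (m c i x) $ e r)" for x
  have h_at: "h (snd c q) = snd d (\<mu> q)" if "q \<in> V" for q
    using that Vd[OF that] cN(5) by (simp add: h_def m_at[OF c] d_def)
  have TD: "T \<subseteq> dom c i" using cN(3) c by (auto simp: T_def V_def c'_def dom_mem)
  have mT: "m c i ` T \<subseteq> snd (tchart i) ` fst cN"
    using Vd by (auto simp: T_def m_at[OF c] V_def)
  have hh: "holo_map T h"
    unfolding holo_map_def h_def
  proof
    fix r
    have "holomorphic_fn (snd (tchart i) ` fst cN) (\<lambda>x. \<phi> x $ e r)" using cN(6) by (simp add: holo_map_def)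
    from holomorphic_fn_compose[OF this holo_map_subset[OF m_holo[OF c] oT TD] mT]
    show "holomorphic_fn T (\<lambda>x. (\<chi> r. \<phi> (m c i x) $ e r) $ r)" by simp
  qed
  have Rh: "local_rep d dZ inv\<mu> (h x) = x \<and> h x \<in> local_dom d dZ inv\<mu>" if xT: "x \<in> T" for x
  proof -
    obtain q where q: "q \<in> V" "x = snd c q" using xT by (auto simp: T_def)
    have iq: "inv\<mu> (\<mu> q) = q" using injE Vd(3)[OF q(1)] by (simp add: inv\<mu>_def)
    have "local_rep d dZ inv\<mu> (snd d (\<mu> q)) = snd dZ (inv\<mu> (\<mu> q))"
      by (rule local_rep_chart[OF injd Vd(1)[OF q(1)]])
    also have "\<dots> = x" using iq q(2) by (simp add: dZ_def c'_def)
    finally have "local_rep d dZ inv\<mu> (h x) = x" using h_at[OF q(1)] q(2) by simp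
    moreover have "h x \<in> local_dom d dZ inv\<mu>"
      unfolding q(2) h_at[OF q(1)] local_dom_def
      using Vd[OF q(1)] iq by (auto simp: dZ_def c'_def)
    ultimately show ?thesis by simp
  qed
  define x0 where "x0 = snd c p"
  have x0: "x0 \<in> T" using pV by (auto simp: x0_def T_def)
  have dR: "(local_rep d dZ inv\<mu> has_derivative frechet_derivative (local_rep d dZ inv\<mu>) (at (h x0))) (at (h x0))"
    by (rule holo_map_has_derivative[OF R]) (use Rh[OF x0] in simp)
  have dm: "(m c i has_derivative frechet_derivative (m c i) (at x0)) (at x0)"
    by (rule holo_map_has_derivative[OF m_holo[OF c]]) (use TD x0 in blast)
  have mx0: "m c i x0 \<in> snd (tchart i) ` fst cN" using mT x0 by blast
  have d\<phi>: "(\<phi> has_derivative frechet_derivative \<phi> (at (m c i x0))) (at (m c i x0))"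
    by (rule holo_map_has_derivative[OF cN(6) mx0])
  have dh: "(h has_derivative (\<lambda>v. \<chi> r. frechet_derivative \<phi> (at (m c i x0)) (frechet_derivative (m c i) (at x0) v) $ e r)) (at x0)"
    unfolding h_def
  proof (rule has_derivative_vec)
    fix r
    show "((\<lambda>x. (\<chi> r. \<phi> (m c i x) $ e r) $ r) has_derivative
       (\<lambda>v. (\<chi> r. frechet_derivative \<phi> (at (m c i x0)) (frechet_derivative (m c i) (at x0) v) $ e r) $ r)) (at x0)"
      using bounded_linear.has_derivative[OF bounded_linear_vec_nth has_derivative_compose[OF dm d\<phi>], of "e r"] by simp
  qed
  have "((\<lambda>x. x) has_derivative (\<lambda>v. frechet_derivative (local_rep d dZ inv\<mu>) (at (h x0))
     (\<chi> r. frechet_derivative \<phi> (at (m c i x0)) (frechet_derivative (m c i) (at x0) v) $ e r))) (at x0)"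
    by (rule has_derivative_transform_within_open[OF has_derivative_compose[OF dh dR] oT x0]) (use Rh in simp)
  from has_derivative_unique[OF this has_derivative_ident]
  have "frechet_derivative (local_rep d dZ inv\<mu>) (at (h x0))
     (\<chi> r. frechet_derivative \<phi> (at (m c i x0)) (frechet_derivative (m c i) (at x0) v) $ e r) = v"
    by (rule fun_cong)
  moreover have "(\<chi> r. frechet_derivative \<phi> (at (m c i x0)) (frechet_derivative (m c i) (at x0) v) $ e r) = 0"
  proof -
    have "frechet_derivative \<phi> (at (m c i x0)) (frechet_derivative (m c i) (at x0) v) = 0"
      using v linear_0[OF has_derivative_linear[OF d\<phi>]] by (simp add: x0_def)
    then show ?thesis by (simp add: vec_eq_iff)
  qed
  ultimately show ?thesis using has_derivative_linear[OF dR] linear_0 by metis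
qed

text \<open>Near each of its points the exceptional set is a single fibre of \<mu>. If \<mu> were
  locally constant, the fibre would have a regular point of dimension 3; if the fibre were a smooth
  hypersurface, one of dimension 2. Smallness excludes both.\<close>

lemma thin_Edom:
  assumes c: "c \<in> max_atlas Z"
  shows "thin_subset (dom c i) (Edom c i)"
  unfolding thin_subset_def
proof (intro conjI ballI allI impI)
  show "Edom c i \<subseteq> dom c i" by (rule Edom_subset)
  have small: "analytic_dim_le Z {p \<in> topspace (ctop Z). \<mu> p = s} 1" if "s \<in> SS" for s
    using res' that by (simp add: small_resolution_def)
  fix x assume x: "x \<in> Edom c i"
  then obtain p where p: "p \<in> fst c" "\<mu> p \<in> fst (tchart i)" "p \<in> EE" "x = snd c p"
    by (auto simp: Edom_def)
  have ptop: "p \<in> topspace (ctop Z)" by (rule chart_top[OF c p(1)])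
  have pS: "\<mu> p \<in> SS" using p(3) by (simp add: EE_def)
  \<comment> \<open>The images of the other singular points are avoided on \<open>W\<close>, so
    there the exceptional set is the fibre through \<open>x\<close>.\<close>
  define F where "F = snd (tchart i) ` (SS \<inter> fst (tchart i)) - {m c i x}"
  have finF: "finite F" using finite_SS by (simp add: F_def)
  define W where "W = dom c i \<inter> m c i -` (- F)"
  have W: "open W"
    unfolding W_def
    by (intro continuous_open_preimage holo_map_continuous[OF m_holo[OF c]] open_dom[OF c] open_Compl finite_imp_closed finF)
  have xW: "x \<in> W" using subsetD[OF Edom_subset x] by (simp add: W_def F_def)
  have EW: "m c i y = m c i x" if "y \<in> Edom c i \<inter> W" for y
  proof -
    have "m c i y \<in> snd (tchart i) ` (SS \<inter> fst (tchart i))"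
      using that by (auto simp: Edom_def EE_def m_at[OF c])
    then show ?thesis using that by (auto simp: W_def F_def)
  qed
  \<comment> \<open>A component of \<open>m c i\<close> that is not locally constant, minus its
    value at \<open>x\<close>, is the local equation required of a thin set.\<close>
  have nonconst: "\<exists>k. \<forall>\<epsilon>>0. \<exists>y\<in>ball x \<epsilon> \<inter> W. m c i y $ k \<noteq> m c i x $ k"
  proof (rule ccontr)
    assume "\<not> ?thesis"
    then have "\<forall>k. \<exists>\<epsilon>>0. \<forall>y\<in>ball x \<epsilon> \<inter> W. m c i y $ k = m c i x $ k" by blast
    then obtain \<epsilon> where \<epsilon>: "\<And>k. \<epsilon> k > 0 \<and> (\<forall>y\<in>ball x (\<epsilon> k) \<inter> W. m c i y $ k = m c i x $ k)" by metis
    define \<delta> where "\<delta> = Min (range \<epsilon>)"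
    have "\<delta> \<in> range \<epsilon>" unfolding \<delta>_def by (rule Min_in) auto
    then have \<delta>: "\<delta> > 0" using \<epsilon> by auto
    have le: "\<delta> \<le> \<epsilon> k" for k by (simp add: \<delta>_def)
    define V where "V = ball x \<delta> \<inter> W"
    have const: "m c i y = m c i x" if "y \<in> V" for y
    proof -
      have "y \<in> ball x (\<epsilon> k) \<inter> W" for k using that le[of k] by (auto simp: V_def)
      then show ?thesis using \<epsilon> by (simp add: vec_eq_iff)
    qed
    define c1 where "c1 = ({q \<in> fst c. snd c q \<in> V}, snd c)"
    have oV: "open V" using W by (simp add: V_def open_Int)
    have sub: "fst c \<inter> {q \<in> fst c. snd c q \<in> V} = {q \<in> fst c. snd c q \<in> V}" by auto
    have c1: "c1 \<in> max_atlas Z"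
      using max_atlas_restrict[OF c is_chart_open_preimage[OF max_atlas_is_chart[OF c] oV] Z_atlas]
      by (simp add: c1_def sub)
    have fib: "q \<in> {p \<in> topspace (ctop Z). \<mu> p = \<mu> p'}" if "q \<in> fst c1" "p' = p" for q p'
    proof -
      have q: "q \<in> fst c" "snd c q \<in> V" using that by (auto simp: c1_def)
      then have "snd c q \<in> dom c i" by (simp add: V_def W_def)
      then have qi: "\<mu> q \<in> fst (tchart i)" using dom_mem[OF c q(1)] by simp
      have "snd (tchart i) (\<mu> q) = snd (tchart i) (\<mu> p)"
        using const[OF q(2)] by (simp add: m_at[OF c] q(1) p)
      then have "\<mu> q = \<mu> p" using tchart_inj[of i] qi p(2) by (auto simp: inj_on_def)
      then show ?thesis using chart_top[OF c q(1)] that by simp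
    qed
    have "regular_point Z {q \<in> topspace (ctop Z). \<mu> q = \<mu> p} 3 p"
      unfolding regular_point_def
    proof (intro conjI bexI[of _ c1] exI[of _ "UNIV :: 3 set"] c1)
      show "p \<in> fst c1" using p xW \<delta> by (simp add: c1_def V_def)
      show "\<forall>q\<in>fst c1. (q \<in> {q \<in> topspace (ctop Z). \<mu> q = \<mu> p}) = (\<forall>j\<in>- UNIV. snd c1 q $ j = 0)"
        using fib by simp
    qed (use ptop in auto)
    then show False using small[OF pS] unfolding analytic_dim_le_def by fastforce
  qed
  then obtain k where k: "\<And>\<epsilon>. \<epsilon> > 0 \<Longrightarrow> \<exists>y\<in>ball x \<epsilon> \<inter> W. m c i y $ k \<noteq> m c i x $ k" by blast
  show "\<exists>W h. open W \<and> x \<in> W \<and> W \<subseteq> dom c i \<and> holomorphic_fn W h \<and> (\<forall>y\<in>Edom c i \<inter> W. h y = 0) \<and>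
      (\<forall>\<epsilon>>0. \<exists>y\<in>ball x \<epsilon> \<inter> W. h y \<noteq> 0)"
  proof (intro exI[of _ W] exI[of _ "\<lambda>y. m c i y $ k - m c i x $ k"] conjI W xW)
    show WD: "W \<subseteq> dom c i" by (auto simp: W_def)
    show "holomorphic_fn W (\<lambda>y. m c i y $ k - m c i x $ k)"
      using holo_map_subset[OF m_holo[OF c] W WD] by (intro holomorphic_fn_diff holomorphic_fn_const W) (simp add: holo_map_def)
  qed (use EW k in auto)
next
  have small: "analytic_dim_le Z {p \<in> topspace (ctop Z). \<mu> p = s} 1" if "s \<in> SS" for s
    using res' that by (simp add: small_resolution_def)
  fix x V \<beta> d
  assume x: "x \<in> Edom c i" and V: "x \<in> V" "V \<subseteq> dom c i" and \<beta>: "holomorphic_fn V \<beta>" "frechet_derivative \<beta> (at x) d \<noteq> 0"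
  obtain p where p: "p \<in> fst c" "\<mu> p \<in> fst (tchart i)" "p \<in> EE" "x = snd c p"
    using x by (auto simp: Edom_def)
  have ptop: "p \<in> topspace (ctop Z)" by (rule chart_top[OF c p(1)])
  have pS: "\<mu> p \<in> SS" using p(3) by (simp add: EE_def)
  show "\<not> (\<forall>y\<in>V. (y \<in> Edom c i) = (\<beta> y = 0))"
  proof
    assume iff: "\<forall>y\<in>V. (y \<in> Edom c i) = (\<beta> y = 0)"
    define F where "F = snd (tchart i) ` (SS \<inter> fst (tchart i)) - {m c i x}"
    have finF: "finite F" using finite_SS by (simp add: F_def)
    define W where "W = dom c i \<inter> m c i -` (- F)"
    have W: "open W"
      unfolding W_def
      by (intro continuous_open_preimage holo_map_continuous[OF m_holo[OF c]] open_dom[OF c] open_Compl finite_imp_closed finF)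
    have xW: "x \<in> W" using subsetD[OF Edom_subset x] by (simp add: W_def F_def)
    have oVW: "open (V \<inter> W)" using W holomorphic_fn_open[OF \<beta>(1)] by auto
    have b: "holomorphic_fn (V \<inter> W) \<beta>" by (rule holomorphic_fn_subset[OF \<beta>(1) oVW]) auto
    have "x \<in> V \<inter> W" using V(1) xW by simp
    then obtain k U V' and \<phi> g :: "complex^3 \<Rightarrow> complex^3" where U: "open U" "x \<in> U" "U \<subseteq> V \<inter> W" "open V'"
      "homeomorphism U V' \<phi> g" "holo_map U \<phi>" "holo_map V' g" "\<And>y. \<phi> y $ k = \<beta> y"
      using submersion_chart[OF b _ \<beta>(2)] by metis
    define c1 where "c1 = ({q \<in> fst c. snd c q \<in> U}, \<phi> \<circ> snd c)"
    have "U \<subseteq> snd c ` fst c" using U(3) V(2) by (auto simp: dom_def local_dom_def)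
    then have c1: "c1 \<in> max_atlas Z"
      unfolding c1_def by (rule max_atlas_compose[OF c U(1) _ U(4-7) Z_atlas])
    have fib: "(q \<in> {q \<in> topspace (ctop Z). \<mu> q = \<mu> p}) = (\<forall>j\<in>- (- {k}). snd c1 q $ j = 0)" if "q \<in> fst c1" for q
    proof -
      have q: "q \<in> fst c" "snd c q \<in> U" using that by (auto simp: c1_def)
      then have qV: "snd c q \<in> V" "snd c q \<in> W" using U(3) by auto
      then have "snd c q \<in> dom c i" by (simp add: W_def)
      then have qi: "\<mu> q \<in> fst (tchart i)" using dom_mem[OF c q(1)] by simp
      have "(\<mu> q = \<mu> p) = (q \<in> EE)"
      proof
        assume "\<mu> q = \<mu> p" then show "q \<in> EE" using pS chart_top[OF c q(1)] by (simp add: EE_def)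
      next
        assume "q \<in> EE"
        then have "m c i (snd c q) \<in> snd (tchart i) ` (SS \<inter> fst (tchart i))"
          using qi by (auto simp: EE_def m_at[OF c] q)
        then have "m c i (snd c q) = m c i x" using qV(2) by (auto simp: W_def F_def)
        then have "snd (tchart i) (\<mu> q) = snd (tchart i) (\<mu> p)" by (simp add: m_at[OF c] q p)
        then show "\<mu> q = \<mu> p" using tchart_inj[of i] qi p(2) by (auto simp: inj_on_def)
      qed
      also have "(q \<in> EE) = (\<beta> (snd c q) = 0)"
        using iff qV(1) Edom_mem[OF c q(1) qi] by blast
      finally show ?thesis using chart_top[OF c q(1)] by (simp add: c1_def U(8))
    qed
    have "regular_point Z {q \<in> topspace (ctop Z). \<mu> q = \<mu> p} 2 p"
      unfolding regular_point_def
    proof (intro conjI bexI[of _ c1] exI[of _ "- {k}"] c1)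
      show "p \<in> fst c1" using p U(2) by (simp add: c1_def)
      show "card (- {k}) = 2" by (simp add: Compl_eq_Diff_UNIV card_Diff_singleton)
    qed (use ptop fib in auto)
    then show False using small[OF pS] unfolding analytic_dim_le_def by fastforce
  qed
qed

lemma holomorphic_vol4:
  assumes f: "holo_map S f"
  shows "holomorphic_fn S (\<lambda>x. vol4 w (frechet_derivative f (at x)))"
proof -
  have e: "holomorphic_fn S (\<lambda>x. frechet_derivative f (at x) (axis l 1) $ k)" for l k
  proof (rule holomorphic_fn_cong)
    show "holomorphic_fn S (\<lambda>x. frechet_derivative (\<lambda>x. f x $ k) (at x) (axis l 1))"
      using f by (intro holomorphic_fn_directional) (simp add: holo_map_def)
    fix x assume "x \<in> S"
    then have "f differentiable (at x)" using holo_map_has_derivative[OF f] differentiableI by blast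
    then show "frechet_derivative (\<lambda>x. f x $ k) (at x) (axis l 1) = frechet_derivative f (at x) (axis l 1) $ k"
      by (simp add: frechet_derivative_component)
  qed
  show ?thesis
    unfolding vol4_def det_4_from_0 vec4_nth
    by (intro holomorphic_fn_add holomorphic_fn_diff holomorphic_fn_mult holomorphic_fn_const e holo_map_open[OF f])
qed

lemma holomorphic_chart_grad:
  assumes f: "holo_map S f"
  shows "holomorphic_fn S (\<lambda>x. chart_grad a b q0 q1 q2 i (f x) w)"
proof -
  have "frechet_derivative (chart_eq a b q0 q1 q2 i) (at X) = chart_grad a b q0 q1 q2 i X" for X
    by (rule frechet_derivative_at[OF chart_eq_has_derivative, symmetric])
  moreover have "holomorphic_fn UNIV (\<lambda>X. frechet_derivative (chart_eq a b q0 q1 q2 i) (at X) w)"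
    by (rule holomorphic_fn_directional[OF holomorphic_chart_eq[OF open_UNIV]])
  ultimately have "holomorphic_fn UNIV (\<lambda>X. chart_grad a b q0 q1 q2 i X w)" by simp
  then show ?thesis by (rule holomorphic_fn_compose[OF _ f]) simp
qed

text \<open>The density of the pullback of the (twisted) Poincare residue of \<open>dX\<^sub>0 dX\<^sub>1 dX\<^sub>2 dX\<^sub>3 / G\<close>
  with respect to the coordinate volume form, where \<open>G = 0\<close> is the equation of the double solid.\<close>

theorem volume_density:
  assumes c: "c \<in> max_atlas Z"
  obtains J where "holomorphic_fn (dom c i) J" "\<And>x. x \<in> dom c i \<Longrightarrow> J x \<noteq> 0"
    "\<And>x v. x \<in> dom c i - Edom c i \<Longrightarrow>
      vol4 v (frechet_derivative (m c i) (at x)) = J x * chart_grad a b q0 q1 q2 i (m c i x) v"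
proof -
  let ?D = "\<lambda>x. frechet_derivative (m c i) (at x)"
  let ?g = "\<lambda>x. chart_grad a b q0 q1 q2 i (m c i x)"
  have gr: "\<exists>w. ?g x w \<noteq> 0" if x: "x \<in> dom c i - Edom c i" for x
  proof -
    obtain p where p: "p \<in> fst c" "\<mu> p \<in> fst (tchart i)" "x = snd c p"
      using x by (auto elim: dom_cases)
    then have "p \<notin> EE" using x Edom_mem[OF c] by auto
    then have "\<mu> p \<in> XX - SS" using mu_in[OF chart_top[OF c p(1)]] chart_top[OF c p(1)] by (simp add: EE_def)
    then obtain w where "chart_grad a b q0 q1 q2 i (snd (tchart i) (\<mu> p)) w \<noteq> 0" using chart_grad_nonzero p(2) by metis
    then show ?thesis using p m_at[OF c p(1)] by auto
  qed
  have ex: "\<exists>J. J \<noteq> 0 \<and> (\<forall>v. vol4 v (?D x) = J * ?g x v)" if x: "x \<in> dom c i - Edom c i" for x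
  proof -
    obtain p where p: "p \<in> fst c" "\<mu> p \<in> fst (tchart i)" "x = snd c p"
      using x by (auto elim: dom_cases)
    then have pE: "p \<notin> EE" using x Edom_mem[OF c] by auto
    obtain w where w: "?g x w \<noteq> 0" using gr[OF x] by blast
    have xd: "x \<in> dom c i" using x by simp
    have dm: "(m c i has_derivative ?D x) (at x)" by (rule holo_map_has_derivative[OF m_holo[OF c] xd])
    have "((\<lambda>x. chart_eq a b q0 q1 q2 i (m c i x)) has_derivative (\<lambda>v. ?g x (?D x v))) (at x)"
      by (rule has_derivative_compose[OF dm chart_eq_has_derivative])
    moreover have "((\<lambda>x. chart_eq a b q0 q1 q2 i (m c i x)) has_derivative (\<lambda>v. 0)) (at x)"
      by (rule has_derivative_transform_within_open[OF has_derivative_const open_dom[OF c] xd])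
        (simp add: chart_eq_m[OF c])
    ultimately have ker: "?g x (?D x v) = 0" for v
      using has_derivative_unique by (metis (no_types, lifting))
    show ?thesis
      by (rule volume_proportional[OF chart_grad_linear w has_derivative_linear[OF dm]
          holo_map_derivative_linear[OF m_holo[OF c] xd] m_immersion[OF c p(1) pE p(2), folded p(3)] ker]) (assumption, intro exI conjI allI, assumption, simp)
  qed
  define J0 where "J0 x = (SOME J. J \<noteq> 0 \<and> (\<forall>v. vol4 v (?D x) = J * ?g x v))" for x
  have J0: "J0 x \<noteq> 0 \<and> (\<forall>v. vol4 v (?D x) = J0 x * ?g x v)" if "x \<in> dom c i - Edom c i" for x
    unfolding J0_def by (rule someI_ex[OF ex[OF that]])
  have oDE: "open (dom c i - Edom c i)"
  proof -
    have 1: "openin (ctop Z) (fst c \<inter> (topspace (ctop Z) - EE) \<inter> {p \<in> topspace (ctop Z). \<mu> p \<in> fst (tchart i)})"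
      by (intro openin_Int open_complement_EE openin_mu is_chart_open_domain is_chart_tchart max_atlas_is_chart[OF c])
    have "dom c i - Edom c i = snd c ` (fst c \<inter> (topspace (ctop Z) - EE) \<inter> {p \<in> topspace (ctop Z). \<mu> p \<in> fst (tchart i)})"
      using chart_top[OF c] Edom_mem[OF c] by (auto simp: dom_def local_dom_def)
    then show ?thesis using is_chart_open_image[OF max_atlas_is_chart[OF c] 1] by auto
  qed
  \<comment> \<open>For a fixed vector \<open>w\<close> the pointwise choice is locally the quotient
    of two holomorphic functions.\<close>
  have hJ: "holomorphic_fn (dom c i - Edom c i) J0"
  proof (rule holomorphic_fn_local)
    fix x assume x: "x \<in> dom c i - Edom c i"
    obtain w where w: "?g x w \<noteq> 0" using gr[OF x] by blast
    have hm: "holo_map (dom c i - Edom c i) (m c i)" by (rule holo_map_subset[OF m_holo[OF c] oDE]) auto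
    define T where "T = (dom c i - Edom c i) \<inter> (\<lambda>x. ?g x w) -` (- {0})"
    have oT: "open T"
      unfolding T_def by (intro continuous_open_preimage holomorphic_fn_continuous[OF holomorphic_chart_grad[OF hm]] oDE) auto
    have hmT: "holo_map T (m c i)" by (rule holo_map_subset[OF hm oT]) (auto simp: T_def)
    have "holomorphic_fn T (\<lambda>x. vol4 w (?D x) / ?g x w)"
      by (intro holomorphic_fn_divide holomorphic_vol4 holomorphic_chart_grad hmT) (auto simp: T_def)
    moreover have "J0 y = vol4 w (?D y) / ?g y w" if "y \<in> T" for y
      using J0[of y] that by (simp add: T_def)
    ultimately show "\<exists>T g. x \<in> T \<and> T \<subseteq> dom c i - Edom c i \<and> holomorphic_fn T g \<and> (\<forall>y\<in>T. J0 y = g y)"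
      using x w by (intro exI[of _ T] exI[of _ "\<lambda>x. vol4 w (?D x) / ?g x w"]) (auto simp: T_def)
  qed
  obtain J where J: "holomorphic_fn (dom c i) J" "\<And>x. x \<in> dom c i - Edom c i \<Longrightarrow> J x = J0 x" "\<And>x. x \<in> dom c i \<Longrightarrow> J x \<noteq> 0"
    using hartogs_extension_nonvanishing[OF hJ open_dom[OF c] _ thin_Edom[OF c]] J0 by metis
  show ?thesis by (rule that[OF J(1,3)]) (use J(2) J0 in auto)
qed

end

section \<open>Transition rules of the density\<close>

context resolution
begin

definition J :: "('a, 3) chart \<Rightarrow> 4 \<Rightarrow> complex^3 \<Rightarrow> complex" where
  "J c i = (SOME J. holomorphic_fn (dom c i) J \<and> (\<forall>x\<in>dom c i. J x \<noteq> 0) \<and> (\<forall>x\<in>dom c i - Edom c i. \<forall>v.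
      vol4 v (frechet_derivative (m c i) (at x)) = J x * chart_grad a b q0 q1 q2 i (m c i x) v))"

lemma J:
  assumes c: "c \<in> max_atlas Z"
  shows "holomorphic_fn (dom c i) (J c i)" "\<And>x. x \<in> dom c i \<Longrightarrow> J c i x \<noteq> 0"
    "\<And>x v. x \<in> dom c i - Edom c i \<Longrightarrow>
      vol4 v (frechet_derivative (m c i) (at x)) = J c i x * chart_grad a b q0 q1 q2 i (m c i x) v"
proof -
  let ?P = "\<lambda>J. holomorphic_fn (dom c i) J \<and> (\<forall>x\<in>dom c i. J x \<noteq> 0) \<and> (\<forall>x\<in>dom c i - Edom c i. \<forall>v.
      vol4 v (frechet_derivative (m c i) (at x)) = J x * chart_grad a b q0 q1 q2 i (m c i x) v)"
  obtain K where "holomorphic_fn (dom c i) K" "\<And>x. x \<in> dom c i \<Longrightarrow> K x \<noteq> 0"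
    "\<And>x v. x \<in> dom c i - Edom c i \<Longrightarrow>
      vol4 v (frechet_derivative (m c i) (at x)) = K x * chart_grad a b q0 q1 q2 i (m c i x) v"
    by (fact volume_density[OF c])
  then have "?P K" by simp
  then have *: "?P (J c i)" unfolding J_def by (rule someI[of ?P])
  show "holomorphic_fn (dom c i) (J c i)" "\<And>x. x \<in> dom c i \<Longrightarrow> J c i x \<noteq> 0" using * by auto
  show "\<And>x v. x \<in> dom c i - Edom c i \<Longrightarrow>
      vol4 v (frechet_derivative (m c i) (at x)) = J c i x * chart_grad a b q0 q1 q2 i (m c i x) v"
    using * by blast
qed

text \<open>Identities known where \<mu> is an immersion carry over by continuity, because the
  complement of the exceptional set is dense.\<close>

lemma agree_off_Edom:
  assumes c: "c \<in> max_atlas Z" and T: "open T" "T \<subseteq> dom c i"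
    and A: "holomorphic_fn T A" and B: "holomorphic_fn T B"
    and eq: "\<And>x. x \<in> T \<Longrightarrow> x \<notin> Edom c i \<Longrightarrow> A x = B x" and x: "x \<in> T"
  shows "A x = B x"
proof (rule ccontr)
  assume ne: "A x \<noteq> B x"
  define V where "V = T \<inter> (\<lambda>x. A x - B x) -` (- {0})"
  have "open V"
    unfolding V_def
    by (intro continuous_open_preimage holomorphic_fn_continuous[OF holomorphic_fn_diff[OF A B]] T) auto
  moreover have "x \<in> V" using ne x by (simp add: V_def)
  moreover have "x \<in> dom c i" using x T by blast
  ultimately obtain z where "z \<in> V" "z \<in> dom c i - Edom c i" using thin_subset_dense[OF thin_Edom[OF c]] by metis
  then show False using eq[of z] by (simp add: V_def)
qed

lemma grad_m_nonzero:
  assumes c: "c \<in> max_atlas Z" and x: "x \<in> dom c i - Edom c i"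
  obtains w where "chart_grad a b q0 q1 q2 i (m c i x) w \<noteq> 0"
proof -
  obtain p where p: "p \<in> fst c" "\<mu> p \<in> fst (tchart i)" "x = snd c p"
    using x by (auto elim: dom_cases)
  then have "p \<notin> EE" using x Edom_mem[OF c] by auto
  then have "\<mu> p \<in> XX - SS" using mu_in[OF chart_top[OF c p(1)]] chart_top[OF c p(1)] by (simp add: EE_def)
  then obtain w where "chart_grad a b q0 q1 q2 i (snd (tchart i) (\<mu> p)) w \<noteq> 0" using chart_grad_nonzero p(2) by metis
  then show ?thesis using that p m_at[OF c p(1)] by auto
qed

definition jac :: "('a, 3) chart \<Rightarrow> ('a, 3) chart \<Rightarrow> complex^3 \<Rightarrow> complex^3^3" where
  "jac c c' x = (\<chi> k l. frechet_derivative (local_rep c c' id) (at x) (axis l 1) $ k)"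

lemma transition_holo:
  "c \<in> max_atlas Z \<Longrightarrow> c' \<in> max_atlas Z \<Longrightarrow> holo_map (local_dom c c' id) (local_rep c c' id)"
  by (rule max_atlas_compatible[OF Z_atlas])

lemma frechet_entry_holomorphic:
  assumes f: "holo_map S f"
  shows "holomorphic_fn S (\<lambda>x. frechet_derivative f (at x) w $ k)"
proof (rule holomorphic_fn_cong)
  show "holomorphic_fn S (\<lambda>x. frechet_derivative (\<lambda>x. f x $ k) (at x) w)"
    using f by (intro holomorphic_fn_directional) (simp add: holo_map_def)
  fix x assume "x \<in> S"
  then have "f differentiable (at x)" using holo_map_has_derivative[OF f] differentiableI by blast
  then show "frechet_derivative (\<lambda>x. f x $ k) (at x) w = frechet_derivative f (at x) w $ k"
    by (simp add: frechet_derivative_component)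
qed

text \<open>The chain rule for \<open>vol4\<close> off the exceptional set; both sides are
  holomorphic, so the rule persists across it.\<close>

lemma J_chart_change:
  assumes c: "c \<in> max_atlas Z" and c': "c' \<in> max_atlas Z"
    and p: "p \<in> fst c" "p \<in> fst c'" "\<mu> p \<in> fst (tchart i)"
  shows "J c i (snd c p) = J c' i (snd c' p) * det (jac c c' (snd c p))"
proof -
  define V where "V = fst c \<inter> fst c' \<inter> {p \<in> topspace (ctop Z). \<mu> p \<in> fst (tchart i)}"
  define T where "T = snd c ` V"
  define t where "t = local_rep c c' id"
  have oV: "openin (ctop Z) V"
    unfolding V_def
    by (intro openin_Int openin_mu is_chart_open_domain is_chart_tchart max_atlas_is_chart[OF c] max_atlas_is_chart[OF c'])
  have oT: "open T" unfolding T_def by (rule is_chart_open_image[OF max_atlas_is_chart[OF c] oV]) (auto simp: V_def)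
  have TD: "T \<subseteq> dom c i" using c by (auto simp: T_def V_def dom_mem)
  have t_at: "t (snd c q) = snd c' q" if "q \<in> fst c" for q
    unfolding t_def by (simp add: local_rep_chart[OF max_atlas_inj[OF c] that])
  have tT: "holo_map T t"
    unfolding t_def by (rule holo_map_subset[OF transition_holo[OF c c'] oT]) (auto simp: T_def V_def local_dom_def)
  have tD: "t ` T \<subseteq> dom c' i" using c' by (auto simp: T_def V_def t_at dom_mem)
  have mt: "m c i x = m c' i (t x)" if "x \<in> T" for x
    using that c c' by (auto simp: T_def V_def t_at m_at)
  have hA: "holomorphic_fn T (J c i)" by (rule holomorphic_fn_subset[OF J(1)[OF c] oT TD])
  have hB: "holomorphic_fn T (\<lambda>x. J c' i (t x) * det (jac c c' x))"
  proof (rule holomorphic_fn_mult)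
    show "holomorphic_fn T (\<lambda>x. J c' i (t x))" by (rule holomorphic_fn_compose[OF J(1)[OF c'] tT tD])
    have e: "holomorphic_fn T (\<lambda>x. jac c c' x $ k $ l)" for k l
      using frechet_entry_holomorphic[OF tT] by (simp add: jac_def t_def)
    show "holomorphic_fn T (\<lambda>x. det (jac c c' x))"
      unfolding det_3_from_0 by (intro holomorphic_fn_add holomorphic_fn_diff holomorphic_fn_mult e)
  qed
  have "J c i x = J c' i (t x) * det (jac c c' x)" if x: "x \<in> T" "x \<notin> Edom c i" for x
  proof -
    obtain q where q: "q \<in> V" "x = snd c q" using x by (auto simp: T_def)
    have qE: "q \<notin> EE" using x(2) q Edom_mem[OF c] by (auto simp: V_def)
    have tE: "t x \<in> dom c' i - Edom c' i"
      using q qE c' Edom_mem[OF c'] by (auto simp: t_at V_def dom_mem)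
    have xE: "x \<in> dom c i - Edom c i" using x TD by blast
    obtain w where w: "chart_grad a b q0 q1 q2 i (m c i x) w \<noteq> 0" using grad_m_nonzero[OF c xE] by blast
    have dt: "(t has_derivative frechet_derivative t (at x)) (at x)" by (rule holo_map_has_derivative[OF tT x(1)])
    have tx: "t x \<in> dom c' i" using tE by simp
    have dm: "(m c' i has_derivative frechet_derivative (m c' i) (at (t x))) (at (t x))"
      by (rule holo_map_has_derivative[OF m_holo[OF c'] tx])
    have "(m c i has_derivative (\<lambda>v. frechet_derivative (m c' i) (at (t x)) (frechet_derivative t (at x) v))) (at x)"
      by (rule has_derivative_transform_within_open[OF has_derivative_compose[OF dt dm] oT x(1)]) (simp add: mt)
    then have fd: "frechet_derivative (m c i) (at x) = (\<lambda>v. frechet_derivative (m c' i) (at (t x)) (frechet_derivative t (at x) v))"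
      by (rule frechet_derivative_at[symmetric])
    have "J c i x * chart_grad a b q0 q1 q2 i (m c i x) w = vol4 w (frechet_derivative (m c i) (at x))"
      using J(3)[OF c xE] by simp
    also have "\<dots> = det (jac c c' x) * vol4 w (frechet_derivative (m c' i) (at (t x)))"
      unfolding fd using vol4_compose_right[OF has_derivative_linear[OF dm] holo_map_derivative_linear[OF m_holo[OF c'] tx],
          of w "frechet_derivative t (at x)"]
      by (simp add: jac_def t_def)
    also have "\<dots> = det (jac c c' x) * (J c' i (t x) * chart_grad a b q0 q1 q2 i (m c i x) w)"
      using J(3)[OF c' tE] mt[OF x(1)] by simp
    finally show ?thesis using w by simp
  qed
  from agree_off_Edom[OF c oT TD hA hB this]
  have "J c i (snd c p) = J c' i (t (snd c p)) * det (jac c c' (snd c p))"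
    using p chart_top[OF c p(1)] by (auto simp: T_def V_def)
  then show ?thesis by (simp add: t_at p)
qed

lemma m_patch_change:
  assumes c: "c \<in> max_atlas Z" and x: "x \<in> dom c i" "x \<in> dom c j"
  shows "m c j x = tcoord j (tlift i (m c i x), m c i x $ i)" "tlift i (m c i x) $ j \<noteq> 0"
proof -
  obtain p where p: "p \<in> fst c" "x = snd c p" "\<mu> p \<in> fst (tchart i)" "\<mu> p \<in> fst (tchart j)"
    using x c by (metis dom_cases dom_mem)
  have mi: "m c i x = snd (tchart i) (\<mu> p)" "m c j x = snd (tchart j) (\<mu> p)" by (simp_all add: p m_at[OF c])
  have "\<mu> p = pt_O2 (tlift i (m c i x), m c i x $ i)" using tchart_image[OF p(3)] mi by simp
  then show "m c j x = tcoord j (tlift i (m c i x), m c i x $ i)" "tlift i (m c i x) $ j \<noteq> 0"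
    using mi(2) p(4) by (simp_all add: tchart_coord pt_O2_mem_tchart)
qed

text \<open>The ambient Jacobian contributes the power -6 of X_j and the gradient of the equation
  the power -4; the difference is the reason why the reciprocal of \<open>J\<close> pairs with
  quadratic monomials.\<close>

lemma J_patch_change:
  assumes c: "c \<in> max_atlas Z" and x: "x \<in> dom c i" "x \<in> dom c j" and ij: "i \<noteq> j"
  shows "J c j x = J c i x / (m c i x $ j)^2"
proof -
  define T where "T = dom c i \<inter> dom c j"
  have oT: "open T" unfolding T_def using open_dom[OF c] by auto
  have TD: "T \<subseteq> dom c i" by (auto simp: T_def)
  have Xj: "m c i x $ j \<noteq> 0" if "x \<in> T" for x
    using m_patch_change(2)[OF c, of x i j] that ij by (auto simp: T_def tlift_def)
  have hm: "holo_map T (m c i)" by (rule holo_map_subset[OF m_holo[OF c] oT TD])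
  have hA: "holomorphic_fn T (J c j)" by (rule holomorphic_fn_subset[OF J(1)[OF c] oT]) (simp add: T_def)
  have hB: "holomorphic_fn T (\<lambda>x. J c i x / (m c i x $ j)^2)"
    by (intro holomorphic_fn_divide holomorphic_fn_power holomorphic_fn_subset[OF J(1)[OF c] oT TD])
      (use hm Xj in \<open>auto simp: holo_map_def\<close>)
  have "J c j x = J c i x / (m c i x $ j)^2" if x: "x \<in> T" "x \<notin> Edom c i" for x
  proof -
    obtain p where p: "p \<in> fst c" "x = snd c p" "\<mu> p \<in> fst (tchart i)" "\<mu> p \<in> fst (tchart j)"
      using x c unfolding T_def by (metis IntE dom_cases dom_mem)
    have xE: "x \<in> dom c i - Edom c i" "x \<in> dom c j - Edom c j"
      using x p Edom_mem[OF c] by (auto simp: T_def)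
    have xd: "x \<in> dom c i" "x \<in> dom c j" using xE by auto
    define X where "X = m c i x"
    have X: "X $ j \<noteq> 0" "chart_eq a b q0 q1 q2 i X = 0"
      using Xj[OF x(1)] chart_eq_m[OF c xd(1)] by (simp_all add: X_def)
    obtain w where w: "chart_grad a b q0 q1 q2 i X w \<noteq> 0" using grad_m_nonzero[OF c xE(1)] by (auto simp: X_def)
    have dm: "(m c i has_derivative frechet_derivative (m c i) (at x)) (at x)"
      by (rule holo_map_has_derivative[OF m_holo[OF c] xd(1)])
    have "(m c j has_derivative (\<lambda>v. chart_change i j X *v frechet_derivative (m c i) (at x) v)) (at x)"
      by (rule has_derivative_transform_within_open[OF has_derivative_compose[OF dm chart_change_has_derivative[OF ij X(1)[unfolded X_def]], folded X_def] oT x(1)])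
        (simp add: m_patch_change(1)[OF c, of _ i j, symmetric] T_def)
    then have fd: "frechet_derivative (m c j) (at x) = (\<lambda>v. chart_change i j X *v frechet_derivative (m c i) (at x) v)"
      by (rule frechet_derivative_at[symmetric])
    have mj: "m c j x = tcoord j (tlift i X, X $ i)" using m_patch_change(1)[OF c xd] by (simp add: X_def)
    have "J c j x * (chart_grad a b q0 q1 q2 i X w / (X $ j)^4) = J c j x * chart_grad a b q0 q1 q2 j (m c j x) (chart_change i j X *v w)"
      unfolding mj chart_grad_change[OF ij X] ..
    also have "\<dots> = vol4 (chart_change i j X *v w) (frechet_derivative (m c j) (at x))"
      using J(3)[OF c xE(2)] by simp
    also have "\<dots> = 1 / (X $ j)^6 * vol4 w (frechet_derivative (m c i) (at x))"
      unfolding fd vol4_compose_left det_chart_change[OF ij X(1)] ..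
    also have "\<dots> = 1 / (X $ j)^6 * (J c i x * chart_grad a b q0 q1 q2 i X w)"
      using J(3)[OF c xE(1)] by (simp add: X_def)
    also have "\<dots> = J c i x * (chart_grad a b q0 q1 q2 i X w / (X $ j)^6)" by simp
    also have "chart_grad a b q0 q1 q2 i X w / (X $ j)^4 = (X $ j)^2 * (chart_grad a b q0 q1 q2 i X w / (X $ j)^6)"
      using X(1) by (simp add: field_simps eval_nat_numeral)
    finally have "(J c j x * (X $ j)^2) * (chart_grad a b q0 q1 q2 i X w / (X $ j)^6) = J c i x * (chart_grad a b q0 q1 q2 i X w / (X $ j)^6)"
      by (simp only: mult.assoc)
    then have "J c j x * (X $ j)^2 = J c i x" using w X(1) by (simp only: mult_cancel_right) simp
    then show ?thesis using X(1) by (simp add: X_def[symmetric] eq_divide_eq)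
  qed
  from agree_off_Edom[OF c oT TD hA hB this] show ?thesis using x by (simp add: T_def)
qed

text \<open>The inverse of the volume density, a section of \<open>K\<^sup>-\<^sup>1\<close> with values in \<open>O(2)\<close>, paired with
  the monomials \<open>y\<^sub>r y\<^sub>s\<close>.\<close>

definition sym :: "('a, 3) chart \<Rightarrow> 'a \<Rightarrow> 4 \<Rightarrow> 4 \<Rightarrow> complex" where
  "sym c p r s = (let i = (SOME i. \<mu> p \<in> fst (tchart i)); y = tlift i (m c i (snd c p)) in y $ r * y $ s / J c i (snd c p))"

text \<open>A change of patch divides the homogeneous coordinates by X_j and the density by its
  square, so the patch picked by \<open>SOME\<close> does not matter.\<close>

lemma sym_eq:
  assumes c: "c \<in> max_atlas Z" and p: "p \<in> fst c" "\<mu> p \<in> fst (tchart i)"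
  shows "sym c p r s = tlift i (m c i (snd c p)) $ r * tlift i (m c i (snd c p)) $ s / J c i (snd c p)"
proof -
  define j where "j = (SOME i. \<mu> p \<in> fst (tchart i))"
  have j: "\<mu> p \<in> fst (tchart j)" unfolding j_def by (rule someI[of "\<lambda>i. \<mu> p \<in> fst (tchart i)", OF p(2)])
  define X where "X = m c i (snd c p)"
  have e: "sym c p r s = tlift j (m c j (snd c p)) $ r * tlift j (m c j (snd c p)) $ s / J c j (snd c p)"
    by (simp add: sym_def j_def Let_def)
  show ?thesis
  proof (cases "i = j")
    case False
    have x: "snd c p \<in> dom c i" "snd c p \<in> dom c j" using dom_mem[OF c p(1)] p(2) j by auto
    have nz: "tlift i X $ j \<noteq> 0" using m_patch_change(2)[OF c x] by (simp add: X_def)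
    then have Xj: "X $ j \<noteq> 0" using False by (simp add: tlift_def)
    have "tlift j (m c j (snd c p)) = (1 / X $ j) *s tlift i X"
      unfolding m_patch_change(1)[OF c x] X_def[symmetric] using False Xj
      by (auto simp: vec_eq_iff tlift_def tcoord_def)
    then show ?thesis
      unfolding e J_patch_change[OF c x False] X_def[symmetric] using Xj
      by (simp add: field_simps power2_eq_square)
  qed (simp add: e)
qed

lemma sym_chart_change:
  assumes c: "c \<in> max_atlas Z" and c': "c' \<in> max_atlas Z" and p: "p \<in> fst c" "p \<in> fst c'"
  shows "sym c' p r s = sym c p r s * det (jac c c' (snd c p))"
proof -
  obtain i where i: "\<mu> p \<in> fst (tchart i)" using tchart_cover[OF mu_top[OF chart_top[OF c p(1)]]] by blast
  have x: "snd c p \<in> dom c i" "snd c' p \<in> dom c' i" using i p c c' by (auto simp: dom_mem)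
  have "m c i (snd c p) = m c' i (snd c' p)" by (simp add: m_at c c' p)
  then show ?thesis
    unfolding sym_eq[OF c p(1) i] sym_eq[OF c' p(2) i] J_chart_change[OF c c' p i]
    using J(2)[OF c' x(2)] J(2)[OF c x(1)] J_chart_change[OF c c' p i] by (auto simp: field_simps)
qed

end

section \<open>Coordinates on the projective line\<close>

lemma UNIV_2_from_0: "(UNIV :: 2 set) = {0, 1}"
proof -
  have "(2::2) = 0" by simp
  then show ?thesis unfolding UNIV_2 by auto
qed

lemma two_cases: "(k::2) = 0 \<or> k = 1"
  using UNIV_2_from_0 by blast

lemma det_2_from_0: "det (A::complex^2^2) = A$0$0 * A$1$1 - A$0$1 * A$1$0"
proof -
  have two: "(2::2) = 0" by simp
  show ?thesis unfolding det_2 two by (simp add: algebra_simps)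
qed

definition ppt :: "2 \<Rightarrow> complex \<Rightarrow> complex^2" where
  "ppt k u = (\<chi> i. if i = k then 1 else u)"

definition pchart :: "2 \<Rightarrow> ((complex^2) set, 1) chart" where
  "pchart k = (affine_patch k, \<lambda>P. \<chi> _. ratio (1 - k) k P)"

lemma pchart_charts: "pchart k \<in> charts proj_line"
  by (auto simp: proj_line_def pchart_def)

lemma pt_self: "y \<in> pt y"
  unfolding pt_def by (auto intro!: exI[of _ 1])

lemma pt_eq_iff: "pt x = pt y \<longleftrightarrow> (\<exists>c. c \<noteq> 0 \<and> y = c *s x)"
proof
  assume "pt x = pt y"
  then have "y \<in> pt x" using pt_self by blast
  then show "\<exists>c. c \<noteq> 0 \<and> y = c *s x" by (auto simp: pt_def)
next
  assume "\<exists>c. c \<noteq> 0 \<and> y = c *s x"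
  then obtain c where c: "c \<noteq> 0" "y = c *s x" by blast
  show "pt x = pt y"
    unfolding pt_def
  proof (intro set_eqI iffI)
    fix v assume "v \<in> {k *s x |k. k \<noteq> 0}"
    then obtain k where "k \<noteq> 0" "v = k *s x" by auto
    then show "v \<in> {k *s y |k. k \<noteq> 0}" using c by (intro CollectI exI[of _ "k / c"]) auto
  next
    fix v assume "v \<in> {k *s y |k. k \<noteq> 0}"
    then obtain k where "k \<noteq> 0" "v = k *s y" by auto
    then show "v \<in> {k *s x |k. k \<noteq> 0}" using c by (intro CollectI exI[of _ "k * c"]) auto
  qed
qed

lemma one_minus_2: "(1::2) - k \<noteq> k"
  using two_cases[of k] by auto

lemma ratio_ppt: "ratio (1 - k) k (pt (ppt k u)) = u"
  by (simp add: ratio_pt ppt_def one_minus_2)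

lemma pt_ppt: "y $ k \<noteq> 0 \<Longrightarrow> pt y = pt (ppt k (y $ (1 - k) / y $ k))"
  unfolding pt_eq_iff
proof (intro exI[of _ "1 / y $ k"] conjI)
  assume y: "y $ k \<noteq> 0"
  show "ppt k (y $ (1 - k) / y $ k) = (1 / y $ k) *s y"
    unfolding vec_eq_iff
  proof
    fix i show "ppt k (y $ (1 - k) / y $ k) $ i = ((1 / y $ k) *s y) $ i"
      using two_cases[of i] two_cases[of k] y by (auto simp: ppt_def)
  qed
qed simp

lemma affine_patch_eq: "affine_patch k = range (\<lambda>u. pt (ppt k u))"
proof
  show "affine_patch k \<subseteq> range (\<lambda>u. pt (ppt k u))"
    unfolding affine_patch_def using pt_ppt by blast
  show "range (\<lambda>u. pt (ppt k u)) \<subseteq> affine_patch k"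
    unfolding affine_patch_def by (auto simp: ppt_def)
qed

lemma pchart_at: "snd (pchart k) (pt (ppt k u)) = (\<chi> _. u)"
  by (simp add: pchart_def ratio_ppt)

lemma pchart_inj: "inj_on (snd (pchart k)) (fst (pchart k))"
  by (auto simp: inj_on_def pchart_def affine_patch_eq ratio_ppt vec_eq_iff)

lemma pchart_mem: "pt (ppt k u) \<in> fst (pchart k)"
  by (simp add: pchart_def affine_patch_eq)

lemma topspace_proj_line: "topspace (ctop proj_line) = pt ` (- {0})"
  using quotient_map_quotient_topology[of "top_of_set (- {0::complex^2})" pt]
  by (simp add: quotient_map_def proj_line_def)

lemma ppt_nonzero: "ppt k u \<noteq> 0"
proof
  assume "ppt k u = 0"
  then have "ppt k u $ k = 0" by simp
  then show False by (simp add: ppt_def)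
qed

section \<open>The rational curve\<close>

locale curve = resolution +
  fixes L :: "'a set" and \<iota> :: "(complex^2) set \<Rightarrow> 'a"
  assumes src: "smooth_rational_curve Z \<iota> L"
    and iso: "bundle_isomorphic proj_line
          (pullback_bundle proj_line \<iota>
             (normal_bundle Z L :: (('a, 3) chart \<times> (2 \<Rightarrow> 3), 'a, 2) cocycle)) O1_sum"
begin

definition lam :: "2 \<Rightarrow> complex \<Rightarrow> 'a" where "lam k u = \<iota> (pt (ppt k u))"

text \<open>In the chart, \<open>L\<close> is the coordinate axis \<tau>; the numbering \<nu> of the
  two normal coordinates makes \<open>(c, \<nu>)\<close> an index of the normal bundle.\<close>

definition adapted :: "('a, 3) chart \<Rightarrow> 3 \<Rightarrow> (2 \<Rightarrow> 3) \<Rightarrow> bool" where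
  "adapted c \<tau> \<nu> \<longleftrightarrow> c \<in> max_atlas Z \<and> inj \<nu> \<and> range \<nu> = - {\<tau>} \<and>
     (\<forall>q\<in>fst c. q \<in> L \<longleftrightarrow> (\<forall>l. snd c q $ \<nu> l = 0))"

lemma L_top: "L \<subseteq> topspace (ctop Z)"
  using src by (simp add: smooth_rational_curve_def closed_submanifold_def closedin_subset)

lemma adapted_exists:
  assumes "p \<in> L" obtains c \<tau> \<nu> where "adapted c \<tau> \<nu>" "p \<in> fst c"
proof -
  have "regular_point Z L 1 p" using src assms by (simp add: smooth_rational_curve_def closed_submanifold_def)
  then obtain c K where c: "c \<in> max_atlas Z" "p \<in> fst c" "card K = 1"
    "\<forall>q\<in>fst c. q \<in> L \<longleftrightarrow> (\<forall>j\<in>-K. snd c q $ j = 0)"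
    unfolding regular_point_def by blast
  then obtain \<tau> where \<tau>: "K = {\<tau>}" by (metis card_1_singletonE)
  have "card (UNIV :: 2 set) = card (- {\<tau>})" by (simp add: Compl_eq_Diff_UNIV card_Diff_singleton)
  then obtain \<nu> :: "2 \<Rightarrow> 3" where "bij_betw \<nu> UNIV (- {\<tau>})"
    using finite_same_card_bij[of "UNIV :: 2 set" "- {\<tau>}"] by auto
  then have \<nu>: "inj \<nu>" "range \<nu> = - {\<tau>}" by (auto simp: bij_betw_def)
  have "adapted c \<tau> \<nu>"
    unfolding adapted_def using c \<tau> \<nu> by (metis (no_types, lifting) imageE rangeI)
  then show ?thesis using that c(2) by blast
qed

lemma iota_bij: "bij_betw \<iota> (pt ` (- {0})) L"
proof -
  have "bij_betw \<iota> (topspace (ctop proj_line)) (topspace (ctop (induced Z L :: ('a, 1) complex_space)))"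
    using src by (simp add: smooth_rational_curve_def biholomorphic_map_def)
  moreover have "topspace (ctop (induced Z L :: ('a, 1) complex_space)) = L"
    using L_top by (auto simp: induced_def)
  ultimately show ?thesis by (simp add: topspace_proj_line)
qed

lemma ppt_top: "pt (ppt k u) \<in> pt ` (- {0})"
  by (simp add: ppt_nonzero)

lemma lam_L: "lam k u \<in> L"
  unfolding lam_def using iota_bij ppt_top by (auto simp: bij_betw_def)

text \<open>The chart of \<open>induced Z L\<close>, as a one-dimensional manifold, that an adapted
  chart cuts out.\<close>

definition flat_chart :: "('a, 3) chart \<Rightarrow> 3 \<Rightarrow> ('a, 1) chart" where
  "flat_chart c \<tau> = (fst c \<inter> L, \<lambda>p. \<chi> k. snd c p $ \<tau>)"

lemma flat_chart_charts:
  assumes "adapted c \<tau> \<nu>"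
  shows "flat_chart c \<tau> \<in> charts (induced Z L :: ('a, 1) complex_space)"
proof -
  define e :: "1 \<Rightarrow> 3" where "e = (\<lambda>_. \<tau>)"
  have "\<forall>x::1. x = 1" unfolding forall_1 by simp
  then have e: "inj e" by (metis injI)
  have r: "- range e = range \<nu>" using assms by (auto simp: e_def adapted_def)
  have "\<forall>q\<in>fst c. q \<in> L \<longleftrightarrow> (\<forall>j\<in>- range e. snd c q $ j = 0)"
    unfolding r using assms unfolding adapted_def by blast
  moreover have "flat_chart c \<tau> = (fst c \<inter> L, \<lambda>p. \<chi> k. snd c p $ e k)" by (simp add: flat_chart_def e_def)
  moreover have "c \<in> max_atlas Z" using assms by (simp add: adapted_def)
  ultimately have "\<exists>c' e. flat_chart c \<tau> = (fst c' \<inter> L, \<lambda>p. \<chi> k. snd c' p $ e k) \<and> c' \<in> max_atlas Z \<and> inj e \<and>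
        (\<forall>q\<in>fst c'. q \<in> L \<longleftrightarrow> (\<forall>j\<in>-range e. snd c' q $ j = 0))"
    using e by blast
  then show ?thesis by (simp add: induced_def)
qed

lemma flat_chart_inj:
  assumes "adapted c \<tau> \<nu>" shows "inj_on (snd (flat_chart c \<tau>)) (fst (flat_chart c \<tau>))"
proof (rule inj_onI)
  fix p q assume pq: "p \<in> fst (flat_chart c \<tau>)" "q \<in> fst (flat_chart c \<tau>)" "snd (flat_chart c \<tau>) p = snd (flat_chart c \<tau>) q"
  then have L: "p \<in> fst c" "q \<in> fst c" "p \<in> L" "q \<in> L" "snd c p $ \<tau> = snd c q $ \<tau>"
    by (auto simp: flat_chart_def vec_eq_iff)
  have "snd c p $ j = snd c q $ j" for j
  proof (cases "j = \<tau>")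
    case False
    then obtain l where "j = \<nu> l" using assms by (metis ComplI adapted_def rangeE singletonD)
    then show ?thesis using assms L by (simp add: adapted_def)
  qed (use L in simp)
  then have "snd c p = snd c q" by (simp add: vec_eq_iff)
  then show "p = q" using max_atlas_inj[of c Z] assms L by (auto simp: adapted_def inj_on_def)
qed

definition dm :: "('a, 3) chart \<Rightarrow> 2 \<Rightarrow> complex set" where "dm c k = {u. lam k u \<in> fst c}"

lemma local_dom_flat: "local_dom (pchart k) (flat_chart c \<tau>) \<iota> = (\<lambda>u. \<chi> _. u) ` dm c k"
proof
  show "local_dom (pchart k) (flat_chart c \<tau>) \<iota> \<subseteq> (\<lambda>u. \<chi> _. u) ` dm c k"
  proof
    fix x assume "x \<in> local_dom (pchart k) (flat_chart c \<tau>) \<iota>"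
    then obtain P where "P \<in> fst (pchart k)" "\<iota> P \<in> fst c" "x = snd (pchart k) P"
      by (auto simp: local_dom_def flat_chart_def)
    then obtain u where "P = pt (ppt k u)" "lam k u \<in> fst c" "x = (\<chi> _. u)"
      by (auto simp: pchart_def affine_patch_eq lam_def ratio_ppt)
    then show "x \<in> (\<lambda>u. \<chi> _. u) ` dm c k" by (auto simp: dm_def)
  qed
  show "(\<lambda>u. \<chi> _. u) ` dm c k \<subseteq> local_dom (pchart k) (flat_chart c \<tau>) \<iota>"
  proof
    fix x assume "x \<in> (\<lambda>u. \<chi> _. u :: complex^1) ` dm c k"
    then obtain u where u: "x = (\<chi> _. u)" "lam k u \<in> fst c" by (auto simp: dm_def)
    then have "pt (ppt k u) \<in> {p \<in> fst (pchart k). \<iota> p \<in> fst (flat_chart c \<tau>)}"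
      using lam_L[of k u] by (simp add: pchart_mem flat_chart_def lam_def)
    then show "x \<in> local_dom (pchart k) (flat_chart c \<tau>) \<iota>"
      unfolding local_dom_def u(1) using pchart_at[of k u] by (metis (no_types, lifting) imageI)
  qed
qed

lemma continuous_const_vec: "continuous_on UNIV (\<lambda>u::complex. \<chi> _::1. u)"
  by (intro continuous_on_vec_lambda continuous_intros)

lemma curve_coord:
  assumes a: "adapted c \<tau> \<nu>"
  shows "open (dm c k)" "(\<lambda>u. snd c (lam k u) $ \<tau>) holomorphic_on dm c k"
proof -
  let ?d = "flat_chart c \<tau>"
  have h: "holomorphic_fn (local_dom (pchart k) ?d \<iota>) (\<lambda>x. local_rep (pchart k) ?d \<iota> x $ 1)"
    using src pchart_charts[of k] flat_chart_charts[OF a]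
    unfolding smooth_rational_curve_def biholomorphic_map_def holomorphic_map_def by blast
  have "open ((\<lambda>u. \<chi> _::1. u) -` local_dom (pchart k) ?d \<iota>)"
    by (rule open_vimage[OF holomorphic_fn_open[OF h] continuous_const_vec])
  moreover have "(\<lambda>u. \<chi> _::1. u) -` local_dom (pchart k) ?d \<iota> = dm c k"
    unfolding local_dom_flat by (auto simp: vec_eq_iff)
  ultimately show o: "open (dm c k)" by simp
  have "(\<lambda>u. local_rep (pchart k) ?d \<iota> (\<chi> _. u) $ 1) holomorphic_on dm c k"
    by (rule holomorphic_on_along_curve[OF h _ o]) (auto simp: local_dom_flat intro!: holomorphic_intros)
  then show "(\<lambda>u. snd c (lam k u) $ \<tau>) holomorphic_on dm c k"
  proof (rule holomorphic_transform)
    fix u assume "u \<in> dm c k"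
    have "local_rep (pchart k) ?d \<iota> (snd (pchart k) (pt (ppt k u))) = snd ?d (\<iota> (pt (ppt k u)))"
      by (rule local_rep_chart[OF pchart_inj pchart_mem])
    then show "local_rep (pchart k) ?d \<iota> (\<chi> _. u) $ 1 = snd c (lam k u) $ \<tau>"
      by (simp add: pchart_at flat_chart_def lam_def)
  qed
qed

definition theta :: "('a, 3) chart \<Rightarrow> 3 \<Rightarrow> 2 \<Rightarrow> complex \<Rightarrow> complex" where
  "theta c \<tau> k u = deriv (\<lambda>u. snd c (lam k u) $ \<tau>) u"

lemma theta_has_derivative:
  assumes "adapted c \<tau> \<nu>" "u \<in> dm c k"
  shows "((\<lambda>u. snd c (lam k u) $ \<tau>) has_field_derivative theta c \<tau> k u) (at u)"
  unfolding theta_def using curve_coord[OF assms(1), of k] assms(2) by (auto intro: holomorphic_derivI)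

text \<open>The inverse of \<iota> is holomorphic as well. Composed with the curve it is the
  identity, whose derivative 1 would be 0 by the chain rule.\<close>

lemma theta_nonzero:
  assumes a: "adapted c \<tau> \<nu>" and u: "u \<in> dm c k"
  shows "theta c \<tau> k u \<noteq> 0"
proof
  assume z: "theta c \<tau> k u = 0"
  let ?d = "flat_chart c \<tau>"
  let ?i = "inv_into (pt ` (- {0})) \<iota>"
  have h: "holomorphic_fn (local_dom ?d (pchart k) ?i) (\<lambda>x. local_rep ?d (pchart k) ?i x $ 1)"
    using src pchart_charts[of k] flat_chart_charts[OF a] topspace_proj_line
    unfolding smooth_rational_curve_def biholomorphic_map_def holomorphic_map_def by metis
  have inv: "?i (lam k v) = pt (ppt k v)" for v
    unfolding lam_def using iota_bij ppt_top by (simp add: bij_betw_def)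
  have mem: "lam k v \<in> fst ?d" if "v \<in> dm c k" for v
    using that lam_L by (simp add: dm_def flat_chart_def)
  have rep: "local_rep ?d (pchart k) ?i (\<chi> _. snd c (lam k v) $ \<tau>) $ 1 = v" if "v \<in> dm c k" for v
  proof -
    have "local_rep ?d (pchart k) ?i (snd ?d (lam k v)) = snd (pchart k) (?i (lam k v))"
      by (rule local_rep_chart[OF flat_chart_inj[OF a] mem[OF that]])
    then show ?thesis by (simp add: inv pchart_at flat_chart_def)
  qed
  have dom: "(\<chi> _. snd c (lam k v) $ \<tau>) \<in> local_dom ?d (pchart k) ?i" if "v \<in> dm c k" for v
  proof -
    have "lam k v \<in> {p \<in> fst ?d. ?i p \<in> fst (pchart k)}"
      using mem[OF that] by (simp add: inv pchart_mem)
    then have "snd ?d (lam k v) \<in> local_dom ?d (pchart k) ?i" unfolding local_dom_def by blast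
    then show ?thesis by (simp add: flat_chart_def)
  qed
  have "((\<lambda>v. local_rep ?d (pchart k) ?i (\<chi> _. snd c (lam k v) $ \<tau>) $ 1) has_field_derivative
     frechet_derivative (\<lambda>x. local_rep ?d (pchart k) ?i x $ 1) (at (\<chi> _. snd c (lam k u) $ \<tau>)) (\<chi> _. theta c \<tau> k u)) (at u)"
    by (rule holomorphic_fn_along_curve[where \<gamma> = "\<lambda>v. \<chi> _. snd c (lam k v) $ \<tau>", OF h dom[OF u]]) (use theta_has_derivative[OF a u] in simp)
  then have "((\<lambda>v. v) has_field_derivative
     frechet_derivative (\<lambda>x. local_rep ?d (pchart k) ?i x $ 1) (at (\<chi> _. snd c (lam k u) $ \<tau>)) (\<chi> _. theta c \<tau> k u)) (at u)"
    by (rule has_field_derivative_transform_within_open[OF _ curve_coord(1)[OF a] u]) (simp add: rep)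
  then have "frechet_derivative (\<lambda>x. local_rep ?d (pchart k) ?i x $ 1) (at (\<chi> _. snd c (lam k u) $ \<tau>)) (\<chi> _. theta c \<tau> k u) = 1"
    using DERIV_unique DERIV_ident by blast
  moreover have "(\<chi> _. theta c \<tau> k u) = (0::complex^1)" using z by (simp add: vec_eq_iff)
  moreover have "linear (frechet_derivative (\<lambda>x. local_rep ?d (pchart k) ?i x $ 1) (at (\<chi> _. snd c (lam k u) $ \<tau>)))"
    using holomorphic_fn_has_derivative[OF h dom[OF u]] has_derivative_linear by blast
  ultimately show False using linear_0 by fastforce
qed

section \<open>The isomorphism of the normal bundle with O(1) + O(1), and adjunction\<close>

definition hh :: "('a, 3) chart \<times> (2 \<Rightarrow> 3) \<Rightarrow> 2 \<Rightarrow> (complex^2) set \<Rightarrow> complex^2^2" where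
  "hh = (SOME h. let E = pullback_bundle proj_line \<iota> (normal_bundle Z L :: (('a, 3) chart \<times> (2 \<Rightarrow> 3), 'a, 2) cocycle); F = O1_sum in
        (\<forall>i\<in>indices E. \<forall>k\<in>indices F.
           (\<forall>u v. holomorphic_on_patch proj_line (patch E i \<inter> patch F k) (\<lambda>p. h i k p $ u $ v)) \<and>
           (\<forall>p\<in>patch E i \<inter> patch F k. invertible (h i k p))) \<and>
        (\<forall>i\<in>indices E. \<forall>i'\<in>indices E. \<forall>k\<in>indices F. \<forall>k'\<in>indices F.
           \<forall>p\<in>patch E i \<inter> patch E i' \<inter> patch F k \<inter> patch F k'.
             h i' k' p ** trans E i i' p = trans F k k' p ** h i k p))"

lemma hh:
  defines "E \<equiv> pullback_bundle proj_line \<iota> (normal_bundle Z L :: (('a, 3) chart \<times> (2 \<Rightarrow> 3), 'a, 2) cocycle)"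
  shows "\<And>i k u v. i \<in> indices E \<Longrightarrow> holomorphic_on_patch proj_line (patch E i \<inter> affine_patch k) (\<lambda>p. hh i k p $ u $ v)"
    "\<And>i k p. i \<in> indices E \<Longrightarrow> p \<in> patch E i \<Longrightarrow> p \<in> affine_patch k \<Longrightarrow> invertible (hh i k p)"
    "\<And>i i' k k' p. i \<in> indices E \<Longrightarrow> i' \<in> indices E \<Longrightarrow> p \<in> patch E i \<Longrightarrow> p \<in> patch E i' \<Longrightarrow>
      p \<in> affine_patch k \<Longrightarrow> p \<in> affine_patch k' \<Longrightarrow> hh i' k' p ** trans E i i' p = mat (ratio k k' p) ** hh i k p"
proof -
  let ?F = "O1_sum :: (2, (complex^2) set, 2) cocycle"
  let ?P = "\<lambda>h. (\<forall>i\<in>indices E. \<forall>k\<in>indices ?F.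
           (\<forall>u v. holomorphic_on_patch proj_line (patch E i \<inter> patch ?F k) (\<lambda>p. h i k p $ u $ v)) \<and>
           (\<forall>p\<in>patch E i \<inter> patch ?F k. invertible (h i k p))) \<and>
        (\<forall>i\<in>indices E. \<forall>i'\<in>indices E. \<forall>k\<in>indices ?F. \<forall>k'\<in>indices ?F.
           \<forall>p\<in>patch E i \<inter> patch E i' \<inter> patch ?F k \<inter> patch ?F k'.
             h i' k' p ** trans E i i' p = trans ?F k k' p ** h i k p)"
  have "\<exists>h. ?P h" using iso unfolding bundle_isomorphic_def E_def .
  then have "?P (SOME h. ?P h)" by (rule someI_ex)
  moreover have "hh = (SOME h. ?P h)" unfolding hh_def Let_def E_def ..
  ultimately have P: "?P hh" by (simp only:)
  have F: "indices ?F = UNIV" "patch ?F = affine_patch" "trans ?F = (\<lambda>i j P. mat (ratio i j P))"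
    by (simp_all add: O1_sum_def)
  show "\<And>i k u v. i \<in> indices E \<Longrightarrow> holomorphic_on_patch proj_line (patch E i \<inter> affine_patch k) (\<lambda>p. hh i k p $ u $ v)"
    "\<And>i k p. i \<in> indices E \<Longrightarrow> p \<in> patch E i \<Longrightarrow> p \<in> affine_patch k \<Longrightarrow> invertible (hh i k p)"
    "\<And>i i' k k' p. i \<in> indices E \<Longrightarrow> i' \<in> indices E \<Longrightarrow> p \<in> patch E i \<Longrightarrow> p \<in> patch E i' \<Longrightarrow>
      p \<in> affine_patch k \<Longrightarrow> p \<in> affine_patch k' \<Longrightarrow> hh i' k' p ** trans E i i' p = mat (ratio k k' p) ** hh i k p"
    using P unfolding F by simp_all
qed

definition nblock :: "('a, 3) chart \<Rightarrow> (2 \<Rightarrow> 3) \<Rightarrow> ('a, 3) chart \<Rightarrow> (2 \<Rightarrow> 3) \<Rightarrow> 'a \<Rightarrow> complex^2^2" where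
  "nblock c \<nu> c' \<nu>' p = (\<chi> k l. frechet_derivative (local_rep c c' id) (at (snd c p)) (axis (\<nu> l) 1) $ \<nu>' k)"

lemma pullback_normal_bundle:
  defines "E \<equiv> pullback_bundle proj_line \<iota> (normal_bundle Z L :: (('a, 3) chart \<times> (2 \<Rightarrow> 3), 'a, 2) cocycle)"
  shows "adapted c \<tau> \<nu> \<Longrightarrow> (c, \<nu>) \<in> indices E"
    "patch E (c, \<nu>) = {P \<in> pt ` (- {0}). \<iota> P \<in> fst c \<inter> L}"
    "trans E (c, \<nu>) (c', \<nu>') P = nblock c \<nu> c' \<nu>' (\<iota> P)"
  by (simp_all add: E_def pullback_bundle_def normal_bundle_def topspace_proj_line adapted_def nblock_def)

definition eta :: "('a, 3) chart \<Rightarrow> (2 \<Rightarrow> 3) \<Rightarrow> 2 \<Rightarrow> complex \<Rightarrow> complex" where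
  "eta c \<nu> k u = det (hh (c, \<nu>) k (pt (ppt k u)))"

lemma patch_lam: "u \<in> dm c k \<Longrightarrow> pt (ppt k u) \<in> {P \<in> pt ` (- {0}). \<iota> P \<in> fst c \<inter> L}"
  using lam_L[of k u] ppt_top by (simp add: dm_def lam_def)

lemma affine_patch_ppt: "pt (ppt k u) \<in> affine_patch k"
  by (simp add: affine_patch_eq)

lemma eta_nonzero:
  assumes "adapted c \<tau> \<nu>" "u \<in> dm c k" shows "eta c \<nu> k u \<noteq> 0"
  unfolding eta_def
  using hh(2)[OF pullback_normal_bundle(1)[OF assms(1)], unfolded pullback_normal_bundle(2), OF patch_lam[OF assms(2)] affine_patch_ppt]
    invertible_det_nz by blast

lemma eta_holomorphic:
  assumes a: "adapted c \<tau> \<nu>" shows "eta c \<nu> k holomorphic_on dm c k"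
proof -
  have o: "open (dm c k)" by (rule curve_coord(1)[OF a])
  have "(\<lambda>u. hh (c, \<nu>) k (pt (ppt k u)) $ r $ s) holomorphic_on dm c k" for r s
  proof -
    let ?W = "{P \<in> pt ` (- {0}). \<iota> P \<in> fst c \<inter> L} \<inter> affine_patch k"
    have h: "holomorphic_fn (snd (pchart k) ` (fst (pchart k) \<inter> ?W))
        ((\<lambda>p. hh (c, \<nu>) k p $ r $ s) \<circ> inv_into (fst (pchart k)) (snd (pchart k)))"
      using hh(1)[OF pullback_normal_bundle(1)[OF a], unfolded pullback_normal_bundle(2), of k r s] pchart_charts[of k]
      unfolding holomorphic_on_patch_def by blast
    have "(\<lambda>u. ((\<lambda>p. hh (c, \<nu>) k p $ r $ s) \<circ> inv_into (fst (pchart k)) (snd (pchart k))) (\<chi> _. u)) holomorphic_on dm c k"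
    proof (rule holomorphic_on_along_curve[OF h _ o])
      show "(\<lambda>u. \<chi> _. u) ` dm c k \<subseteq> snd (pchart k) ` (fst (pchart k) \<inter> ?W)"
      proof
        fix x assume "x \<in> (\<lambda>u. \<chi> _. u :: complex^1) ` dm c k"
        then obtain u where u: "x = (\<chi> _. u)" "u \<in> dm c k" by blast
        then have "pt (ppt k u) \<in> fst (pchart k) \<inter> ?W"
          using patch_lam[OF u(2)] pchart_mem affine_patch_ppt by blast
        then show "x \<in> snd (pchart k) ` (fst (pchart k) \<inter> ?W)"
          unfolding u(1) using pchart_at[of k u] by (metis (no_types, lifting) imageI)
      qed
    qed (auto intro!: holomorphic_intros)
    then show ?thesis
    proof (rule holomorphic_transform)
      fix u assume "u \<in> dm c k"
      have "inv_into (fst (pchart k)) (snd (pchart k)) (\<chi> _. u) = pt (ppt k u)"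
        using inv_into_f_f[OF pchart_inj pchart_mem[of k u]] by (simp add: pchart_at)
      then show "((\<lambda>p. hh (c, \<nu>) k p $ r $ s) \<circ> inv_into (fst (pchart k)) (snd (pchart k))) (\<chi> _. u)
        = hh (c, \<nu>) k (pt (ppt k u)) $ r $ s" by simp
    qed
  qed
  then show ?thesis unfolding eta_def[abs_def] det_2_from_0 by (intro holomorphic_intros)
qed

lemma eta_chart_change:
  assumes a: "adapted c \<tau> \<nu>" and a': "adapted c' \<tau>' \<nu>'" and u: "u \<in> dm c k" "u \<in> dm c' k"
  shows "eta c' \<nu>' k u * det (nblock c \<nu> c' \<nu>' (lam k u)) = eta c \<nu> k u"
proof -
  have "hh (c', \<nu>') k (pt (ppt k u)) ** nblock c \<nu> c' \<nu>' (\<iota> (pt (ppt k u)))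
      = mat (ratio k k (pt (ppt k u))) ** hh (c, \<nu>) k (pt (ppt k u))"
    using hh(3)[OF pullback_normal_bundle(1)[OF a] pullback_normal_bundle(1)[OF a'], unfolded pullback_normal_bundle(2,3),
        OF patch_lam[OF u(1)] patch_lam[OF u(2)] affine_patch_ppt affine_patch_ppt] .
  moreover have "ratio k k (pt (ppt k u)) = 1" by (simp add: ratio_pt ppt_def)
  ultimately have "hh (c', \<nu>') k (pt (ppt k u)) ** nblock c \<nu> c' \<nu>' (\<iota> (pt (ppt k u))) = hh (c, \<nu>) k (pt (ppt k u))"
    by simp
  then show ?thesis unfolding eta_def lam_def by (metis det_mul)
qed

lemma nblock_self:
  assumes a: "adapted c \<tau> \<nu>" and p: "p \<in> fst c"
  shows "nblock c \<nu> c \<nu> p = mat 1"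
proof -
  have c: "c \<in> max_atlas Z" using a by (simp add: adapted_def)
  have o: "open (snd c ` fst c)"
    using max_atlas_is_chart[OF c] by (simp add: is_chart_def)
  have "(local_rep c c id has_derivative (\<lambda>v. v)) (at (snd c p))"
    by (rule has_derivative_transform_within_open[OF has_derivative_ident o])
      (use p in \<open>auto simp: local_rep_chart[OF max_atlas_inj[OF c]]\<close>)
  then have "frechet_derivative (local_rep c c id) (at (snd c p)) = (\<lambda>v. v)"
    by (rule frechet_derivative_at[symmetric])
  then show ?thesis
    using a by (auto simp: nblock_def vec_eq_iff mat_def axis_def adapted_def inj_def)
qed

text \<open>The scalar matrix 1/u of size 2 has determinant 1/u^2: the determinant of O(1) + O(1) is
  O(2).\<close>

lemma eta_patch_change:
  assumes a: "adapted c \<tau> \<nu>" and u: "u \<noteq> 0" "u \<in> dm c 1"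
  shows "eta c \<nu> 0 (1 / u) = eta c \<nu> 1 u / u^2"
proof -
  have e: "pt (ppt 0 (1 / u)) = pt (ppt 1 u)"
    using u(1) by (subst pt_ppt[of "ppt 1 u" 0]) (simp_all add: ppt_def)
  have m0: "pt (ppt 1 u) \<in> affine_patch 0" using affine_patch_ppt[of 0 "1 / u"] by (simp add: e)
  have "hh (c, \<nu>) 0 (pt (ppt 1 u)) ** nblock c \<nu> c \<nu> (\<iota> (pt (ppt 1 u)))
      = mat (ratio 1 0 (pt (ppt 1 u))) ** hh (c, \<nu>) 1 (pt (ppt 1 u))"
    using hh(3)[OF pullback_normal_bundle(1)[OF a] pullback_normal_bundle(1)[OF a], unfolded pullback_normal_bundle(2,3),
        OF patch_lam[OF u(2)] patch_lam[OF u(2)] affine_patch_ppt m0] .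
  moreover have "ratio 1 0 (pt (ppt 1 u)) = 1 / u" by (simp add: ratio_pt ppt_def)
  moreover have "nblock c \<nu> c \<nu> (\<iota> (pt (ppt 1 u))) = mat 1"
    by (rule nblock_self[OF a]) (use u(2) in \<open>simp add: dm_def lam_def\<close>)
  ultimately have "det (hh (c, \<nu>) 0 (pt (ppt 1 u))) = det (mat (1 / u) :: complex^2^2) * det (hh (c, \<nu>) 1 (pt (ppt 1 u)))"
    by (metis det_mul matrix_mul_rid)
  moreover have "det (mat (1 / u) :: complex^2^2) = 1 / u^2"
    by (simp add: det_2_from_0 mat_def power2_eq_square)
  ultimately show ?thesis unfolding eta_def e by simp
qed

text \<open>The columns are the tangent axis and the two normal axes. For adapted data this is a
  permutation matrix, and its determinant is the sign of the order (tangent, normal,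
  normal).\<close>

definition frame :: "3 \<Rightarrow> (2 \<Rightarrow> 3) \<Rightarrow> complex^3^3" where
  "frame \<tau> \<nu> = (\<chi> r s. (if s = 0 then axis \<tau> 1 else if s = 1 then axis (\<nu> 0) 1 else axis (\<nu> 1) 1) $ r)"

lemma adapted_distinct:
  assumes "adapted c \<tau> \<nu>"
  shows "\<tau> \<noteq> \<nu> l" "\<nu> 0 \<noteq> \<nu> 1" "j = \<tau> \<or> j = \<nu> 0 \<or> j = \<nu> 1"
proof -
  have r: "range \<nu> = - {\<tau>}" and i: "inj \<nu>" using assms by (auto simp: adapted_def)
  show "\<tau> \<noteq> \<nu> l" using r by blast
  show "\<nu> 0 \<noteq> \<nu> 1" using i by (simp add: inj_eq)
  show "j = \<tau> \<or> j = \<nu> 0 \<or> j = \<nu> 1"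
  proof (cases "j = \<tau>")
    case False
    then obtain l where "j = \<nu> l" using r by (metis ComplI rangeE singletonD)
    then show ?thesis using two_cases[of l] by auto
  qed simp
qed

lemma frame_columns:
  "(\<Sum>k\<in>UNIV. frame \<tau> \<nu> $ r $ k * x $ k) = (x $ 0 *s axis \<tau> 1 + x $ 1 *s axis (\<nu> 0) 1 + x $ 2 *s axis (\<nu> 1) 1) $ r"
  by (simp add: sum_3_from_0 frame_def mult.commute)

lemma det_frame_nonzero:
  assumes a: "adapted c \<tau> \<nu>" shows "det (frame \<tau> \<nu>) \<noteq> 0"
proof
  assume "det (frame \<tau> \<nu>) = 0"
  then obtain x where x: "x \<noteq> 0" "frame \<tau> \<nu> *v x = 0" by (rule det_zero_kernel)
  have e: "(x $ 0 *s axis \<tau> 1 + x $ 1 *s axis (\<nu> 0) 1 + x $ 2 *s axis (\<nu> 1) 1) $ r = 0" for r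
    using arg_cong[OF x(2), of "\<lambda>v. v $ r"] frame_columns[of \<tau> \<nu> r x] by (simp add: matrix_vector_mult_def)
  note d = adapted_distinct[OF a]
  have "x $ 0 = 0" using e[of \<tau>] d(1)[of 0] d(1)[of 1] by (simp add: axis_def)
  moreover have "x $ 1 = 0" using e[of "\<nu> 0"] d(1)[of 0] d(2) by (simp add: axis_def)
  moreover have "x $ 2 = 0" using e[of "\<nu> 1"] d(1)[of 1] d(2) by (simp add: axis_def)
  ultimately have "x = 0" by (simp add: vec_eq_iff forall_3_from_0)
  then show False using x(1) by simp
qed

lemma curve_vec_has_derivative:
  assumes a: "adapted c \<tau> \<nu>" and u: "u \<in> dm c k"
  shows "((\<lambda>u. snd c (lam k u) $ j) has_field_derivative (theta c \<tau> k u *s axis \<tau> 1) $ j) (at u)"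
proof (cases "j = \<tau>")
  case True
  then show ?thesis using theta_has_derivative[OF a u] by simp
next
  case False
  then obtain l where l: "j = \<nu> l" using adapted_distinct(3)[OF a, of j] by auto
  have "snd c (lam k v) $ j = 0" if "v \<in> dm c k" for v
    using that lam_L[of k v] a unfolding dm_def adapted_def l by blast
  then have "((\<lambda>u. snd c (lam k u) $ j) has_field_derivative 0) (at u)"
    by (intro has_field_derivative_transform_within_open[OF DERIV_const curve_coord(1)[OF a] u]) auto
  then show ?thesis using False by (simp add: axis_def)
qed

text \<open>The transition map carries the \<tau>-axis into \<open>L\<close>, where all normal
  coordinates vanish; thus its Jacobian is block triangular in adapted frames.\<close>

lemma transition_on_curve:
  assumes a: "adapted c \<tau> \<nu>" and a': "adapted c' \<tau>' \<nu>'" and p: "p \<in> L" "p \<in> fst c" "p \<in> fst c'"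
  shows "frechet_derivative (local_rep c c' id) (at (snd c p)) (axis \<tau> 1) $ \<nu>' l = 0"
proof -
  have c: "c \<in> max_atlas Z" "c' \<in> max_atlas Z" using a a' by (auto simp: adapted_def)
  let ?t = "local_rep c c' id"
  define D where "D = local_dom c c' id"
  have ht: "holo_map D ?t" unfolding D_def by (rule transition_holo[OF c])
  have xD: "snd c p \<in> D" using p by (auto simp: D_def local_dom_def)
  have hl: "holomorphic_fn D (\<lambda>x. ?t x $ \<nu>' l)" using ht by (simp add: holo_map_def)
  have oS: "open ((\<lambda>s. snd c p + s *s axis \<tau> 1) -` D)"
    by (intro open_vimage holo_map_open[OF ht] continuous_intros)
  have z: "0 = ?t (snd c p + s *s axis \<tau> 1) $ \<nu>' l" if s: "s \<in> (\<lambda>s. snd c p + s *s axis \<tau> 1) -` D" for s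
  proof -
    obtain q where q: "q \<in> fst c" "q \<in> fst c'" "snd c p + s *s axis \<tau> 1 = snd c q"
      using s by (auto simp: D_def local_dom_def)
    have "snd c q $ \<nu> l = 0" for l
      unfolding q(3)[symmetric] using a p adapted_distinct(1)[OF a, of l] by (simp add: adapted_def axis_def)
    then have "q \<in> L" using a q(1) by (simp add: adapted_def)
    then have "snd c' q $ \<nu>' l = 0" using a' q(2) by (simp add: adapted_def)
    then show ?thesis unfolding q(3) by (simp add: local_rep_chart[OF max_atlas_inj[OF c(1)] q(1)])
  qed
  have "((\<lambda>s. ?t (snd c p + s *s axis \<tau> 1) $ \<nu>' l) has_field_derivative 0) (at 0)"
    by (rule has_field_derivative_transform_within_open[OF DERIV_const oS _ z]) (use xD in simp)
  then have "frechet_derivative (\<lambda>x. ?t x $ \<nu>' l) (at (snd c p)) (axis \<tau> 1) = 0"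
    using deriv_on_line[OF hl xD, of "axis \<tau> 1"] DERIV_imp_deriv by metis
  moreover have "?t differentiable (at (snd c p))"
    using holo_map_has_derivative[OF ht xD] differentiableI by blast
  ultimately show ?thesis by (simp add: frechet_derivative_component)
qed

text \<open>The blocks of the triangular Jacobian are a scalar \<alpha>, which is the quotient of
  the two velocities, and the normal block. This is the identity of the determinant of TZ along
  \<open>L\<close> with TL times the determinant of the normal bundle.\<close>

lemma frame_change:
  assumes a: "adapted c \<tau> \<nu>" and a': "adapted c' \<tau>' \<nu>'" and u: "u \<in> dm c k" "u \<in> dm c' k"
  shows "det (jac c c' (snd c (lam k u))) * det (frame \<tau> \<nu>) * theta c \<tau> k u =
     theta c' \<tau>' k u * det (nblock c \<nu> c' \<nu>' (lam k u)) * det (frame \<tau>' \<nu>')"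
proof -
  define p where "p = lam k u"
  have c: "c \<in> max_atlas Z" "c' \<in> max_atlas Z" using a a' by (auto simp: adapted_def)
  have p: "p \<in> L" "p \<in> fst c" "p \<in> fst c'" using u lam_L by (auto simp: p_def dm_def)
  let ?t = "local_rep c c' id"
  define t' where "t' = frechet_derivative ?t (at (snd c p))"
  have xD: "snd c p \<in> local_dom c c' id" using p by (auto simp: local_dom_def)
  have ht: "holo_map (local_dom c c' id) ?t" by (rule transition_holo[OF c])
  have dt: "(?t has_derivative t') (at (snd c p))" unfolding t'_def by (rule holo_map_has_derivative[OF ht xD])
  have jv: "jac c c' (snd c p) $ r $ s = t' (axis s 1) $ r" for r s by (simp add: jac_def t'_def)
  define \<alpha> where "\<alpha> = t' (axis \<tau> 1) $ \<tau>'"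
  define N where "N = nblock c \<nu> c' \<nu>' p"
  \<comment> \<open>The Jacobian with respect to the two frames; its first column is (\<alpha>, 0,
    0) because vectors tangent to \<open>L\<close> stay tangent.\<close>
  define B :: "complex^3^3" where "B = (\<chi> r s. if s = 0 then (if r = 0 then \<alpha> else 0)
    else if r = 0 then t' (axis (if s = 1 then \<nu> 0 else \<nu> 1) 1) $ \<tau>'
    else N $ (if r = 1 then 0 else 1) $ (if s = 1 then 0 else 1))"
  note d' = adapted_distinct[OF a']
  have tau0: "t' (axis \<tau> 1) $ \<nu>' l = 0" for l unfolding t'_def by (rule transition_on_curve[OF a a' p])
  have J1: "(jac c c' (snd c p) ** frame \<tau> \<nu>) $ r $ s = t' (axis (if s = 0 then \<tau> else if s = 1 then \<nu> 0 else \<nu> 1) 1) $ r" for r s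
  proof -
    have *: "(\<Sum>k\<in>UNIV. t' (axis k 1) $ r * axis j 1 $ k) = t' (axis j 1) $ r" for j :: 3
      by (simp add: axis_def if_distrib[of "\<lambda>x. _ * x"] cong: if_cong)
    show ?thesis using *[of \<tau>] *[of "\<nu> 0"] *[of "\<nu> 1"]
      by (simp add: matrix_matrix_mult_def frame_def jv)
  qed
  have J2: "(frame \<tau>' \<nu>' ** B) $ r $ s = (B $ 0 $ s *s axis \<tau>' 1 + B $ 1 $ s *s axis (\<nu>' 0) 1 + B $ 2 $ s *s axis (\<nu>' 1) 1) $ r" for r s
    using frame_columns[of \<tau>' \<nu>' r "column s B"] by (simp add: matrix_matrix_mult_def column_def)
  have "jac c c' (snd c p) ** frame \<tau> \<nu> = frame \<tau>' \<nu>' ** B"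
    unfolding vec_eq_iff
  proof (intro allI)
    fix r s :: 3
    have N: "N $ k $ l = t' (axis (\<nu> l) 1) $ \<nu>' k" for k l by (simp add: N_def nblock_def t'_def)
    have s: "s = 0 \<or> s = 1 \<or> s = 2" using forall_3_from_0[of "\<lambda>s. s = 0 \<or> s = 1 \<or> s = 2"] by simp
    consider "r = \<tau>'" | "r = \<nu>' 0" | "r = \<nu>' 1" using d'(3)[of r] by blast
    then show "(jac c c' (snd c p) ** frame \<tau> \<nu>) $ r $ s = (frame \<tau>' \<nu>' ** B) $ r $ s"
    proof cases
      case 1
      then show ?thesis using s d'(1)[of 0] d'(1)[of 1] unfolding J1 J2
        by (elim disjE) (simp_all add: B_def axis_def \<alpha>_def)
    next
      case 2
      then show ?thesis using s d'(1)[of 0] d'(2) tau0[of 0] unfolding J1 J2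
        by (elim disjE) (simp_all add: B_def axis_def N)
    next
      case 3
      then show ?thesis using s d'(1)[of 1] d'(2) tau0[of 1] unfolding J1 J2
        by (elim disjE) (simp_all add: B_def axis_def N)
    qed
  qed
  then have "det (jac c c' (snd c p)) * det (frame \<tau> \<nu>) = det (frame \<tau>' \<nu>') * det B" by (metis det_mul)
  moreover have "det B = \<alpha> * det N"
    unfolding det_3_from_0 det_2_from_0 B_def by simp
  moreover have "theta c' \<tau>' k u = \<alpha> * theta c \<tau> k u"
  proof -
    have h: "holomorphic_fn (local_dom c c' id) (\<lambda>x. ?t x $ \<tau>')" using ht by (simp add: holo_map_def)
    have "((\<lambda>v. ?t (snd c (lam k v)) $ \<tau>') has_field_derivative
       frechet_derivative (\<lambda>x. ?t x $ \<tau>') (at (snd c (lam k u))) (theta c \<tau> k u *s axis \<tau> 1)) (at u)"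
      by (rule holomorphic_fn_along_curve[where \<gamma> = "\<lambda>v. snd c (lam k v)", OF h])
        (use xD curve_vec_has_derivative[OF a u(1)] in \<open>auto simp: p_def\<close>)
    moreover have "frechet_derivative (\<lambda>x. ?t x $ \<tau>') (at (snd c (lam k u))) = (\<lambda>v. t' v $ \<tau>')"
      unfolding t'_def p_def by (rule frechet_derivative_component) (use dt differentiableI p_def in blast)
    moreover have "t' (theta c \<tau> k u *s axis \<tau> 1) = theta c \<tau> k u *s t' (axis \<tau> 1)"
      unfolding t'_def by (rule holo_map_derivative_linear[OF ht xD])
    ultimately have 1: "((\<lambda>v. ?t (snd c (lam k v)) $ \<tau>') has_field_derivative \<alpha> * theta c \<tau> k u) (at u)"
      by (simp add: \<alpha>_def mult.commute)
    have "((\<lambda>v. snd c' (lam k v) $ \<tau>') has_field_derivative \<alpha> * theta c \<tau> k u) (at u)"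
      by (rule has_field_derivative_transform_within_open[OF 1 curve_coord(1)[OF a] u(1)])
        (simp add: dm_def local_rep_chart[OF max_atlas_inj[OF c(1)]])
    then show ?thesis using theta_has_derivative[OF a' u(2)] DERIV_unique by blast
  qed
  ultimately show ?thesis by (simp add: p_def N_def mult_ac)
qed

text \<open>\<open>theta\<close> is the velocity of the curve and \<open>eta\<close> the determinant of the isomorphism from the
  normal bundle to \<open>O(1) \<oplus> O(1)\<close>; together they trivialize \<open>K\<^sup>-\<^sup>1\<close>, restricted to \<open>L\<close>, over
  the \<open>k\<close>-th affine patch.\<close>

definition QQ :: "('a, 3) chart \<Rightarrow> 3 \<Rightarrow> (2 \<Rightarrow> 3) \<Rightarrow> 2 \<Rightarrow> complex \<Rightarrow> 4 \<Rightarrow> 4 \<Rightarrow> complex" where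
  "QQ c \<tau> \<nu> k u r s = sym c (lam k u) r s * eta c \<nu> k u / (det (frame \<tau> \<nu>) * theta c \<tau> k u)"

text \<open>The Jacobian factor of \<open>sym\<close>, the normal block in \<open>eta\<close> and
  the quotient of velocities cancel by \<open>frame_change\<close>.\<close>

lemma QQ_chart_change:
  assumes a: "adapted c \<tau> \<nu>" and a': "adapted c' \<tau>' \<nu>'" and u: "u \<in> dm c k" "u \<in> dm c' k"
  shows "QQ c' \<tau>' \<nu>' k u r s = QQ c \<tau> \<nu> k u r s"
proof -
  have c: "c \<in> max_atlas Z" "c' \<in> max_atlas Z" using a a' by (auto simp: adapted_def)
  have p: "lam k u \<in> fst c" "lam k u \<in> fst c'" using u by (auto simp: dm_def)
  note nz = theta_nonzero[OF a u(1)] theta_nonzero[OF a' u(2)] det_frame_nonzero[OF a] det_frame_nonzero[OF a']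
  define dJ where "dJ = det (jac c c' (snd c (lam k u)))"
  define dN where "dN = det (nblock c \<nu> c' \<nu>' (lam k u))"
  define S where "S = sym c (lam k u) r s"
  define e' where "e' = eta c' \<nu>' k u"
  have s: "sym c' (lam k u) r s = S * dJ" unfolding dJ_def S_def by (rule sym_chart_change[OF c p])
  have e: "eta c \<nu> k u = e' * dN" unfolding dN_def e'_def by (rule eta_chart_change[OF a a' u, symmetric])
  have f: "dJ * det (frame \<tau> \<nu>) * theta c \<tau> k u = theta c' \<tau>' k u * dN * det (frame \<tau>' \<nu>')"
    unfolding dJ_def dN_def by (rule frame_change[OF a a' u])
  have "S * dJ * e' * (det (frame \<tau> \<nu>) * theta c \<tau> k u) = S * e' * (dJ * det (frame \<tau> \<nu>) * theta c \<tau> k u)"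
    by (simp add: mult_ac)
  also have "\<dots> = S * (e' * dN) * (det (frame \<tau>' \<nu>') * theta c' \<tau>' k u)"
    unfolding f by (simp add: mult_ac)
  finally show ?thesis
    unfolding QQ_def s e S_def[symmetric] e'_def[symmetric] using nz by (simp add: frac_eq_eq)
qed

definition Q :: "2 \<Rightarrow> complex \<Rightarrow> 4 \<Rightarrow> 4 \<Rightarrow> complex" where
  "Q k u r s = (let (c, \<tau>, \<nu>) = SOME (c, \<tau>, \<nu>). adapted c \<tau> \<nu> \<and> u \<in> dm c k in QQ c \<tau> \<nu> k u r s)"

lemma adapted_at:
  obtains c \<tau> \<nu> where "adapted c \<tau> \<nu>" "u \<in> dm c k"
  using adapted_exists[OF lam_L[of k u]] unfolding dm_def by blast

lemma Q_eq:
  assumes a: "adapted c \<tau> \<nu>" and u: "u \<in> dm c k"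
  shows "Q k u r s = QQ c \<tau> \<nu> k u r s"
proof -
  let ?P = "\<lambda>(c, \<tau>, \<nu>). adapted c \<tau> \<nu> \<and> u \<in> dm c k"
  define t where "t = (SOME t. ?P t)"
  have "?P (c, \<tau>, \<nu>)" using assms by simp
  then have P: "?P t" unfolding t_def by (rule someI[of ?P])
  obtain c' \<tau>' \<nu>' where e: "t = (c', \<tau>', \<nu>')" by (cases t) auto
  have a': "adapted c' \<tau>' \<nu>'" "u \<in> dm c' k" using P unfolding e by simp_all
  have "QQ c' \<tau>' \<nu>' k u r s = QQ c \<tau> \<nu> k u r s" by (rule QQ_chart_change[OF a a'(1) u a'(2)])
  then show ?thesis unfolding Q_def t_def[symmetric] e by simp
qed

lemma curve_coords_holomorphic:
  assumes a: "adapted c \<tau> \<nu>" shows "(\<lambda>u. snd c (lam k u) $ j) holomorphic_on dm c k"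
  unfolding holomorphic_on_open[OF curve_coord(1)[OF a]] using curve_vec_has_derivative[OF a] by blast

lemma curve_patch_open:
  assumes a: "adapted c \<tau> \<nu>"
  shows "open {u \<in> dm c k. \<mu> (lam k u) \<in> fst (tchart i)}"
proof -
  have c: "c \<in> max_atlas Z" using a by (simp add: adapted_def)
  have "continuous_on (dm c k) (\<lambda>u. snd c (lam k u))"
  proof -
    have "continuous_on (dm c k) (\<lambda>u. \<chi> j. snd c (lam k u) $ j)"
      by (intro continuous_on_vec_lambda holomorphic_on_imp_continuous_on curve_coords_holomorphic[OF a])
    then show ?thesis by simp
  qed
  then have "open (dm c k \<inter> (\<lambda>u. snd c (lam k u)) -` dom c i)"
    by (rule continuous_open_preimage[OF _ curve_coord(1)[OF a] open_dom[OF c]])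
  moreover have "dm c k \<inter> (\<lambda>u. snd c (lam k u)) -` dom c i = {u \<in> dm c k. \<mu> (lam k u) \<in> fst (tchart i)}"
    using dom_mem[OF c] by (auto simp: dm_def)
  ultimately show ?thesis by simp
qed

lemma curve_compose_holomorphic:
  assumes a: "adapted c \<tau> \<nu>" and f: "holomorphic_fn (dom c i) f"
  shows "(\<lambda>u. f (snd c (lam k u))) holomorphic_on {u \<in> dm c k. \<mu> (lam k u) \<in> fst (tchart i)}"
proof (rule holomorphic_on_along_curve[OF f _ curve_patch_open[OF a]])
  have c: "c \<in> max_atlas Z" using a by (simp add: adapted_def)
  show "(\<lambda>u. snd c (lam k u)) ` {u \<in> dm c k. \<mu> (lam k u) \<in> fst (tchart i)} \<subseteq> dom c i"
    using dom_mem[OF c] by (auto simp: dm_def)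
  show "(\<lambda>u. snd c (lam k u) $ j) holomorphic_on {u \<in> dm c k. \<mu> (lam k u) \<in> fst (tchart i)}" for j
    by (rule holomorphic_on_subset[OF curve_coords_holomorphic[OF a]]) auto
qed

lemma patch_at: obtains i where "\<mu> (lam k u) \<in> fst (tchart i)"
  using tchart_cover[OF mu_top] lam_L L_top by blast

lemma tlift_m_holomorphic:
  assumes c: "c \<in> max_atlas Z" shows "holomorphic_fn (dom c i) (\<lambda>x. tlift i (m c i x) $ r)"
proof (cases "r = i")
  case True
  then show ?thesis using holomorphic_fn_const[OF open_dom[OF c], of i 1] by (simp add: tlift_def)
next
  case False
  then show ?thesis using m_holo[OF c, of i] by (simp add: tlift_def holo_map_def)
qed

theorem Q_holomorphic: "(\<lambda>u. Q k u r s) holomorphic_on UNIV"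
  unfolding holomorphic_on_open[OF open_UNIV]
proof
  fix u
  obtain c \<tau> \<nu> where a: "adapted c \<tau> \<nu>" "u \<in> dm c k" by (rule adapted_at)
  obtain i where i: "\<mu> (lam k u) \<in> fst (tchart i)" by (rule patch_at)
  have c: "c \<in> max_atlas Z" using a by (simp add: adapted_def)
  define W where "W = {u \<in> dm c k. \<mu> (lam k u) \<in> fst (tchart i)}"
  have W: "open W" "u \<in> W" "W \<subseteq> dm c k" using curve_patch_open[OF a(1)] a(2) i by (auto simp: W_def)
  have f: "holomorphic_fn (dom c i) (\<lambda>x. tlift i (m c i x) $ r * tlift i (m c i x) $ s / J c i x)"
    by (intro holomorphic_fn_divide holomorphic_fn_mult tlift_m_holomorphic J c)
  have S: "(\<lambda>u. sym c (lam k u) r s) holomorphic_on W"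
  proof (rule holomorphic_transform)
    show "(\<lambda>u. tlift i (m c i (snd c (lam k u))) $ r * tlift i (m c i (snd c (lam k u))) $ s / J c i (snd c (lam k u))) holomorphic_on W"
      unfolding W_def by (rule curve_compose_holomorphic[OF a(1) f])
    show "tlift i (m c i (snd c (lam k u))) $ r * tlift i (m c i (snd c (lam k u))) $ s / J c i (snd c (lam k u)) = sym c (lam k u) r s"
      if "u \<in> W" for u
      by (rule sym_eq[OF c, symmetric]) (use that in \<open>auto simp: W_def dm_def\<close>)
  qed
  have th: "theta c \<tau> k holomorphic_on W"
    unfolding theta_def[abs_def] using W
    by (intro holomorphic_deriv holomorphic_on_subset[OF curve_coord(2)[OF a(1)]]) auto
  have "(\<lambda>u. QQ c \<tau> \<nu> k u r s) holomorphic_on W"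
    unfolding QQ_def
    by (intro holomorphic_intros S th holomorphic_on_subset[OF eta_holomorphic[OF a(1)] W(3)])
      (use det_frame_nonzero[OF a(1)] theta_nonzero[OF a(1)] W(3) in auto)
  then have "(\<lambda>u. Q k u r s) holomorphic_on W"
    by (rule holomorphic_transform) (use Q_eq[OF a(1)] W(3) in auto)
  then show "\<exists>f'. ((\<lambda>u. Q k u r s) has_field_derivative f') (at u)"
    using W by (meson holomorphic_derivI)
qed

text \<open>In one chart and patch, all factors of \<open>QQ\<close> besides the two homogeneous
  coordinates are nonzero and common to all entries, so the matrix remembers the image
  point.\<close>

theorem Q_rank_one:
  obtains y z \<kappa> where "\<kappa> \<noteq> 0" "y \<noteq> 0" "\<mu> (lam k u) = pt_O2 (y, z)" "\<And>r s. Q k u r s = \<kappa> * y $ r * y $ s"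
proof -
  obtain c \<tau> \<nu> where a: "adapted c \<tau> \<nu>" "u \<in> dm c k" by (rule adapted_at)
  obtain i where i: "\<mu> (lam k u) \<in> fst (tchart i)" by (rule patch_at)
  have c: "c \<in> max_atlas Z" using a by (simp add: adapted_def)
  have p: "lam k u \<in> fst c" using a(2) by (simp add: dm_def)
  define X where "X = m c i (snd c (lam k u))"
  define \<kappa> where "\<kappa> = eta c \<nu> k u / (J c i (snd c (lam k u)) * (det (frame \<tau> \<nu>) * theta c \<tau> k u))"
  have "J c i (snd c (lam k u)) \<noteq> 0" by (rule J(2)[OF c]) (use dom_mem[OF c p] i in simp)
  then have "\<kappa> \<noteq> 0"
    using eta_nonzero[OF a] det_frame_nonzero[OF a(1)] theta_nonzero[OF a] by (simp add: \<kappa>_def)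
  moreover have "\<mu> (lam k u) = pt_O2 (tlift i X, X $ i)"
    using tchart_image[OF i] by (simp add: X_def m_at[OF c p])
  moreover have "Q k u r s = \<kappa> * tlift i X $ r * tlift i X $ s" for r s
    unfolding Q_eq[OF a] QQ_def sym_eq[OF c p i] \<kappa>_def X_def by simp
  ultimately show ?thesis using that tlift_nonzero by blast
qed

text \<open>One factor u^2 comes from \<open>eta\<close>, the normal bundle, and the other, with the
  sign, from the derivative of 1/u in \<open>theta\<close>, the tangent bundle of
  \<open>L\<close>.\<close>

theorem Q_patch_change:
  assumes u: "u \<noteq> 0" shows "Q 1 u r s = - (u^4) * Q 0 (1 / u) r s"
proof -
  obtain c \<tau> \<nu> where a: "adapted c \<tau> \<nu>" "u \<in> dm c 1" by (rule adapted_at)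
  have e: "pt (ppt 0 (1 / v)) = pt (ppt 1 v)" if "v \<noteq> 0" for v
    using that by (subst pt_ppt[of "ppt 1 v" 0]) (simp_all add: ppt_def)
  have l: "lam 0 (1 / v) = lam 1 v" if "v \<noteq> 0" for v unfolding lam_def e[OF that] ..
  have a0: "1 / u \<in> dm c 0" using a(2) l[OF u] by (simp add: dm_def)
  have "((\<lambda>v. 1 / v) has_field_derivative - 1 / u^2) (at u)"
    using u by (auto intro!: derivative_eq_intros simp: power2_eq_square)
  from DERIV_chain2[OF theta_has_derivative[OF a(1) a0] this]
  have "((\<lambda>v. snd c (lam 0 (1 / v)) $ \<tau>) has_field_derivative theta c \<tau> 0 (1 / u) * (- 1 / u^2)) (at u)" .
  then have "((\<lambda>v. snd c (lam 1 v) $ \<tau>) has_field_derivative theta c \<tau> 0 (1 / u) * (- 1 / u^2)) (at u)"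
    by (rule has_field_derivative_transform_within_open[of _ _ _ "- {0}"]) (use u l in auto)
  then have th: "theta c \<tau> 1 u = theta c \<tau> 0 (1 / u) * (- 1 / u^2)"
    using theta_has_derivative[OF a] DERIV_unique by blast
  show ?thesis
    unfolding Q_eq[OF a] Q_eq[OF a(1) a0] QQ_def l[OF u] th eta_patch_change[OF a(1) u a(2)]
    using u theta_nonzero[OF a(1) a0] det_frame_nonzero[OF a(1)]
    by (simp add: field_simps power2_eq_square power4_eq_xxxx)
qed

end

section \<open>Quadratic parametrization of the image\<close>

lemma entire_polynomial_growth:
  assumes h: "f holomorphic_on UNIV" and n: "\<And>z. A \<le> norm z \<Longrightarrow> norm (f z) \<le> B * norm z ^ n"
  obtains p where "degree p \<le> n" "\<And>z. f z = poly p z"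
proof -
  define p where "p = (\<Sum>k\<le>n. monom ((deriv ^^ k) f 0 / fact k) k)"
  have "degree p \<le> n" unfolding p_def by (rule degree_sum_le) (auto intro: order.trans[OF degree_monom_le])
  moreover have "f z = poly p z" for z
    unfolding p_def using Liouville_polynomial[OF h n, where \<xi> = z] by (simp add: poly_sum poly_monom)
  ultimately show ?thesis using that by blast
qed

text \<open>Every root has order at least 2, so the square of a linear factor splits off and the
  degree drops, until a constant is left.\<close>

lemma even_order_square:
  fixes p :: "complex poly"
  assumes "p \<noteq> 0" "\<And>x. even (order x p)"
  obtains g where "p = g^2"
proof -
  have "\<exists>g. p = g^2" using assms
  proof (induction "degree p" arbitrary: p rule: less_induct)
    case less
    show ?case
    proof (cases "degree p = 0")
      case True
      then obtain c where "p = [:c:]" by (meson degree_eq_zeroE)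
      moreover have "csqrt c * csqrt c = c" by (metis power2_csqrt power2_eq_square)
      ultimately have "p = [:csqrt c:]^2" by (simp add: power2_eq_square)
      then show ?thesis by blast
    next
      case False
      then obtain x where x: "poly p x = 0"
        using fundamental_theorem_of_algebra[of "coeff p" "degree p"] False
        by (metis atLeastAtMost_iff bot_nat_0.not_eq_extremum leading_coeff_0_iff less.prems(1) less_eq_Suc_le One_nat_def le_refl poly_altdef)
      then have "order x p \<noteq> 0" using less.prems(1) by (simp add: order_root)
      then have "order x p \<ge> 2" using less.prems(2)[of x] by (metis One_nat_def dvd_refl even_zero le_neq_implies_less less_2_cases_iff not_less odd_one)
      then have "[:- x, 1:]^2 dvd p" using order_1[of x p] by (meson le_imp_power_dvd dvd_trans)
      then obtain q where q: "p = [:- x, 1:]^2 * q" by (auto simp: dvd_def)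
      have q0: "q \<noteq> 0" using less.prems(1) q by auto
      have "degree p = 2 + degree q" unfolding q using q0 by (subst degree_mult_eq) (auto simp: degree_power_eq)
      moreover have "even (order y q)" for y
      proof -
        have "order y p = order y ([:- x, 1:]^2) + order y q"
          unfolding q by (rule order_mult) (use less.prems(1) q in auto)
        moreover have "order y ([:- x, 1:]^2) = 2 * order y [:- x, 1:]"
          unfolding power2_eq_square by (subst order_mult) auto
        ultimately show ?thesis using less.prems(2)[of y] by (metis dvd_add_right_iff dvd_triv_left)
      qed
      ultimately obtain g where "q = g^2" using less.hyps[of q] q0 by auto
      then have "p = ([:- x, 1:] * g)^2" unfolding q by (simp only: power_mult_distrib)
      then show ?thesis by blast
    qed
  qed
  then show ?thesis using that by blast
qed

lemma square_dvd_square_poly: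
  fixes g p :: "complex poly"
  assumes "g \<noteq> 0" "g^2 dvd p^2"
  shows "g dvd p"
  using assms
proof (induction "degree g" arbitrary: g p rule: less_induct)
  case less
  show ?case
  proof (cases "degree g = 0")
    case True
    then show ?thesis using less.prems(1) by (metis is_unit_iff_degree unit_imp_dvd)
  next
    case False
    then obtain x where x: "poly g x = 0"
      using fundamental_theorem_of_algebra[of "coeff g" "degree g"]
      by (metis atLeastAtMost_iff bot_nat_0.not_eq_extremum leading_coeff_0_iff less.prems(1) less_eq_Suc_le One_nat_def le_refl poly_altdef)
    then obtain g' where g': "g = [:- x, 1:] * g'" by (auto simp: poly_eq_0_iff_dvd dvd_def)
    obtain w where w: "p^2 = g^2 * w" using less.prems(2) by (auto simp: dvd_def)
    then have "(poly p x)^2 = 0" using x by (metis poly_mult poly_power mult_zero_left power_zero_numeral)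
    then obtain p' where p': "p = [:- x, 1:] * p'" by (auto simp: poly_eq_0_iff_dvd dvd_def)
    have nz: "g' \<noteq> 0" using g' less.prems(1) by auto
    have "[:- x, 1:]^2 * p'^2 = [:- x, 1:]^2 * (g'^2 * w)"
      using w unfolding p' g' by (simp only: power_mult_distrib mult.assoc)
    then have "p'^2 = g'^2 * w" by simp
    moreover have "degree g' < degree g" unfolding g' using nz by (subst degree_mult_eq) auto
    ultimately have "g' dvd p'" using less.hyps nz by (metis dvd_triv_left)
    then show ?thesis unfolding g' p' by (rule mult_dvd_mono[OF dvd_refl])
  qed
qed

text \<open>All minors of size 2 vanish. At each point some diagonal entry \<open>P s s\<close> is
  nonzero and \<open>P r0 r0 * P s s\<close> is a square, so \<open>P r0 r0\<close> has even order
  everywhere and is a square g^2. Then g divides the row of \<open>r0\<close>, and the quotients are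
  the \<open>F s\<close>.\<close>

lemma rank_one_polynomials:
  fixes P :: "'i \<Rightarrow> 'i \<Rightarrow> complex poly"
  assumes r: "\<And>u. \<exists>\<kappa> y. \<kappa> \<noteq> 0 \<and> (\<exists>r. y r \<noteq> 0) \<and> (\<forall>r s. poly (P r s) u = \<kappa> * y r * y s)"
  obtains F where "\<And>r s. P r s = F r * F s"
proof -
  have prod: "P r s * P t v = P r t * P s v" for r s t v
  proof (rule poly_eq_poly_eq_iff[THEN iffD1], rule ext)
    fix u
    obtain \<kappa> y where "\<forall>r s. poly (P r s) u = \<kappa> * y r * y s" using r[of u] by blast
    then show "poly (P r s * P t v) u = poly (P r t * P s v) u" by simp
  qed
  have sym: "P r s = P s r" for r s
  proof (rule poly_eq_poly_eq_iff[THEN iffD1], rule ext)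
    fix u
    obtain \<kappa> y where "\<forall>r s. poly (P r s) u = \<kappa> * y r * y s" using r[of u] by blast
    then show "poly (P r s) u = poly (P s r) u" by simp
  qed
  obtain \<kappa> y r0 where "\<kappa> \<noteq> 0" "y r0 \<noteq> 0" "poly (P r0 r0) 0 = \<kappa> * y r0 * y r0" using r[of 0] by metis
  then have "poly (P r0 r0) 0 \<noteq> 0" by simp
  then have p0: "P r0 r0 \<noteq> 0" by auto
  have ev: "even (order u (P r0 r0))" for u
  proof -
    obtain \<kappa> y s where k: "\<kappa> \<noteq> 0" "y s \<noteq> 0" "\<forall>r s. poly (P r s) u = \<kappa> * y r * y s" using r[of u] by metis
    then have nz: "poly (P s s) u \<noteq> 0" by simp
    then have ps: "P s s \<noteq> 0" by auto
    have e: "P r0 r0 * P s s = P r0 s * P r0 s" using prod[of r0 r0 s s] by simp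
    have "order u (P r0 r0) = order u (P r0 r0 * P s s)"
      using nz order_0I[OF nz] p0 ps by (subst order_mult) auto
    also have "\<dots> = 2 * order u (P r0 s)"
      unfolding e using e p0 ps by (subst order_mult) auto
    finally show ?thesis by simp
  qed
  obtain g where g: "P r0 r0 = g^2" using even_order_square[OF p0 ev] by blast
  have g0: "g \<noteq> 0" using g p0 by auto
  have "g dvd P r0 s" for s
  proof -
    have "g^2 dvd (P r0 s)^2" using prod[of r0 r0 s s] g by (metis dvd_triv_left power2_eq_square)
    then show ?thesis by (rule square_dvd_square_poly[OF g0])
  qed
  then obtain F where F: "\<And>s. P r0 s = g * F s" unfolding dvd_def by metis
  have "P s t = F s * F t" for s t
  proof -
    have "g^2 * P s t = P r0 s * P r0 t" using prod[of r0 r0 s t] unfolding g .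
    then have "g^2 * P s t = g^2 * (F s * F t)" unfolding F by (simp only: power2_eq_square mult_ac)
    then show ?thesis using g0 by simp
  qed
  then show ?thesis by (rule that)
qed

lemma poly_degree_2:
  assumes "degree (p :: complex poly) \<le> 2"
  shows "poly p u = coeff p 0 + coeff p 1 * u + coeff p 2 * u^2"
proof -
  have "p = [:coeff p 0, coeff p 1, coeff p 2:]"
  proof (rule poly_eqI)
    fix n :: nat
    consider "n = 0" | "n = 1" | "n = 2" | "n > 2" by linarith
    then show "coeff p n = coeff [:coeff p 0, coeff p 1, coeff p 2:] n"
      by cases (use assms in \<open>auto simp: coeff_pCons coeff_eq_0 numeral_2_eq_2 split: nat.split\<close>)
  qed
  then have "poly p u = poly [:coeff p 0, coeff p 1, coeff p 2:] u" by simp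
  then show ?thesis by (simp add: algebra_simps power2_eq_square)
qed

definition qmap :: "complex^'n \<Rightarrow> complex^'n \<Rightarrow> complex^'n \<Rightarrow> complex^2 \<Rightarrow> complex^'n" where
  "qmap \<alpha> \<beta> \<gamma> x = (x $ 0)^2 *s \<alpha> + (x $ 0 * x $ 1) *s \<beta> + (x $ 1)^2 *s \<gamma>"

lemma qmap_scale: "qmap \<alpha> \<beta> \<gamma> (c *s x) = c^2 *s qmap \<alpha> \<beta> \<gamma> x"
  by (simp add: qmap_def vec_eq_iff power2_eq_square algebra_simps)

lemma nonzero_ppt:
  assumes "x \<noteq> (0 :: complex^2)" obtains c k u where "c \<noteq> 0" "x = c *s ppt k u"
proof -
  obtain k where k: "x $ k \<noteq> 0" using assms by (auto simp: vec_eq_iff)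
  have "x = x $ k *s ppt k (x $ (1 - k) / x $ k)"
    unfolding vec_eq_iff
  proof
    fix i show "x $ i = (x $ k *s ppt k (x $ (1 - k) / x $ k)) $ i"
      using two_cases[of i] two_cases[of k] k by (auto simp: ppt_def)
  qed
  then show ?thesis using that k by blast
qed

text \<open>A nonzero vector is determined up to a scalar by its outer square.\<close>

lemma rank_one_vectors:
  fixes y F :: "complex^'n"
  assumes "\<kappa> \<noteq> 0" "y \<noteq> 0" "\<epsilon> \<noteq> 0" "\<And>r s. \<epsilon> * (F $ r * F $ s) = \<kappa> * y $ r * y $ s"
  obtains d where "d \<noteq> 0" "F = d *s y"
proof -
  obtain r where r: "y $ r \<noteq> 0" using assms(2) by (auto simp: vec_eq_iff)
  have Fr: "F $ r \<noteq> 0" using assms(4)[of r r] assms(1) r by auto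
  define d where "d = \<kappa> * y $ r / (\<epsilon> * F $ r)"
  have "F $ s = d * y $ s" for s
    using assms(4)[of r s] assms(3) Fr by (simp add: d_def field_simps)
  then have "F = d *s y" by (simp add: vec_eq_iff)
  moreover have "d \<noteq> 0" using assms r Fr by (simp add: d_def)
  ultimately show ?thesis using that by blast
qed

context resolution
begin

lemma mu_inj:
  assumes "p \<in> topspace (ctop Z)" "q \<in> topspace (ctop Z)" "\<mu> p = \<mu> q" "p \<notin> EE"
  shows "p = q"
proof -
  let ?E = "{p \<in> topspace (ctop Z). \<mu> p \<notin> SS}"
  have "biholomorphic_map (induced Z ?E :: ('a, 3) complex_space) (induced tot_O2 (XX - SS) :: (_, 3) complex_space) \<mu>"
    using res' by (simp add: small_resolution_def)
  moreover have "topspace (ctop (induced Z ?E :: ('a, 3) complex_space)) = ?E"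
    by (auto simp: induced_def)
  ultimately have "inj_on \<mu> ?E" by (simp add: biholomorphic_map_def bij_betw_def)
  then show ?thesis using assms by (auto simp: inj_on_def EE_def)
qed

end

context curve
begin

text \<open>\<open>Q 0\<close> is bounded on the unit disc, so the transition factor bounds the
  entire function \<open>Q 1\<close> by a multiple of |u|^4 outside it.\<close>

lemma Q_polynomial: "\<exists>p. degree p \<le> 4 \<and> (\<forall>u. Q 1 u r s = poly p u)"
proof -
  have "continuous_on (cball 0 1) (\<lambda>u. Q 0 u r s)"
    using Q_holomorphic holomorphic_on_imp_continuous_on continuous_on_subset by blast
  then have "bounded ((\<lambda>u. Q 0 u r s) ` cball 0 1)"
    by (intro compact_imp_bounded compact_continuous_image) auto
  then obtain B where B: "\<And>u. u \<in> cball 0 1 \<Longrightarrow> norm (Q 0 u r s) \<le> B"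
    unfolding bounded_iff by blast
  have "norm (Q 1 u r s) \<le> B * norm u ^ 4" if "1 \<le> norm u" for u
  proof -
    have u: "u \<noteq> 0" using that by auto
    have "1 / u \<in> cball 0 1" using that u by (simp add: norm_divide field_simps)
    then have "norm (Q 0 (1 / u) r s) \<le> B" by (rule B)
    then have "norm u ^ 4 * norm (Q 0 (1 / u) r s) \<le> norm u ^ 4 * B" by (intro mult_left_mono) auto
    then show ?thesis unfolding Q_patch_change[OF u] by (simp add: norm_mult norm_power mult.commute)
  qed
  from entire_polynomial_growth[OF Q_holomorphic this] show ?thesis by metis
qed

theorem quadratic_parametrization:
  obtains \<alpha> \<beta> \<gamma> where "\<And>x. x \<noteq> 0 \<Longrightarrow> qmap \<alpha> \<beta> \<gamma> x \<noteq> 0"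
    "\<And>x. x \<noteq> 0 \<Longrightarrow> \<exists>z. \<mu> (\<iota> (pt x)) = pt_O2 (qmap \<alpha> \<beta> \<gamma> x, z)"
proof -
  obtain P where P: "\<And>r s. degree (P r s) \<le> 4" "\<And>r s u. Q 1 u r s = poly (P r s) u"
    using Q_polynomial by metis
  have "\<exists>\<kappa> y. \<kappa> \<noteq> 0 \<and> (\<exists>r. y r \<noteq> 0) \<and> (\<forall>r s. poly (P r s) u = \<kappa> * y r * y s)" for u
  proof -
    obtain y z \<kappa> where "\<kappa> \<noteq> 0" "y \<noteq> 0" "\<And>r s. Q 1 u r s = \<kappa> * y $ r * y $ s" using Q_rank_one[of 1 u] by metis
    then show ?thesis unfolding P(2)[symmetric]
      by (intro exI[of _ \<kappa>] exI[of _ "\<lambda>r. y $ r"]) (auto simp: vec_eq_iff)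
  qed
  then obtain G where G: "\<And>r s. P r s = G r * G s" using rank_one_polynomials[of P] by metis
  have dG: "degree (G r) \<le> 2" for r
  proof (cases "G r = 0")
    case False
    then have "degree (P r r) = 2 * degree (G r)" unfolding G by (subst degree_mult_eq) auto
    then show ?thesis using P(1)[of r r] by simp
  qed simp
  define \<alpha> where "\<alpha> = (\<chi> r. coeff (G r) 2)"
  define \<beta> where "\<beta> = (\<chi> r. coeff (G r) 1)"
  define \<gamma> where "\<gamma> = (\<chi> r. coeff (G r) 0)"
  let ?F = "qmap \<alpha> \<beta> \<gamma>"
  have F1: "?F (ppt 1 u) $ r = poly (G r) u" for u r
    unfolding poly_degree_2[OF dG] by (simp add: qmap_def ppt_def \<alpha>_def \<beta>_def \<gamma>_def)
  have Q1: "Q 1 u r s = 1 * (?F (ppt 1 u) $ r * ?F (ppt 1 u) $ s)" for u r s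
    unfolding F1 P(2) G by simp
  have F0: "?F (ppt 0 v) = v^2 *s ?F (ppt 1 (1 / v))" if "v \<noteq> 0" for v
    using that by (simp add: qmap_def ppt_def vec_eq_iff field_simps power2_eq_square)
  \<comment> \<open>The transition factor -u^4 makes the matrix on this patch the negative of the
    outer square. Only proportionality is used later, and the sign goes into \<epsilon>.\<close>
  have Q0': "Q 0 v r s = (-1) * (?F (ppt 0 v) $ r * ?F (ppt 0 v) $ s)" if v: "v \<noteq> 0" for v r s
  proof -
    have "Q 1 (1 / v) r s = - ((1 / v)^4) * Q 0 v r s" using Q_patch_change[of "1 / v" r s] v by simp
    then have "Q 0 v r s = - (v^4) * Q 1 (1 / v) r s" using v by (simp add: field_simps)
    then show ?thesis unfolding Q1 F0[OF v] by (simp add: power2_eq_square power4_eq_xxxx)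
  qed
  \<comment> \<open>The point v = 0 does not lie on the other patch; the identity there follows by
    continuity.\<close>
  have Q0: "Q 0 v r s = (-1) * (?F (ppt 0 v) $ r * ?F (ppt 0 v) $ s)" for v r s
  proof (cases "v = 0")
    case True
    have "continuous_on UNIV (\<lambda>v. Q 0 v r s - (-1) * (?F (ppt 0 v) $ r * ?F (ppt 0 v) $ s))"
      by (simp add: qmap_def ppt_def)
         (intro continuous_intros holomorphic_on_imp_continuous_on[OF Q_holomorphic])
    then have "isCont (\<lambda>v. Q 0 v r s - (-1) * (?F (ppt 0 v) $ r * ?F (ppt 0 v) $ s)) 0"
      using continuous_on_eq_continuous_at by blast
    then have "((\<lambda>v. Q 0 v r s - (-1) * (?F (ppt 0 v) $ r * ?F (ppt 0 v) $ s)) \<longlongrightarrow>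
      Q 0 0 r s - (-1) * (?F (ppt 0 0) $ r * ?F (ppt 0 0) $ s)) (at 0)" by (simp add: isCont_def)
    moreover have "((\<lambda>v. Q 0 v r s - (-1) * (?F (ppt 0 v) $ r * ?F (ppt 0 v) $ s)) \<longlongrightarrow> 0) (at 0)"
      by (rule Lim_transform_eventually[OF tendsto_const]) (auto simp: eventually_at_filter Q0')
    ultimately have "Q 0 0 r s - (-1) * (?F (ppt 0 0) $ r * ?F (ppt 0 0) $ s) = 0"
      using LIM_unique by blast
    then show ?thesis using True by (simp add: add_eq_0_iff2)
  qed (rule Q0')
  have ppt: "?F (ppt k u) \<noteq> 0 \<and> (\<exists>z. \<mu> (\<iota> (pt (ppt k u))) = pt_O2 (?F (ppt k u), z))" for k u
  proof -
    obtain y z \<kappa> where y: "\<kappa> \<noteq> 0" "y \<noteq> 0" "\<mu> (lam k u) = pt_O2 (y, z)" "\<And>r s. Q k u r s = \<kappa> * y $ r * y $ s"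
      using Q_rank_one[of k u] by metis
    obtain \<epsilon> :: complex where e: "\<epsilon> \<noteq> 0" "\<And>r s. Q k u r s = \<epsilon> * (?F (ppt k u) $ r * ?F (ppt k u) $ s)"
      using two_cases[of k] Q0 Q1 that by (metis neg_equal_0_iff_equal zero_neq_one)
    obtain d where d: "d \<noteq> 0" "?F (ppt k u) = d *s y"
      using rank_one_vectors[OF y(1,2) e(1)] e(2) y(4) by metis
    have "?F (ppt k u) \<noteq> 0" using d y(2) by simp
    moreover have "\<mu> (\<iota> (pt (ppt k u))) = pt_O2 (?F (ppt k u), d^2 * z)"
      using y(3) pt_O2_scale[OF d(1), of y z] by (simp add: lam_def d(2))
    ultimately show ?thesis by blast
  qed
  show ?thesis
  proof (rule that)
    fix x :: "complex^2" assume "x \<noteq> 0"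
    then obtain c k u where x: "c \<noteq> 0" "x = c *s ppt k u" by (rule nonzero_ppt)
    show "?F x \<noteq> 0" using ppt[of k u] x by (simp add: qmap_scale)
    obtain z where "\<mu> (\<iota> (pt (ppt k u))) = pt_O2 (?F (ppt k u), z)" using ppt[of k u] by blast
    moreover have "pt x = pt (ppt k u)" unfolding pt_eq_iff by (rule exI[of _ "1 / c"]) (use x in simp)
    ultimately show "\<exists>z. \<mu> (\<iota> (pt x)) = pt_O2 (?F x, z)"
      using pt_O2_scale[of "c^2" "?F (ppt k u)" z] x by (auto simp: qmap_scale)
  qed
qed

end

section \<open>The fibre coordinate along the curve\<close>

locale parametrized_curve = curve +
  fixes \<alpha> \<beta> \<gamma> :: "complex^4"
  assumes F_nonzero: "\<And>x. x \<noteq> 0 \<Longrightarrow> qmap \<alpha> \<beta> \<gamma> x \<noteq> 0"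
    and F_lift: "\<And>x. x \<noteq> 0 \<Longrightarrow> \<exists>z. \<mu> (\<iota> (pt x)) = pt_O2 (qmap \<alpha> \<beta> \<gamma> x, z)"
begin

abbreviation F :: "complex^2 \<Rightarrow> complex^4" where "F \<equiv> qmap \<alpha> \<beta> \<gamma>"

text \<open>The representative \<open>F x\<close> of the image point fixes the scale and thereby the
  fibre coordinate. As \<open>F\<close> has degree 2 and z has weight 2, it is homogeneous of degree
  4.\<close>

definition zz :: "complex^2 \<Rightarrow> complex" where "zz x = (SOME z. \<mu> (\<iota> (pt x)) = pt_O2 (F x, z))"

lemma mu_iota: "x \<noteq> 0 \<Longrightarrow> \<mu> (\<iota> (pt x)) = pt_O2 (F x, zz x)"
  unfolding zz_def by (rule someI_ex[OF F_lift])

lemma zz_unique: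
  assumes "x \<noteq> 0" "\<mu> (\<iota> (pt x)) = pt_O2 (F x, z)" shows "zz x = z"
proof -
  obtain c where c: "c \<noteq> 0" "F x = c *s F x" "z = c^2 * zz x"
    using assms(2) mu_iota[OF assms(1)] by (auto simp: pt_O2_eq_iff)
  obtain r where "F x $ r \<noteq> 0" using F_nonzero[OF assms(1)] by (auto simp: vec_eq_iff)
  moreover have "F x $ r = c * F x $ r" using arg_cong[OF c(2), of "\<lambda>v. v $ r"] by simp
  ultimately have "c = 1" by simp
  then show ?thesis using c(3) by simp
qed

lemma zz_scale: assumes "c \<noteq> 0" "x \<noteq> 0" shows "zz (c *s x) = c^4 * zz x"
proof (rule zz_unique)
  show "c *s x \<noteq> 0" using assms by simp
  have "pt (c *s x) = pt x" unfolding pt_eq_iff by (rule exI[of _ "1 / c"]) (use assms in simp)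
  then show "\<mu> (\<iota> (pt (c *s x))) = pt_O2 (F (c *s x), c^4 * zz x)"
    using mu_iota[OF assms(2)] pt_O2_scale[of "c^2" "F x" "zz x"] assms by (simp add: qmap_scale flip: power_mult)
qed

lemma iota_L: "x \<noteq> 0 \<Longrightarrow> \<iota> (pt x) \<in> L"
  using iota_bij by (auto simp: bij_betw_def)

lemma iota_surj: "p \<in> L \<Longrightarrow> \<exists>x. x \<noteq> 0 \<and> p = \<iota> (pt x)"
  using iota_bij by (auto simp: bij_betw_def)

lemma zz_eq: "x \<noteq> 0 \<Longrightarrow> (zz x)^2 + quartic a b q0 q1 q2 (F x) = 0"
proof -
  assume x: "x \<noteq> 0"
  have "\<mu> (\<iota> (pt x)) \<in> XX" using iota_L[OF x] L_top mu_in by blast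
  then show ?thesis using mu_iota[OF x] by (simp add: XX_def double_solid_iff)
qed

lemma EE_iota: "x \<noteq> 0 \<Longrightarrow> \<iota> (pt x) \<in> EE \<longleftrightarrow> pt (F x) \<in> {Pinf, Pinf', P0 l0}"
proof -
  assume x: "x \<noteq> 0"
  have t: "\<iota> (pt x) \<in> topspace (ctop Z)" using iota_L[OF x] L_top by blast
  have "pt_O2 (F x, zz x) \<in> XX" using mu_in[OF t] by (simp add: mu_iota[OF x])
  then show ?thesis using t by (simp add: EE_def SS_def mu_iota[OF x] proj_O2_pt)
qed

text \<open>The curve is embedded, and \<mu> is injective off the exceptional set.\<close>

lemma curve_injective:
  assumes x: "x \<noteq> 0" "x' \<noteq> 0" and c: "c \<noteq> 0" "F x' = c *s F x" "zz x' = c^2 * zz x"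
    and S: "pt (F x) \<notin> {Pinf, Pinf', P0 l0}"
  shows "pt x = pt x'"
proof -
  have "\<mu> (\<iota> (pt x)) = \<mu> (\<iota> (pt x'))"
    using pt_O2_scale[OF c(1), of "F x" "zz x"] by (simp add: mu_iota x c)
  then have "\<iota> (pt x) = \<iota> (pt x')"
    using iota_L x L_top S EE_iota[OF x(1)] by (intro mu_inj) auto
  then show ?thesis using iota_bij x by (auto simp: bij_betw_def inj_on_def)
qed

lemma tchart_iota:
  assumes "x \<noteq> 0" "F x $ i \<noteq> 0"
  shows "\<mu> (\<iota> (pt x)) \<in> fst (tchart i)" "snd (tchart i) (\<mu> (\<iota> (pt x))) = tcoord i (F x, zz x)"
  using assms by (simp_all add: mu_iota pt_O2_mem_tchart tchart_coord)

text \<open>Chart data valid along the parameters \<open>x0 + t *s x1\<close> for t near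
  \<open>t0\<close>. The numerator in the derivative of the affine coordinate \<open>v\<close> is,
  up to sign, the determinant of \<open>x0\<close> and \<open>x1\<close>.\<close>

lemma line_local:
  assumes x: "x0 + t0 *s x1 \<noteq> 0"
  obtains c \<tau> \<nu> k i T v where "adapted c \<tau> \<nu>" "open T" "t0 \<in> T"
    "\<And>t. t \<in> T \<Longrightarrow> x0 + t *s x1 \<noteq> 0 \<and> F (x0 + t *s x1) $ i \<noteq> 0 \<and> v t \<in> dm c k \<and> \<iota> (pt (x0 + t *s x1)) = lam k (v t)
       \<and> \<mu> (lam k (v t)) \<in> fst (tchart i)"
    "\<And>t. t \<in> T \<Longrightarrow> (v has_field_derivative
        ((x1 $ (1 - k)) * x0 $ k - (x0 $ (1 - k)) * x1 $ k) / ((x0 + t *s x1) $ k)^2) (at t)"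
proof -
  obtain k where k: "(x0 + t0 *s x1) $ k \<noteq> 0" using x by (auto simp: vec_eq_iff)
  obtain i where i: "F (x0 + t0 *s x1) $ i \<noteq> 0" using F_nonzero[OF x] by (auto simp: vec_eq_iff)
  define v where "v t = (x0 + t *s x1) $ (1 - k) / (x0 + t *s x1) $ k" for t
  define T0 where "T0 = {t. (x0 + t *s x1) $ k \<noteq> 0}"
  have T0: "open T0"
  proof -
    have "open ((\<lambda>t. (x0 + t *s x1) $ k) -` (- {0}))" by (intro open_vimage) (auto intro!: continuous_intros)
    then show ?thesis by (simp add: T0_def vimage_def Compl_eq)
  qed
  have lam: "\<iota> (pt (x0 + t *s x1)) = lam k (v t)" if "t \<in> T0" for t
    using that pt_ppt[of "x0 + t *s x1" k] by (simp add: T0_def lam_def v_def)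
  have dv: "(v has_field_derivative
        ((x1 $ (1 - k)) * x0 $ k - (x0 $ (1 - k)) * x1 $ k) / ((x0 + t *s x1) $ k)^2) (at t)" if "t \<in> T0" for t
    unfolding v_def using that
    by (auto intro!: derivative_eq_intros simp: T0_def power2_eq_square algebra_simps)
  obtain c \<tau> \<nu> where a: "adapted c \<tau> \<nu>" "v t0 \<in> dm c k" by (rule adapted_at)
  define T where "T = T0 \<inter> v -` {u \<in> dm c k. \<mu> (lam k u) \<in> fst (tchart i)}"
  have cv: "continuous_on T0 v"
    by (intro continuous_at_imp_continuous_on ballI DERIV_isCont[OF dv])
  have oT: "open T" unfolding T_def by (rule continuous_open_preimage[OF cv T0 curve_patch_open[OF a(1)]])
  have t0: "t0 \<in> T0" using k by (simp add: T0_def)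
  have "\<mu> (lam k (v t0)) \<in> fst (tchart i)" using tchart_iota(1)[OF x i] lam[OF t0] by simp
  then have tT: "t0 \<in> T" using t0 a(2) by (simp add: T_def)
  show ?thesis
  proof (rule that[OF a(1) oT tT])
    fix t assume t: "t \<in> T"
    then have t': "t \<in> T0" "v t \<in> dm c k" "\<mu> (lam k (v t)) \<in> fst (tchart i)" by (auto simp: T_def)
    have nz: "x0 + t *s x1 \<noteq> 0"
    proof
      assume "x0 + t *s x1 = 0"
      then have "(x0 + t *s x1) $ k = 0" by (simp only: zero_index)
      then show False using t'(1) by (simp only: T0_def mem_Collect_eq)
    qed
    have "pt_O2 (F (x0 + t *s x1), zz (x0 + t *s x1)) \<in> fst (tchart i)"
      using t'(3) lam[OF t'(1)] mu_iota[OF nz] by simp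
    then show "x0 + t *s x1 \<noteq> 0 \<and> F (x0 + t *s x1) $ i \<noteq> 0 \<and> v t \<in> dm c k \<and> \<iota> (pt (x0 + t *s x1)) = lam k (v t)
       \<and> \<mu> (lam k (v t)) \<in> fst (tchart i)"
      using nz t' lam[OF t'(1)] by (simp add: pt_O2_mem_tchart)
    show "(v has_field_derivative
        ((x1 $ (1 - k)) * x0 $ k - (x0 $ (1 - k)) * x1 $ k) / ((x0 + t *s x1) $ k)^2) (at t)"
      by (rule dv[OF t'(1)])
  qed
qed

lemma F_line_holomorphic: "(\<lambda>t. F (x0 + t *s x1) $ r) holomorphic_on S"
  unfolding qmap_def by (auto intro!: holomorphic_intros)

text \<open>The i-th slot of the chart is z / y_i^2, so z is that slot times the square of the i-th
  component of \<open>F\<close>.\<close>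

lemma zz_holomorphic: "(\<lambda>t. zz (x0 + t *s x1)) holomorphic_on {t. x0 + t *s x1 \<noteq> 0}"
proof -
  have "open ((\<lambda>t. x0 + t *s x1) -` (- {0}))" by (intro open_vimage continuous_intros)
  then have o: "open {t. x0 + t *s x1 \<noteq> 0}" by (simp add: vimage_def Compl_eq)
  show ?thesis
    unfolding holomorphic_on_open[OF o]
  proof
    fix t0 assume "t0 \<in> {t. x0 + t *s x1 \<noteq> 0}"
    then have "x0 + t0 *s x1 \<noteq> 0" by simp
    then obtain c \<tau> \<nu> k i T v where l: "adapted c \<tau> \<nu>" "open T" "t0 \<in> T"
    "\<And>t. t \<in> T \<Longrightarrow> x0 + t *s x1 \<noteq> 0 \<and> F (x0 + t *s x1) $ i \<noteq> 0 \<and> v t \<in> dm c k \<and> \<iota> (pt (x0 + t *s x1)) = lam k (v t)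
       \<and> \<mu> (lam k (v t)) \<in> fst (tchart i)"
    "\<And>t. t \<in> T \<Longrightarrow> (v has_field_derivative
        ((x1 $ (1 - k)) * x0 $ k - (x0 $ (1 - k)) * x1 $ k) / ((x0 + t *s x1) $ k)^2) (at t)"
      by (rule line_local) blast
    have c: "c \<in> max_atlas Z" using l(1) by (simp add: adapted_def)
    have h: "holomorphic_fn (dom c i) (\<lambda>x. m c i x $ i)" using m_holo[OF c] by (simp add: holo_map_def)
    have hv: "v holomorphic_on T" unfolding holomorphic_on_open[OF l(2)] using l(5) by blast
    have "(\<lambda>t. m c i (snd c (lam k (v t))) $ i) holomorphic_on T"
      by (rule holomorphic_on_compose_gen[OF hv curve_compose_holomorphic[OF l(1) h], unfolded o_def]) (use l(4) in auto)
    then have "(\<lambda>t. m c i (snd c (lam k (v t))) $ i * (F (x0 + t *s x1) $ i)^2) holomorphic_on T"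
      by (intro holomorphic_intros F_line_holomorphic)
    then have "(\<lambda>t. zz (x0 + t *s x1)) holomorphic_on T"
    proof (rule holomorphic_transform)
      fix t assume t: "t \<in> T"
      have p: "lam k (v t) \<in> fst c" using l(4)[OF t] by (simp add: dm_def)
      have "m c i (snd c (lam k (v t))) = tcoord i (F (x0 + t *s x1), zz (x0 + t *s x1))"
        using tchart_iota(2)[of "x0 + t *s x1" i] l(4)[OF t] by (simp add: m_at[OF c p])
      then show "m c i (snd c (lam k (v t))) $ i * (F (x0 + t *s x1) $ i)^2 = zz (x0 + t *s x1)"
        using l(4)[OF t] by (simp add: tcoord_def)
    qed
    then show "\<exists>f'. ((\<lambda>t. zz (x0 + t *s x1)) has_field_derivative f') (at t0)"
      using l(2,3) by (meson holomorphic_derivI)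
  qed
qed

text \<open>The velocity of the embedded curve is nonzero and \<mu> is immersive off the exceptional
  set, so \<open>F\<close> and \<open>zz\<close> cannot both be stationary at a point that is not
  singular.\<close>

lemma curve_immersive:
  assumes x: "x0 \<noteq> 0" and ind: "x0 $ 0 * x1 $ 1 \<noteq> x0 $ 1 * x1 $ 0"
    and dF: "\<And>r. ((\<lambda>t. F (x0 + t *s x1) $ r) has_field_derivative 0) (at 0)"
    and dz: "((\<lambda>t. zz (x0 + t *s x1)) has_field_derivative 0) (at 0)"
  shows "pt (F x0) \<in> {Pinf, Pinf', P0 l0}"
proof (rule ccontr)
  assume S: "pt (F x0) \<notin> {Pinf, Pinf', P0 l0}"
  have "x0 + 0 *s x1 \<noteq> 0" using x by simp
  then obtain c \<tau> \<nu> k i T v where l: "adapted c \<tau> \<nu>" "open T" "0 \<in> T"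
    "\<And>t. t \<in> T \<Longrightarrow> x0 + t *s x1 \<noteq> 0 \<and> F (x0 + t *s x1) $ i \<noteq> 0 \<and> v t \<in> dm c k \<and> \<iota> (pt (x0 + t *s x1)) = lam k (v t)
       \<and> \<mu> (lam k (v t)) \<in> fst (tchart i)"
    "\<And>t. t \<in> T \<Longrightarrow> (v has_field_derivative
        ((x1 $ (1 - k)) * x0 $ k - (x0 $ (1 - k)) * x1 $ k) / ((x0 + t *s x1) $ k)^2) (at t)"
    by (rule line_local) blast
  have c: "c \<in> max_atlas Z" using l(1) by (simp add: adapted_def)
  define p where "p = lam k (v 0)"
  have p: "p \<in> fst c" "\<mu> p \<in> fst (tchart i)" "p = \<iota> (pt x0)" "v 0 \<in> dm c k" "F x0 $ i \<noteq> 0"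
    using l(4)[OF l(3)] by (auto simp: p_def dm_def)
  have pE: "p \<notin> EE" using EE_iota[OF x] S p(3) by simp
  define D where "D = frechet_derivative (m c i) (at (snd c p))"
  have xd: "snd c p \<in> dom c i" using dom_mem[OF c p(1)] p(2) by simp
  define w where "w = ((x1 $ (1 - k)) * x0 $ k - (x0 $ (1 - k)) * x1 $ k) / ((x0 + 0 *s x1) $ k)^2"
  have dv: "(v has_field_derivative w) (at 0)" unfolding w_def by (rule l(5)[OF l(3)])
  have th: "theta c \<tau> k (v 0) \<noteq> 0" by (rule theta_nonzero[OF l(1) p(4)])
  have dg: "((\<lambda>t. snd c (lam k (v t)) $ j) has_field_derivative ((w * theta c \<tau> k (v 0)) *s axis \<tau> 1) $ j) (at 0)" for j
    using DERIV_chain2[OF curve_vec_has_derivative[OF l(1) p(4), of j] dv] by (simp add: mult_ac)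
  have dm: "((\<lambda>t. m c i (snd c (lam k (v t))) $ j) has_field_derivative D ((w * theta c \<tau> k (v 0)) *s axis \<tau> 1) $ j) (at 0)" for j
  proof -
    have h: "holomorphic_fn (dom c i) (\<lambda>x. m c i x $ j)" using m_holo[OF c] by (simp add: holo_map_def)
    have "((\<lambda>t. m c i (snd c (lam k (v t))) $ j) has_field_derivative
       frechet_derivative (\<lambda>x. m c i x $ j) (at (snd c (lam k (v 0)))) ((w * theta c \<tau> k (v 0)) *s axis \<tau> 1)) (at 0)"
      by (rule holomorphic_fn_along_curve[where \<gamma> = "\<lambda>t. snd c (lam k (v t))", OF h]) (use xd dg in \<open>auto simp: p_def\<close>)
    moreover have "m c i differentiable (at (snd c p))"
      using holo_map_has_derivative[OF m_holo[OF c] xd] differentiableI by blast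
    ultimately show ?thesis by (simp add: frechet_derivative_component D_def p_def)
  qed
  have zero: "D ((w * theta c \<tau> k (v 0)) *s axis \<tau> 1) $ j = 0" for j
  proof -
    have nz: "F (x0 + 0 *s x1) $ i \<noteq> 0" using p(5) by simp
    have "((\<lambda>t. tcoord i (F (x0 + t *s x1), zz (x0 + t *s x1)) $ j) has_field_derivative 0) (at 0)"
    proof (cases "j = i")
      case True
      have "((\<lambda>t. zz (x0 + t *s x1) / (F (x0 + t *s x1) $ i)^2) has_field_derivative 0) (at 0)"
        by (rule DERIV_cong[OF DERIV_divide[OF dz DERIV_power[OF dF[of i]]]]) (use nz in auto)
      then show ?thesis using True by (simp add: tcoord_def)
    next
      case False
      have "((\<lambda>t. F (x0 + t *s x1) $ j / F (x0 + t *s x1) $ i) has_field_derivative 0) (at 0)"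
        by (rule DERIV_cong[OF DERIV_divide[OF dF[of j] dF[of i]]]) (use nz in auto)
      then show ?thesis using False by (simp add: tcoord_def)
    qed
    then have "((\<lambda>t. m c i (snd c (lam k (v t))) $ j) has_field_derivative 0) (at 0)"
    proof (rule has_field_derivative_transform_within_open[OF _ l(2,3)])
      fix t assume t: "t \<in> T"
      have p: "lam k (v t) \<in> fst c" using l(4)[OF t] by (simp add: dm_def)
      show "tcoord i (F (x0 + t *s x1), zz (x0 + t *s x1)) $ j = m c i (snd c (lam k (v t))) $ j"
        using tchart_iota(2)[of "x0 + t *s x1" i] l(4)[OF t] by (simp add: m_at[OF c p])
    qed
    then show ?thesis using dm[of j] DERIV_unique by blast
  qed
  then have "D ((w * theta c \<tau> k (v 0)) *s axis \<tau> 1) = 0" by (simp add: vec_eq_iff)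
  then have "(w * theta c \<tau> k (v 0)) *s axis \<tau> (1::complex) = 0" unfolding D_def by (rule m_immersion[OF c p(1) pE p(2)])
  then have "w * theta c \<tau> k (v 0) = 0" by (metis axis_nth mult.right_neutral vector_smult_component zero_index)
  then have "w = 0" using th by simp
  \<comment> \<open>Division by zero yields 0, so only with this does \<open>w = 0\<close> say that
    the determinant of \<open>x0\<close> and \<open>x1\<close> vanishes.\<close>
  moreover have "x0 $ k \<noteq> 0"
  proof
    assume z: "x0 $ k = 0"
    have "\<iota> (pt x0) = lam k (v 0)" using p(3) p_def by simp
    then have "pt x0 = pt (ppt k (v 0))"
      using iota_bij x ppt_nonzero[of k "v 0"] by (auto simp: lam_def bij_betw_def inj_on_def)
    then obtain d where "d \<noteq> 0" "ppt k (v 0) = d *s x0" by (auto simp: pt_eq_iff)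
    then have "ppt k (v 0) $ k = 0" using z by simp
    then show False by (simp add: ppt_def)
  qed
  ultimately have "(x1 $ (1 - k)) * x0 $ k = (x0 $ (1 - k)) * x1 $ k" by (simp add: w_def)
  then show False using ind two_cases[of k] by (auto simp: mult.commute)
qed

end

section \<open>Lines and conics\<close>

lemma entire_zero_product:
  assumes h: "f holomorphic_on UNIV" "g holomorphic_on UNIV" and z: "\<And>t. f t * g t = (0::complex)"
  shows "(\<forall>t. f t = 0) \<or> (\<forall>t. g t = 0)"
proof (rule disjCI)
  assume "\<not> (\<forall>t. g t = 0)"
  then obtain t0 where t0: "g t0 \<noteq> 0" by blast
  define U where "U = g -` (- {0})"
  have "open U" unfolding U_def
    by (rule open_vimage[OF _ holomorphic_on_imp_continuous_on[OF h(2)]]) (rule open_Compl, simp)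
  moreover have "t0 \<in> U" using t0 by (simp add: U_def)
  moreover have "f t = 0" if "t \<in> U" for t using z[of t] that by (simp add: U_def)
  ultimately have "f t = 0" for t
    using analytic_continuation_open[of U UNIV f "\<lambda>_. 0" t] h(1) by (metis UNIV_I connected_UNIV empty_iff holomorphic_on_const open_UNIV subset_UNIV)
  then show "\<forall>t. f t = 0" by blast
qed

text \<open>The quotient f(t)^2 / t^2 tends both to \<open>D^2\<close> and to
  \<open>c1\<close>.\<close>

lemma odd_square_root_coefficients:
  fixes f :: "complex \<Rightarrow> complex"
  assumes d: "(f has_field_derivative D) (at 0)" and f0: "f 0 = 0"
    and sq: "\<And>t. (f t)^2 = c0 + c1 * t^2 + c2 * t^4 + c3 * t^6 + c4 * t^8"
  shows "c0 = 0" "c1 = D^2"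
proof -
  show c0: "c0 = 0" using sq[of 0] f0 by simp
  have "((\<lambda>t. (f t / t)^2) \<longlongrightarrow> D^2) (at 0)"
    by (intro tendsto_power) (use d f0 in \<open>simp add: has_field_derivative_iff\<close>)
  moreover have "((\<lambda>t. (f t / t)^2) \<longlongrightarrow> c1) (at 0)"
  proof -
    have "((\<lambda>t. c1 + c2 * t^2 + c3 * t^4 + c4 * t^6) \<longlongrightarrow> c1 + c2 * 0^2 + c3 * 0^4 + c4 * 0^6) (at 0)"
      by (intro tendsto_intros)
    then have "((\<lambda>t. c1 + c2 * t^2 + c3 * t^4 + c4 * t^6) \<longlongrightarrow> c1) (at 0)" by simp
    then show ?thesis
    proof (rule Lim_transform_eventually)
      have "c1 + c2 * t^2 + c3 * t^4 + c4 * t^6 = (f t / t)^2" if "t \<noteq> 0" for t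
      proof -
        have "t^4 = t^2 * t^2" "t^6 = t^2 * t^4" "t^8 = t^2 * t^6" by (simp_all flip: power_add)
        then have "(f t)^2 = (c1 + c2 * t^2 + c3 * t^4 + c4 * t^6) * t^2"
          using sq[of t] c0 by (simp add: algebra_simps)
        then show ?thesis using that by (simp add: power_divide)
      qed
      then show "\<forall>\<^sub>F t in at 0. c1 + c2 * t^2 + c3 * t^4 + c4 * t^6 = (f t / t)^2"
        by (simp add: eventually_at_filter)
    qed
  qed
  ultimately show "c1 = D^2" using LIM_unique by blast
qed

lemma binary_quadratic_mult:
  fixes s :: "'a::comm_ring_1"
  shows "(p0 * s^2 + p1 * s * t + p2 * t^2) * (r0 * s^2 + r1 * s * t + r2 * t^2) =
    (p0 * r0) * s^4 + (p0 * r1 + p1 * r0) * s^3 * t + (p0 * r2 + p1 * r1 + p2 * r0) * s^2 * t^2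
    + (p1 * r2 + p2 * r1) * s * t^3 + (p2 * r2) * t^4"
  by (simp add: power2_eq_square power3_eq_cube power4_eq_xxxx algebra_simps)

lemma quartic_pencil:
  obtains c0 c1 c2 c3 c4 where
    "\<And>s t. quartic a b q0 q1 q2 (s *s A + t *s C) =
       c0 * s^4 + c1 * s^3 * t + c2 * s^2 * t^2 + c3 * s * t^3 + c4 * t^4"
proof -
  let ?a = "of_real a :: complex" and ?b = "of_real b :: complex"
  define m0 where "m0 = A$2 * A$3 + Qf q0 q1 q2 (A$0) (A$1)"
  define m2 where "m2 = C$2 * C$3 + Qf q0 q1 q2 (C$0) (C$1)"
  define m1 where "m1 = A$2 * C$3 + A$3 * C$2 + 2 * of_real q0 * A$0 * C$0 + of_real q1 * (A$0 * C$1 + A$1 * C$0)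
    + 2 * of_real q2 * A$1 * C$1"
  define u0 where "u0 = A$0 * A$1"
  define u1 where "u1 = A$0 * C$1 + A$1 * C$0"
  define u2 where "u2 = C$0 * C$1"
  define v0 where "v0 = (A$0 + A$1) * (?a * A$0 - ?b * A$1)"
  define v1 where "v1 = (A$0 + A$1) * (?a * C$0 - ?b * C$1) + (C$0 + C$1) * (?a * A$0 - ?b * A$1)"
  define v2 where "v2 = (C$0 + C$1) * (?a * C$0 - ?b * C$1)"
  have "quartic a b q0 q1 q2 (s *s A + t *s C) =
      (m0 * m0 - u0 * v0) * s^4 + (m0 * m1 + m1 * m0 - u0 * v1 - u1 * v0) * s^3 * t
      + (m0 * m2 + m1 * m1 + m2 * m0 - u0 * v2 - u1 * v1 - u2 * v0) * s^2 * t^2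
      + (m1 * m2 + m2 * m1 - u1 * v2 - u2 * v1) * s * t^3 + (m2 * m2 - u2 * v2) * t^4" for s t
  proof -
    have m: "(s *s A + t *s C) $ 2 * (s *s A + t *s C) $ 3 + Qf q0 q1 q2 ((s *s A + t *s C) $ 0) ((s *s A + t *s C) $ 1)
       = m0 * s^2 + m1 * s * t + m2 * t^2"
      by (simp add: Qf_def m0_def m1_def m2_def power2_eq_square algebra_simps)
    have u: "(s *s A + t *s C) $ 0 * (s *s A + t *s C) $ 1 = u0 * s^2 + u1 * s * t + u2 * t^2"
      by (simp add: u0_def u1_def u2_def power2_eq_square algebra_simps)
    have v: "((s *s A + t *s C) $ 0 + (s *s A + t *s C) $ 1)
        * (?a * (s *s A + t *s C) $ 0 - ?b * (s *s A + t *s C) $ 1) = v0 * s^2 + v1 * s * t + v2 * t^2"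
      by (simp add: v0_def v1_def v2_def power2_eq_square algebra_simps)
    let ?P = "m0 * s^2 + m1 * s * t + m2 * t^2"
    have "quartic a b q0 q1 q2 (s *s A + t *s C) = ?P * ?P
        - (u0 * s^2 + u1 * s * t + u2 * t^2) * (v0 * s^2 + v1 * s * t + v2 * t^2)"
      unfolding quartic_def m u[symmetric] v[symmetric] by (simp only: power2_eq_square mult.assoc)
    also have "\<dots> = (m0 * m0 - u0 * v0) * s^4 + (m0 * m1 + m1 * m0 - u0 * v1 - u1 * v0) * s^3 * t
      + (m0 * m2 + m1 * m1 + m2 * m0 - u0 * v2 - u1 * v1 - u2 * v0) * s^2 * t^2
      + (m1 * m2 + m2 * m1 - u1 * v2 - u2 * v1) * s * t^3 + (m2 * m2 - u2 * v2) * t^4"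
      unfolding binary_quadratic_mult by (simp add: left_diff_distrib distrib_right)
    finally show ?thesis .
  qed
  then show ?thesis by (rule that)
qed

section \<open>Linear algebra of quadratic maps in two variables\<close>

definition vec2 :: "'a \<Rightarrow> 'a \<Rightarrow> 'a^2" where "vec2 u v = (\<chi> i. if i = 0 then u else v)"

lemma vec2_nth [simp]: "vec2 u v $ 0 = u" "vec2 u v $ 1 = v" by (simp_all add: vec2_def)

lemma vec2_eq_iff: "x = y \<longleftrightarrow> x $ 0 = y $ 0 \<and> x $ (1::2) = y $ 1"
proof
  assume e: "x $ 0 = y $ 0 \<and> x $ (1::2) = y $ 1"
  have "x $ i = y $ i" for i using two_cases[of i] e by auto
  then show "x = y" by (simp add: vec_eq_iff)
qed simp

definition det2 :: "complex^2 \<Rightarrow> complex^2 \<Rightarrow> complex" where "det2 x y = x $ 0 * y $ 1 - x $ 1 * y $ 0"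

lemma det2_nonzero: "det2 x y \<noteq> 0 \<Longrightarrow> s *s x + t *s y = 0 \<Longrightarrow> s = 0 \<and> t = 0"
proof -
  assume d: "det2 x y \<noteq> 0" and e: "s *s x + t *s y = 0"
  have e0: "s * x$0 + t * y$0 = 0" and e1: "s * x$1 + t * y$1 = 0"
    using arg_cong[OF e, of "\<lambda>v. v $ 0"] arg_cong[OF e, of "\<lambda>v. v $ 1"] by simp_all
  have "s * det2 x y = y$1 * (s * x$0 + t * y$0) - y$0 * (s * x$1 + t * y$1)"
    "t * det2 x y = x$0 * (s * x$1 + t * y$1) - x$1 * (s * x$0 + t * y$0)"
    by (simp_all add: det2_def algebra_simps)
  then have "s * det2 x y = 0" "t * det2 x y = 0" unfolding e0 e1 by auto
  then show ?thesis using d by auto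
qed

lemma det2_basis:
  assumes "det2 x y \<noteq> 0" obtains s t where "v = s *s x + t *s y"
proof (rule that)
  have "(v$0 * y$1 - v$1 * y$0) * x$0 + (x$0 * v$1 - x$1 * v$0) * y$0 = det2 x y * v$0"
    "(v$0 * y$1 - v$1 * y$0) * x$1 + (x$0 * v$1 - x$1 * v$0) * y$1 = det2 x y * v$1"
    by (simp_all add: det2_def algebra_simps)
  then show "v = (det2 v y / det2 x y) *s x + (det2 x v / det2 x y) *s y"
    unfolding vec2_eq_iff using assms
    by (simp add: det2_def[of v] det2_def[of x v] field_simps)
qed

lemma det2_exists: assumes "x \<noteq> 0" obtains y where "det2 x y \<noteq> 0"
proof -
  have "det2 x (vec2 0 1) \<noteq> 0 \<or> det2 x (vec2 1 0) \<noteq> 0" using assms by (auto simp: det2_def vec2_eq_iff)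
  then show ?thesis using that by blast
qed

text \<open>The symmetric bilinear map with polar(x, x) = 2 qmap(x), i.e. the mixed coefficient of
  \<open>qmap\<close> on a line.\<close>

definition polar :: "complex^'n \<Rightarrow> complex^'n \<Rightarrow> complex^'n \<Rightarrow> complex^2 \<Rightarrow> complex^2 \<Rightarrow> complex^'n" where
  "polar \<alpha> \<beta> \<gamma> x y = (2 * x$0 * y$0) *s \<alpha> + (x$0 * y$1 + x$1 * y$0) *s \<beta> + (2 * x$1 * y$1) *s \<gamma>"

lemma qmap_line: "qmap \<alpha> \<beta> \<gamma> (s *s x + t *s y) = s^2 *s qmap \<alpha> \<beta> \<gamma> x + (s * t) *s polar \<alpha> \<beta> \<gamma> x y + t^2 *s qmap \<alpha> \<beta> \<gamma> y"
  by (simp add: qmap_def polar_def vec_eq_iff power2_eq_square algebra_simps)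

lemma qmap_change: "qmap (qmap \<alpha> \<beta> \<gamma> x) (polar \<alpha> \<beta> \<gamma> x y) (qmap \<alpha> \<beta> \<gamma> y) (vec2 s t) = qmap \<alpha> \<beta> \<gamma> (s *s x + t *s y)"
  by (simp add: qmap_line) (simp add: qmap_def)

text \<open>The coefficients of the relation form a binary quadratic form, which over the complex
  numbers is a product of two linear ones; these are \<open>x\<close> and \<open>y\<close>. If they
  were proportional, \<open>polar\<close> would be a nonzero multiple of \<open>qmap\<close> at
  \<open>x\<close>.\<close>

lemma polar_zero_if_dependent:
  assumes r: "k0 *s \<alpha> + k1 *s \<beta> + k2 *s \<gamma> = 0" and k: "k0 \<noteq> 0 \<or> k1 \<noteq> 0 \<or> k2 \<noteq> 0"
    and nz: "\<And>x. x \<noteq> 0 \<Longrightarrow> qmap \<alpha> \<beta> \<gamma> x \<noteq> 0"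
  obtains x y where "det2 x y \<noteq> 0" "polar \<alpha> \<beta> \<gamma> x y = 0"
proof -
  have "\<exists>(x :: complex^2) (y :: complex^2). x \<noteq> 0 \<and> y \<noteq> 0 \<and> 2 * x$0 * y$0 = k0 \<and> x$0 * y$1 + x$1 * y$0 = k1 \<and> 2 * x$1 * y$1 = k2"
  proof (cases "k0 = 0")
    case True
    let ?x = "vec2 0 1 :: complex^2" and ?y = "vec2 k1 (k2 / 2) :: complex^2"
    have h: "?x \<noteq> 0 \<and> ?y \<noteq> 0 \<and> 2 * ?x$0 * ?y$0 = k0 \<and> ?x$0 * ?y$1 + ?x$1 * ?y$0 = k1 \<and> 2 * ?x$1 * ?y$1 = k2"
      using k True by (auto simp: vec2_eq_iff)
    show ?thesis by (rule exI[of _ ?x], rule exI[of _ ?y], rule h)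
  next
    case False
    \<comment> \<open>The root of the discriminant: the quadratic formula solves the three product
      equations for \<open>x\<close> and \<open>y\<close>.\<close>
    define d where "d = csqrt (k1^2 - k0 * k2)"
    have d: "d * d = k1^2 - k0 * k2" by (simp add: d_def flip: power2_eq_square)
    let ?x = "vec2 k0 (k1 - d) :: complex^2" and ?y = "vec2 (1 / 2) ((k1 + d) / (2 * k0)) :: complex^2"
    have "?x \<noteq> 0" "?y \<noteq> 0" using False by (auto simp: vec2_eq_iff)
    moreover have "(k1 - d) * (k1 + d) = k0 * k2" using d by (simp add: power2_eq_square algebra_simps)
    then have "(k1 - d) * (k1 + d) / k0 = k2" using False by simp
    then have "2 * (k1 - d) * ((k1 + d) / (2 * k0)) = k2" by (simp only: times_divide_eq_right mult.assoc) simp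
    then have "2 * ?x$1 * ?y$1 = k2" by (simp only: vec2_nth)
    moreover have "?x$0 * ?y$1 + ?x$1 * ?y$0 = k1" using False by (simp add: field_simps)
    moreover have "2 * ?x$0 * ?y$0 = k0" by simp
    ultimately have h: "?x \<noteq> 0 \<and> ?y \<noteq> 0 \<and> 2 * ?x$0 * ?y$0 = k0 \<and> ?x$0 * ?y$1 + ?x$1 * ?y$0 = k1 \<and> 2 * ?x$1 * ?y$1 = k2"
      by (intro conjI)
    show ?thesis by (rule exI[of _ ?x], rule exI[of _ ?y], rule h)
  qed
  then obtain x y :: "complex^2"
    where xy: "x \<noteq> 0 \<and> y \<noteq> 0 \<and> 2 * x$0 * y$0 = k0 \<and> x$0 * y$1 + x$1 * y$0 = k1 \<and> 2 * x$1 * y$1 = k2"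
    by (elim exE)
  note xy = xy[THEN conjunct1] xy[THEN conjunct2, THEN conjunct1] xy[THEN conjunct2, THEN conjunct2, THEN conjunct1]
    xy[THEN conjunct2, THEN conjunct2, THEN conjunct2, THEN conjunct1] xy[THEN conjunct2, THEN conjunct2, THEN conjunct2, THEN conjunct2]
  have p: "polar \<alpha> \<beta> \<gamma> x y = 0" using r unfolding polar_def xy .
  have "det2 x y \<noteq> 0"
  proof
    assume d: "det2 x y = 0"
    obtain k where k: "x $ k \<noteq> 0" using xy(1) by (auto simp: vec_eq_iff)
    have "x $ k *s y = y $ k *s x"
      using d two_cases[of k] by (auto simp: vec2_eq_iff det2_def algebra_simps)
    then have e: "x $ k * y $ 0 = y $ k * x $ 0" "x $ k * y $ 1 = y $ k * x $ 1"
      by (simp_all add: vec2_eq_iff)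
    have "x $ k *s polar \<alpha> \<beta> \<gamma> x y = (2 * x$0 * (x $ k * y$0)) *s \<alpha> + (x$0 * (x $ k * y$1) + x$1 * (x $ k * y$0)) *s \<beta>
        + (2 * x$1 * (x $ k * y$1)) *s \<gamma>"
      by (simp add: polar_def vec_eq_iff algebra_simps)
    also have "\<dots> = (2 * y $ k) *s qmap \<alpha> \<beta> \<gamma> x"
      unfolding e by (simp add: qmap_def vec_eq_iff power2_eq_square algebra_simps)
    finally have "x $ k *s polar \<alpha> \<beta> \<gamma> x y = (2 * y $ k) *s qmap \<alpha> \<beta> \<gamma> x" .
    moreover have "y $ k \<noteq> 0" using \<open>x $ k *s y = y $ k *s x\<close> k xy(2) by auto
    ultimately show False using p nz[OF xy(1)] by simp
  qed
  then show ?thesis using p that by blast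
qed

definition indep3 :: "complex^'n \<Rightarrow> complex^'n \<Rightarrow> complex^'n \<Rightarrow> bool" where
  "indep3 \<alpha> \<beta> \<gamma> \<longleftrightarrow>
    (\<forall>k0 k1 k2. k0 *s \<alpha> + k1 *s \<beta> + k2 *s \<gamma> = 0 \<longrightarrow> k0 = 0 \<and> k1 = 0 \<and> k2 = 0)"

lemma indep3_coefficients:
  assumes "indep3 \<alpha> \<beta> \<gamma>" "u *s \<alpha> + v *s \<beta> + w *s \<gamma> = u' *s \<alpha> + v' *s \<beta> + w' *s \<gamma>"
  shows "u = u' \<and> v = v' \<and> w = w'"
proof -
  have "(u - u') *s \<alpha> + (v - v') *s \<beta> + (w - w') *s \<gamma>
      = (u *s \<alpha> + v *s \<beta> + w *s \<gamma>) - (u' *s \<alpha> + v' *s \<beta> + w' *s \<gamma>)"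
    by (simp add: vec_eq_iff algebra_simps)
  then have "(u - u') *s \<alpha> + (v - v') *s \<beta> + (w - w') *s \<gamma> = 0" unfolding assms(2) by simp
  then have "u - u' = 0 \<and> v - v' = 0 \<and> w - w' = 0" using assms(1) unfolding indep3_def by blast
  then show ?thesis by simp
qed

text \<open>The change of coordinates is the symmetric square of an invertible matrix of size 2; the
  identities at the end invert it up to the square of the determinant.\<close>

lemma indep3_change:
  assumes ind: "indep3 \<alpha> \<beta> \<gamma>" and d: "det2 x y \<noteq> 0"
  shows "indep3 (qmap \<alpha> \<beta> \<gamma> x) (polar \<alpha> \<beta> \<gamma> x y) (qmap \<alpha> \<beta> \<gamma> y)"
  unfolding indep3_def
proof (intro allI impI)
  fix k0 k1 k2
  assume z: "k0 *s qmap \<alpha> \<beta> \<gamma> x + k1 *s polar \<alpha> \<beta> \<gamma> x y + k2 *s qmap \<alpha> \<beta> \<gamma> y = 0"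
  define p q r s where "p = x$0" and "q = x$1" and "r = y$0" and "s = y$1"
  define e0 where "e0 = k0 * p^2 + k1 * (2 * p * r) + k2 * r^2"
  define e1 where "e1 = k0 * (p * q) + k1 * (p * s + q * r) + k2 * (r * s)"
  define e2 where "e2 = k0 * q^2 + k1 * (2 * q * s) + k2 * s^2"
  have "e0 *s \<alpha> + e1 *s \<beta> + e2 *s \<gamma> = 0"
    using z by (simp add: vec_eq_iff qmap_def polar_def e0_def e1_def e2_def p_def q_def r_def s_def algebra_simps)
  then have e: "e0 = 0" "e1 = 0" "e2 = 0" using ind unfolding indep3_def by blast+
  have "k0 * (p * s - q * r)^2 = s^2 * e0 - 2 * r * s * e1 + r^2 * e2"
    "k1 * (p * s - q * r)^2 = (p * s + q * r) * e1 - q * s * e0 - p * r * e2"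
    "k2 * (p * s - q * r)^2 = q^2 * e0 - 2 * p * q * e1 + p^2 * e2"
    by (simp_all add: e0_def e1_def e2_def power2_eq_square algebra_simps)
  moreover have "p * s - q * r \<noteq> 0" using d by (simp add: det2_def p_def q_def r_def s_def)
  ultimately show "k0 = 0 \<and> k1 = 0 \<and> k2 = 0" using e by simp
qed

text \<open>A vector \<open>e\<close> off the plane completes the three vectors to a basis, and the
  rows of the inverse matrix are the dual basis.\<close>

lemma dual_basis_4:
  fixes \<alpha> \<beta> \<gamma> :: "complex^4"
  assumes ind: "indep3 \<alpha> \<beta> \<gamma>"
  obtains l f0 f1 f2 where "l \<noteq> 0"
    "\<And>u v w. linear_form f0 (u *s \<alpha> + v *s \<beta> + w *s \<gamma>) = u"
    "\<And>u v w. linear_form f1 (u *s \<alpha> + v *s \<beta> + w *s \<gamma>) = v"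
    "\<And>u v w. linear_form f2 (u *s \<alpha> + v *s \<beta> + w *s \<gamma>) = w"
    "\<And>y. linear_form l y = 0 \<longleftrightarrow> y = linear_form f0 y *s \<alpha> + linear_form f1 y *s \<beta> + linear_form f2 y *s \<gamma>"
proof -
  \<comment> \<open>The zero row makes \<open>R\<close> singular, and a kernel vector is a linear
    form vanishing on the three vectors.\<close>
  define R :: "complex^4^4" where "R = vec4 \<alpha> \<beta> \<gamma> 0"
  have "row 3 R = 0" by (simp add: R_def row_def vec_eq_iff)
  then have "det R = 0" by (rule det_zero_row)
  then obtain l where l0: "l \<noteq> 0" and l: "R *v l = 0" using det_zero_kernel by metis
  have la: "linear_form l \<alpha> = 0" "linear_form l \<beta> = 0" "linear_form l \<gamma> = 0"
    using l by (simp_all add: vec_eq_iff forall_4_from_0 matrix_vector_mult_def linear_form_def R_def mult.commute)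
  obtain j where j: "l $ j \<noteq> 0" using l0 by (auto simp: vec_eq_iff)
  define e where "e = axis j (1::complex)"
  have le: "linear_form l e \<noteq> 0" using j by (simp add: linear_form_def e_def axis_def if_distrib cong: if_cong)
  define M :: "complex^4^4" where "M = (\<chi> i k. if k = 0 then \<alpha> $ i else if k = 1 then \<beta> $ i else if k = 2 then \<gamma> $ i else e $ i)"
  have M: "M *v x = x$0 *s \<alpha> + x$1 *s \<beta> + x$2 *s \<gamma> + x$3 *s e" for x
    by (simp add: M_def matrix_vector_mult_def vec_eq_iff sum_4_from_0 algebra_simps)
  have lin: "linear_form l (u *s \<alpha> + v *s \<beta> + w *s \<gamma> + x *s e) = x * linear_form l e" for u v w x
  proof -
    have "linear_form l (u *s \<alpha> + v *s \<beta> + w *s \<gamma> + x *s e)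
       = u * linear_form l \<alpha> + v * linear_form l \<beta> + w * linear_form l \<gamma> + x * linear_form l e"
      by (simp add: linear_form_def sum.distrib sum_distrib_left algebra_simps)
    then show ?thesis by (simp add: la)
  qed
  have "x = 0" if "M *v x = 0" for x
  proof -
    have s: "x$0 *s \<alpha> + x$1 *s \<beta> + x$2 *s \<gamma> + x$3 *s e = 0" using that M by simp
    have "x$3 * linear_form l e = 0" using lin[of "x$0" "x$1" "x$2" "x$3"] unfolding s by (simp add: linear_form_def)
    then have x3: "x$3 = 0" using le by simp
    then have "x$0 *s \<alpha> + x$1 *s \<beta> + x$2 *s \<gamma> = 0" using s by simp
    then have "x$0 = 0 \<and> x$1 = 0 \<and> x$2 = 0" using ind unfolding indep3_def by blast
    then show ?thesis using x3 by (simp add: vec_eq_iff[of x] forall_4_from_0)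
  qed
  then have "invertible M" using det_zero_kernel[of M] by (metis invertible_det_nz)
  then obtain N where N: "M ** N = mat 1" "N ** M = mat 1" by (auto simp: invertible_def)
  have f: "linear_form (N $ k) y = (N *v y) $ k" for k y
    by (simp add: linear_form_def matrix_vector_mult_def)
  have NM: "N *v (M *v x) = x" for x using N(2) by (simp add: matrix_vector_mul_assoc)
  have MN: "M *v (N *v x) = x" for x using N(1) by (simp add: matrix_vector_mul_assoc)
  have c: "linear_form (N $ k) (u *s \<alpha> + v *s \<beta> + w *s \<gamma>) = vec4 u v w 0 $ k" for k u v w
    using NM[of "vec4 u v w 0"] by (simp add: f M)
  show ?thesis
  proof (rule that[of l "N $ 0" "N $ 1" "N $ 2"])
    show "linear_form (N $ 0) (u *s \<alpha> + v *s \<beta> + w *s \<gamma>) = u"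
      "linear_form (N $ 1) (u *s \<alpha> + v *s \<beta> + w *s \<gamma>) = v"
      "linear_form (N $ 2) (u *s \<alpha> + v *s \<beta> + w *s \<gamma>) = w" for u v w by (simp_all add: c)
    fix y
    have y: "y = linear_form (N $ 0) y *s \<alpha> + linear_form (N $ 1) y *s \<beta> + linear_form (N $ 2) y *s \<gamma>
        + linear_form (N $ 3) y *s e"
      using MN[of y] by (simp add: M f)
    show "linear_form l y = 0 \<longleftrightarrow> y = linear_form (N $ 0) y *s \<alpha> + linear_form (N $ 1) y *s \<beta> + linear_form (N $ 2) y *s \<gamma>"
      (is "_ \<longleftrightarrow> y = ?z")
    proof
      assume "linear_form l y = 0"
      then have "linear_form (N $ 3) y * linear_form l e = 0" using lin y by metis
      then have "linear_form (N $ 3) y = 0" using le by simp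
      then show "y = ?z" using y by simp
    next
      assume "y = ?z"
      then show "linear_form l y = 0" using lin[of "linear_form (N $ 0) y" "linear_form (N $ 1) y" "linear_form (N $ 2) y" 0] by simp
    qed
  qed (rule l0)
qed

lemma pt_in_image: "pt y \<in> pt ` S \<longleftrightarrow> (\<exists>x\<in>S. \<exists>c. c \<noteq> 0 \<and> y = c *s x)"
  unfolding image_iff by (metis pt_eq_iff)

lemma is_line_span:
  fixes A C :: "complex^4"
  assumes ind: "\<And>u v. u *s A + v *s C = 0 \<Longrightarrow> u = 0 \<and> v = 0"
  shows "is_line (pt ` ({u *s A + v *s C | u v. True} - {0}))"
proof -
  have A: "A \<noteq> 0" using ind[of 1 0] by auto
  have nC: "A \<notin> vec.span {C}"
  proof
    assume "A \<in> vec.span {C}"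
    then obtain k where "A = k *s C" by (auto simp: vec.span_singleton)
    then have "1 *s A + (- k) *s C = 0" by simp
    then show False using ind by fastforce
  qed
  have C: "C \<noteq> 0" using ind[of 0 1] by auto
  have "vec.independent {A, C}"
    using nC C by (simp add: vec.independent_insert)
  moreover have "A \<noteq> C" using nC vec.span_base by blast
  ultimately have "vec.dim (vec.span {A, C}) = 2" by (subst vec.dim_span_eq_card_independent) simp_all
  moreover have "vec.span {A, C} = {u *s A + v *s C | u v. True}"
    by (auto simp: vec.span_insert vec.span_singleton) (metis add.commute diff_add_cancel, metis add_diff_cancel_left')
  ultimately show ?thesis unfolding is_line_def using vec.subspace_span by metis
qed

text \<open>Injectivity of the Veronese map with scalars kept: \<open>d\<close> is the ratio in a
  coordinate where \<open>x\<close> is nonzero.\<close>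

lemma qmap_veronese:
  assumes ind: "indep3 \<alpha> \<beta> \<gamma>" and x: "x \<noteq> 0" and c: "c \<noteq> 0" and e: "qmap \<alpha> \<beta> \<gamma> x' = c *s qmap \<alpha> \<beta> \<gamma> x"
  obtains d where "d \<noteq> 0" "c = d^2" "x' = d *s x"
proof -
  have "(x'$0)^2 *s \<alpha> + (x'$0 * x'$1) *s \<beta> + (x'$1)^2 *s \<gamma>
      = (c * (x$0)^2) *s \<alpha> + (c * (x$0 * x$1)) *s \<beta> + (c * (x$1)^2) *s \<gamma>"
    using e by (simp add: qmap_def vector_add_ldistrib)
  then have q: "(x'$0)^2 = c * (x$0)^2" "x'$0 * x'$1 = c * (x$0 * x$1)" "(x'$1)^2 = c * (x$1)^2"
    using indep3_coefficients[OF ind] by blast+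
  obtain k where k: "x $ k \<noteq> 0" using x by (auto simp: vec_eq_iff)
  have qk: "(x' $ k)^2 = c * (x $ k)^2" "x' $ k * x' $ (1 - k) = c * (x $ k * x $ (1 - k))"
    using two_cases[of k] q by (auto simp: mult.commute)
  define d where "d = x' $ k / x $ k"
  have d2: "c = d^2" using qk(1) k by (simp add: d_def power_divide)
  then have d: "d \<noteq> 0" using c by auto
  have xk: "x' $ k = d * x $ k" using k by (simp add: d_def)
  then have "d * x $ k * x' $ (1 - k) = d * x $ k * (d * x $ (1 - k))"
    using qk(2) d2 by (simp add: power2_eq_square)
  then have "x' $ (1 - k) = d * x $ (1 - k)" using d k by simp
  then have "x' = d *s x" using xk two_cases[of k] by (auto simp: vec2_eq_iff)
  then show ?thesis using that d d2 by blast
qed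

lemma qmap_nonzero:
  assumes ind: "indep3 \<alpha> \<beta> \<gamma>" and x: "x \<noteq> 0" shows "qmap \<alpha> \<beta> \<gamma> x \<noteq> 0"
proof
  assume "qmap \<alpha> \<beta> \<gamma> x = 0"
  then have "(x$0)^2 = 0 \<and> x$0 * x$1 = 0 \<and> (x$1)^2 = 0" using ind unfolding qmap_def indep3_def by blast
  then show False using x by (simp add: vec2_eq_iff)
qed

section \<open>Conics as images of quadratic maps\<close>

definition conic :: "complex^4 \<Rightarrow> complex^4 \<Rightarrow> complex^4 \<Rightarrow> (complex^4) set set" where
  "conic \<alpha> \<beta> \<gamma> = pt ` qmap \<alpha> \<beta> \<gamma> ` (- {0})"

lemma mem_conic: "pt y \<in> conic \<alpha> \<beta> \<gamma> \<longleftrightarrow> (\<exists>x. x \<noteq> 0 \<and> (\<exists>c. c \<noteq> 0 \<and> y = c *s qmap \<alpha> \<beta> \<gamma> x))"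
  unfolding conic_def pt_in_image by auto

lemma mem_conic': "pt y \<in> conic \<alpha> \<beta> \<gamma> \<longleftrightarrow> (\<exists>x. x \<noteq> 0 \<and> y = qmap \<alpha> \<beta> \<gamma> x)"
proof
  assume "pt y \<in> conic \<alpha> \<beta> \<gamma>"
  then obtain x c where x: "x \<noteq> 0" "c \<noteq> 0" "y = c *s qmap \<alpha> \<beta> \<gamma> x" by (auto simp: mem_conic)
  then have "y = qmap \<alpha> \<beta> \<gamma> (csqrt c *s x)" "csqrt c *s x \<noteq> 0" by (simp_all add: qmap_scale)
  then show "\<exists>x. x \<noteq> 0 \<and> y = qmap \<alpha> \<beta> \<gamma> x" by blast
next
  assume "\<exists>x. x \<noteq> 0 \<and> y = qmap \<alpha> \<beta> \<gamma> x"
  then obtain x where "x \<noteq> 0" "y = 1 *s qmap \<alpha> \<beta> \<gamma> x" by auto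
  then show "pt y \<in> conic \<alpha> \<beta> \<gamma>" unfolding mem_conic by (metis zero_neq_one)
qed

lemma conic_change:
  assumes d: "det2 x y \<noteq> 0"
  shows "conic (qmap \<alpha> \<beta> \<gamma> x) (polar \<alpha> \<beta> \<gamma> x y) (qmap \<alpha> \<beta> \<gamma> y) = conic \<alpha> \<beta> \<gamma>"
proof -
  have "qmap (qmap \<alpha> \<beta> \<gamma> x) (polar \<alpha> \<beta> \<gamma> x y) (qmap \<alpha> \<beta> \<gamma> y) ` (- {0}) = qmap \<alpha> \<beta> \<gamma> ` (- {0})"
  proof (intro equalityI image_subsetI)
    fix v :: "complex^2" assume "v \<in> - {0}"
    then have v: "v$0 *s x + v$1 *s y \<noteq> 0" using det2_nonzero[OF d] by (auto simp: vec2_eq_iff[of v])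
    have "vec2 (v$0) (v$1) = v" by (simp add: vec2_eq_iff)
    then have "qmap (qmap \<alpha> \<beta> \<gamma> x) (polar \<alpha> \<beta> \<gamma> x y) (qmap \<alpha> \<beta> \<gamma> y) v = qmap \<alpha> \<beta> \<gamma> (v$0 *s x + v$1 *s y)"
      using qmap_change[of \<alpha> \<beta> \<gamma> x y "v$0" "v$1"] by simp
    then show "qmap (qmap \<alpha> \<beta> \<gamma> x) (polar \<alpha> \<beta> \<gamma> x y) (qmap \<alpha> \<beta> \<gamma> y) v \<in> qmap \<alpha> \<beta> \<gamma> ` (- {0})" using v by auto
  next
    fix v :: "complex^2" assume "v \<in> - {0}"
    moreover obtain s t where st: "v = s *s x + t *s y" by (rule det2_basis[OF d])
    ultimately have "vec2 s t \<noteq> 0" by (auto simp: vec2_eq_iff[of "vec2 s t"])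
    then show "qmap \<alpha> \<beta> \<gamma> v \<in> qmap (qmap \<alpha> \<beta> \<gamma> x) (polar \<alpha> \<beta> \<gamma> x y) (qmap \<alpha> \<beta> \<gamma> y) ` (- {0})"
      unfolding st qmap_change[symmetric] by blast
  qed
  then show ?thesis by (simp add: conic_def)
qed

text \<open>In the coordinates of the dual basis the parametrization is (s^2, st, t^2), with
  equation u w = v^2; complex square roots of u and w give the preimages.\<close>

lemma conic_equation:
  assumes ind: "indep3 \<alpha> \<beta> \<gamma>"
  obtains l f0 f1 f2 where "l \<noteq> 0"
    "\<And>u v w. linear_form f0 (u *s \<alpha> + v *s \<beta> + w *s \<gamma>) = u"
    "\<And>u v w. linear_form f1 (u *s \<alpha> + v *s \<beta> + w *s \<gamma>) = v"
    "\<And>u v w. linear_form f2 (u *s \<alpha> + v *s \<beta> + w *s \<gamma>) = w"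
    "\<And>y. linear_form l y = 0 \<longleftrightarrow> y = linear_form f0 y *s \<alpha> + linear_form f1 y *s \<beta> + linear_form f2 y *s \<gamma>"
    "\<And>y. y \<noteq> 0 \<Longrightarrow> pt y \<in> conic \<alpha> \<beta> \<gamma> \<longleftrightarrow> linear_form l y = 0 \<and> linear_form f0 y * linear_form f2 y = (linear_form f1 y)^2"
proof -
  obtain l f0 f1 f2 where f: "l \<noteq> 0"
    "\<And>u v w. linear_form f0 (u *s \<alpha> + v *s \<beta> + w *s \<gamma>) = u"
    "\<And>u v w. linear_form f1 (u *s \<alpha> + v *s \<beta> + w *s \<gamma>) = v"
    "\<And>u v w. linear_form f2 (u *s \<alpha> + v *s \<beta> + w *s \<gamma>) = w"
    "\<And>y. linear_form l y = 0 \<longleftrightarrow> y = linear_form f0 y *s \<alpha> + linear_form f1 y *s \<beta> + linear_form f2 y *s \<gamma>"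
    by (fact dual_basis_4[OF ind])
  show ?thesis
  proof (rule that[OF f])
    fix y :: "complex^4" assume y: "y \<noteq> 0"
    show "pt y \<in> conic \<alpha> \<beta> \<gamma> \<longleftrightarrow> linear_form l y = 0 \<and> linear_form f0 y * linear_form f2 y = (linear_form f1 y)^2"
    proof
      assume "pt y \<in> conic \<alpha> \<beta> \<gamma>"
      then obtain x where x: "y = qmap \<alpha> \<beta> \<gamma> x" by (auto simp: mem_conic')
      show "linear_form l y = 0 \<and> linear_form f0 y * linear_form f2 y = (linear_form f1 y)^2"
        unfolding f(5) unfolding x qmap_def f(2-4) by (simp add: power_mult_distrib)
    next
      assume a: "linear_form l y = 0 \<and> linear_form f0 y * linear_form f2 y = (linear_form f1 y)^2"
      define u v w where "u = linear_form f0 y" and "v = linear_form f1 y" and "w = linear_form f2 y"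
      have yy: "y = u *s \<alpha> + v *s \<beta> + w *s \<gamma>" using a f(5) by (simp add: u_def v_def w_def)
      have uw: "u * w = v^2" using a by (simp add: u_def v_def w_def)
      have "\<exists>x. y = qmap \<alpha> \<beta> \<gamma> x"
      proof (cases "u = 0")
        case True
        then have "v = 0" using uw by simp
        then have "y = qmap \<alpha> \<beta> \<gamma> (vec2 0 (csqrt w))" using True by (simp add: yy qmap_def)
        then show ?thesis by blast
      next
        case False
        have "(v / csqrt u)^2 = w" using uw False by (simp add: power_divide) (metis nonzero_mult_div_cancel_left)
        then have "y = qmap \<alpha> \<beta> \<gamma> (vec2 (csqrt u) (v / csqrt u))" using False by (simp add: yy qmap_def)
        then show ?thesis by blast
      qed
      then obtain x where x: "y = qmap \<alpha> \<beta> \<gamma> x" by blast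
      then have "x \<noteq> 0" using y by (auto simp: qmap_def)
      then show "pt y \<in> conic \<alpha> \<beta> \<gamma>" using x by (auto simp: mem_conic')
    qed
  qed
qed

lemma linear_form_add: "linear_form l (x + y) = linear_form l x + linear_form l y"
  by (simp add: linear_form_def algebra_simps sum.distrib)

lemma linear_form_scale: "linear_form l (c *s x) = c * linear_form l x"
  by (simp add: linear_form_def sum_distrib_left algebra_simps)

lemma irreducible_conic_conic:
  assumes ind: "indep3 \<alpha> \<beta> \<gamma>"
  shows "irreducible_conic (conic \<alpha> \<beta> \<gamma>)"
proof -
  obtain l f0 f1 f2 where f: "l \<noteq> 0"
    "\<And>u v w. linear_form f0 (u *s \<alpha> + v *s \<beta> + w *s \<gamma>) = u"
    "\<And>u v w. linear_form f1 (u *s \<alpha> + v *s \<beta> + w *s \<gamma>) = v"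
    "\<And>u v w. linear_form f2 (u *s \<alpha> + v *s \<beta> + w *s \<gamma>) = w"
    "\<And>y. linear_form l y = 0 \<longleftrightarrow> y = linear_form f0 y *s \<alpha> + linear_form f1 y *s \<beta> + linear_form f2 y *s \<gamma>"
    "\<And>y. y \<noteq> 0 \<Longrightarrow> pt y \<in> conic \<alpha> \<beta> \<gamma> \<longleftrightarrow> linear_form l y = 0 \<and> linear_form f0 y * linear_form f2 y = (linear_form f1 y)^2"
    by (fact conic_equation[OF ind])
  define A where "A = (\<chi> i j. f0 $ i * f2 $ j - f1 $ i * f1 $ j)"
  have "(\<Sum>i\<in>UNIV. \<Sum>j\<in>UNIV. (f0 $ i * f2 $ j - f1 $ i * f1 $ j) * y $ i * y $ j)
     = (\<Sum>i\<in>UNIV. \<Sum>j\<in>UNIV. (f0 $ i * y $ i) * (f2 $ j * y $ j)) - (\<Sum>i\<in>UNIV. \<Sum>j\<in>UNIV. (f1 $ i * y $ i) * (f1 $ j * y $ j))" for y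
    by (simp add: algebra_simps flip: sum_subtractf)
  then have A: "quadratic_form A y = linear_form f0 y * linear_form f2 y - (linear_form f1 y)^2" for y
    by (simp add: quadratic_form_def A_def linear_form_def power2_eq_square sum_product)
  have "\<not> (\<forall>y. linear_form l y = 0 \<longrightarrow> quadratic_form A y = linear_form m y * linear_form n y)" for m n
  proof
    assume a: "\<forall>y. linear_form l y = 0 \<longrightarrow> quadratic_form A y = linear_form m y * linear_form n y"
    define m0 m1 m2 n0 n1 n2 where "m0 = linear_form m \<alpha>" and "m1 = linear_form m \<beta>" and "m2 = linear_form m \<gamma>"
      and "n0 = linear_form n \<alpha>" and "n1 = linear_form n \<beta>" and "n2 = linear_form n \<gamma>"
    have e: "u * w - v^2 = (m0 * u + m1 * v + m2 * w) * (n0 * u + n1 * v + n2 * w)" for u v w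
    proof -
      let ?y = "u *s \<alpha> + v *s \<beta> + w *s \<gamma>"
      have "linear_form l ?y = 0" unfolding f(5) unfolding f(2-4) ..
      then have "quadratic_form A ?y = linear_form m ?y * linear_form n ?y" using a by blast
      then show ?thesis unfolding A f(2-4)
        by (simp add: linear_form_add linear_form_scale m0_def m1_def m2_def n0_def n1_def n2_def mult.commute)
    qed
    \<comment> \<open>Comparison of coefficients: \<open>m1 n1 = -1\<close> and the vanishing
      uv-term turn \<open>m0 n0 = 0\<close> into m0 = n0 = 0, and then the coefficient of uw cannot
      be 1.\<close>
    have "m0 * n0 = 0" "m2 * n2 = 0" "m1 * n1 = -1" using e[of 1 0 0] e[of 0 1 0] e[of 0 0 1] by simp_all
    moreover have "(m0 + m1) * (n0 + n1) = -1" "(m0 + m2) * (n0 + n2) = 1" using e[of 1 0 1] e[of 1 1 0] by simp_all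
    ultimately have "m0 * n1 + m1 * n0 = 0" "m0 * n2 + m2 * n0 = 1" "m0 = 0 \<or> n0 = 0" "m1 \<noteq> 0" "n1 \<noteq> 0"
      by (auto simp: algebra_simps)
    then show False by auto
  qed
  moreover have "conic \<alpha> \<beta> \<gamma> = pt ` {y. y \<noteq> 0 \<and> linear_form l y = 0 \<and> quadratic_form A y = 0}"
  proof (intro equalityI subsetI)
    fix P assume P: "P \<in> conic \<alpha> \<beta> \<gamma>"
    then obtain x where x: "x \<noteq> 0" "P = pt (qmap \<alpha> \<beta> \<gamma> x)" by (auto simp: conic_def)
    have nz: "qmap \<alpha> \<beta> \<gamma> x \<noteq> 0" by (rule qmap_nonzero[OF ind x(1)])
    then show "P \<in> pt ` {y. y \<noteq> 0 \<and> linear_form l y = 0 \<and> quadratic_form A y = 0}"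
      using f(6)[OF nz] P x(2) A by auto
  next
    fix P assume "P \<in> pt ` {y. y \<noteq> 0 \<and> linear_form l y = 0 \<and> quadratic_form A y = 0}"
    then show "P \<in> conic \<alpha> \<beta> \<gamma>" using f(6) A by auto
  qed
  ultimately show ?thesis unfolding irreducible_conic_def using f(1) by blast
qed

text \<open>The points of parameters (1,0), (0,1) and (1,1) already span a space of dimension
  3.\<close>

lemma conic_not_line:
  assumes ind: "indep3 \<alpha> \<beta> \<gamma>"
  shows "\<not> is_line (conic \<alpha> \<beta> \<gamma>)"
proof
  assume "is_line (conic \<alpha> \<beta> \<gamma>)"
  then obtain V where V: "vec.subspace V" "vec.dim V = 2" "conic \<alpha> \<beta> \<gamma> = pt ` (V - {0})" by (auto simp: is_line_def)
  have q: "qmap \<alpha> \<beta> \<gamma> x \<in> V" if x: "x \<noteq> 0" for x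
  proof -
    have "pt (qmap \<alpha> \<beta> \<gamma> x) \<in> pt ` (V - {0})" using x V(3) by (auto simp: conic_def)
    then obtain y c where "y \<in> V" "qmap \<alpha> \<beta> \<gamma> x = c *s y" by (auto simp: pt_in_image)
    then show ?thesis using V(1) by (simp add: vec.subspace_scale)
  qed
  have g: "vec2 1 0 \<noteq> (0 :: complex^2)" "vec2 0 1 \<noteq> (0 :: complex^2)" "vec2 1 1 \<noteq> (0 :: complex^2)" by (auto simp: vec2_eq_iff)
  have al: "\<alpha> \<in> V" and ga: "\<gamma> \<in> V" and s: "\<alpha> + \<beta> + \<gamma> \<in> V"
    using q[OF g(1)] q[OF g(2)] q[OF g(3)] by (simp_all add: qmap_def)
  have "(\<alpha> + \<beta> + \<gamma>) - (\<alpha> + \<gamma>) \<in> V" by (intro vec.subspace_diff vec.subspace_add V(1) al ga s)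
  then have be: "\<beta> \<in> V" by simp
  have c0: "\<gamma> \<noteq> 0" using indep3_coefficients[OF ind, of 0 0 1 0 0 0] by auto
  have c1: "\<beta> \<notin> vec.span {\<gamma>}"
  proof
    assume "\<beta> \<in> vec.span {\<gamma>}"
    then obtain k where "\<beta> = k *s \<gamma>" by (auto simp: vec.span_singleton)
    then show False using indep3_coefficients[OF ind, of 0 1 0 0 0 k] by auto
  qed
  have c2: "\<alpha> \<notin> vec.span {\<beta>, \<gamma>}"
  proof
    assume "\<alpha> \<in> vec.span {\<beta>, \<gamma>}"
    then obtain k k' where "\<alpha> - k *s \<beta> = k' *s \<gamma>" by (auto simp: vec.span_insert vec.span_singleton)
    then have "\<alpha> = k *s \<beta> + k' *s \<gamma>" by (simp add: algebra_simps)
    then show False using indep3_coefficients[OF ind, of 1 0 0 0 k k'] by auto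
  qed
  have "vec.independent {\<alpha>, \<beta>, \<gamma>}" using c0 c1 c2 by (simp add: vec.independent_insert)
  moreover have "{\<alpha>, \<beta>, \<gamma>} \<subseteq> V" using al be ga by simp
  ultimately have "card {\<alpha>, \<beta>, \<gamma>} \<le> 2" using vec.independent_card_le_dim V(2) by metis
  moreover have "\<alpha> \<noteq> \<beta>" "\<alpha> \<noteq> \<gamma>" "\<beta> \<noteq> \<gamma>" using c1 c2 vec.span_base by blast+
  ultimately show False by simp
qed

section \<open>Intersection numbers with conics\<close>

lemma linear_form_holomorphic:
  assumes "\<And>i. (\<lambda>t. g t $ i) holomorphic_on S" shows "(\<lambda>t. linear_form l (g t)) holomorphic_on S"
  unfolding linear_form_def by (intro holomorphic_intros assms)

lemma nonzero_on_small_ball: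
  fixes f :: "complex \<Rightarrow> complex"
  assumes "f holomorphic_on ball 0 r" "0 < r" "f 0 \<noteq> 0"
  obtains r' where "0 < r'" "r' \<le> r" "\<And>t. t \<in> ball 0 r' \<Longrightarrow> f t \<noteq> 0"
proof -
  have "open (ball 0 r \<inter> f -` (- {0}))"
    by (intro continuous_open_preimage holomorphic_on_imp_continuous_on assms) (auto simp: open_Compl)
  moreover have "0 \<in> ball 0 r \<inter> f -` (- {0})" using assms by simp
  ultimately obtain e where e: "0 < e" "ball 0 e \<subseteq> ball 0 r \<inter> f -` (- {0})" by (meson openE)
  show ?thesis
  proof (rule that[of "min e r"])
    show "0 < min e r" "min e r \<le> r" using e(1) assms(2) by auto
    show "\<And>t. t \<in> ball 0 (min e r) \<Longrightarrow> f t \<noteq> 0" using e(2) by auto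
  qed
qed

text \<open>\<open>intersection_number\<close> is defined with \<open>THE\<close>, so the order of
  vanishing has to be the same for all parametrizations. Each of them is the standard one up to a
  factor \<open>u\<close> without zeros and a substitution t \<tau>(t) with \<tau> nonzero.\<close>

lemma conic_reparametrization:
  assumes ind: "indep3 \<alpha> \<beta> \<gamma>" and lp: "local_parametrization (conic \<alpha> \<beta> \<gamma>) (pt \<alpha>) g"
  obtains r u \<tau> where "0 < r" "u holomorphic_on ball 0 r" "\<And>t. t \<in> ball 0 r \<Longrightarrow> u t \<noteq> 0"
    "\<tau> holomorphic_on ball 0 r" "\<And>t. t \<in> ball 0 r \<Longrightarrow> \<tau> t \<noteq> 0"
    "\<And>t. t \<in> ball 0 r \<Longrightarrow> g t = u t *s qmap \<alpha> \<beta> \<gamma> (vec2 1 (t * \<tau> t))"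
proof -
  obtain l f0 f1 f2 where f: "l \<noteq> 0"
    "\<And>u v w. linear_form f0 (u *s \<alpha> + v *s \<beta> + w *s \<gamma>) = u"
    "\<And>u v w. linear_form f1 (u *s \<alpha> + v *s \<beta> + w *s \<gamma>) = v"
    "\<And>u v w. linear_form f2 (u *s \<alpha> + v *s \<beta> + w *s \<gamma>) = w"
    "\<And>y. linear_form l y = 0 \<longleftrightarrow> y = linear_form f0 y *s \<alpha> + linear_form f1 y *s \<beta> + linear_form f2 y *s \<gamma>"
    "\<And>y. y \<noteq> 0 \<Longrightarrow> pt y \<in> conic \<alpha> \<beta> \<gamma> \<longleftrightarrow> linear_form l y = 0 \<and> linear_form f0 y * linear_form f2 y = (linear_form f1 y)^2"
    by (fact conic_equation[OF ind])
  obtain r0 where r0: "0 < r0" and hg: "\<And>i. (\<lambda>t. g t $ i) holomorphic_on ball 0 r0"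
    and gC: "\<And>t. t \<in> ball 0 r0 \<Longrightarrow> g t \<noteq> 0 \<and> pt (g t) \<in> conic \<alpha> \<beta> \<gamma>"
    and g0: "pt (g 0) = pt \<alpha>" and im: "\<And>c. (\<chi> i. deriv (\<lambda>t. g t $ i) 0) \<noteq> c *s g 0"
    using lp unfolding local_parametrization_def by blast
  define u where "u t = linear_form f0 (g t)" for t
  have f\<alpha>: "linear_form f0 \<alpha> = 1" "linear_form f1 \<alpha> = 0" using f(2)[of 1 0 0] f(3)[of 1 0 0] by simp_all
  obtain c where c: "c \<noteq> 0" "g 0 = c *s \<alpha>" using g0[symmetric] by (auto simp: pt_eq_iff)
  have u0: "u 0 \<noteq> 0" using c f\<alpha> by (simp add: u_def linear_form_scale)
  have hu: "u holomorphic_on ball 0 r0" unfolding u_def by (rule linear_form_holomorphic[OF hg])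
  obtain r1 where r1: "0 < r1" "r1 \<le> r0" and unz: "\<And>t. t \<in> ball 0 r1 \<Longrightarrow> u t \<noteq> 0"
    by (rule nonzero_on_small_ball[OF hu r0 u0]) blast
  have sub: "ball 0 r1 \<subseteq> ball (0::complex) r0" using r1 by auto
  \<comment> \<open>The affine coordinate v / u on the conic; by the equation it determines the
    third coordinate as well.\<close>
  define T where "T t = linear_form f1 (g t) / u t" for t
  have hT: "T holomorphic_on ball 0 r1" unfolding T_def
    using unz by (intro holomorphic_intros holomorphic_on_subset[OF hu sub] holomorphic_on_subset[OF linear_form_holomorphic[OF hg] sub]) auto
  have T0: "T 0 = 0" using c(2) f\<alpha> by (simp add: T_def linear_form_scale)
  have gT: "g t = u t *s qmap \<alpha> \<beta> \<gamma> (vec2 1 (T t))" if t: "t \<in> ball 0 r1" for t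
  proof -
    have gt: "g t \<noteq> 0" "pt (g t) \<in> conic \<alpha> \<beta> \<gamma>" using gC t sub by blast+
    then have l: "linear_form l (g t) = 0" and q: "u t * linear_form f2 (g t) = (linear_form f1 (g t))^2"
      using f(6) by (simp_all add: u_def)
    have "linear_form f1 (g t) = u t * T t" using unz[OF t] by (simp add: T_def)
    moreover have "linear_form f2 (g t) = u t * (T t)^2"
      using q unz[OF t] by (simp add: T_def power_divide) (simp add: field_simps power2_eq_square)
    moreover have "g t = u t *s \<alpha> + linear_form f1 (g t) *s \<beta> + linear_form f2 (g t) *s \<gamma>" using l f(5) by (simp add: u_def)
    ultimately show ?thesis by (simp add: qmap_def vector_add_ldistrib)
  qed
  \<comment> \<open>Otherwise the derivative of \<open>g\<close> at 0 would be a multiple of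
    \<open>g 0\<close>, against the immersion condition.\<close>
  have dT: "deriv T 0 \<noteq> 0"
  proof
    assume z: "deriv T 0 = 0"
    have z0: "0 \<in> ball (0::complex) r1" using r1 by simp
    have dT: "(T has_field_derivative 0) (at 0)" using holomorphic_derivI[OF hT open_ball z0] z by simp
    have du: "(u has_field_derivative deriv u 0) (at 0)"
      using holomorphic_derivI[OF hu open_ball] r0 by simp
    have "((\<lambda>t. u t * (\<alpha> $ i + T t * \<beta> $ i + (T t)^2 * \<gamma> $ i)) has_field_derivative deriv u 0 * \<alpha> $ i) (at 0)" for i
      by (rule derivative_eq_intros du dT refl)+ (simp add: T0)
    then have "((\<lambda>t. g t $ i) has_field_derivative deriv u 0 * \<alpha> $ i) (at 0)" for i
      by (rule has_field_derivative_transform_within_open[OF _ open_ball z0]) (simp add: gT qmap_def algebra_simps)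
    then have "deriv (\<lambda>t. g t $ i) 0 = deriv u 0 * \<alpha> $ i" for i by (rule DERIV_imp_deriv)
    then have "(\<chi> i. deriv (\<lambda>t. g t $ i) 0) = (deriv u 0 / c) *s g 0"
      using c by (simp add: vec_eq_iff)
    then show False using im by blast
  qed
  obtain \<tau> r2 where r2: "0 < r2" and h\<tau>: "\<tau> holomorphic_on ball 0 r2"
    and T\<tau>: "\<And>w. w \<in> ball 0 r2 \<Longrightarrow> T w - T 0 = (w - 0)^1 * \<tau> w" and \<tau>nz: "\<And>w. w \<in> ball 0 r2 \<Longrightarrow> \<tau> w \<noteq> 0"
    by (rule holomorphic_factor_order_of_zero[OF hT open_ball, of 0 1]) (use r1 dT in auto)
  show ?thesis
  proof (rule that[of "min r1 r2" u \<tau>])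
    show "0 < min r1 r2" using r1 r2 by simp
    show "u holomorphic_on ball 0 (min r1 r2)" by (rule holomorphic_on_subset[OF hu]) (use r1 in auto)
    show "\<tau> holomorphic_on ball 0 (min r1 r2)" by (rule holomorphic_on_subset[OF h\<tau>]) auto
    fix t :: complex assume "t \<in> ball 0 (min r1 r2)"
    then have t: "t \<in> ball 0 r1" "t \<in> ball 0 r2" by auto
    show "u t \<noteq> 0" "\<tau> t \<noteq> 0" using unz \<tau>nz t by auto
    show "g t = u t *s qmap \<alpha> \<beta> \<gamma> (vec2 1 (t * \<tau> t))" using gT[OF t(1)] T\<tau>[OF t(2)] T0 by simp
  qed
qed

lemma conic_local_parametrization:
  assumes ind: "indep3 \<alpha> \<beta> \<gamma>"
  shows "local_parametrization (conic \<alpha> \<beta> \<gamma>) (pt \<alpha>) (\<lambda>t. qmap \<alpha> \<beta> \<gamma> (vec2 1 t))"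
  unfolding local_parametrization_def
proof (intro conjI exI[of _ 1] allI ballI)
  show "(\<lambda>t. qmap \<alpha> \<beta> \<gamma> (vec2 1 t) $ i) holomorphic_on ball 0 1" for i
    unfolding qmap_def by (simp add: holomorphic_intros)
  fix t :: complex
  have v: "vec2 1 t \<noteq> 0" by (simp add: vec2_eq_iff)
  show "qmap \<alpha> \<beta> \<gamma> (vec2 1 t) \<noteq> 0" by (rule qmap_nonzero[OF ind v])
  show "pt (qmap \<alpha> \<beta> \<gamma> (vec2 1 t)) \<in> conic \<alpha> \<beta> \<gamma>" unfolding conic_def using v by blast
next
  show "pt (qmap \<alpha> \<beta> \<gamma> (vec2 1 0)) = pt \<alpha>" by (simp add: qmap_def)
  fix c
  have "((\<lambda>t. qmap \<alpha> \<beta> \<gamma> (vec2 1 t) $ i) has_field_derivative \<beta> $ i) (at 0)" for i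
    unfolding qmap_def by (auto intro!: derivative_eq_intros)
  then have "deriv (\<lambda>t. qmap \<alpha> \<beta> \<gamma> (vec2 1 t) $ i) 0 = \<beta> $ i" for i by (rule DERIV_imp_deriv)
  moreover have "\<beta> \<noteq> c *s \<alpha>" using indep3_coefficients[OF ind, of 0 1 0 c 0 0] by auto
  ultimately show "(\<chi> i. deriv (\<lambda>t. qmap \<alpha> \<beta> \<gamma> (vec2 1 t) $ i) 0) \<noteq> c *s qmap \<alpha> \<beta> \<gamma> (vec2 1 0)"
    by (simp add: vec_eq_iff qmap_def)
qed simp_all

text \<open>In every parametrization \<open>q\<close> is minus the square of a reparametrized
  \<open>G\<close> times a factor without zeros, so its order is twice the positive order of
  \<open>G\<close>.\<close>

lemma even_intersection_number:
  assumes ind: "indep3 \<alpha> \<beta> \<gamma>" and hom: "\<And>c y. q (c *s y) = c^4 * q y"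
    and G: "G holomorphic_on ball 0 \<rho>" "G 0 = 0" "\<exists>t\<in>ball 0 \<rho>. G t \<noteq> 0" and \<rho>: "0 < \<rho>"
    and sq: "\<And>t. t \<in> ball 0 \<rho> \<Longrightarrow> q (qmap \<alpha> \<beta> \<gamma> (vec2 1 t)) = - ((G t)^2)"
  shows "intersection_number q (conic \<alpha> \<beta> \<gamma>) (pt \<alpha>) \<ge> 2"
proof -
  define N where "N = nat (zorder G 0)"
  obtain h r where N: "0 < zorder G 0" and r: "0 < r" "cball (0::complex) r \<subseteq> ball 0 \<rho>" and hh: "h holomorphic_on cball 0 r"
    and Gh: "\<And>w. w \<in> cball 0 r \<Longrightarrow> G w = h w * (w - 0)^N \<and> h w \<noteq> 0"
  proof -
    have z0: "0 \<in> ball (0::complex) \<rho>" using \<rho> by simp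
    note z = zorder_exist_zero[OF G(1) open_ball connected_ball z0 G(3), folded N_def]
    obtain r where "r > 0 \<and> cball (0::complex) r \<subseteq> ball 0 \<rho> \<and> zor_poly G 0 holomorphic_on cball 0 r \<and>
        (\<forall>w\<in>cball 0 r. G w = zor_poly G 0 w * (w - 0)^N \<and> zor_poly G 0 w \<noteq> 0)"
      using z[THEN conjunct2] by (elim exE) (rule that)
    moreover have "0 < zorder G 0" using z[THEN conjunct1] G(2) by simp
    ultimately show ?thesis by (intro that[of r "zor_poly G 0"]) blast+
  qed
  have ord: "zorder (\<lambda>t. q (g t)) 0 = int (2 * N)" if lp: "local_parametrization (conic \<alpha> \<beta> \<gamma>) (pt \<alpha>) g" for g
  proof -
    obtain r' u \<tau> where r': "0 < r'" "u holomorphic_on ball 0 r'" "\<And>t. t \<in> ball 0 r' \<Longrightarrow> u t \<noteq> 0"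
      "\<tau> holomorphic_on ball 0 r'" "\<And>t. t \<in> ball 0 r' \<Longrightarrow> \<tau> t \<noteq> 0"
      "\<And>t. t \<in> ball 0 r' \<Longrightarrow> g t = u t *s qmap \<alpha> \<beta> \<gamma> (vec2 1 (t * \<tau> t))"
      by (fact conic_reparametrization[OF ind lp])
    define S where "S = ball 0 r' \<inter> (\<lambda>t. t * \<tau> t) -` ball 0 r"
    have ht: "(\<lambda>t. t * \<tau> t) holomorphic_on ball 0 r'" by (intro holomorphic_intros r')
    have oS: "open S" unfolding S_def
      by (intro continuous_open_preimage holomorphic_on_imp_continuous_on[OF ht] open_ball)
    have S0: "0 \<in> S" using r r' by (simp add: S_def)
    have sub: "S \<subseteq> ball 0 r'" by (auto simp: S_def)
    have "(\<lambda>t. h (t * \<tau> t)) holomorphic_on S"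
      by (rule holomorphic_on_compose_gen[OF holomorphic_on_subset[OF ht sub] hh, unfolded o_def]) (auto simp: S_def)
    then have hol: "(\<lambda>t. - ((u t)^4 * (h (t * \<tau> t))^2 * (\<tau> t)^(2 * N))) holomorphic_on S"
      by (intro holomorphic_intros holomorphic_on_subset[OF r'(2) sub] holomorphic_on_subset[OF r'(4) sub])
    have "h 0 \<noteq> 0" using Gh[of 0] r by simp
    then have nz: "- ((u 0)^4 * (h (0 * \<tau> 0))^2 * (\<tau> 0)^(2 * N)) \<noteq> 0" using r'(3,5)[of 0] r'(1) by simp
    show ?thesis
    proof (rule zorder_eqI[OF oS S0 hol nz])
      fix w assume w: "w \<in> S" "w \<noteq> 0"
      have "w * \<tau> w \<in> ball 0 r" "w \<in> ball 0 r'" using w(1) by (simp_all only: S_def Int_iff vimage_eq)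
      then have b: "w * \<tau> w \<in> cball 0 r" "w * \<tau> w \<in> ball 0 \<rho>" "w \<in> ball 0 r'"
        using subsetD[OF ball_subset_cball] subsetD[OF r(2)] by blast+
      have "q (g w) = - ((u w)^4 * (h (w * \<tau> w) * (w * \<tau> w)^N)^2)"
        using r'(6)[OF b(3)] sq[OF b(2)] Gh[OF b(1)] by (simp add: hom)
      also have "\<dots> = - ((u w)^4 * (h (w * \<tau> w))^2 * (\<tau> w)^(2 * N)) * w^(2 * N)"
        by (simp add: power_mult_distrib flip: power_mult) (simp add: mult.commute)
      finally show "q (g w) = - ((u w)^4 * (h (w * \<tau> w))^2 * (\<tau> w)^(2 * N)) * (w - 0) powi int (2 * N)"
        by (simp only: power_int_of_nat diff_zero)
    qed
  qed
  have "intersection_number q (conic \<alpha> \<beta> \<gamma>) (pt \<alpha>) = int (2 * N)"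
    unfolding intersection_number_def
  proof (rule the_equality)
    show "\<exists>g. local_parametrization (conic \<alpha> \<beta> \<gamma>) (pt \<alpha>) g \<and> zorder (\<lambda>t. q (g t)) 0 = int (2 * N)"
      using conic_local_parametrization[OF ind] ord by blast
  qed (use ord in blast)
  then show ?thesis using N by (simp add: N_def)
qed

section \<open>The real structure, the conic case and the line case\<close>

lemma conj4_scale: "conj4 (c *s y) = cnj c *s conj4 y"
  by (simp add: conj4_def vec_eq_iff forall_4_from_0)

lemma conj4_add: "conj4 (x + y) = conj4 x + conj4 y"
  by (simp add: conj4_def vec_eq_iff forall_4_from_0)

lemma conj4_conj4 [simp]: "conj4 (conj4 y) = y"
  by (simp add: conj4_def vec_eq_iff forall_4_from_0)

lemma conj4_zero_iff [simp]: "conj4 y = 0 \<longleftrightarrow> y = 0"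
  by (metis conj4_conj4 conj4_scale vector_smult_lzero complex_cnj_zero)

lemma sigma_pt: "sigma (pt y) = pt (conj4 y)"
proof (intro equalityI subsetI)
  fix v assume "v \<in> sigma (pt y)"
  then obtain c where "c \<noteq> 0" "v = conj4 (c *s y)" by (auto simp: sigma_def pt_def)
  then show "v \<in> pt (conj4 y)" unfolding pt_def conj4_scale by (intro CollectI exI[of _ "cnj c"]) simp
next
  fix v assume "v \<in> pt (conj4 y)"
  then obtain c where c: "c \<noteq> 0" "v = c *s conj4 y" by (auto simp: pt_def)
  then have "v = conj4 (cnj c *s y)" by (simp add: conj4_scale)
  then show "v \<in> sigma (pt y)" using c(1) by (auto simp: sigma_def pt_def)
qed

lemma conj_O2_pt: "conj_O2 (pt_O2 (y, z)) = pt_O2 (conj4 y, cnj z)"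
proof (intro equalityI subsetI)
  fix v assume "v \<in> conj_O2 (pt_O2 (y, z))"
  then obtain c where "c \<noteq> 0" "v = (conj4 (c *s y), cnj (c^2 * z))" by (auto simp: conj_O2_def pt_O2_def)
  then show "v \<in> pt_O2 (conj4 y, cnj z)" unfolding pt_O2_def conj4_scale
    by (intro CollectI exI[of _ "cnj c"]) simp
next
  fix v assume "v \<in> pt_O2 (conj4 y, cnj z)"
  then obtain c where c: "c \<noteq> 0" "v = (c *s conj4 y, c^2 * cnj z)" by (auto simp: pt_O2_def)
  have "(cnj c *s y, (cnj c)^2 * z) \<in> pt_O2 (y, z)" unfolding pt_O2_def using c(1) by (intro CollectI exI[of _ "cnj c"]) simp
  moreover have "v = (\<lambda>(y, z). (conj4 y, cnj z)) (cnj c *s y, (cnj c)^2 * z)" using c by (simp add: conj4_scale)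
  ultimately show "v \<in> conj_O2 (pt_O2 (y, z))" unfolding conj_O2_def by (rule rev_image_eqI)
qed

locale real_curve = parametrized_curve +
  fixes s :: "'a \<Rightarrow> 'a"
  assumes lift: "real_structure_lift Z \<mu> s" and sL: "s ` L = L"
begin

text \<open>The involution that \<open>s\<close> induces on the parameters enters only in this
  implicit form.\<close>

lemma real_iota:
  assumes x: "x \<noteq> 0"
  obtains x' c where "x' \<noteq> 0" "s (\<iota> (pt x)) = \<iota> (pt x')" "c \<noteq> 0" "F x' = c *s conj4 (F x)" "zz x' = c^2 * cnj (zz x)"
proof -
  have "s (\<iota> (pt x)) \<in> L" using sL iota_L[OF x] by blast
  then obtain x' where x': "x' \<noteq> 0" "s (\<iota> (pt x)) = \<iota> (pt x')" using iota_surj by blast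
  have "\<iota> (pt x) \<in> topspace (ctop Z)" using iota_L[OF x] L_top by blast
  then have "\<mu> (s (\<iota> (pt x))) = conj_O2 (\<mu> (\<iota> (pt x)))" using lift by (simp add: real_structure_lift_def)
  then have "pt_O2 (conj4 (F x), cnj (zz x)) = pt_O2 (F x', zz x')"
    by (simp add: x'(2) mu_iota x x'(1) conj_O2_pt)
  then show ?thesis using x' that by (auto simp: pt_O2_eq_iff)
qed

definition C :: "(complex^4) set set" where "C = (proj_O2 \<circ> \<mu>) ` L"

lemma C_conic: "C = conic \<alpha> \<beta> \<gamma>"
proof -
  have p: "proj_O2 (\<mu> (\<iota> (pt x))) = pt (F x)" if "x \<noteq> 0" for x
  proof -
    have "\<mu> (\<iota> (pt x)) \<in> XX" using iota_L[OF that] L_top mu_in by blast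
    then show ?thesis by (simp add: mu_iota[OF that] proj_O2_pt)
  qed
  have L: "L = (\<lambda>x. \<iota> (pt x)) ` (- {0})" using iota_L iota_surj by auto
  have "C = (\<lambda>x. proj_O2 (\<mu> (\<iota> (pt x)))) ` (- {0})"
    unfolding C_def by (subst L) (simp only: image_image o_def)
  also have "\<dots> = (\<lambda>x. pt (F x)) ` (- {0})" by (rule image_cong) (simp_all add: p)
  finally show ?thesis by (simp add: conic_def image_image)
qed

lemma sigma_C: "sigma ` C = C"
proof -
  have 1: "sigma P \<in> C" if P: "P \<in> C" for P
  proof -
    obtain x where x: "x \<noteq> 0" "P = pt (F x)" using P by (auto simp: C_conic conic_def)
    obtain x' c where "x' \<noteq> 0" "s (\<iota> (pt x)) = \<iota> (pt x')" "c \<noteq> 0" "F x' = c *s conj4 (F x)" "zz x' = c^2 * cnj (zz x)"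
      by (fact real_iota[OF x(1)])
    then have "sigma P = pt (F x')" unfolding x(2) sigma_pt pt_eq_iff by blast
    then show ?thesis using \<open>x' \<noteq> 0\<close> by (auto simp: C_conic conic_def)
  qed
  have 2: "sigma (sigma P) = P" if "P \<in> C" for P
    using that by (auto simp: C_conic conic_def sigma_pt)
  show ?thesis using 1 2 by (metis image_subset_iff subsetI subset_antisym rev_image_eqI)
qed

lemma C_in_surface_iff: "x \<noteq> 0 \<Longrightarrow> pt (F x) \<in> surface_B a b q0 q1 q2 \<longleftrightarrow> quartic a b q0 q1 q2 (F x) = 0"
proof
  assume "pt (F x) \<in> surface_B a b q0 q1 q2"
  then show "quartic a b q0 q1 q2 (F x) = 0" by (auto simp: surface_B_def pt_in_image quartic_scale)
qed (use F_nonzero in \<open>auto simp: surface_B_def\<close>)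

lemma touching_conic:
  assumes ind: "indep3 \<alpha> \<beta> \<gamma>"
  shows "real_touching_conic a b q0 q1 q2 C"
proof -
  have "intersection_number (quartic a b q0 q1 q2) C p \<ge> 2"
    if n: "\<not> C \<subseteq> surface_B a b q0 q1 q2" and p: "p \<in> C" "p \<in> surface_B a b q0 q1 q2" for p
  proof -
    obtain x' where x': "x' \<noteq> 0" "quartic a b q0 q1 q2 (F x') \<noteq> 0"
      using n C_in_surface_iff by (auto simp: C_conic conic_def)
    obtain x where x: "x \<noteq> 0" "p = pt (F x)" "quartic a b q0 q1 q2 (F x) = 0"
      using p C_in_surface_iff by (auto simp: C_conic conic_def)
    have d0: "det2 x x' \<noteq> 0"
    proof
      assume d: "det2 x x' = 0"
      obtain k where k: "x $ k \<noteq> 0" using x(1) by (auto simp: vec_eq_iff)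
      have "x' = (x' $ k / x $ k) *s x"
        using d k two_cases[of k] by (auto simp: vec2_eq_iff det2_def field_simps)
      then have "F x' = (x' $ k / x $ k)^2 *s F x" using qmap_scale by metis
      then show False using x(3) x'(2) by (simp add: quartic_scale)
    qed
    \<comment> \<open>The line of parameters runs through the intersection point at t = 0 and
      through \<open>x'\<close>, where the quartic is nonzero, at t = 1; hence the disc of radius
      2.\<close>
    define y where "y = x' - x"
    have d: "det2 x y \<noteq> 0" using d0 by (simp add: det2_def y_def algebra_simps)
    have nz: "x + t *s y \<noteq> 0" for t using det2_nonzero[OF d, of 1 t] by auto
    define G where "G t = zz (x + t *s y)" for t
    have "G holomorphic_on UNIV" unfolding G_def using zz_holomorphic[of x y] nz by simp
    then have G: "G holomorphic_on ball 0 2" by (rule holomorphic_on_subset) simp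
    have sq: "quartic a b q0 q1 q2 (F (x + t *s y)) = - ((G t)^2)" for t
      using zz_eq[OF nz[of t]] unfolding G_def by (metis add.commute eq_neg_iff_add_eq_0)
    have G0: "G 0 = 0" using sq[of 0] x(3) by simp
    have "G 1 \<noteq> 0" using sq[of 1] x'(2) by (simp add: y_def)
    then have G1: "\<exists>t\<in>ball 0 2. G t \<noteq> 0" by (intro bexI[of _ 1]) simp_all
    have "intersection_number (quartic a b q0 q1 q2) (conic (F x) (polar \<alpha> \<beta> \<gamma> x y) (F y)) (pt (F x)) \<ge> 2"
      by (rule even_intersection_number[OF indep3_change[OF ind d] quartic_scale G G0 G1])
         (simp_all add: qmap_change sq)
    then show ?thesis by (simp add: C_conic conic_change[OF d] x(2))
  qed
  then show ?thesis unfolding real_touching_conic_def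
    using irreducible_conic_conic[OF ind] sigma_C by (auto simp: C_conic)
qed

text \<open>The second real point comes from a real line through P0 in the plane of the conic that
  is not tangent there: its other intersection with the conic is unique, hence real.\<close>

lemma P0_notin_conic:
  assumes ind: "indep3 \<alpha> \<beta> \<gamma>"
  shows "P0 l0 \<notin> C"
proof
  assume P: "P0 l0 \<in> C"
  define e where "e = vec4 (of_real l0) 1 0 (0::complex)"
  have e: "conj4 e = e" "P0 l0 = pt e" by (simp_all add: e_def conj4_def P0_def vec_eq_iff forall_4_from_0)
  obtain x where x: "x \<noteq> 0" "e = F x" using P unfolding e C_conic mem_conic' by blast
  \<comment> \<open>By injectivity of the Veronese map a real image point comes from a real point of
    the curve. Comparing fibre coordinates shows that \<open>zz v\<close> is real, so
    \<open>real_point\<close> applies.\<close>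
  have real_null: "\<exists>k. y = k *s e" if y: "y \<noteq> 0" "conj4 y = y" "pt y \<in> C" for y
  proof -
    obtain v where v: "v \<noteq> 0" "y = F v" using y(3) unfolding C_conic mem_conic' by blast
    obtain v' c where v': "v' \<noteq> 0" "s (\<iota> (pt v)) = \<iota> (pt v')" "c \<noteq> 0" "F v' = c *s conj4 (F v)" "zz v' = c^2 * cnj (zz v)"
      by (fact real_iota[OF v(1)])
    then have "F v' = c *s F v" using y(2) v(2) by simp
    then obtain d where d: "d \<noteq> 0" "c = d^2" "v' = d *s v" by (rule qmap_veronese[OF ind v(1) v'(3)])
    have "c^2 * zz v = c^2 * cnj (zz v)" using zz_scale[OF d(1) v(1)] v'(5) d by (simp flip: power_mult)
    then have "cnj (zz v) = 1^2 * zz v" using v'(3) by simp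
    moreover have "conj4 (F v) = 1 *s F v" using y(2) v(2) by simp
    ultimately have "pt (F v) = P0 l0" using real_point[OF F_nonzero[OF v(1)] zz_eq[OF v(1)]] by blast
    then have "pt e = pt y" by (simp add: v(2) e(2))
    then show ?thesis by (auto simp: pt_eq_iff)
  qed
  obtain y where d: "det2 x y \<noteq> 0" by (rule det2_exists[OF x(1)])
  define \<beta>' \<gamma>' where "\<beta>' = polar \<alpha> \<beta> \<gamma> x y" and "\<gamma>' = F y"
  have ind': "indep3 e \<beta>' \<gamma>'" unfolding \<beta>'_def \<gamma>'_def x(2) by (rule indep3_change[OF ind d])
  have C': "C = conic e \<beta>' \<gamma>'" unfolding \<beta>'_def \<gamma>'_def x(2) conic_change[OF d] by (rule C_conic)
  obtain l f0 f1 f2 where f: "l \<noteq> 0"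
    "\<And>u v w. linear_form f0 (u *s e + v *s \<beta>' + w *s \<gamma>') = u"
    "\<And>u v w. linear_form f1 (u *s e + v *s \<beta>' + w *s \<gamma>') = v"
    "\<And>u v w. linear_form f2 (u *s e + v *s \<beta>' + w *s \<gamma>') = w"
    "\<And>y. linear_form l y = 0 \<longleftrightarrow> y = linear_form f0 y *s e + linear_form f1 y *s \<beta>' + linear_form f2 y *s \<gamma>'"
    "\<And>y. y \<noteq> 0 \<Longrightarrow> pt y \<in> conic e \<beta>' \<gamma>' \<longleftrightarrow> linear_form l y = 0 \<and> linear_form f0 y * linear_form f2 y = (linear_form f1 y)^2"
    by (fact conic_equation[OF ind'])
  have fe: "linear_form f0 e = 1" "linear_form f1 e = 0" "linear_form f2 e = 0" "linear_form l e = 0"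
    using f(2)[of 1 0 0] f(3)[of 1 0 0] f(4)[of 1 0 0] f(5)[of e] by simp_all
  have fc: "linear_form f2 \<gamma>' = 1" "linear_form l \<gamma>' = 0"
    using f(2)[of 0 0 1] f(3)[of 0 0 1] f(4)[of 0 0 1] f(5)[of \<gamma>'] by simp_all
  have C_conj: "pt (conj4 v) \<in> C" if "pt v \<in> C" for v using that sigma_C sigma_pt by (metis imageI)
  have \<gamma>C: "pt \<gamma>' \<in> C"
  proof -
    have "y \<noteq> 0" using d by (auto simp: det2_def)
    then show ?thesis unfolding C_conic mem_conic' \<gamma>'_def by blast
  qed
  have \<gamma>0: "\<gamma>' \<noteq> 0" using fc(1) by (auto simp: linear_form_def)
  have lc: "linear_form l (conj4 \<gamma>') = 0" using f(6)[of "conj4 \<gamma>'"] C_conj[OF \<gamma>C] \<gamma>0 C' by simp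
  \<comment> \<open>The form \<open>f2\<close> cuts out the tangent line at \<open>e\<close>, so
    \<open>w\<close> is a real direction transversal to the conic. Either the real or the imaginary
    part of \<gamma>' serves, because \<open>f2\<close> is 1 at \<gamma>'.\<close>
  obtain w where w: "conj4 w = w" "linear_form l w = 0" "linear_form f2 w \<noteq> 0"
  proof (cases "linear_form f2 (\<gamma>' + conj4 \<gamma>') = 0")
    case False
    then show ?thesis
      by (intro that[of "\<gamma>' + conj4 \<gamma>'"]) (simp_all add: conj4_add linear_form_add lc fc add.commute)
  next
    case True
    then have "linear_form f2 (conj4 \<gamma>') = -1" using fc(1) by (simp add: linear_form_add add_eq_0_iff)
    then have "linear_form f2 (\<i> *s \<gamma>' + (- \<i>) *s conj4 \<gamma>') \<noteq> 0"
      by (simp only: linear_form_add linear_form_scale fc) simp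
    moreover have "linear_form l (\<i> *s \<gamma>' + (- \<i>) *s conj4 \<gamma>') = 0"
      by (simp only: linear_form_add linear_form_scale fc lc) simp
    moreover have "conj4 (\<i> *s \<gamma>' + (- \<i>) *s conj4 \<gamma>') = \<i> *s \<gamma>' + (- \<i>) *s conj4 \<gamma>'"
      by (simp only: conj4_add conj4_scale conj4_conj4) (simp add: add.commute)
    ultimately show ?thesis using that by blast
  qed
  have w0: "w \<noteq> 0" using w(3) by (auto simp: linear_form_def)
  \<comment> \<open>The equation of the conic at \<open>w\<close>. At \<open>e + k *s w\<close> the
    equation reads k (f2(w) + k D) = 0, so the second point has k = - f2(w) / D, or is
    \<open>w\<close> itself if D = 0.\<close>
  define D where "D = linear_form f0 w * linear_form f2 w - (linear_form f1 w)^2"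
  show False
  proof (cases "D = 0")
    case True
    then have "pt w \<in> C" using f(6)[OF w0] w(2) by (simp add: C' D_def)
    then obtain k where "w = k *s e" using real_null[OF w0 w(1)] by blast
    then show False using w(3) by (simp add: linear_form_scale fe)
  next
    case False
    define t where "t = - linear_form f2 w / D"
    have t: "t \<noteq> 0" using False w(3) by (simp add: t_def)
    have f2: "linear_form f2 (e + k *s w) = k * linear_form f2 w" for k
      by (simp add: linear_form_add linear_form_scale fe)
    have nz: "e + k *s w \<noteq> 0" if "k \<noteq> 0" for k
    proof
      assume "e + k *s w = 0"
      then have "linear_form f2 (e + k *s w) = 0" by (simp add: linear_form_def)
      then show False using f2[of k] that w(3) by simp
    qed
    have mem: "pt (e + k *s w) \<in> C \<longleftrightarrow> k = t" if k: "k \<noteq> 0" for k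
    proof -
      have "(1 + k * linear_form f0 w) * (k * linear_form f2 w) - (k * linear_form f1 w)^2 = k * (linear_form f2 w + k * D)"
        by (simp add: D_def power2_eq_square algebra_simps)
      then have "(1 + k * linear_form f0 w) * (k * linear_form f2 w) = (k * linear_form f1 w)^2 \<longleftrightarrow> linear_form f2 w + k * D = 0"
        using k by (metis eq_iff_diff_eq_0 mult_eq_0_iff)
      also have "\<dots> \<longleftrightarrow> k = t" using False by (auto simp: t_def field_simps add_eq_0_iff)
      finally show ?thesis
        unfolding C' f(6)[OF nz[OF k]] linear_form_add linear_form_scale fe w(2) by simp
    qed
    have "pt (conj4 (e + t *s w)) \<in> C" by (rule C_conj) (use mem[OF t] in simp)
    then have "pt (e + cnj t *s w) \<in> C" by (simp add: conj4_add conj4_scale e w)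
    then have "cnj t = t" using mem[of "cnj t"] t by simp
    then have "conj4 (e + t *s w) = e + t *s w" by (simp add: conj4_add conj4_scale e w)
    then obtain k where "e + t *s w = k *s e" using real_null[OF nz[OF t]] mem[OF t] by blast
    then have "t * linear_form f2 w = 0" using f2[of t] by (simp add: linear_form_scale fe)
    then show False using t w(3) by simp
  qed
qed

text \<open>An even fibre coordinate would identify the points of parameters t and -t, which is
  possible only over singular points. The image depends injectively on t^2, so four values of t^2
  are too many for three singular points.\<close>

lemma not_even_line:
  assumes d: "det2 x y \<noteq> 0" and p: "polar \<alpha> \<beta> \<gamma> x y = 0" and e: "\<And>t. zz (x + (- t) *s y) = zz (x + t *s y)"
  shows False
proof -
  have nz: "x + t *s y \<noteq> 0" for t using det2_nonzero[OF d, of 1 t] by auto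
  have F: "F (x + t *s y) = F x + t^2 *s F y" for t using qmap_line[of \<alpha> \<beta> \<gamma> 1 x t y] p by simp
  have ind: "F x + u *s F y = c *s (F x + v *s F y) \<Longrightarrow> u = v" for u v c
  proof -
    assume a: "F x + u *s F y = c *s (F x + v *s F y)"
    \<comment> \<open>With square roots of the coefficients, every vector in the span of
      \<open>F x\<close> and \<open>F y\<close> is a value of \<open>F\<close>, and \<open>F\<close>
      vanishes only at 0.\<close>
    have "F (csqrt (1 - c) *s x + csqrt (u - c * v) *s y) = (1 - c) *s F x + (u - c * v) *s F y"
      by (simp add: qmap_line p)
    also have "\<dots> = 0" using a by (simp add: vec_eq_iff algebra_simps)
    finally have "csqrt (1 - c) *s x + csqrt (u - c * v) *s y = 0" using F_nonzero by blast
    then show "u = v" using det2_nonzero[OF d] by force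
  qed
  define f where "f u = pt (F x + u *s F y)" for u
  have inj: "inj f"
  proof (rule injI)
    fix u v assume "f u = f v"
    then obtain c where "F x + v *s F y = c *s (F x + u *s F y)" by (auto simp: f_def pt_eq_iff)
    then show "u = v" using ind by metis
  qed
  have S: "f (t^2) \<in> {Pinf, Pinf', P0 l0}" if t: "t \<noteq> 0" for t
  proof (rule ccontr)
    assume "f (t^2) \<notin> {Pinf, Pinf', P0 l0}"
    then have S: "pt (F (x + t *s y)) \<notin> {Pinf, Pinf', P0 l0}" by (simp add: f_def F)
    have "pt (x + t *s y) = pt (x + (- t) *s y)"
      by (rule curve_injective[OF nz nz _ _ _ S, where c = 1]) (simp_all only: F power2_minus e, simp_all)
    then obtain c where "x + (- t) *s y = c *s (x + t *s y)" by (auto simp: pt_eq_iff)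
    then have "(1 - c) *s x + (- t - c * t) *s y = 0" by (simp add: vec_eq_iff algebra_simps)
    then have "1 - c = 0 \<and> - t - c * t = 0" by (rule det2_nonzero[OF d])
    then show False using t by auto
  qed
  have "f ` ((\<lambda>t. t^2) ` {1, 2, 3, 4}) \<subseteq> {Pinf, Pinf', P0 l0}"
  proof
    fix P assume "P \<in> f ` ((\<lambda>t. t^2) ` {1, 2, 3, 4})"
    then obtain t where t: "t \<in> {1, 2, 3, 4}" "P = f (t^2)" by blast
    then have "t \<noteq> 0" by auto
    then show "P \<in> {Pinf, Pinf', P0 l0}" unfolding t(2) by (rule S)
  qed
  then have "card (f ` ((\<lambda>t. t^2) ` {1, 2, 3, 4})) \<le> card {Pinf, Pinf', P0 l0}" by (intro card_mono) auto
  also have "\<dots> \<le> 3" by (simp add: card_insert_if)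
  also have "card (f ` ((\<lambda>t. t^2) ` {1, 2, 3, 4})) = card ((\<lambda>t::complex. t^2) ` {1, 2, 3, 4})"
    by (intro card_image inj_on_subset[OF inj]) simp
  also have "\<dots> = 4" by simp
  finally show False by simp
qed

text \<open>The square of the fibre coordinate depends on t^2 only. By the identity theorem the
  function is even or odd, and \<open>not_even_line\<close> excludes the former.\<close>

lemma odd_line:
  assumes d: "det2 x y \<noteq> 0" and p: "polar \<alpha> \<beta> \<gamma> x y = 0"
  shows "zz (x + (- t) *s y) = - zz (x + t *s y)"
proof -
  have nz: "x + t *s y \<noteq> 0" for t using det2_nonzero[OF d, of 1 t] by auto
  have F: "F (x + t *s y) = F x + t^2 *s F y" for t using qmap_line[of \<alpha> \<beta> \<gamma> 1 x t y] p by simp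
  define g where "g t = zz (x + t *s y)" for t
  have hg: "g holomorphic_on UNIV" unfolding g_def using zz_holomorphic[of x y] nz by simp
  have sq: "(g t)^2 = - quartic a b q0 q1 q2 (F x + t^2 *s F y)" for t
    using zz_eq[OF nz[of t]] unfolding F g_def by (metis add_eq_0_iff2)
  have hg': "(\<lambda>t. g (- t)) holomorphic_on UNIV"
    using holomorphic_on_compose_gen[of uminus UNIV g UNIV] hg by (simp add: o_def holomorphic_intros)
  have "(g (- t) - g t) * (g (- t) + g t) = 0" for t using sq[of t] sq[of "- t"] by (simp add: power2_eq_square algebra_simps)
  then have "(\<forall>t. g (- t) - g t = 0) \<or> (\<forall>t. g (- t) + g t = 0)"
    by (intro entire_zero_product holomorphic_intros hg hg')
  moreover have "\<not> (\<forall>t. g (- t) - g t = 0)"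
  proof
    assume "\<forall>t. g (- t) - g t = 0"
    then have "g (- t) = g t" for t by (metis eq_iff_diff_eq_0)
    then show False unfolding g_def by (rule not_even_line[OF d p])
  qed
  ultimately have "g (- t) + g t = 0" by blast
  then show ?thesis by (simp only: g_def eq_neg_iff_add_eq_0)
qed

text \<open>At t = 0 the map \<open>F\<close> is stationary, being a function of t^2, so immersivity
  forces the odd function z to have a simple zero there; \<open>c1\<close> is minus the square of
  its derivative.\<close>

lemma zz_line_end:
  assumes d: "det2 x y \<noteq> 0" and p: "polar \<alpha> \<beta> \<gamma> x y = 0"
    and S: "pt (F x) \<notin> {Pinf, Pinf', P0 l0}"
    and c: "\<And>t. quartic a b q0 q1 q2 (F x + t *s F y) = c0 + c1 * t + c2 * t^2 + c3 * t^3 + c4 * t^4"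
  shows "c0 = 0" "c1 \<noteq> 0"
proof -
  have nz: "x + t *s y \<noteq> 0" for t using det2_nonzero[OF d, of 1 t] by auto
  have x: "x \<noteq> 0" using nz[of 0] by simp
  have F: "F (x + t *s y) = F x + t^2 *s F y" for t using qmap_line[of \<alpha> \<beta> \<gamma> 1 x t y] p by simp
  define g where "g t = zz (x + t *s y)" for t
  have "g holomorphic_on UNIV" unfolding g_def using zz_holomorphic[of x y] nz by simp
  then obtain D where D: "(g has_field_derivative D) (at 0)" by (metis holomorphic_on_open open_UNIV UNIV_I)
  have g0: "g 0 = 0" using odd_line[OF d p, of 0] by (simp add: g_def)
  have "(g t)^2 = (- c0) + (- c1) * t^2 + (- c2) * t^4 + (- c3) * t^6 + (- c4) * t^8" for t
  proof -
    have "(g t)^2 = - quartic a b q0 q1 q2 (F x + t^2 *s F y)"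
      using zz_eq[OF nz[of t]] unfolding F g_def by (metis add_eq_0_iff2)
    then show ?thesis unfolding c by (simp flip: power_mult)
  qed
  then have "- c0 = 0" "- c1 = D^2" by (rule odd_square_root_coefficients[OF D g0])+
  moreover have "D \<noteq> 0"
  proof
    assume "D = 0"
    then have "((\<lambda>t. zz (x + t *s y)) has_field_derivative 0) (at 0)" using D by (simp add: g_def[abs_def])
    moreover have "((\<lambda>t. F (x + t *s y) $ r) has_field_derivative 0) (at 0)" for r
      unfolding F by (auto intro!: derivative_eq_intros)
    ultimately have "pt (F x) \<in> {Pinf, Pinf', P0 l0}"
      using curve_immersive[OF x] d by (simp add: det2_def)
    then show False using S by blast
  qed
  ultimately show "c0 = 0" "c1 \<noteq> 0" by auto
qed

text \<open>Without singular points on the line, the quartic has simple zeros at both ends, so a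
  quadratic factor is left with a root w = t^2, t nonzero. There z = 0 at t and at -t, against
  injectivity. If one of the points Pinf, Pinf' is on the line, then so is the other by reality, and
  z turns out to be even.\<close>

lemma line_contains_P0:
  assumes d: "det2 x y \<noteq> 0" and p: "polar \<alpha> \<beta> \<gamma> x y = 0"
  shows "P0 l0 \<in> C"
proof (rule ccontr)
  assume P0: "P0 l0 \<notin> C"
  have nz: "x + t *s y \<noteq> 0" for t using det2_nonzero[OF d, of 1 t] by auto
  have nz': "t *s x + y \<noteq> 0" for t using det2_nonzero[OF d, of t 1] by auto
  have xy0: "x \<noteq> 0" "y \<noteq> 0" using nz[of 0] nz'[of 0] by auto
  have F: "F (s *s x + t *s y) = s^2 *s F x + t^2 *s F y" for s t using qmap_line[of \<alpha> \<beta> \<gamma> s x t y] p by simp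
  have F1: "F (x + t *s y) = F x + t^2 *s F y" for t using F[of 1 t] by simp
  have mem: "pt (F v) \<in> C" if "v \<noteq> 0" for v using that by (auto simp: C_conic conic_def)
  define g where "g t = zz (x + t *s y)" for t
  have hg: "g holomorphic_on UNIV" unfolding g_def using zz_holomorphic[of x y] nz by simp
  have sq: "(g t)^2 = - quartic a b q0 q1 q2 (F x + t^2 *s F y)" for t
    using zz_eq[OF nz[of t]] unfolding F1 g_def by (metis add_eq_0_iff2)
  have no_S: "pt (F v) \<notin> {Pinf, Pinf', P0 l0}" if v: "v \<noteq> 0" for v
  proof
    assume "pt (F v) \<in> {Pinf, Pinf', P0 l0}"
    then have Pv: "pt (F v) = Pinf \<or> pt (F v) = Pinf'" using P0 mem[OF v] by (metis insertE empty_iff)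
    have s: "sigma Pinf = Pinf'" "sigma Pinf' = Pinf"
      by (simp_all add: Pinf_def Pinf'_def sigma_pt conj4_def)
    have "Pinf \<in> C \<and> Pinf' \<in> C" using Pv mem[OF v] s sigma_C by (metis imageI)
    then obtain v w where v: "vec4 0 0 0 1 = F v" and w: "vec4 0 0 1 0 = F w"
      unfolding Pinf_def Pinf'_def C_conic mem_conic' by blast
    obtain s t where st: "v = s *s x + t *s y" by (rule det2_basis[OF d])
    obtain s' t' where st': "w = s' *s x + t' *s y" by (rule det2_basis[OF d])
    \<comment> \<open>The determinant of the system expressing the two points through
      \<open>F x\<close> and \<open>F y\<close>. It is nonzero, so the first two coordinates of
      \<open>F x\<close> and \<open>F y\<close> vanish.\<close>
    define E where "E = s^2 * t'^2 - s'^2 * t^2"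
    have V: "s^2 * F x $ i + t^2 * F y $ i = vec4 0 0 0 1 $ i" and W: "s'^2 * F x $ i + t'^2 * F y $ i = vec4 0 0 1 0 $ i" for i
      by (simp_all add: v w st st' F)
    have E1: "E * F x $ i = t'^2 * vec4 0 0 0 1 $ i - t^2 * vec4 0 0 1 0 $ i"
      "E * F y $ i = s^2 * vec4 0 0 1 0 $ i - s'^2 * vec4 0 0 0 1 $ i" for i
      unfolding V[symmetric] W[symmetric] by (simp_all add: E_def algebra_simps)
    have "E \<noteq> 0"
    proof
      assume "E = 0"
      then have "t' = 0" "t = 0" "s = 0" using E1[of 2] E1[of 3] by simp_all
      then show False using V[of 3] by simp
    qed
    then have A: "F x $ 0 = 0" "F x $ 1 = 0" "F y $ 0 = 0" "F y $ 1 = 0" using E1[of 0] E1[of 1] by simp_all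
    \<comment> \<open>Where y_0 = y_1 = 0 the quartic is (y_2 y_3)^2, so z is plus or minus i y_2
      y_3, which is even in t.\<close>
    define h where "h t = \<i> * ((F x $ 2 + t^2 * F y $ 2) * (F x $ 3 + t^2 * F y $ 3))" for t
    have hh: "h holomorphic_on UNIV" unfolding h_def by (intro holomorphic_intros)
    have "(g t)^2 = (h t)^2" for t
      unfolding sq by (simp add: h_def quartic_def Qf_def A power_mult_distrib)
    then have "(g t - h t) * (g t + h t) = 0" for t by (simp add: power2_eq_square algebra_simps)
    then have "(\<forall>t. g t - h t = 0) \<or> (\<forall>t. g t + h t = 0)"
      by (intro entire_zero_product holomorphic_intros hg hh)
    then have "(\<forall>t. g t = h t) \<or> (\<forall>t. g t = - h t)" by (simp add: eq_neg_iff_add_eq_0)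
    then have "g (- t) = g t" for t by (auto simp: h_def)
    then show False unfolding g_def by (rule not_even_line[OF d p])
  qed
  obtain c0 c1 c2 c3 c4 where c: "\<And>s t. quartic a b q0 q1 q2 (s *s F x + t *s F y) =
       c0 * s^4 + c1 * s^3 * t + c2 * s^2 * t^2 + c3 * s * t^3 + c4 * t^4" by (fact quartic_pencil)
  have d': "det2 y x \<noteq> 0" using d by (simp add: det2_def algebra_simps)
  have p': "polar \<alpha> \<beta> \<gamma> y x = 0" using p by (simp add: polar_def mult_ac add.commute)
  have "quartic a b q0 q1 q2 (F x + t *s F y) = c0 + c1 * t + c2 * t^2 + c3 * t^3 + c4 * t^4" for t
    using c[of 1 t] by simp
  then have c01: "c0 = 0" "c1 \<noteq> 0" by (rule zz_line_end[OF d p no_S[OF xy0(1)]])+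
  have "quartic a b q0 q1 q2 (F y + t *s F x) = c4 + c3 * t + c2 * t^2 + c1 * t^3 + c0 * t^4" for t
    using c[of t 1] by (simp add: add_ac)
  then have c34: "c4 = 0" "c3 \<noteq> 0" by (rule zz_line_end[OF d' p' no_S[OF xy0(2)]])+
  \<comment> \<open>The factor of the quartic between its simple zeros at the two ends. It has a
    root because \<open>c3\<close> is nonzero, and the root is nonzero because \<open>c1\<close>
    is.\<close>
  obtain w where w: "c1 + c2 * w + c3 * w^2 = 0"
  proof -
    define D where "D = csqrt (c2^2 - 4 * c1 * c3)"
    have D: "D^2 = c2^2 - 4 * c1 * c3" by (simp add: D_def)
    define r where "r = (- c2 + D) / (2 * c3)"
    have "D = 2 * c3 * r + c2" using c34(2) by (simp add: r_def)
    then have "(4 * c3) * (c1 + c2 * r + c3 * r^2) = 0" using D by (simp add: power2_eq_square algebra_simps)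
    then have "c1 + c2 * r + c3 * r^2 = 0" using c34(2) by simp
    then show ?thesis by (rule that)
  qed
  define t where "t = csqrt w"
  have w0: "w \<noteq> 0" using w c01 by auto
  then have t: "t \<noteq> 0" "t^2 = w" by (simp_all add: t_def)
  have "quartic a b q0 q1 q2 (F x + w *s F y) = w * (c1 + c2 * w + c3 * w^2)"
    using c[of 1 w] by (simp add: c01 c34 algebra_simps power2_eq_square power3_eq_cube)
  then have "g t = 0" using sq[of t] w by (simp add: t)
  then have zero: "zz (x + t *s y) = 0" "zz (x + (- t) *s y) = 0" using odd_line[OF d p, of t] by (simp_all add: g_def)
  have "pt (x + t *s y) = pt (x + (- t) *s y)"
    by (rule curve_injective[OF nz nz _ _ _ no_S[OF nz], where c = 1]) (simp_all only: F1 power2_minus zero, simp_all)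
  then obtain k where "x + (- t) *s y = k *s (x + t *s y)" by (auto simp: pt_eq_iff)
  then have "(1 - k) *s x + (- t - k * t) *s y = 0" by (simp add: vec_eq_iff algebra_simps)
  then have "1 - k = 0 \<and> - t - k * t = 0" by (rule det2_nonzero[OF d])
  then show False using t by auto
qed

text \<open>Complex coefficients have square roots, so s^2 and t^2 take all pairs of values and the
  image is the full line through \<open>F x\<close> and \<open>F y\<close>.\<close>

lemma dependent_is_line:
  assumes "\<not> indep3 \<alpha> \<beta> \<gamma>"
  shows "is_line C" "P0 l0 \<in> C"
proof -
  obtain k0 k1 k2 where k: "k0 *s \<alpha> + k1 *s \<beta> + k2 *s \<gamma> = 0" "k0 \<noteq> 0 \<or> k1 \<noteq> 0 \<or> k2 \<noteq> 0"
    using assms unfolding indep3_def by blast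
  obtain x y where d: "det2 x y \<noteq> 0" and p: "polar \<alpha> \<beta> \<gamma> x y = 0"
    by (rule polar_zero_if_dependent[OF k F_nonzero])
  show "P0 l0 \<in> C" by (rule line_contains_P0[OF d p])
  have F: "F (s *s x + t *s y) = s^2 *s F x + t^2 *s F y" for s t using qmap_line[of \<alpha> \<beta> \<gamma> s x t y] p by simp
  have ind: "u = 0 \<and> v = 0" if z: "u *s F x + v *s F y = 0" for u v
  proof -
    have "F (csqrt u *s x + csqrt v *s y) = 0" using z by (simp add: F)
    then have "csqrt u *s x + csqrt v *s y = 0" using F_nonzero by blast
    then show ?thesis using det2_nonzero[OF d] by force
  qed
  have "F ` (- {0}) = {u *s F x + v *s F y | u v. True} - {0}"
  proof (intro equalityI subsetI)
    fix z assume "z \<in> F ` (- {0})"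
    then obtain v where v: "v \<noteq> 0" "z = F v" by blast
    moreover obtain s t where st: "v = s *s x + t *s y" by (rule det2_basis[OF d])
    ultimately show "z \<in> {u *s F x + v *s F y | u v. True} - {0}" using F_nonzero[OF v(1)] F by auto
  next
    fix z assume "z \<in> {u *s F x + v *s F y | u v. True} - {0}"
    then obtain u v where uv: "z = u *s F x + v *s F y" "z \<noteq> 0" by blast
    then have z: "z = F (csqrt u *s x + csqrt v *s y)" by (simp add: F)
    moreover have "csqrt u *s x + csqrt v *s y \<noteq> 0"
    proof
      assume "csqrt u *s x + csqrt v *s y = 0"
      then show False using uv(2) unfolding z by (simp add: qmap_def)
    qed
    ultimately show "z \<in> F ` (- {0})" by blast
  qed
  then have "C = pt ` ({u *s F x + v *s F y | u v. True} - {0})" by (simp only: C_conic conic_def)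
  then show "is_line C" using is_line_span[OF ind] by simp
qed

theorem line_iff_meets_P0:
  "is_line C \<longleftrightarrow> P0 l0 \<in> C" "\<not> is_line C \<Longrightarrow> real_touching_conic a b q0 q1 q2 C"
  using dependent_is_line conic_not_line P0_notin_conic touching_conic by (metis C_conic)+

end

theorem proposition3p2:
  fixes a b q0 q1 q2 l0 :: real
    and Z :: "('a, 3) complex_space"
    and \<mu> :: "'a \<Rightarrow> ((complex^4) \<times> complex) set"
    and s :: "'a \<Rightarrow> 'a"
    and \<Phi> :: "'a \<Rightarrow> (complex^4) set"
    and \<Gamma>0 L :: "'a set"
  assumes "a > 0" and "b > 0"
    and "\<And>t::real. (Qf q0 q1 q2 t 1)^2 - cubic a b t \<ge> 0"
    and "\<And>t::real. (Qf q0 q1 q2 t 1)^2 - cubic a b t = 0 \<longleftrightarrow> t = l0"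
    and "order l0 (discr_poly a b q0 q1 q2) = 2"
    and "\<And>t::real. cubic a b t \<ge> 0 \<Longrightarrow> t \<noteq> l0 \<Longrightarrow> Qf q0 q1 q2 t 1 > sqrt (cubic a b t)"
    and "small_resolution Z tot_O2 (double_solid a b q0 q1 q2)
           {P \<in> double_solid a b q0 q1 q2. proj_O2 P \<in> {Pinf, Pinf', P0 l0}} \<mu>"
    and "real_structure_lift Z \<mu> s"
    and "\<Phi> = proj_O2 \<circ> \<mu>"
    and "\<Gamma>0 = {p \<in> topspace (ctop Z). \<Phi> p = P0 l0}"
    and "real_line Z s L"
  shows "(is_line (\<Phi> ` L) \<longleftrightarrow> L \<inter> \<Gamma>0 \<noteq> {}) \<and>
         (\<not> is_line (\<Phi> ` L) \<longrightarrow> real_touching_conic a b q0 q1 q2 (\<Phi> ` L))"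
proof -
  obtain \<iota> where \<iota>: "smooth_rational_curve Z \<iota> L"
    "bundle_isomorphic proj_line
      (pullback_bundle proj_line \<iota> (normal_bundle Z L :: (('a, 3) chart \<times> (2 \<Rightarrow> 3), 'a, 2) cocycle)) O1_sum"
    and sL: "s ` L = L"
    using assms(11) unfolding real_line_def by blast
  interpret pencil a b q0 q1 q2 l0 by unfold_locales (fact assms)+
  interpret curve a b q0 q1 q2 l0 Z \<mu> L \<iota> by unfold_locales (fact assms(7) \<iota>)+
  obtain \<alpha> \<beta> \<gamma> where q: "\<And>x. x \<noteq> 0 \<Longrightarrow> qmap \<alpha> \<beta> \<gamma> x \<noteq> 0"
    "\<And>x. x \<noteq> 0 \<Longrightarrow> \<exists>z. \<mu> (\<iota> (pt x)) = pt_O2 (qmap \<alpha> \<beta> \<gamma> x, z)"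
    by (fact quadratic_parametrization)
  interpret real_curve a b q0 q1 q2 l0 Z \<mu> L \<iota> \<alpha> \<beta> \<gamma> s
    by unfold_locales (fact q assms(8) sL)+
  have C: "\<Phi> ` L = C" by (simp add: C_def assms(9))
  have "P0 l0 \<in> C \<longleftrightarrow> L \<inter> \<Gamma>0 \<noteq> {}"
    unfolding C[symmetric] assms(10) using L_top by (auto simp: image_iff)
  then show ?thesis unfolding C using line_iff_meets_P0 by blast
qed

end
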